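(* Let $m\ge2$ be an integer and $\rho>-m$ a real number, and set $\nu=\frac{(m-1)(m+\rho)}{m(m+\rho+1)}\in(0,1)$. Let $X^{(n)}$ be the number of descendants of vertex $n$ in the preferential attachment graph with self-loops $G_n$ with parameters $m$ and $\rho$ (defined in the context). Let $\xi_1$ have the $\mathrm{Gamma}(m/(m-1),1)$ distribution, and let $$K:=\frac{\Gamma\left(\frac{(m-1)(m+\rho)}{m(m+\rho+1)}\right)\Gamma\left(\frac{m+\rho}{m(m+\rho+1)}+1\right)}{\Gamma\left(\frac{m+\rho}{m+\rho+1}\right)}\left(\frac{(m+\rho+1)(m-1)}{2m+\rho}\right)^{1-\nu}.$$ Then, as $n\to\infty$, $$n^{-\nu}X^{(n)}\ \overset{d}{\longrightarrow}\ K\,\xi_1^{1-\nu},$$ and all moments converge, i.e. for every real $p>0$, $$\frac{\mathbb E[(X^{(n)})^p]}{n^{p\nu}}\to K^p\cdot\frac{\Gamma\left(p(1-\nu)+\frac{m}{m-1}\right)}{\Gamma\left(\frac{m}{m-1}\right)}.$$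
   Context: Preferential attachment graph with self-loops: $G_1$ is a single vertex 1 with $m$ self-loops. For $n\ge2$, given $G_{n-1}$ (a directed multigraph on $[n-1]=\{1,\dots,n-1\}$), add vertex $n$ and sequentially add $m$ outgoing edges from $n$, each attached to a vertex in $[n]$. Let $d_j(n-1)$ be the degree of vertex $j$ in $G_{n-1}$ (a self-loop contributes 2 to the degree) and let $n\overset{\ell}{\to}j$ denote the event that the $\ell$-th outgoing edge of $n$ is attached to $j$. Given the first $k$ outgoing edges of $n$ ($0\le k\le m-1$), the $(k+1)$-th outgoing edge of $n$ is attached to $j\in[n]$ with probability $$\frac{d_j(n-1)+\sum_{\ell=1}^k\mathbf 1[n\overset{\ell}{\to}j]+\rho}{2(n-1)m+2k+1+n\rho}\ \text{ if } j<n,\qquad \frac{k+1+\sum_{\ell=1}^k\mathbf 1[n\overset{\ell}{\to}n]+\rho}{2(n-1)m+2k+1+n\rho}\ \text{ if } j=n.$$ The number of descendants $X^{(n)}$ of $n$ is the number of vertices of $G_n$ that can be reached from vertex $n$ by a directed path, including vertex $n$ itself. $\mathrm{Gamma}(a,b)$ is the distribution with density $\Gamma(a)^{-1}b^{-a}x^{a-1}e^{-x/b}$ on $(0,\infty)$. $\overset{d}{\longrightarrow}$ denotes convergence in distribution. *)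

theory Defs
  imports "HOL-Probability.Probability" "Graph_Theory.Digraph"
begin

text \<open>
  The edge configuration of the growing graph is a function \<open>h\<close>, where \<open>h i l\<close> is the vertex to
  which the \<open>l\<close>-th outgoing edge of vertex \<open>i\<close> is attached (\<open>i \<ge> 1\<close>, \<open>1 \<le> l \<le> m\<close>). The arc
  \<open>(i, l)\<close> of the multigraph is the \<open>l\<close>-th outgoing edge of \<open>i\<close>.
\<close>

definition pa_graph :: "nat \<Rightarrow> (nat \<Rightarrow> nat \<Rightarrow> nat) \<Rightarrow> nat \<Rightarrow> (nat, nat \<times> nat) pre_digraph"
  where "pa_graph m h n =
    \<lparr>verts = {1..n}, arcs = {1..n} \<times> {1..m}, tail = fst, head = (\<lambda>(i, l). h i l)\<rparr>"

text \<open>A self-loop is both an in-arc and an out-arc, so it contributes 2 to the degree.\<close>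

definition vertex_degree :: "('v, 'e) pre_digraph \<Rightarrow> 'v \<Rightarrow> nat"
  where "vertex_degree G v = in_degree G v + out_degree G v"

definition descendants :: "('v, 'e) pre_digraph \<Rightarrow> 'v \<Rightarrow> 'v set"
  where "descendants G v = {w \<in> verts G. v \<rightarrow>\<^sup>*\<^bsub>G\<^esub> w}"

text \<open>
  The probability that the \<open>(k+1)\<close>-th outgoing edge of \<open>n\<close> is attached to \<open>j\<close>, given that
  \<open>h\<close> describes the graph on \<open>n - 1\<close> vertices and the first \<open>k\<close> outgoing edges of \<open>n\<close>.
\<close>

definition attach_prob ::
    "nat \<Rightarrow> real \<Rightarrow> (nat \<Rightarrow> nat \<Rightarrow> nat) \<Rightarrow> nat \<Rightarrow> nat \<Rightarrow> nat \<Rightarrow> real"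
  where "attach_prob m \<rho> h n k j =
    (if j < n
     then real (vertex_degree (pa_graph m h (n - 1)) j) + (\<Sum>l=1..k. of_bool (h n l = j)) + \<rho>
     else real k + 1 + (\<Sum>l=1..k. of_bool (h n l = n)) + \<rho>)
    / (2 * (real n - 1) * real m + 2 * real k + 1 + real n * \<rho>)"

text \<open>
  \<open>E n l\<close> is the random endpoint of the \<open>l\<close>-th outgoing edge of vertex \<open>n\<close>. The attachment rule is
  stated conditionally on every history that has positive probability. As \<open>attach_prob m \<rho> h 2 0 2\<close>
  has the sign of \<open>1 + \<rho>\<close>, the rule is a genuine probability distribution only when \<open>\<rho> \<ge> -1\<close>;
  no process satisfies it for \<open>-m < \<rho> < -1\<close>.
\<close>

locale pref_attachment_selfloops = prob_space M
  for M :: "'a measure" and m :: nat and \<rho> :: real and E :: "nat \<Rightarrow> nat \<Rightarrow> 'a \<Rightarrow> nat" +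
  assumes measurable_E:
      "\<And>n l. n \<ge> 1 \<Longrightarrow> l \<in> {1..m} \<Longrightarrow> E n l \<in> measurable M (count_space UNIV)"
    and first_vertex: "\<And>l. l \<in> {1..m} \<Longrightarrow> AE \<omega> in M. E 1 l \<omega> = 1"
    and attachment: "\<And>n k j h. n \<ge> 2 \<Longrightarrow> k < m \<Longrightarrow> j \<in> {1..n} \<Longrightarrow>
      \<P>(\<omega> in M. (\<forall>i\<in>{1..<n}. \<forall>l\<in>{1..m}. E i l \<omega> = h i l) \<and> (\<forall>l\<in>{1..k}. E n l \<omega> = h n l)) > 0 \<Longrightarrow>
      \<P>(\<omega> in M. E n (k + 1) \<omega> = j \<bar>
          (\<forall>i\<in>{1..<n}. \<forall>l\<in>{1..m}. E i l \<omega> = h i l) \<and> (\<forall>l\<in>{1..k}. E n l \<omega> = h n l))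
        = attach_prob m \<rho> h n k j"
begin

definition num_descendants :: "nat \<Rightarrow> 'a \<Rightarrow> nat"
  where "num_descendants n \<omega> = card (descendants (pa_graph m (\<lambda>i l. E i l \<omega>) n) n)"

end

definition gamma_density :: "real \<Rightarrow> real \<Rightarrow> real \<Rightarrow> real"
  where "gamma_density a b x =
    (if x > 0 then b powr (- a) * x powr (a - 1) * exp (- x / b) / Gamma a else 0)"

end

theory Submission imports Defs "HOL-Real_Asymp.Real_Asymp"
begin

text \<open>
  The descendants of \<open>n\<close> are found by exploring the vertices backwards, \<open>n, n - 1, \<dots>, 1\<close>, revealing for each vertex
  only its self-loops and which of the open edges (those of already found descendants, with unknown head) point
  to it. The probability of a configuration is a product of rising factorials, one for each vertex, so edges with
  unknown heads are exchangeable and the number of open edges is a Markov chain driven by Polya urns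
  (\<open>total_weight_chain\<close>, \<open>descendants_law\<close>). The number of descendants is one more than the number of hits.
  
  As long as the number \<open>y\<close> of open edges is small compared with \<open>k\<close>, each open edge points to \<open>k\<close> with probability
  about \<open>\<alpha> / (c * k)\<close> and is then replaced by \<open>m\<close> edges. In units of \<open>m - 1\<close> edges this is a branching process in which
  particles split in two, and its rescaled size converges to a gamma variable with shape parameter
  \<open>m / (m - 1)\<close>. The proof follows the characteristic function of the gamma law along the chain: by \<open>gcf_succ\<close>,
  adding one particle and dilating the time scale cancel each other, so \<open>branching_step\<close> has an error of order
  \<open>y\<^sup>2 / k\<^sup>2\<close> only (\<open>limit_var_char\<close>). This phase ends at \<open>cut n\<close>, well above \<open>n powr \<nu>\<close>, where randomness
  has essentially come to an end.
  
  Afterwards \<open>y\<close> follows an explicitly solvable differential equation. A Gronwall estimate for the mean square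
  deviation (\<open>deviation_bound\<close>) and a variance estimate for the martingale part of the hits
  (\<open>compensated_square\<close>) show that the number of descendants is close in mean to the sum of the deterministic
  hitting rates \<open>1 - (1 + x * k powr (- \<beta>)) powr (- \<kappa>)\<close>, where \<open>x\<close> is proportional to \<open>n powr \<gamma>\<close> times the gamma
  variable (\<open>descendants_fluid_error\<close>). These rates are tail probabilities of a single random variable, so their sum is
  \<open>x powr (1 - \<nu>)\<close> times a Beta integral up to a bounded error (\<open>rate_series_comparison\<close>); this produces \<open>K\<close>.
  
  Levy's continuity theorem then gives convergence in distribution. Factorial moments of the hits bound all moments of
  the normalised number of descendants (\<open>descendants_moment\<close>), so the moments converge as well.
\<close>

section \<open>Expectations over finitely supported distributions and urns\<close>

abbreviation Ep :: "'a pmf \<Rightarrow> ('a \<Rightarrow> 'b::{banach, second_countable_topology}) \<Rightarrow> 'b"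
  where "Ep p f \<equiv> measure_pmf.expectation p f"

lemma Ep_bind:
  fixes h :: "'b \<Rightarrow> 'c::{banach, second_countable_topology}"
  assumes "finite (set_pmf p)" "\<And>x. x \<in> set_pmf p \<Longrightarrow> finite (set_pmf (f x))"
  shows "Ep (bind_pmf p f) h = Ep p (\<lambda>x. Ep (f x) h)"
  using assms by (subst pmf_expectation_bind[of "set_pmf p"])
    (auto intro!: integral_measure_pmf[symmetric])

lemma Ep_cong: "(\<And>x. x \<in> set_pmf p \<Longrightarrow> f x = g x) \<Longrightarrow> Ep p f = Ep p g"
  by (rule Bochner_Integration.integral_cong_AE) (auto simp: AE_measure_pmf_iff)

lemma Ep_mono:
  fixes f g :: "'a \<Rightarrow> real"
  assumes "finite (set_pmf p)" "\<And>x. x \<in> set_pmf p \<Longrightarrow> f x \<le> g x"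
  shows "Ep p f \<le> Ep p g"
  using assms by (intro integral_mono_AE)
    (auto simp: AE_measure_pmf_iff intro: integrable_measure_pmf_finite)

lemma Ep_add:
  fixes f g :: "'a \<Rightarrow> 'b::{banach, second_countable_topology}"
  shows "finite (set_pmf p) \<Longrightarrow> Ep p (\<lambda>x. f x + g x) = Ep p f + Ep p g"
  by (intro Bochner_Integration.integral_add integrable_measure_pmf_finite)

lemma Ep_diff:
  fixes f g :: "'a \<Rightarrow> 'b::{banach, second_countable_topology}"
  shows "finite (set_pmf p) \<Longrightarrow> Ep p (\<lambda>x. f x - g x) = Ep p f - Ep p g"
  by (intro Bochner_Integration.integral_diff integrable_measure_pmf_finite)

lemma Ep_sum:
  fixes f :: "'i \<Rightarrow> 'a \<Rightarrow> 'b::{banach, second_countable_topology}"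
  shows "finite (set_pmf p) \<Longrightarrow> Ep p (\<lambda>x. \<Sum>i\<in>I. f i x) = (\<Sum>i\<in>I. Ep p (f i))"
  by (intro Bochner_Integration.integral_sum integrable_measure_pmf_finite)

lemma Ep_norm_le:
  fixes f :: "'a \<Rightarrow> 'b::{banach, second_countable_topology}"
  shows "norm (Ep p f) \<le> Ep p (\<lambda>x. norm (f x))"
  by (rule integral_norm_bound)

lemma Ep_nonneg:
  fixes f :: "'a \<Rightarrow> real"
  shows "(\<And>x. x \<in> set_pmf p \<Longrightarrow> 0 \<le> f x) \<Longrightarrow> 0 \<le> Ep p f"
  by (intro integral_nonneg_AE) (auto simp: AE_measure_pmf_iff)

lemma Ep_le_const:
  fixes f :: "'a \<Rightarrow> real"
  assumes "finite (set_pmf p)" "\<And>x. x \<in> set_pmf p \<Longrightarrow> f x \<le> C"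
  shows "Ep p f \<le> C"
  using Ep_mono[OF assms(1), of f "\<lambda>_. C"] assms(2) by simp

lemma Ep_abs_le_sqrt:
  fixes f :: "'a \<Rightarrow> real"
  assumes "finite (set_pmf p)"
  shows "Ep p (\<lambda>x. \<bar>f x\<bar>) \<le> sqrt (Ep p (\<lambda>x. (f x)\<^sup>2))"
proof -
  have i: "integrable (measure_pmf p) h" for h :: "'a \<Rightarrow> real"
    by (rule integrable_measure_pmf_finite[OF assms])
  let ?e = "Ep p (\<lambda>x. \<bar>f x\<bar>)"
  have "0 \<le> Ep p (\<lambda>x. (\<bar>f x\<bar> - ?e)\<^sup>2)" by (rule Ep_nonneg) simp
  also have "\<dots> = Ep p (\<lambda>x. (f x)\<^sup>2 - 2 * ?e * \<bar>f x\<bar> + ?e\<^sup>2)"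
    by (rule Ep_cong) (simp add: power2_eq_square algebra_simps)
  also have "\<dots> = Ep p (\<lambda>x. (f x)\<^sup>2) - ?e\<^sup>2"
    using i by (simp add: power2_eq_square)
  finally have "?e\<^sup>2 \<le> Ep p (\<lambda>x. (f x)\<^sup>2)" by simp
  then show ?thesis by (rule real_le_rsqrt)
qed

text \<open>
  The number of successes in \<open>n\<close> draws of a Polya urn, where the success weight \<open>g i\<close> may depend on
  the draw and every success adds one to it. A constant \<open>g\<close> gives the classical urn; the function
  \<open>g i = i + 1 + \<rho>\<close> describes the self-loops of a new vertex.
\<close>

primrec urn :: "(nat \<Rightarrow> real) \<Rightarrow> real \<Rightarrow> nat \<Rightarrow> nat pmf" where
  "urn g b 0 = return_pmf 0"
| "urn g b (Suc i) = bind_pmf (urn g b i) (\<lambda>z. map_pmf (\<lambda>s. if s then Suc z else z)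
     (bernoulli_pmf ((g i + real z) / (g i + b + real i))))"

lemma urn_le: "z \<in> set_pmf (urn g b n) \<Longrightarrow> z \<le> n"
  by (induction n arbitrary: z) (auto split: if_splits, fastforce+)

lemma finite_urn [simp]: "finite (set_pmf (urn g b n))"
  by (rule finite_subset[of _ "{..n}"]) (auto dest: urn_le)

lemma Ep_urn_Suc:
  fixes f :: "nat \<Rightarrow> 'b::{banach, second_countable_topology}"
  assumes "0 \<le> g n" "0 < b"
  shows "Ep (urn g b (Suc n)) f =
    Ep (urn g b n) (\<lambda>z. ((g n + real z) / (g n + b + real n)) *\<^sub>R f (Suc z)
       + ((b + real n - real z) / (g n + b + real n)) *\<^sub>R f z)"
proof -
  have "Ep (urn g b (Suc n)) f = Ep (urn g b n) (\<lambda>z. Ep (map_pmf (\<lambda>s. if s then Suc z else z)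
     (bernoulli_pmf ((g n + real z) / (g n + b + real n)))) f)"
    unfolding urn.simps by (rule Ep_bind) (auto intro: finite_subset[OF subset_UNIV])
  also have "\<dots> = Ep (urn g b n) (\<lambda>z. ((g n + real z) / (g n + b + real n)) *\<^sub>R f (Suc z)
       + ((b + real n - real z) / (g n + b + real n)) *\<^sub>R f z)"
  proof (rule Ep_cong)
    fix z assume "z \<in> set_pmf (urn g b n)"
    then have zn: "z \<le> n" by (rule urn_le)
    let ?p = "(g n + real z) / (g n + b + real n)"
    have p: "0 \<le> ?p" "?p \<le> 1" using assms zn by auto
    have q: "1 - ?p = (b + real n - real z) / (g n + b + real n)"
      using assms by (simp add: field_simps)
    have "Ep (map_pmf (\<lambda>s. if s then Suc z else z) (bernoulli_pmf ?p)) f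
        = ?p *\<^sub>R f (Suc z) + (1 - ?p) *\<^sub>R f z"
      using p by (simp add: integral_measure_pmf[of UNIV] UNIV_bool)
    then show "Ep (map_pmf (\<lambda>s. if s then Suc z else z) (bernoulli_pmf ?p)) f
        = ?p *\<^sub>R f (Suc z) + ((b + real n - real z) / (g n + b + real n)) *\<^sub>R f z"
      unfolding q .
  qed
  finally show ?thesis .
qed

lemma polya_mean:
  assumes "0 \<le> A" "0 < b"
  shows "Ep (urn (\<lambda>_. A) b n) real = real n * A / (A + b)"
proof (induction n)
  case (Suc n)
  let ?T = "A + b + real n"
  have T: "?T > 0" "A + b > 0" using assms by auto
  have "Ep (urn (\<lambda>_. A) b (Suc n)) real
      = Ep (urn (\<lambda>_. A) b n) (\<lambda>z. A / ?T + (1 + 1 / ?T) * real z)"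
    unfolding Ep_urn_Suc[where g="\<lambda>_. A", OF assms]
    by (rule Ep_cong) (use T in \<open>simp add: field_simps\<close>)
  also have "\<dots> = A / ?T + (1 + 1 / ?T) * (real n * A / (A + b))"
    using Suc by (simp add: integrable_measure_pmf_finite)
  also have "\<dots> = real (Suc n) * A / (A + b)"
    using T by (simp add: divide_simps) (simp add: algebra_simps)
  finally show ?case .
qed simp

lemma polya_factorial_moment:
  assumes "0 \<le> A" "0 < b"
  shows "Ep (urn (\<lambda>_. A) b n) (\<lambda>z. real z * (real z - 1))
    = real n * (real n - 1) * A * (A + 1) / ((A + b) * (A + b + 1))"
proof (induction n)
  case (Suc n)
  let ?T = "A + b + real n"
  have T: "?T > 0" "A + b > 0" "A + b + 1 > 0" using assms by auto
  have "Ep (urn (\<lambda>_. A) b (Suc n)) (\<lambda>z. real z * (real z - 1))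
      = Ep (urn (\<lambda>_. A) b n) (\<lambda>z. (1 + 2 / ?T) * (real z * (real z - 1)) + (2 * (A + 1) / ?T) * real z)"
    unfolding Ep_urn_Suc[where g="\<lambda>_. A", OF assms]
    by (rule Ep_cong) (use T in \<open>simp add: divide_simps, simp add: algebra_simps\<close>)
  also have "\<dots> = (1 + 2 / ?T) * (real n * (real n - 1) * A * (A + 1) / ((A + b) * (A + b + 1)))
      + (2 * (A + 1) / ?T) * (real n * A / (A + b))"
    using Suc polya_mean[OF assms, of n] by (simp add: integrable_measure_pmf_finite)
  also have "\<dots> = real (Suc n) * (real (Suc n) - 1) * A * (A + 1) / ((A + b) * (A + b + 1))"
    using T by (simp add: divide_simps) (simp add: algebra_simps)
  finally show ?case .
qed simp

lemma polya_none:
  assumes "0 \<le> A" "0 < b"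
  shows "Ep (urn (\<lambda>_. A) b n) (\<lambda>z. of_bool (z = 0)) = (\<Prod>i<n. (b + real i) / (A + b + real i))"
proof (induction n)
  case (Suc n)
  let ?T = "A + b + real n"
  have T: "?T > 0" using assms by auto
  have "Ep (urn (\<lambda>_. A) b (Suc n)) (\<lambda>z. of_bool (z = 0))
      = Ep (urn (\<lambda>_. A) b n) (\<lambda>z. ((b + real n) / ?T) * of_bool (z = 0))"
    unfolding Ep_urn_Suc[where g="\<lambda>_. A", OF assms]
    by (rule Ep_cong) (use T in \<open>simp add: field_simps of_bool_def\<close>)
  also have "\<dots> = ((b + real n) / ?T) * Ep (urn (\<lambda>_. A) b n) (\<lambda>z. of_bool (z = 0))"
    by simp
  finally show ?case unfolding Suc by (simp add: mult.commute)
qed simp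

section \<open>The backward exploration of the descendants\<close>

locale pa_parameters =
  fixes m :: nat and \<rho> :: real
  assumes m2: "m \<ge> 2" and rho: "\<rho> \<ge> -1"
begin

text \<open>
  A vertex without in-edges has attachment weight \<open>\<alpha>\<close>; the average attachment weight of a vertex is \<open>c\<close>.
  The number of open edges in the exploration grows like \<open>(n / k) powr \<gamma>\<close>.
\<close>

definition \<alpha> :: real where "\<alpha> = real m + \<rho>"
definition c :: real where "c = 2 * real m + \<rho>"
definition \<gamma> :: real where "\<gamma> = (real m - 1) * \<alpha> / c"

lemma alpha_ge: "1 \<le> \<alpha>" using m2 rho by (simp add: \<alpha>_def)
lemma alpha_pos [simp]: "0 < \<alpha>" using alpha_ge by simp
lemma c_eq: "c = \<alpha> + real m" by (simp add: c_def \<alpha>_def)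
lemma c_ge: "3 \<le> c" using m2 alpha_ge by (simp add: c_eq)
lemma c_pos [simp]: "0 < c" using c_ge by simp
lemma c_nz [simp]: "c \<noteq> 0" using c_pos by linarith
lemma gamma_pos [simp]: "0 < \<gamma>" using m2 by (simp add: \<gamma>_def)
lemma alpha_nonneg [simp]: "0 \<le> \<alpha>" and c_nonneg [simp]: "0 \<le> c" and gamma_nonneg [simp]: "0 \<le> \<gamma>"
  using alpha_pos c_pos gamma_pos by linarith+
lemma m_pos [simp]: "0 < m" using m2 by simp

text \<open>
  The vertices are explored in the order \<open>n, n - 1, \<dots>, 1\<close>. An out-edge of a descendant is open as long as its
  head is only known to be at most \<open>k\<close>. Given \<open>y\<close> open edges at vertex \<open>k\<close>, first the number \<open>l\<close> of self-loops
  of \<open>k\<close> is drawn, then the number \<open>z\<close> of open edges that point to \<open>k\<close>. If \<open>z > 0\<close>, then \<open>k\<close> is a descendant: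
  the \<open>z\<close> edges are closed and the \<open>m - l\<close> proper out-edges of \<open>k\<close> are opened. In \<open>chain k y\<close> the value at
  \<open>i\<close> is the pair of the indicator that \<open>i\<close> is hit and the number of open edges just before \<open>i\<close> is explored.
\<close>

definition loops :: "nat \<Rightarrow> nat pmf"
  where "loops k = urn (\<lambda>i. real i + 1 + \<rho>) ((real k - 1) * c) m"

definition draws :: "nat \<Rightarrow> nat \<Rightarrow> (nat \<times> nat) pmf"
  where "draws k y = bind_pmf (loops k) (\<lambda>l. map_pmf (Pair l)
     (urn (\<lambda>_. \<alpha> + real l) ((real k - 1) * c + real m - real l) y))"

definition move :: "nat \<Rightarrow> nat \<times> nat \<Rightarrow> bool \<times> nat"
  where "move y = (\<lambda>(l, z). if z = 0 then (False, y) else (True, y - z + (m - l)))"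

definition ker :: "nat \<Rightarrow> nat \<Rightarrow> (bool \<times> nat) pmf"
  where "ker k y = (if k \<le> 1 then return_pmf (y > 0, 0) else map_pmf (move y) (draws k y))"

primrec chain :: "nat \<Rightarrow> nat \<Rightarrow> (nat \<Rightarrow> bool \<times> nat) pmf" where
  "chain 0 y = return_pmf (\<lambda>_. (False, 0))"
| "chain (Suc k) y = bind_pmf (ker (Suc k) y)
     (\<lambda>(j, y'). map_pmf (\<lambda>w. w(Suc k := (j, y))) (chain k y'))"

lemma loops_le: "l \<in> set_pmf (loops k) \<Longrightarrow> l \<le> m"
  unfolding loops_def by (rule urn_le)

lemma finite_loops [simp]: "finite (set_pmf (loops k))"
  unfolding loops_def by simp

lemma finite_draws [simp]: "finite (set_pmf (draws k y))"
  unfolding draws_def by auto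

lemma draws_le: "(l, z) \<in> set_pmf (draws k y) \<Longrightarrow> l \<le> m \<and> z \<le> y"
  unfolding draws_def by (auto dest: urn_le loops_le)

lemma Ep_draws:
  fixes f :: "nat \<times> nat \<Rightarrow> 'b::{banach, second_countable_topology}"
  shows "Ep (draws k y) f = Ep (loops k) (\<lambda>l.
    Ep (urn (\<lambda>_. \<alpha> + real l) ((real k - 1) * c + real m - real l) y) (\<lambda>z. f (l, z)))"
  unfolding draws_def by (subst Ep_bind) auto

lemma finite_ker [simp]: "finite (set_pmf (ker k y))"
  unfolding ker_def by auto

lemma finite_chain [simp]: "finite (set_pmf (chain k y))"
  by (induction k arbitrary: y) auto

lemma Ep_ker:
  fixes f :: "bool \<times> nat \<Rightarrow> 'b::{banach, second_countable_topology}"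
  assumes "k \<ge> 2"
  shows "Ep (ker k y) f = Ep (draws k y) (\<lambda>d. f (move y d))"
  using assms unfolding ker_def by simp

lemma Ep_chain_Suc:
  fixes f :: "(nat \<Rightarrow> bool \<times> nat) \<Rightarrow> 'b::{banach, second_countable_topology}"
  shows "Ep (chain (Suc k) y) f
    = Ep (ker (Suc k) y) (\<lambda>(j, y'). Ep (chain k y') (\<lambda>w. f (w(Suc k := (j, y)))))"
  unfolding chain.simps by (subst Ep_bind) (auto simp: case_prod_unfold)

text \<open>
  A uniform bound on the success probabilities is enough here, as the urn for self-loops has a success
  weight that grows with the draw and no closed formula is needed.
\<close>

lemma urn_mean_le:
  assumes "\<And>i. i < n \<Longrightarrow> 0 \<le> g i" "0 < b" "0 \<le> P"
    and "\<And>i z. i < n \<Longrightarrow> z \<le> i \<Longrightarrow> (g i + real z) / (g i + b + real i) \<le> P"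
  shows "Ep (urn g b n) real \<le> real n * P"
  using assms(1,4)
proof (induction n)
  case (Suc n)
  have T: "g n + b + real n > 0" using Suc.prems(1)[of n] assms(2) by auto
  have "Ep (urn g b (Suc n)) real
      = Ep (urn g b n) (\<lambda>z. real z + (g n + real z) / (g n + b + real n))"
    by (subst Ep_urn_Suc[where g=g], use Suc.prems(1)[of n] assms(2) in auto)
      (rule Ep_cong, use T in \<open>simp add: divide_simps, simp add: algebra_simps\<close>)
  also have "\<dots> \<le> Ep (urn g b n) (\<lambda>z. real z + P)"
    by (rule Ep_mono) (auto intro!: Suc.prems(2) dest: urn_le)
  also have "\<dots> = Ep (urn g b n) real + P"
    by (simp add: integrable_measure_pmf_finite)
  also have "\<dots> \<le> real n * P + P" using Suc by simp
  finally show ?case by (simp add: algebra_simps)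
qed simp

lemma loops_mean:
  assumes "k \<ge> 2"
  shows "Ep (loops k) real \<le> 2 * real m / real k"
proof -
  have k: "real k \<ge> 2" using assms by simp
  have b: "(real k - 1) * c > 0" using k by simp
  have "Ep (loops k) real \<le> real m * (1 / (real k - 1))"
    unfolding loops_def
  proof (rule urn_mean_le)
    fix i z :: nat assume iz: "i < m" "z \<le> i"
    then have "real i + 1 \<le> real m" "real z + 1 \<le> real m" by simp_all
    then have n: "real i + 1 + \<rho> + real z \<le> c" by (simp add: c_def)
    have n0: "0 \<le> real i + 1 + \<rho>" using rho by simp
    have "(real i + 1 + \<rho> + real z) / (real i + 1 + \<rho> + (real k - 1) * c + real i) \<le> c / ((real k - 1) * c)"
      using n n0 b by (intro frac_le) auto
    also have "\<dots> = 1 / (real k - 1)" using k by simp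
    finally show "(real i + 1 + \<rho> + real z) / (real i + 1 + \<rho> + (real k - 1) * c + real i) \<le> 1 / (real k - 1)" .
  qed (use rho b k in auto)
  also have "\<dots> \<le> real m * (2 / real k)"
    using k by (intro mult_left_mono) (auto simp: field_simps)
  finally show ?thesis by (simp add: mult.commute)
qed

end

context pa_parameters begin

lemma urn_base_pos: "k \<ge> 2 \<Longrightarrow> l \<le> m \<Longrightarrow> (real k - 1) * c + real m - real l > 0"
proof -
  assume "k \<ge> 2" "l \<le> m"
  then have "real k - 1 > 0" "real m - real l \<ge> 0" by simp_all
  then have "(real k - 1) * c > 0" by simp
  then show ?thesis using \<open>real m - real l \<ge> 0\<close> by linarith
qed

lemma urn_total: "\<alpha> + real l + ((real k - 1) * c + real m - real l) = real k * c"
  by (simp add: c_eq algebra_simps)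

lemma draws_mean_weighted:
  assumes "k \<ge> 2"
  shows "Ep (draws k y) (\<lambda>(l, z). h l * real z)
    = Ep (loops k) (\<lambda>l. h l * (real y * (\<alpha> + real l) / (real k * c)))"
  unfolding Ep_draws
proof (rule Ep_cong)
  fix l assume "l \<in> set_pmf (loops k)"
  then have l: "l \<le> m" by (rule loops_le)
  have "Ep (urn (\<lambda>_. \<alpha> + real l) ((real k - 1) * c + real m - real l) y) (\<lambda>z. h l * real z)
     = h l * Ep (urn (\<lambda>_. \<alpha> + real l) ((real k - 1) * c + real m - real l) y) real"
    by simp
  also have "\<dots> = h l * (real y * (\<alpha> + real l) / (real k * c))"
    using polya_mean[of "\<alpha> + real l" "(real k - 1) * c + real m - real l" y]
      urn_base_pos[OF assms l] alpha_pos urn_total[of l k] by simp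
  finally show "Ep (urn (\<lambda>_. \<alpha> + real l) ((real k - 1) * c + real m - real l) y)
      (\<lambda>z. case (l, z) of (l, z) \<Rightarrow> h l * real z) = h l * (real y * (\<alpha> + real l) / (real k * c))"
    by simp
qed

lemma draws_mean:
  assumes "k \<ge> 2"
  shows "Ep (draws k y) (\<lambda>(l, z). real z)
    = real y * \<alpha> / (real k * c) + real y * Ep (loops k) real / (real k * c)"
proof -
  have "Ep (draws k y) (\<lambda>(l, z). real z)
     = Ep (loops k) (\<lambda>l. real y * \<alpha> / (real k * c) + real y / (real k * c) * real l)"
    using draws_mean_weighted[OF assms, of y "\<lambda>_. 1"]
    by (simp add: algebra_simps add_divide_distrib case_prod_unfold)
  also have "\<dots> = real y * \<alpha> / (real k * c) + real y / (real k * c) * Ep (loops k) real"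
    by (simp add: integrable_measure_pmf_finite)
  finally show ?thesis by simp
qed

lemma loops_nonneg: "0 \<le> Ep (loops k) real"
  by (rule Ep_nonneg) simp

lemma draws_mean_error:
  assumes "k \<ge> 2"
  shows "\<bar>Ep (draws k y) (\<lambda>(l, z). real z) - real y * \<alpha> / (real k * c)\<bar> \<le> 2 * real m * real y / (real k)\<^sup>2"
proof -
  have k: "real k > 0" using assms by simp
  have "real y * Ep (loops k) real / (real k * c) \<le> real y * (2 * real m / real k) / (real k * 1)"
    using loops_mean[OF assms] loops_nonneg k c_ge by (intro frac_le mult_left_mono mult_nonneg_nonneg) auto
  also have "\<dots> = 2 * real m * real y / (real k)\<^sup>2" by (simp add: power2_eq_square)
  finally have "real y * Ep (loops k) real / (real k * c) \<le> 2 * real m * real y / (real k)\<^sup>2" .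
  moreover have "0 \<le> real y * Ep (loops k) real / (real k * c)"
    using loops_nonneg[of k] by simp
  ultimately show ?thesis using draws_mean[OF assms, of y] by simp
qed

lemma draws_loop_moment:
  assumes "k \<ge> 2"
  shows "Ep (draws k y) (\<lambda>(l, z). real l * real z) \<le> 2 * real m * real y / (real k)\<^sup>2"
proof -
  have k: "real k > 0" using assms by simp
  have "Ep (draws k y) (\<lambda>(l, z). real l * real z)
     = Ep (loops k) (\<lambda>l. real l * (real y * (\<alpha> + real l) / (real k * c)))"
    by (rule draws_mean_weighted[OF assms])
  also have "\<dots> \<le> Ep (loops k) (\<lambda>l. real l * (real y * c / (real k * c)))"
  proof (rule Ep_mono)
    fix l assume "l \<in> set_pmf (loops k)"
    then have "\<alpha> + real l \<le> c" using loops_le[of l k] by (simp add: c_eq)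
    then show "real l * (real y * (\<alpha> + real l) / (real k * c)) \<le> real l * (real y * c / (real k * c))"
      using k by (intro mult_left_mono divide_right_mono) auto
  qed simp
  also have "\<dots> = real y / real k * Ep (loops k) real" by simp
  also have "\<dots> \<le> real y / real k * (2 * real m / real k)"
    using loops_mean[OF assms] by (intro mult_left_mono) auto
  finally show ?thesis by (simp add: power2_eq_square mult.commute)
qed

lemma draws_factorial_moment:
  assumes "k \<ge> 2"
  shows "Ep (draws k y) (\<lambda>(l, z). real z * (real z - 1)) \<le> 2 * (real y)\<^sup>2 / (real k)\<^sup>2"
  unfolding Ep_draws
proof (rule Ep_le_const)
  fix l assume "l \<in> set_pmf (loops k)"
  then have l: "l \<le> m" by (rule loops_le)
  have k: "real k > 0" using assms by simp
  have al: "0 \<le> \<alpha> + real l" "\<alpha> + real l \<le> c" using l by (simp_all add: c_eq)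
  have T: "\<alpha> + real l + ((real k - 1) * c + real m - real l) = real k * c" by (rule urn_total)
  have yy: "real y * (real y - 1) \<le> (real y)\<^sup>2" "0 \<le> real y * (real y - 1)"
    by (auto simp: power2_eq_square algebra_simps) (cases y; simp)
  have "Ep (urn (\<lambda>_. \<alpha> + real l) ((real k - 1) * c + real m - real l) y) (\<lambda>z. real z * (real z - 1))
     = real y * (real y - 1) * (\<alpha> + real l) * (\<alpha> + real l + 1) / (real k * c * (real k * c + 1))"
    unfolding polya_factorial_moment[OF al(1) urn_base_pos[OF assms l]] T ..
  also have "\<dots> \<le> (real y)\<^sup>2 * c * (2 * c) / (real k * c * (real k * c))"
    using al yy k c_ge by (intro frac_le mult_mono mult_nonneg_nonneg) auto
  also have "\<dots> = 2 * (real y)\<^sup>2 / (real k)\<^sup>2" using k by (simp add: power2_eq_square)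
  finally show "Ep (urn (\<lambda>_. \<alpha> + real l) ((real k - 1) * c + real m - real l) y)
     (\<lambda>z. case (l, z) of (l, z) \<Rightarrow> real z * (real z - 1)) \<le> 2 * (real y)\<^sup>2 / (real k)\<^sup>2" by simp
qed simp

text \<open>
  Up to a summable correction, \<open>\<eta> k\<close> is the rate at which a single particle hits vertex \<open>k\<close>.
\<close>

definition \<eta> :: "nat \<Rightarrow> real" where "\<eta> k = \<gamma> / real k * (1 + 2 * real m / real k)"

text \<open>
  A hit by one open edge replaces this edge by \<open>m\<close> new ones when there are no self-loops. Counted in units of
  \<open>m - 1\<close> open edges, every hit therefore produces one new particle.
\<close>

definition particles :: "nat \<Rightarrow> real" where "particles y = real y / (real m - 1)"

lemma eta_nonneg: "0 \<le> \<eta> k" using gamma_pos unfolding \<eta>_def by (intro mult_nonneg_nonneg) auto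

lemma particles_nonneg [simp]: "0 \<le> particles y" using m2 by (simp add: particles_def)

lemma hit_prob_le:
  assumes "k \<ge> 2"
  shows "Ep (ker k y) (\<lambda>(j, y'). of_bool j) \<le> particles y * \<eta> k"
proof -
  have k: "real k > 0" using assms by simp
  have "Ep (ker k y) (\<lambda>(j, y'). of_bool j :: real) \<le> Ep (draws k y) (\<lambda>(l, z). real z)"
    unfolding Ep_ker[OF assms] by (rule Ep_mono) (auto simp: move_def)
  also have "\<dots> \<le> real y * \<alpha> / (real k * c) + real y * (\<alpha> * (2 * real m / real k)) / (real k * c)"
    unfolding draws_mean[OF assms]
  proof -
    have "Ep (loops k) real \<le> 1 * (2 * real m / real k)" using loops_mean[OF assms] by simp
    also have "\<dots> \<le> \<alpha> * (2 * real m / real k)" using alpha_ge by (intro mult_right_mono) auto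
    finally show "real y * \<alpha> / (real k * c) + real y * Ep (loops k) real / (real k * c)
      \<le> real y * \<alpha> / (real k * c) + real y * (\<alpha> * (2 * real m / real k)) / (real k * c)"
      using k by (intro add_left_mono divide_right_mono mult_left_mono) auto
  qed
  also have "\<dots> = particles y * \<eta> k"
    using k m2 by (simp add: particles_def \<eta>_def \<gamma>_def field_simps)
  finally show ?thesis .
qed

lemma move_le:
  assumes "(l, z) \<in> set_pmf (draws k y)" "move y (l, z) = (j, y')"
  shows "j \<Longrightarrow> y' \<le> y + (m - 1)" "\<not> j \<Longrightarrow> y' = y"
  using draws_le[OF assms(1)] assms(2) m2 by (auto simp: move_def split: if_splits)

lemma ker_le:
  assumes "k \<ge> 2" "(j, y') \<in> set_pmf (ker k y)"
  shows "j \<Longrightarrow> y' \<le> y + (m - 1)" "\<not> j \<Longrightarrow> y' = y"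
  using assms move_le unfolding ker_def by auto

lemma particles_step: "particles (y + (m - 1)) = particles y + 1"
  using m2 by (simp add: particles_def field_simps of_nat_diff)

lemma particles_mono: "y \<le> y' \<Longrightarrow> particles y \<le> particles y'"
  using m2 by (simp add: particles_def divide_right_mono)

lemma pochhammer_mono_real: "0 \<le> x \<Longrightarrow> x \<le> y \<Longrightarrow> pochhammer x p \<le> pochhammer (y::real) p"
  unfolding pochhammer_prod by (intro prod_mono) auto

lemma pochhammer_nonneg_real: "0 \<le> (x::real) \<Longrightarrow> 0 \<le> pochhammer x p"
  unfolding pochhammer_prod by (intro prod_nonneg) auto

lemma pochhammer_shift: "(x::real) * pochhammer (x + 1) p = pochhammer x p * (x + real p)"
  using pochhammer_rec[of x p] pochhammer_rec'[of x p] by (simp add: mult.commute)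

text \<open>
  A rising factorial of the particle number is the right test function: adding one particle multiplies
  \<open>pochhammer x p\<close> by \<open>1 + p / x\<close>, and a hit has probability at most \<open>x * \<eta> k\<close>, so the factor \<open>x\<close> cancels.
\<close>

lemma ker_moment_step:
  assumes "k \<ge> 2"
  shows "Ep (ker k y) (\<lambda>(j, y'). pochhammer (particles y') p)
    \<le> (1 + \<eta> k) ^ p * pochhammer (particles y) p"
proof -
  let ?s = "particles y"
  let ?d = "pochhammer (?s + 1) p - pochhammer ?s p"
  have d: "0 \<le> ?d" using pochhammer_mono_real[of ?s "?s + 1" p] by simp
  have "Ep (ker k y) (\<lambda>(j, y'). pochhammer (particles y') p)
      \<le> Ep (ker k y) (\<lambda>x. pochhammer ?s p + ?d * (case x of (j, y') \<Rightarrow> of_bool j))"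
  proof (rule Ep_mono, simp, clarify)
    fix j y' assume x: "(j, y') \<in> set_pmf (ker k y)"
    show "pochhammer (particles y') p \<le> pochhammer ?s p + ?d * of_bool j"
    proof (cases j)
      case True
      then have "particles y' \<le> ?s + 1"
        using ker_le(1)[OF assms x] particles_mono[of y' "y + (m - 1)"] particles_step by simp
      then show ?thesis using True pochhammer_mono_real[of "particles y'" "?s + 1" p] by simp
    qed (use ker_le(2)[OF assms x] in simp)
  qed
  also have "\<dots> = pochhammer ?s p + ?d * Ep (ker k y) (\<lambda>(j, y'). of_bool j)"
    by (simp add: integrable_measure_pmf_finite)
  also have "\<dots> \<le> pochhammer ?s p + ?d * (?s * \<eta> k)"
    using hit_prob_le[OF assms, of y] d by (intro add_left_mono mult_left_mono) auto
  also have "?d * (?s * \<eta> k) = \<eta> k * (?s * pochhammer (?s + 1) p - ?s * pochhammer ?s p)"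
    by (simp add: algebra_simps)
  also have "pochhammer ?s p + \<dots> = (1 + real p * \<eta> k) * pochhammer ?s p"
    unfolding pochhammer_shift by (simp add: algebra_simps)
  also have "\<dots> \<le> (1 + \<eta> k) ^ p * pochhammer ?s p"
    using Bernoulli_inequality[of "\<eta> k" p] eta_nonneg[of k] pochhammer_nonneg_real[of ?s p]
    by (intro mult_right_mono) auto
  finally show ?thesis .
qed

definition growth :: "nat \<Rightarrow> nat \<Rightarrow> real" where "growth k n = (\<Prod>i\<in>{k<..n}. 1 + \<eta> i)"

lemma growth_same [simp]: "growth k k = 1" by (simp add: growth_def)

lemma growth_Suc: "k \<le> n \<Longrightarrow> growth k (Suc n) = (1 + \<eta> (Suc n)) * growth k n"
proof -
  assume "k \<le> n"
  then have "{k<..Suc n} = insert (Suc n) {k<..n}" by auto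
  then show ?thesis by (simp add: growth_def)
qed

lemma growth_ge1: "1 \<le> growth k n"
  unfolding growth_def by (rule prod_ge_1) (simp add: eta_nonneg)

lemma chain_moment:
  assumes "1 \<le> k" "k \<le> n"
  shows "Ep (chain n y) (\<lambda>w. pochhammer (particles (snd (w k))) p)
    \<le> growth k n ^ p * pochhammer (particles y) p"
  using assms(2)
proof (induction n arbitrary: y rule: dec_induct)
  case base
  obtain k' where k': "k = Suc k'" using assms(1) by (cases k) auto
  show ?case unfolding k' by (subst Ep_chain_Suc) (simp add: case_prod_unfold)
next
  case (step n)
  have n2: "Suc n \<ge> 2" using step.hyps assms(1) by simp
  have "Ep (chain (Suc n) y) (\<lambda>w. pochhammer (particles (snd (w k))) p)
     = Ep (ker (Suc n) y) (\<lambda>(j, y'). Ep (chain n y') (\<lambda>w. pochhammer (particles (snd (w k))) p))"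
    using step.hyps by (subst Ep_chain_Suc) (simp add: case_prod_unfold)
  also have "\<dots> \<le> Ep (ker (Suc n) y) (\<lambda>x. growth k n ^ p * (case x of (j, y') \<Rightarrow> pochhammer (particles y') p))"
    by (rule Ep_mono) (use step.IH in auto)
  also have "\<dots> = growth k n ^ p * Ep (ker (Suc n) y) (\<lambda>(j, y'). pochhammer (particles y') p)"
    by simp
  also have "\<dots> \<le> growth k n ^ p * ((1 + \<eta> (Suc n)) ^ p * pochhammer (particles y) p)"
    by (intro mult_left_mono ker_moment_step[OF n2]) (use growth_ge1[of k n] in auto)
  finally show ?case using step.hyps by (simp add: growth_Suc power_mult_distrib mult_ac)
qed

text \<open>
  Since \<open>1 + \<eta> i \<le> exp (\<eta> i)\<close>, the logarithm of the product is compared with the telescoping sums of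
  \<open>ln i - ln (i - 1)\<close> and \<open>1 / (i - 1) - 1 / i\<close>.
\<close>

lemma growth_le:
  assumes "1 \<le> k" "k \<le> n"
  shows "growth k n \<le> exp (2 * real m * \<gamma>) * (real n / real k) powr \<gamma>"
proof -
  have "growth k n \<le> exp (\<gamma> * (ln (real n) - ln (real k)) + 2 * real m * \<gamma> * (1 / real k - 1 / real n))"
    using assms(2)
  proof (induction n rule: dec_induct)
    case (step n)
    have n: "real n \<ge> 1" "real n > 0" using step.hyps assms(1) by simp_all
    have 1: "1 / real (Suc n) \<le> ln (real (Suc n)) - ln (real n)"
    proof -
      have "ln (real n / real (Suc n)) \<le> real n / real (Suc n) - 1"
        using n by (intro ln_le_minus_one) auto
      then show ?thesis using n by (simp add: ln_div field_simps)
    qed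
    have 2: "1 / (real (Suc n))\<^sup>2 \<le> 1 / real n - 1 / real (Suc n)"
      using n by (simp add: divide_simps power2_eq_square)
    have e: "\<eta> (Suc n) = \<gamma> * (1 / real (Suc n)) + 2 * real m * \<gamma> * (1 / (real (Suc n))\<^sup>2)"
      by (simp add: \<eta>_def power2_eq_square algebra_simps add_divide_distrib)
    have "1 + \<eta> (Suc n) \<le> exp (\<eta> (Suc n))" by (rule exp_ge_add_one_self)
    also have "\<dots> \<le> exp (\<gamma> * (ln (real (Suc n)) - ln (real n)) + 2 * real m * \<gamma> * (1 / real n - 1 / real (Suc n)))"
      unfolding exp_le_cancel_iff e by (intro add_mono mult_left_mono 1 2) auto
    finally have "1 + \<eta> (Suc n) \<le> \<dots>" .
    then have "growth k (Suc n) \<le> exp (\<gamma> * (ln (real (Suc n)) - ln (real n)) + 2 * real m * \<gamma> * (1 / real n - 1 / real (Suc n)))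
       * exp (\<gamma> * (ln (real n) - ln (real k)) + 2 * real m * \<gamma> * (1 / real k - 1 / real n))"
      unfolding growth_Suc[OF step.hyps(1)] using step.IH growth_ge1[of k n] by (intro mult_mono) auto
    also have "\<dots> = exp (\<gamma> * (ln (real (Suc n)) - ln (real k)) + 2 * real m * \<gamma> * (1 / real k - 1 / real (Suc n)))"
      unfolding mult_exp_exp by (simp only: right_diff_distrib) simp
    finally show ?case .
  qed simp
  also have "\<dots> \<le> exp (\<gamma> * (ln (real n) - ln (real k)) + 2 * real m * \<gamma> * 1)"
  proof -
    have "1 / real k - 1 / real n \<le> 1 / real k" by simp
    also have "\<dots> \<le> 1" using assms by simp
    finally show ?thesis unfolding exp_le_cancel_iff by (intro add_left_mono mult_left_mono) auto
  qed
  also have "\<dots> = exp (2 * real m * \<gamma>) * (real n / real k) powr \<gamma>"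
    using assms by (simp add: powr_def exp_add ln_div)
  finally show ?thesis .
qed

end

section \<open>Weighted sums over edge configurations\<close>

definition words :: "nat \<Rightarrow> nat \<Rightarrow> nat list set"
  where "words K y = {xs. set xs \<subseteq> {1..K} \<and> length xs = y}"

lemma finite_words [simp]: "finite (words K y)"
  unfolding words_def by (rule finite_lists_length_eq) simp

lemma words_0 [simp]: "words K 0 = {[]}"
  by (auto simp: words_def)

lemma sum_words_Suc:
  "(\<Sum>xs\<in>words K (Suc y). F xs) = (\<Sum>xs\<in>words K y. \<Sum>v\<in>{1..K}. F (v # xs))"
proof -
  have "words K (Suc y) = (\<lambda>(xs, v). v # xs) ` (words K y \<times> {1..K})"
    by (auto simp: words_def image_iff length_Suc_conv)
  moreover have "inj_on (\<lambda>(xs, v). v # xs) (words K y \<times> {1..K})"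
    by (auto simp: inj_on_def)
  ultimately show ?thesis
    by (simp add: sum.reindex sum.cartesian_product case_prod_unfold)
qed

lemma sum_words_append:
  "(\<Sum>xs\<in>words K (p + q). F xs) = (\<Sum>r\<in>words K q. \<Sum>xs\<in>words K p. F (xs @ r))"
proof (induction p arbitrary: F)
  case (Suc p)
  have "(\<Sum>xs\<in>words K (Suc p + q). F xs) = (\<Sum>xs\<in>words K (p + q). \<Sum>v\<in>{1..K}. F (v # xs))"
    unfolding add_Suc by (rule sum_words_Suc)
  also have "\<dots> = (\<Sum>r\<in>words K q. \<Sum>xs\<in>words K p. \<Sum>v\<in>{1..K}. F (v # xs @ r))"
    by (rule Suc)
  also have "\<dots> = (\<Sum>r\<in>words K q. \<Sum>xs\<in>words K (Suc p). F (xs @ r))"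
    unfolding sum_words_Suc by simp
  finally show ?case .
qed simp

text \<open>
  The unnormalised probability with which the urn produces the positions of the letter \<open>K\<close> in a word. Words
  are read from the right, so the head of the list is the last draw. The coefficients \<open>urn_coeff\<close> sum
  these weights over all words with a given number of occurrences of \<open>K\<close>.
\<close>

primrec urn_weight :: "(nat \<Rightarrow> real) \<Rightarrow> nat \<Rightarrow> nat list \<Rightarrow> real" where
  "urn_weight g K [] = 1"
| "urn_weight g K (v # xs) =
    (if v = K then g (length xs) + real (count_list xs K) else 1) * urn_weight g K xs"

primrec urn_coeff :: "(nat \<Rightarrow> real) \<Rightarrow> nat \<Rightarrow> nat \<Rightarrow> real" where
  "urn_coeff g 0 z = of_bool (z = 0)"
| "urn_coeff g (Suc y) z = urn_coeff g y z
     + (if z = 0 then 0 else (g y + real (z - 1)) * urn_coeff g y (z - 1))"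

lemma urn_coeff_zero: "z > y \<Longrightarrow> urn_coeff g y z = 0"
  by (induction y arbitrary: z) auto

lemma sum_urn_coeff_Suc:
  "(\<Sum>z\<le>Suc y. urn_coeff g (Suc y) z * f z)
    = (\<Sum>z\<le>y. urn_coeff g y z * (f z + (g y + real z) * f (Suc z)))"
proof -
  have "(\<Sum>z\<le>Suc y. urn_coeff g (Suc y) z * f z)
    = (\<Sum>z\<le>Suc y. urn_coeff g y z * f z)
      + (\<Sum>z\<le>Suc y. (if z = 0 then 0 else (g y + real (z - 1)) * urn_coeff g y (z - 1)) * f z)"
    by (simp add: algebra_simps sum.distrib)
  also have "(\<Sum>z\<le>Suc y. urn_coeff g y z * f z) = (\<Sum>z\<le>y. urn_coeff g y z * f z)"
    by (simp add: urn_coeff_zero)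
  also have "(\<Sum>z\<le>Suc y. (if z = 0 then 0 else (g y + real (z - 1)) * urn_coeff g y (z - 1)) * f z)
     = (\<Sum>z\<le>y. (g y + real z) * urn_coeff g y z * f (Suc z))"
    by (subst sum.atMost_Suc_shift) simp
  finally show ?thesis by (simp add: algebra_simps sum.distrib)
qed

text \<open>
  A word splits into the positions of the letter \<open>K\<close> and the word of the remaining letters. This is what allows
  vertex \<open>K\<close> to be separated from the older vertices.
\<close>

lemma sum_words_urn:
  assumes "K \<ge> 1"
  shows "(\<Sum>xs\<in>words K y. urn_weight g K xs * F (count_list xs K) (filter (\<lambda>v. v \<noteq> K) xs))
    = (\<Sum>z\<le>y. urn_coeff g y z * (\<Sum>xs\<in>words (K - 1) (y - z). F z xs))"
proof (induction y arbitrary: F)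
  case (Suc y)
  define F' where "F' z xs = (g y + real z) * F (Suc z) xs + (\<Sum>v\<in>{1..K-1}. F z (v # xs))" for z xs
  have K: "{1..K} = insert K {1..K-1}" "K \<notin> {1..K-1}" using assms by auto
  have "(\<Sum>xs\<in>words K (Suc y). urn_weight g K xs * F (count_list xs K) (filter (\<lambda>v. v \<noteq> K) xs))
    = (\<Sum>xs\<in>words K y. urn_weight g K xs * F' (count_list xs K) (filter (\<lambda>v. v \<noteq> K) xs))"
    unfolding sum_words_Suc
  proof (rule sum.cong[OF refl])
    fix xs assume "xs \<in> words K y"
    then have len: "length xs = y" by (simp add: words_def)
    show "(\<Sum>v\<in>{1..K}. urn_weight g K (v # xs) * F (count_list (v # xs) K) (filter (\<lambda>v. v \<noteq> K) (v # xs)))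
      = urn_weight g K xs * F' (count_list xs K) (filter (\<lambda>v. v \<noteq> K) xs)"
      unfolding K(1) by (subst sum.insert) (use K(2) len in \<open>auto simp: F'_def algebra_simps sum_distrib_left intro!: sum.cong\<close>)
  qed
  also have "\<dots> = (\<Sum>z\<le>y. urn_coeff g y z * (\<Sum>xs\<in>words (K - 1) (y - z). F' z xs))"
    by (rule Suc)
  also have "\<dots> = (\<Sum>z\<le>y. urn_coeff g y z * ((\<Sum>xs\<in>words (K - 1) (Suc y - z). F z xs)
      + (g y + real z) * (\<Sum>xs\<in>words (K - 1) (Suc y - Suc z). F (Suc z) xs)))"
  proof (rule sum.cong[OF refl])
    fix z assume "z \<in> {..y}"
    then have "Suc y - z = Suc (y - z)" by auto
    then show "urn_coeff g y z * (\<Sum>xs\<in>words (K - 1) (y - z). F' z xs)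
      = urn_coeff g y z * ((\<Sum>xs\<in>words (K - 1) (Suc y - z). F z xs)
      + (g y + real z) * (\<Sum>xs\<in>words (K - 1) (Suc y - Suc z). F (Suc z) xs))"
      by (simp only: sum_words_Suc F'_def sum.distrib sum_distrib_left) simp
  qed
  also have "\<dots> = (\<Sum>z\<le>Suc y. urn_coeff g (Suc y) z * (\<Sum>xs\<in>words (K - 1) (Suc y - z). F z xs))"
    by (rule sum_urn_coeff_Suc[symmetric])
  finally show ?case .
qed simp

lemma Ep_urn_coeff:
  fixes f :: "nat \<Rightarrow> real"
  assumes "0 < b" "\<And>i. 0 \<le> g i"
  shows "(\<Sum>z\<le>y. urn_coeff g y z * (pochhammer b (y - z) * f z))
    = (\<Prod>i<y. g i + b + real i) * Ep (urn g b y) f"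
proof (induction y arbitrary: f)
  case (Suc y)
  have T: "g y + b + real y > 0" using assms(1) assms(2)[of y] by simp
  have "(\<Sum>z\<le>Suc y. urn_coeff g (Suc y) z * (pochhammer b (Suc y - z) * f z))
    = (\<Sum>z\<le>y. urn_coeff g y z * (pochhammer b (Suc y - z) * f z
        + (g y + real z) * (pochhammer b (Suc y - Suc z) * f (Suc z))))"
    by (rule sum_urn_coeff_Suc)
  also have "\<dots> = (\<Sum>z\<le>y. urn_coeff g y z * (pochhammer b (y - z) *
       ((b + real y - real z) * f z + (g y + real z) * f (Suc z))))"
    by (rule sum.cong) (auto simp: Suc_diff_le pochhammer_Suc of_nat_diff algebra_simps)
  also have "\<dots> = (\<Prod>i<y. g i + b + real i) * Ep (urn g b y) (\<lambda>z. (b + real y - real z) * f z + (g y + real z) * f (Suc z))"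
    by (rule Suc)
  also have "Ep (urn g b y) (\<lambda>z. (b + real y - real z) * f z + (g y + real z) * f (Suc z))
    = Ep (urn g b y) (\<lambda>z. (g y + b + real y) * (((g y + real z) / (g y + b + real y)) *\<^sub>R f (Suc z)
       + ((b + real y - real z) / (g y + b + real y)) *\<^sub>R f z))"
    using T by (intro Ep_cong) (simp add: divide_simps)
  also have "\<dots> = (g y + b + real y) * Ep (urn g b (Suc y)) f"
    using assms by (subst Ep_urn_Suc) auto
  finally show ?case by (simp add: mult_ac)
qed simp

lemma urn_weight_const:
  "urn_weight (\<lambda>_. A) K xs = pochhammer A (count_list xs K)"
  by (induction xs) (auto simp: pochhammer_Suc)

lemma count_list_filter_neq: "j \<noteq> K \<Longrightarrow> count_list (filter (\<lambda>v. v \<noteq> K) xs) j = count_list xs j"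
  by (induction xs) auto

context pa_parameters begin

text \<open>
  A history is a list of rows, newest first; the row of a vertex lists the heads of its \<open>m\<close> out-edges, last
  edge first. The first vertex has no row, so a history of length \<open>k\<close> describes \<open>k + 1\<close> vertices.
\<close>

primrec graphs :: "nat \<Rightarrow> nat list list set" where
  "graphs 0 = {[]}"
| "graphs (Suc k) = (\<lambda>(r, hs). r # hs) ` (words (k + 2) m \<times> graphs k)"

text \<open>
  The unnormalised probability of the history \<open>hs\<close> together with \<open>e v\<close> further edges into each vertex \<open>v\<close>,
  sequentially attached in a fixed order. The attachment weight of a vertex rises by one with each in-edge, so
  all edges into one vertex together contribute a rising factorial, whatever their order. In particular
  further edges are exchangeable, and this is the reason why the graph can be explored backwards.
\<close>

primrec weight :: "nat list list \<Rightarrow> (nat \<Rightarrow> nat) \<Rightarrow> real" where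
  "weight [] e = pochhammer c (e 1)"
| "weight (r # hs) e = urn_weight (\<lambda>i. real i + 1 + \<rho>) (length hs + 2) r
     * pochhammer (\<alpha> + real (count_list r (length hs + 2))) (e (length hs + 2))
     * weight hs (\<lambda>j. e j + count_list r j)"

text \<open>
  The vertices that are reachable from \<open>S\<close>, computed in one pass from the newest row down: edges lead to
  older vertices only, so a vertex is reached before its row is inspected.
\<close>

primrec reach :: "nat list list \<Rightarrow> nat set \<Rightarrow> nat set" where
  "reach [] S = S \<inter> {1}"
| "reach (r # hs) S = (if length hs + 2 \<in> S then insert (length hs + 2) (reach hs (S \<union> set r))
     else reach hs S)"

primrec indeg :: "nat list list \<Rightarrow> nat \<Rightarrow> nat" where
  "indeg [] v = (if v = 1 then m else 0)"
| "indeg (r # hs) v = count_list r v + indeg hs v"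

primrec norm_const :: "nat \<Rightarrow> real" where
  "norm_const 0 = 1"
| "norm_const (Suc k) = norm_const k * (\<Prod>i<m. real i + 1 + \<rho> + real (k + 1) * c + real i)"

lemma finite_graphs [simp]: "finite (graphs k)"
  by (induction k) auto

lemma graphs_length: "hs \<in> graphs k \<Longrightarrow> length hs = k"
  by (induction k arbitrary: hs) auto

lemma sum_graphs_Suc:
  "(\<Sum>hs\<in>graphs (Suc k). F hs) = (\<Sum>hs\<in>graphs k. \<Sum>r\<in>words (k + 2) m. F (r # hs))"
proof -
  have "inj_on (\<lambda>(r, hs). r # hs) (words (k + 2) m \<times> graphs k)" by (auto simp: inj_on_def)
  then have "(\<Sum>hs\<in>graphs (Suc k). F hs) = (\<Sum>(r, hs)\<in>words (k + 2) m \<times> graphs k. F (r # hs))"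
    by (simp add: sum.reindex case_prod_unfold)
  also have "\<dots> = (\<Sum>r\<in>words (k + 2) m. \<Sum>hs\<in>graphs k. F (r # hs))"
    by (simp add: sum.cartesian_product)
  finally show ?thesis by (simp add: sum.swap[of _ "graphs k"])
qed

lemma weight_cong: "(\<And>j. j \<in> {1..length hs + 1} \<Longrightarrow> e j = e' j) \<Longrightarrow> weight hs e = weight hs e'"
proof (induction hs arbitrary: e e')
  case (Cons r hs)
  have "weight hs (\<lambda>j. e j + count_list r j) = weight hs (\<lambda>j. e' j + count_list r j)"
    by (rule Cons.IH) (use Cons.prems in auto)
  then show ?case using Cons.prems[of "length hs + 2"] by simp
qed simp

lemma reach_cong:
  "(\<And>v. v \<in> {1..length hs + 1} \<Longrightarrow> v \<in> S \<longleftrightarrow> v \<in> S') \<Longrightarrow> reach hs S = reach hs S'"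
proof (induction hs arbitrary: S S')
  case (Cons r hs)
  have "reach hs (S \<union> set r) = reach hs (S' \<union> set r)" "reach hs S = reach hs S'"
    using Cons.prems by (auto intro!: Cons.IH)
  then show ?case using Cons.prems[of "length hs + 2"] by simp
qed auto

lemma reach_subset: "reach hs S \<subseteq> {1..length hs + 1}"
proof (induction hs arbitrary: S)
  case (Cons r hs)
  have "reach (r # hs) S \<subseteq> insert (length hs + 2) (reach hs (S \<union> set r) \<union> reach hs S)" by auto
  also have "\<dots> \<subseteq> insert (length hs + 2) {1..length hs + 1}"
    using Cons.IH[of "S \<union> set r"] Cons.IH[of S] by blast
  also have "\<dots> \<subseteq> {1..length (r # hs) + 1}" by auto
  finally show ?case .
qed simp

lemma graphs_SucE:
  assumes "hs \<in> graphs (Suc k)"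
  obtains r hs' where "hs = r # hs'" "hs' \<in> graphs k" "set r \<subseteq> {1..k + 2}" "length r = m" "length hs' = k"
  using assms graphs_length by (auto simp: words_def)

lemma indeg_fresh: "hs \<in> graphs k \<Longrightarrow> v > k + 1 \<Longrightarrow> indeg hs v = 0"
proof (induction k arbitrary: hs)
  case (Suc k)
  from Suc.prems(1) obtain r hs' where "hs = r # hs'" "hs' \<in> graphs k" "set r \<subseteq> {1..k + 2}"
    by (elim graphs_SucE)
  then show ?case using Suc.IH[of hs'] Suc.prems(2) by (auto simp: count_list_0_iff)
qed simp

text \<open>
  One more edge into \<open>v\<close> costs the current attachment weight of \<open>v\<close>.
\<close>

lemma weight_increment:
  assumes "hs \<in> graphs k" "v \<in> {1..k + 1}"
  shows "weight hs (e(v := Suc (e v))) = (\<alpha> + real (indeg hs v) + real (e v)) * weight hs e"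
  using assms
proof (induction k arbitrary: hs e)
  case 0
  then show ?case by (simp add: pochhammer_Suc c_eq)
next
  case (Suc k)
  then obtain r hs' where hs: "hs = r # hs'" "hs' \<in> graphs k" "r \<in> words (k + 2) m" by auto
  have len: "length hs' = k" using hs(2) by (rule graphs_length)
  show ?case
  proof (cases "v = k + 2")
    case True
    have 1: "weight hs' (\<lambda>j. (e(v := Suc (e v))) j + count_list r j) = weight hs' (\<lambda>j. e j + count_list r j)"
      by (rule weight_cong) (use True len in auto)
    show ?thesis unfolding hs(1) weight.simps 1 using True len indeg_fresh[OF hs(2), of v]
      by (simp add: pochhammer_Suc)
  next
    case False
    then have v: "v \<in> {1..k + 1}" using Suc.prems by auto
    have "(\<lambda>j. (e(v := Suc (e v))) j + count_list r j)
       = (\<lambda>j. e j + count_list r j)(v := Suc (e v + count_list r v))" by auto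
    then have 1: "weight hs' (\<lambda>j. (e(v := Suc (e v))) j + count_list r j)
       = (\<alpha> + real (indeg hs' v) + real (e v + count_list r v)) * weight hs' (\<lambda>j. e j + count_list r j)"
      by (metis Suc.IH[OF hs(2) v, of "\<lambda>j. e j + count_list r j"])
    show ?thesis unfolding hs(1) weight.simps 1
      using False len by simp
  qed
qed

lemma sum_count_list: "set xs \<subseteq> A \<Longrightarrow> finite A \<Longrightarrow> (\<Sum>v\<in>A. count_list xs v) = length xs"
  using sum_count_set by fastforce

lemma sum_indeg:
  assumes "hs \<in> graphs k"
  shows "(\<Sum>v\<in>{1..k + 1}. indeg hs v) = (k + 1) * m"
  using assms
proof (induction k arbitrary: hs)
  case (Suc k)
  then obtain r hs' where hs: "hs = r # hs'" "hs' \<in> graphs k" "r \<in> words (k + 2) m" by auto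
  have r: "(\<Sum>v\<in>{1..k + 2}. count_list r v) = m"
    using hs(3) sum_count_list[of r "{1..k + 2}"] by (simp add: words_def)
  have "{1..Suc k + 1} = insert (k + 2) {1..k + 1}" by auto
  then have "(\<Sum>v\<in>{1..Suc k + 1}. indeg hs' v) = (k + 1) * m"
    using Suc.IH[OF hs(2)] indeg_fresh[OF hs(2), of "k + 2"] by simp
  then show ?case using r unfolding hs(1) by (simp add: sum.distrib)
qed simp

lemma weight_sum_one:
  assumes "hs \<in> graphs k" "xs \<in> words (k + 1) q"
  shows "(\<Sum>v\<in>{1..k + 1}. weight hs (count_list (v # xs)))
    = (real (k + 1) * c + real q) * weight hs (count_list xs)"
proof -
  have "(\<Sum>v\<in>{1..k + 1}. weight hs (count_list (v # xs)))
     = (\<Sum>v\<in>{1..k + 1}. (\<alpha> + real (indeg hs v) + real (count_list xs v)) * weight hs (count_list xs))"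
  proof (rule sum.cong[OF refl])
    fix v assume v: "v \<in> {1..k + 1}"
    have "count_list (v # xs) = (count_list xs)(v := Suc (count_list xs v))" by auto
    then show "weight hs (count_list (v # xs))
      = (\<alpha> + real (indeg hs v) + real (count_list xs v)) * weight hs (count_list xs)"
      using weight_increment[OF assms(1) v] by simp
  qed
  also have "\<dots> = (real (k + 1) * \<alpha> + real (\<Sum>v\<in>{1..k + 1}. indeg hs v)
      + real (\<Sum>v\<in>{1..k + 1}. count_list xs v)) * weight hs (count_list xs)"
    by (simp only: sum_distrib_right[symmetric] sum.distrib of_nat_sum) simp
  also have "(\<Sum>v\<in>{1..k + 1}. indeg hs v) = (k + 1) * m" by (rule sum_indeg[OF assms(1)])
  also have "(\<Sum>v\<in>{1..k + 1}. count_list xs v) = q"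
    using assms(2) by (subst sum_count_list) (auto simp: words_def)
  also have "real (k + 1) * \<alpha> + real ((k + 1) * m) + real q = real (k + 1) * c + real q"
    by (simp add: c_eq algebra_simps)
  finally show ?thesis .
qed

text \<open>
  Summing over the heads of additional edges leaves the total attachment weight \<open>(k + 1) * c\<close>, raised by one
  with every edge. Hence edges whose heads are never inspected can be dropped.
\<close>

lemma weight_sum:
  assumes "hs \<in> graphs k" "xs \<in> words (k + 1) q"
  shows "(\<Sum>r\<in>words (k + 1) p. weight hs (count_list (r @ xs)))
    = pochhammer (real (k + 1) * c + real q) p * weight hs (count_list xs)"
proof (induction p)
  case (Suc p)
  have "(\<Sum>r\<in>words (k + 1) (Suc p). weight hs (count_list (r @ xs)))
    = (\<Sum>r\<in>words (k + 1) p. (real (k + 1) * c + real (p + q)) * weight hs (count_list (r @ xs)))"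
    unfolding sum_words_Suc append_Cons
  proof (rule sum.cong[OF refl])
    fix r assume "r \<in> words (k + 1) p"
    then have "r @ xs \<in> words (k + 1) (p + q)" using assms(2) by (auto simp: words_def)
    from weight_sum_one[OF assms(1) this]
    show "(\<Sum>v\<in>{1..k + 1}. weight hs (count_list (v # r @ xs)))
      = (real (k + 1) * c + real (p + q)) * weight hs (count_list (r @ xs))" .
  qed
  also have "\<dots> = (real (k + 1) * c + real (p + q)) * (pochhammer (real (k + 1) * c + real q) p * weight hs (count_list xs))"
    by (simp only: sum_distrib_left[symmetric] Suc)
  also have "\<dots> = pochhammer (real (k + 1) * c + real q) (Suc p) * weight hs (count_list xs)"
    by (simp add: pochhammer_Suc algebra_simps)
  finally show ?case .
qed simp

text \<open>
  The weighted sum over all histories and all heads \<open>xs\<close> of \<open>y\<close> open edges, of a function of the number of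
  vertices that these edges reach.
\<close>

definition total_weight :: "nat \<Rightarrow> nat \<Rightarrow> (nat \<Rightarrow> real) \<Rightarrow> real" where
  "total_weight k y g = (\<Sum>hs\<in>graphs k. \<Sum>xs\<in>words (k + 1) y.
     weight hs (count_list xs) * g (card (reach hs (set xs))))"

definition hits :: "nat \<Rightarrow> (nat \<Rightarrow> bool \<times> nat) \<Rightarrow> nat" where
  "hits k w = card {i \<in> {1..k}. fst (w i)}"

lemma hits_upd: "hits (Suc k) (w(Suc k := (j, y))) = of_bool j + hits k w"
proof -
  have "{i \<in> {1..Suc k}. fst ((w(Suc k := (j, y))) i)}
     = (if j then insert (Suc k) {i \<in> {1..k}. fst (w i)} else {i \<in> {1..k}. fst (w i)})"
    by (auto simp: le_Suc_eq)
  then show ?thesis by (simp add: hits_def)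
qed

text \<open>
  If the newest vertex is not hit, then its row is irrelevant; if it is hit, then its proper out-edges join the
  remaining open edges.
\<close>

lemma reach_Cons_card:
  assumes "hs \<in> graphs k" "set r \<subseteq> {1..k + 2}" "set xs \<subseteq> {1..k + 2}"
  defines "fil \<equiv> filter (\<lambda>v. v \<noteq> k + 2)"
  shows "card (reach (r # hs) (set xs)) = (if count_list xs (k + 2) = 0 then card (reach hs (set (fil xs)))
     else Suc (card (reach hs (set (fil xs @ fil r)))))"
proof (cases "k + 2 \<in> set xs")
  case False
  then have "fil xs = xs" unfolding fil_def by (intro filter_True) auto
  then show ?thesis using False graphs_length[OF assms(1)] by (simp add: count_list_0_iff)
next
  case True
  have len: "length hs = k" by (rule graphs_length[OF assms(1)])
  have "reach hs (set xs \<union> set r) = reach hs (set (fil xs @ fil r))"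
    by (rule reach_cong) (use len in \<open>auto simp: fil_def\<close>)
  moreover have "k + 2 \<notin> reach hs S" "finite (reach hs S)" for S
    using reach_subset[of hs S] len finite_subset by auto
  ultimately show ?thesis using True len by (simp add: count_list_0_iff)
qed

lemma weight_Cons:
  assumes "hs \<in> graphs k"
  defines "fil \<equiv> filter (\<lambda>v. v \<noteq> k + 2)"
  shows "weight (r # hs) (count_list xs) = urn_weight (\<lambda>i. real i + 1 + \<rho>) (k + 2) r
     * (urn_weight (\<lambda>_. \<alpha> + real (count_list r (k + 2))) (k + 2) xs * weight hs (count_list (fil xs @ fil r)))"
proof -
  have len: "length hs = k" by (rule graphs_length[OF assms(1)])
  have "weight hs (\<lambda>j. count_list xs j + count_list r j) = weight hs (count_list (fil xs @ fil r))"
    by (rule weight_cong) (use len in \<open>auto simp: fil_def count_list_filter_neq\<close>)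
  then show ?thesis using len by (simp add: urn_weight_const)
qed

text \<open>
  The law of the backward exploration. In the inductive step the newest vertex is separated from the older
  ones: the row of the newest vertex contributes the urn for its self-loops, and the open edges contribute the
  urn for the hits. When the vertex is not hit, its proper out-edges are summed away by \<open>weight_sum\<close>; when
  it is hit, they are added to the open edges. Either way a weighted sum over shorter histories remains.
\<close>

lemma total_weight_chain:
  "total_weight k y g = norm_const k * pochhammer (real (k + 1) * c) y
     * Ep (chain (k + 1) y) (\<lambda>w. g (hits (k + 1) w))"
proof (induction k arbitrary: y g)
  case 0
  have w1: "words (Suc 0) y = {replicate y (Suc 0)}"
    unfolding words_def by (auto simp: replicate_length_same[symmetric] intro!: replicate_eqI)
  have "Ep (chain 1 y) (\<lambda>w. g (hits 1 w)) = g (of_bool (y > 0))"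
    by (simp add: ker_def hits_def bind_return_pmf)
  moreover have "count_list (replicate y (Suc 0)) (Suc 0) = y" by (induction y) auto
  moreover have "card (set (replicate y (Suc 0)) \<inter> {Suc 0}) = of_bool (y > 0)" by (cases y) auto
  ultimately show ?case
    unfolding total_weight_def by (simp add: w1)
next
  case (Suc k)
  define K where "K = k + 2"
  define b where "b = real (k + 1) * c"
  define g1 where "g1 = (\<lambda>i. real i + 1 + \<rho>)"
  define fil where "fil = filter (\<lambda>v. v \<noteq> K)"
  define \<Psi> where "\<Psi> r z xs = (\<Sum>hs\<in>graphs k. weight hs (count_list (xs @ r)) *
     (if z = 0 then g (card (reach hs (set xs))) else g (Suc (card (reach hs (set (xs @ r)))))))"
    for r xs :: "nat list" and z :: nat
  define \<Omega> where "\<Omega> l r = (\<Sum>z\<le>y. urn_coeff (\<lambda>_. \<alpha> + real l) y z * (\<Sum>xs\<in>words (k + 1) (y - z). \<Psi> r z xs))"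
    for l :: nat and r :: "nat list"
  define \<phi> where "\<phi> l z = (case move y (l, z) of (j, y') \<Rightarrow>
     Ep (chain (k + 1) y') (\<lambda>w. g (of_bool j + hits (k + 1) w)))" for l z
  have K: "K \<ge> 1" "K - 1 = k + 1" "real K - 1 = real (k + 1)" by (simp_all add: K_def)
  have b: "b > 0" by (simp add: b_def)
  have summand: "weight (r # hs) (count_list xs) * g (card (reach (r # hs) (set xs)))
     = urn_weight g1 K r * (urn_weight (\<lambda>_. \<alpha> + real (count_list r K)) K xs *
        (weight hs (count_list (fil xs @ fil r)) *
        (if count_list xs K = 0 then g (card (reach hs (set (fil xs)))) else g (Suc (card (reach hs (set (fil xs @ fil r))))))))"
    if "hs \<in> graphs k" "r \<in> words K m" "xs \<in> words K y" for r hs xs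
  proof -
    have sub: "set r \<subseteq> {1..k + 2}" "set xs \<subseteq> {1..k + 2}" using that by (auto simp: words_def K_def)
    show ?thesis
      unfolding weight_Cons[OF that(1)] reach_Cons_card[OF that(1) sub] fil_def K_def g1_def by simp
  qed
  have "total_weight (Suc k) y g = (\<Sum>hs\<in>graphs k. \<Sum>r\<in>words K m. \<Sum>xs\<in>words K y.
     weight (r # hs) (count_list xs) * g (card (reach (r # hs) (set xs))))"
    unfolding total_weight_def sum_graphs_Suc K_def by simp
  also have "\<dots> = (\<Sum>r\<in>words K m. \<Sum>xs\<in>words K y. \<Sum>hs\<in>graphs k.
     weight (r # hs) (count_list xs) * g (card (reach (r # hs) (set xs))))"
    by (subst sum.swap, rule sum.cong[OF refl], rule sum.swap)
  also have "\<dots> = (\<Sum>r\<in>words K m. urn_weight g1 K r * (\<Sum>xs\<in>words K y.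
      urn_weight (\<lambda>_. \<alpha> + real (count_list r K)) K xs * \<Psi> (fil r) (count_list xs K) (fil xs)))"
    unfolding sum_distrib_left \<Psi>_def by (intro sum.cong refl summand)
  also have "\<dots> = (\<Sum>r\<in>words K m. urn_weight g1 K r * \<Omega> (count_list r K) (fil r))"
    unfolding \<Omega>_def fil_def by (subst sum_words_urn[OF K(1)]) (simp only: K(2))
  also have "\<dots> = (\<Sum>l\<le>m. urn_coeff g1 m l * (\<Sum>r\<in>words (k + 1) (m - l). \<Omega> l r))"
    unfolding fil_def by (subst sum_words_urn[OF K(1)]) (simp only: K(2))
  also have "\<dots> = (\<Sum>l\<le>m. urn_coeff g1 m l * (norm_const k * (pochhammer b (m - l) *
      (\<Sum>z\<le>y. urn_coeff (\<lambda>_. \<alpha> + real l) y z * (pochhammer (b + real m - real l) (y - z) * \<phi> l z)))))"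
  proof (intro sum.cong refl arg_cong2[where f="(*)"])
    fix l assume "l \<in> {..m}"
    then have l: "l \<le> m" "real (m - l) = real m - real l" by auto
    have key: "(\<Sum>r\<in>words (k + 1) (m - l). \<Sum>xs\<in>words (k + 1) (y - z). \<Psi> r z xs)
      = norm_const k * (pochhammer b (m - l) * (pochhammer (b + real m - real l) (y - z) * \<phi> l z))"
      if z: "z \<le> y" for z
    proof (cases "z = 0")
      case False
      have "(\<Sum>r\<in>words (k + 1) (m - l). \<Sum>xs\<in>words (k + 1) (y - z). \<Psi> r z xs)
        = (\<Sum>xs\<in>words (k + 1) ((y - z) + (m - l)). \<Sum>hs\<in>graphs k.
            weight hs (count_list xs) * g (Suc (card (reach hs (set xs)))))"
        unfolding sum_words_append using False by (simp add: \<Psi>_def)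
      also have "\<dots> = total_weight k ((y - z) + (m - l)) (\<lambda>x. g (Suc x))"
        unfolding total_weight_def by (rule sum.swap)
      also have "\<dots> = norm_const k * pochhammer b ((m - l) + (y - z)) * \<phi> l z"
        unfolding Suc b_def using False by (simp add: \<phi>_def move_def add.commute)
      also have "pochhammer b ((m - l) + (y - z)) = pochhammer b (m - l) * pochhammer (b + real m - real l) (y - z)"
        using pochhammer_product'[of b "m - l" "y - z"] l by (simp add: algebra_simps)
      finally show ?thesis by (simp add: mult_ac)
    next
      case True
      have "(\<Sum>r\<in>words (k + 1) (m - l). \<Sum>xs\<in>words (k + 1) (y - z). \<Psi> r z xs)
        = (\<Sum>hs\<in>graphs k. \<Sum>xs\<in>words (k + 1) y. (\<Sum>r\<in>words (k + 1) (m - l). weight hs (count_list (xs @ r)))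
            * g (card (reach hs (set xs))))"
        unfolding \<Psi>_def using True
        by (simp add: sum_distrib_right)
          (subst sum.swap, subst sum.swap[of _ "graphs k"], rule sum.cong[OF refl], rule sum.swap)
      also have "\<dots> = (\<Sum>hs\<in>graphs k. \<Sum>xs\<in>words (k + 1) y. pochhammer (b + real y) (m - l) *
            (weight hs (count_list xs) * g (card (reach hs (set xs)))))"
      proof (intro sum.cong refl)
        fix hs xs assume h: "hs \<in> graphs k" "xs \<in> words (k + 1) y"
        have "count_list (xs @ r) = count_list (r @ xs)" for r by auto
        then have "(\<Sum>r\<in>words (k + 1) (m - l). weight hs (count_list (xs @ r)))
          = pochhammer (b + real y) (m - l) * weight hs (count_list xs)"
          using weight_sum[OF h, of "m - l"] by (simp only: b_def)
        then show "(\<Sum>r\<in>words (k + 1) (m - l). weight hs (count_list (xs @ r))) * g (card (reach hs (set xs)))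
          = pochhammer (b + real y) (m - l) * (weight hs (count_list xs) * g (card (reach hs (set xs))))"
          by simp
      qed
      also have "\<dots> = pochhammer (b + real y) (m - l) * total_weight k y g"
        unfolding total_weight_def by (simp only: sum_distrib_left)
      also have "\<dots> = norm_const k * (pochhammer b y * pochhammer (b + real y) (m - l)) * \<phi> l z"
        unfolding Suc b_def using True by (simp add: \<phi>_def move_def)
      also have "pochhammer b y * pochhammer (b + real y) (m - l) = pochhammer b (m - l) * pochhammer (b + real m - real l) (y - z)"
        using pochhammer_product'[of b "m - l" y] pochhammer_product'[of b y "m - l"] l True
        by (simp add: algebra_simps)
      finally show ?thesis by (simp add: mult_ac)
    qed
    have "(\<Sum>r\<in>words (k + 1) (m - l). \<Omega> l r)
      = (\<Sum>z\<le>y. urn_coeff (\<lambda>_. \<alpha> + real l) y z * (\<Sum>r\<in>words (k + 1) (m - l). \<Sum>xs\<in>words (k + 1) (y - z). \<Psi> r z xs))"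
      unfolding \<Omega>_def sum_distrib_left by (rule sum.swap)
    also have "\<dots> = (\<Sum>z\<le>y. urn_coeff (\<lambda>_. \<alpha> + real l) y z * (norm_const k * (pochhammer b (m - l) * (pochhammer (b + real m - real l) (y - z) * \<phi> l z))))"
      using key by (intro sum.cong) auto
    finally show "(\<Sum>r\<in>words (k + 1) (m - l). \<Omega> l r) = norm_const k * (pochhammer b (m - l) *
      (\<Sum>z\<le>y. urn_coeff (\<lambda>_. \<alpha> + real l) y z * (pochhammer (b + real m - real l) (y - z) * \<phi> l z)))"
      by (simp add: sum_distrib_left mult_ac)
  qed
  also have "\<dots> = (\<Sum>l\<le>m. norm_const k * pochhammer (real K * c) y * (urn_coeff g1 m l * (pochhammer b (m - l) *
      Ep (urn (\<lambda>_. \<alpha> + real l) (b + real m - real l) y) (\<phi> l))))"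
  proof (intro sum.cong refl)
    fix l assume "l \<in> {..m}"
    then have l: "l \<le> m" by simp
    have bl: "b + real m - real l > 0" using b l by simp
    have "(\<Sum>z\<le>y. urn_coeff (\<lambda>_. \<alpha> + real l) y z * (pochhammer (b + real m - real l) (y - z) * \<phi> l z))
      = (\<Prod>i<y. \<alpha> + real l + (b + real m - real l) + real i) * Ep (urn (\<lambda>_. \<alpha> + real l) (b + real m - real l) y) (\<phi> l)"
      by (rule Ep_urn_coeff) (use bl in auto)
    also have "(\<Prod>i<y. \<alpha> + real l + (b + real m - real l) + real i) = pochhammer (real K * c) y"
      unfolding pochhammer_prod by (simp add: lessThan_atLeast0 b_def K_def c_eq algebra_simps)
    finally show "urn_coeff g1 m l * (norm_const k * (pochhammer b (m - l) *
      (\<Sum>z\<le>y. urn_coeff (\<lambda>_. \<alpha> + real l) y z * (pochhammer (b + real m - real l) (y - z) * \<phi> l z))))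
      = norm_const k * pochhammer (real K * c) y * (urn_coeff g1 m l * (pochhammer b (m - l) *
      Ep (urn (\<lambda>_. \<alpha> + real l) (b + real m - real l) y) (\<phi> l)))"
      by simp
  qed
  also have "\<dots> = norm_const k * pochhammer (real K * c) y * (\<Sum>l\<le>m. urn_coeff g1 m l * (pochhammer b (m - l) *
      Ep (urn (\<lambda>_. \<alpha> + real l) (b + real m - real l) y) (\<phi> l)))"
    by (simp only: sum_distrib_left)
  also have "(\<Sum>l\<le>m. urn_coeff g1 m l * (pochhammer b (m - l) *
      Ep (urn (\<lambda>_. \<alpha> + real l) (b + real m - real l) y) (\<phi> l)))
    = (\<Prod>i<m. g1 i + b + real i) * Ep (urn g1 b m) (\<lambda>l. Ep (urn (\<lambda>_. \<alpha> + real l) (b + real m - real l) y) (\<phi> l))"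
    by (rule Ep_urn_coeff) (use b rho in \<open>auto simp: g1_def\<close>)
  also have "Ep (urn g1 b m) (\<lambda>l. Ep (urn (\<lambda>_. \<alpha> + real l) (b + real m - real l) y) (\<phi> l))
    = Ep (draws K y) (\<lambda>(l, z). \<phi> l z)"
    unfolding Ep_draws loops_def g1_def b_def K(3) by simp
  also have "\<dots> = Ep (chain K y) (\<lambda>w. g (hits K w))"
  proof -
    have "K = Suc (k + 1)" "K \<ge> 2" by (simp_all add: K_def)
    then show ?thesis
      by (simp only: Ep_chain_Suc Ep_ker hits_upd \<phi>_def case_prod_unfold prod.collapse)
  qed
  finally show ?case by (simp add: K_def g1_def b_def mult_ac)
qed

end

section \<open>The law of the number of descendants\<close>

text \<open>
  Every process with \<open>\<rho> > - m\<close> has \<open>\<rho> \<ge> -1\<close> by \<open>selfloops_rho_ge\<close> and thus belongs to this locale when \<open>m \<ge> 2\<close>.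
\<close>

locale pa_process = pref_attachment_selfloops M m \<rho> E + pa_parameters m \<rho>
  for M :: "'a measure" and m :: nat and \<rho> :: real and E :: "nat \<Rightarrow> nat \<Rightarrow> 'a \<Rightarrow> nat"
begin

text \<open>
  Rows are reversed because the attachment rule extends a row by its next edge, which becomes the head of the
  list.
\<close>

definition heads :: "nat \<Rightarrow> nat \<Rightarrow> 'a \<Rightarrow> nat list"
  where "heads n i \<omega> = map (\<lambda>l. E n l \<omega>) (rev [1..<Suc i])"

primrec hist :: "nat \<Rightarrow> 'a \<Rightarrow> nat list list" where
  "hist 0 \<omega> = []"
| "hist (Suc k) \<omega> = heads (k + 2) m \<omega> # hist k \<omega>"

lemma heads_0 [simp]: "heads n 0 \<omega> = []" by (simp add: heads_def)

lemma heads_Suc: "heads n (Suc i) \<omega> = E n (Suc i) \<omega> # heads n i \<omega>"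
  by (simp add: heads_def)

lemma length_heads [simp]: "length (heads n i \<omega>) = i" by (simp add: heads_def)

lemma set_heads: "set (heads n i \<omega>) = (\<lambda>l. E n l \<omega>) ` {1..i}"
  by (auto simp: heads_def)

lemma count_heads: "count_list (heads n i \<omega>) v = (\<Sum>l=1..i. of_bool (E n l \<omega> = v))"
  by (induction i) (simp_all add: heads_Suc)

lemma heads_eq_iff: "heads n i \<omega> = heads n i \<omega>' \<longleftrightarrow> (\<forall>l\<in>{1..i}. E n l \<omega> = E n l \<omega>')"
  by (auto simp: heads_def)

lemma hist_eq_iff: "hist k \<omega> = hist k \<omega>' \<longleftrightarrow> (\<forall>n\<in>{2..k + 1}. \<forall>l\<in>{1..m}. E n l \<omega> = E n l \<omega>')"
proof (induction k)
  case (Suc k)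
  have "{2..Suc k + 1} = insert (k + 2) {2..k + 1}" by auto
  then show ?case using Suc heads_eq_iff[of "k + 2" m \<omega> \<omega>'] by simp
qed simp

lemma length_hist [simp]: "length (hist k \<omega>) = k" by (induction k) auto

lemma measurable_Cons_countable:
  fixes f :: "'a \<Rightarrow> 'b::countable" and g :: "'a \<Rightarrow> 'b list"
  assumes "f \<in> measurable M (count_space UNIV)" "g \<in> measurable M (count_space UNIV)"
  shows "(\<lambda>\<omega>. f \<omega> # g \<omega>) \<in> measurable M (count_space UNIV)"
proof (rule measurable_compose_countable[OF _ assms(1)])
  fix i show "(\<lambda>\<omega>. i # g \<omega>) \<in> measurable M (count_space UNIV)"
    by (rule measurable_compose[OF assms(2)]) simp
qed

lemma measurable_heads [measurable]: "n \<ge> 1 \<Longrightarrow> i \<le> m \<Longrightarrow> heads n i \<in> measurable M (count_space UNIV)"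
proof (induction i)
  case (Suc i)
  have "(\<lambda>\<omega>. E n (Suc i) \<omega> # heads n i \<omega>) \<in> measurable M (count_space UNIV)"
    using Suc by (intro measurable_Cons_countable measurable_E) auto
  then show ?case by (simp add: heads_Suc[abs_def])
qed (simp add: heads_def[abs_def])

lemma measurable_hist [measurable]: "hist k \<in> measurable M (count_space UNIV)"
proof (induction k)
  case (Suc k)
  have "(\<lambda>\<omega>. heads (k + 2) m \<omega> # hist k \<omega>) \<in> measurable M (count_space UNIV)"
    using Suc by (intro measurable_Cons_countable measurable_heads) auto
  then show ?case by (simp add: hist.simps(2)[abs_def])
qed (simp add: hist.simps(1)[abs_def])

lemma first_row: "AE \<omega> in M. \<forall>l\<in>{1..m}. E 1 l \<omega> = 1"
  by (subst AE_finite_all) (use first_vertex in auto)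

lemma card_arcs_into:
  assumes "\<forall>l\<in>{1..m}. E 1 l \<omega> = 1"
  shows "card {e \<in> {1..k + 1} \<times> {1..m}. E (fst e) (snd e) \<omega> = v} = indeg (hist k \<omega>) v"
proof (induction k)
  case 0
  have "{e \<in> {1..0 + 1} \<times> {1..m}. E (fst e) (snd e) \<omega> = v} = (if v = 1 then {1} \<times> {1..m} else {})"
    using assms by auto
  then show ?case by (simp add: card_cartesian_product)
next
  case (Suc k)
  let ?A = "{e \<in> {1..k + 1} \<times> {1..m}. E (fst e) (snd e) \<omega> = v}"
  let ?B = "Pair (k + 2) ` {l \<in> {1..m}. E (k + 2) l \<omega> = v}"
  have "{e \<in> {1..Suc k + 1} \<times> {1..m}. E (fst e) (snd e) \<omega> = v} = ?A \<union> ?B"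
  proof (rule set_eqI)
    fix e :: "nat \<times> nat"
    obtain i l where e: "e = (i, l)" by (cases e)
    have "i \<in> {1..Suc k + 1} \<longleftrightarrow> i \<in> {1..k + 1} \<or> i = k + 2" by auto
    then show "e \<in> {e \<in> {1..Suc k + 1} \<times> {1..m}. E (fst e) (snd e) \<omega> = v} \<longleftrightarrow> e \<in> ?A \<union> ?B"
      unfolding e by (cases "i = k + 2") (simp_all add: image_iff)
  qed
  moreover have "?A \<inter> ?B = {}"
  proof (rule equals0I)
    fix e assume "e \<in> ?A \<inter> ?B"
    then have "fst e \<le> k + 1" "fst e = k + 2" by (simp_all add: image_iff mem_Times_iff) (elim conjE exE bexE, simp)
    then show False by simp
  qed
  moreover have "finite ?A" by (rule finite_subset[of _ "{1..k + 1} \<times> {1..m}"]) auto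
  moreover have "finite ?B" by simp
  moreover have "card ?B = count_list (heads (k + 2) m \<omega>) v"
  proof -
    have "{l \<in> {1..m}. E (k + 2) l \<omega> = v} = {1..m} \<inter> {l. E (k + 2) l \<omega> = v}" by auto
    then have "card {l \<in> {1..m}. E (k + 2) l \<omega> = v} = count_list (heads (k + 2) m \<omega>) v"
      unfolding count_heads by (subst sum_of_bool_eq) auto
    then show ?thesis by (subst card_image) (auto simp: inj_on_def)
  qed
  ultimately show ?case using Suc by (simp add: card_Un_disjoint)
qed

lemma degree_hist:
  assumes "\<forall>l\<in>{1..m}. E 1 l \<omega> = 1" "v \<in> {1..k + 1}"
  shows "vertex_degree (pa_graph m (\<lambda>i l. E i l \<omega>) (k + 1)) v = m + indeg (hist k \<omega>) v"
proof -
  let ?G = "pa_graph m (\<lambda>i l. E i l \<omega>) (k + 1)"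
  have "in_arcs ?G v = {e \<in> {1..k + 1} \<times> {1..m}. E (fst e) (snd e) \<omega> = v}"
    by (auto simp: pa_graph_def in_arcs_def)
  moreover have "out_arcs ?G v = {v} \<times> {1..m}"
    using assms(2) by (auto simp: pa_graph_def out_arcs_def)
  ultimately show ?thesis
    unfolding vertex_degree_def in_degree_def out_degree_def
    using card_arcs_into[OF assms(1), of k v] by (simp add: card_cartesian_product)
qed

definition row_weight :: "nat \<Rightarrow> nat list \<Rightarrow> nat list list \<Rightarrow> real"
  where "row_weight k r hs = urn_weight (\<lambda>i. real i + 1 + \<rho>) (k + 2) r * weight hs (count_list r)"

definition edge_total :: "nat \<Rightarrow> nat \<Rightarrow> real"
  where "edge_total k i = real i + 1 + \<rho> + real (k + 1) * c + real i"

lemma edge_total_pos: "edge_total k i > 0"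
proof -
  have "real (k + 1) * c > 0" by simp
  then show ?thesis unfolding edge_total_def using rho by linarith
qed

lemma norm_const_pos: "norm_const k > 0"
proof (induction k)
  case (Suc k)
  have "norm_const (Suc k) = norm_const k * (\<Prod>i<m. edge_total k i)" by (simp add: edge_total_def)
  then show ?case using Suc by (simp only:) (intro mult_pos_pos prod_pos ballI edge_total_pos)
qed simp

definition attach_weight :: "nat \<Rightarrow> nat list \<Rightarrow> nat list list \<Rightarrow> nat \<Rightarrow> real"
  where "attach_weight k r hs v = (if v = k + 2 then real (length r) + 1 + \<rho> + real (count_list r v)
     else \<alpha> + real (indeg hs v) + real (count_list r v))"

lemma row_weight_Cons:
  assumes "hs \<in> graphs k" "v \<in> {1..k + 2}"
  shows "row_weight k (v # r) hs = attach_weight k r hs v * row_weight k r hs"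
proof (cases "v = k + 2")
  case True
  have "weight hs (count_list (v # r)) = weight hs (count_list r)"
    by (rule weight_cong) (use True graphs_length[OF assms(1)] in auto)
  then show ?thesis using True by (simp add: row_weight_def attach_weight_def)
next
  case False
  then have v: "v \<in> {1..k + 1}" using assms(2) by auto
  have "count_list (v # r) = (count_list r)(v := Suc (count_list r v))" by auto
  then have "weight hs (count_list (v # r)) = (\<alpha> + real (indeg hs v) + real (count_list r v)) * weight hs (count_list r)"
    using weight_increment[OF assms(1) v, of "count_list r"] by simp
  then show ?thesis using False by (simp add: row_weight_def attach_weight_def)
qed

text \<open>
  The attachment probability of the model is the ratio of consecutive weights. At the new
  vertex, \<open>length r + 1\<close> counts the tails of the edges drawn so far, the current one included.
\<close>

lemma attach_prob_hist:
  assumes "\<forall>l\<in>{1..m}. E 1 l \<omega> = 1" "v \<in> {1..k + 2}"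
  shows "attach_prob m \<rho> (\<lambda>i l. E i l \<omega>) (k + 2) i v
    = attach_weight k (heads (k + 2) i \<omega>) (hist k \<omega>) v / edge_total k i"
proof -
  have den: "2 * (real (k + 2) - 1) * real m + 2 * real i + 1 + real (k + 2) * \<rho> = edge_total k i"
    by (simp add: edge_total_def c_def algebra_simps)
  have cnt: "(\<Sum>l=1..i. of_bool (E (k + 2) l \<omega> = v)) = real (count_list (heads (k + 2) i \<omega>) v)"
    by (simp add: count_heads)
  show ?thesis
  proof (cases "v = k + 2")
    case True
    then show ?thesis unfolding attach_prob_def den using cnt by (simp add: attach_weight_def)
  next
    case False
    then have v: "v \<in> {1..k + 1}" using assms(2) by auto
    have n: "k + 2 - 1 = k + 1" by simp
    show ?thesis unfolding attach_prob_def den n degree_hist[OF assms(1) v]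
      using cnt False v by (simp add: attach_weight_def \<alpha>_def)
  qed
qed

lemma prob_edge:
  assumes hs: "hs \<in> graphs k" and i: "i < m" and v: "v \<in> {1..k + 2}"
  shows "prob {\<omega> \<in> space M. hist k \<omega> = hs \<and> heads (k + 2) (Suc i) \<omega> = v # r}
    = prob {\<omega> \<in> space M. hist k \<omega> = hs \<and> heads (k + 2) i \<omega> = r} * (attach_weight k r hs v / edge_total k i)"
    (is "prob ?A = prob ?B * _")
proof (cases "prob ?B > 0")
  case False
  have hm: "heads (k + 2) i \<in> measurable M (count_space UNIV)" using i by (intro measurable_heads) auto
  have "?B \<in> sets M" using hm by measurable
  then have "prob ?A \<le> prob ?B" by (intro finite_measure_mono) (auto simp: heads_Suc)
  then have "prob ?A = 0" "prob ?B = 0" using False measure_nonneg[of M ?A] measure_nonneg[of M ?B] by linarith+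
  then show ?thesis by simp
next
  case True
  have hm: "heads (k + 2) i \<in> measurable M (count_space UNIV)" using i by (intro measurable_heads) auto
  have em [measurable]: "E (k + 2) (Suc i) \<in> measurable M (count_space UNIV)"
    using i by (intro measurable_E) auto
  have Bm [measurable]: "?B \<in> sets M" using hm by measurable
  have "\<exists>\<omega>0\<in>?B. \<forall>l\<in>{1..m}. E 1 l \<omega>0 = 1"
  proof (rule ccontr)
    assume "\<not> ?thesis"
    then have "AE \<omega> in M. \<omega> \<notin> ?B" using first_row by auto
    then have "prob ?B = 0" using Bm by (subst prob_eq_0) auto
    then show False using True by simp
  qed
  then obtain \<omega>0 where w0: "\<omega>0 \<in> ?B" "\<forall>l\<in>{1..m}. E 1 l \<omega>0 = 1" by auto
  define Q where "Q \<omega> \<longleftrightarrow> (\<forall>n\<in>{1..<k + 2}. \<forall>l\<in>{1..m}. E n l \<omega> = E n l \<omega>0)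
     \<and> (\<forall>l\<in>{1..i}. E (k + 2) l \<omega> = E (k + 2) l \<omega>0)" for \<omega>
  have "AE \<omega> in M. Q \<omega> \<longleftrightarrow> hist k \<omega> = hs \<and> heads (k + 2) i \<omega> = r"
    using first_row
  proof eventually_elim
    case (elim \<omega>)
    have "{1..<k + 2} = insert 1 {2..k + 1}" by auto
    then have "(\<forall>n\<in>{1..<k + 2}. \<forall>l\<in>{1..m}. E n l \<omega> = E n l \<omega>0) \<longleftrightarrow> hist k \<omega> = hist k \<omega>0"
      using elim w0(2) unfolding hist_eq_iff by simp
    then show ?case using w0(1) heads_eq_iff[of "k + 2" i \<omega> \<omega>0] by (simp add: Q_def)
  qed
  note AEQ = this
  have Qm [measurable]: "Measurable.pred M Q"
    unfolding Q_def using i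
    by (intro pred_intros_logic pred_intros_finite) (auto intro!: pred_eq_const1 measurable_E)
  have 1: "prob {\<omega> \<in> space M. Q \<omega>} = prob ?B"
  proof (rule measure_eq_AE[OF _ _ Bm])
    show "AE \<omega> in M. \<omega> \<in> {\<omega> \<in> space M. Q \<omega>} \<longleftrightarrow> \<omega> \<in> ?B" using AEQ by eventually_elim auto
  qed simp
  have 2: "prob {\<omega> \<in> space M. E (k + 2) (i + 1) \<omega> = v \<and> Q \<omega>} = prob ?A"
  proof (rule measure_eq_AE)
    show "AE \<omega> in M. \<omega> \<in> {\<omega> \<in> space M. E (k + 2) (i + 1) \<omega> = v \<and> Q \<omega>} \<longleftrightarrow> \<omega> \<in> ?A"
      using AEQ by eventually_elim (auto simp: heads_Suc)
    have A: "?A = {\<omega> \<in> space M. E (k + 2) (Suc i) \<omega> = v} \<inter> ?B" by (auto simp: heads_Suc)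
    have m1: "{\<omega> \<in> space M. E (k + 2) (Suc i) \<omega> = v} \<in> sets M" by measurable
    show "?A \<in> sets M" unfolding A by (rule sets.Int[OF m1 Bm])
    show "{\<omega> \<in> space M. E (k + 2) (i + 1) \<omega> = v \<and> Q \<omega>} \<in> sets M"
      unfolding Suc_eq_plus1[symmetric] by measurable
  qed
  have "\<P>(\<omega> in M. E (k + 2) (i + 1) \<omega> = v \<bar> Q \<omega>) = attach_prob m \<rho> (\<lambda>i l. E i l \<omega>0) (k + 2) i v"
    unfolding Q_def
    by (rule attachment) (use i v True 1 in \<open>auto simp: Q_def\<close>)
  also have "\<dots> = attach_weight k r hs v / edge_total k i"
    using attach_prob_hist[OF w0(2) v, of i] w0(1) by simp
  finally show ?thesis using True unfolding cond_prob_def 1 2 by (simp add: field_simps)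
qed

text \<open>
  The chain rule: each edge multiplies the probability by an attachment weight and divides it by a total weight
  that depends on the position of the edge only. The weights multiply to \<open>row_weight\<close>.
\<close>

lemma prob_history:
  assumes "hs \<in> graphs k" "set r \<subseteq> {1..k + 2}" "length r = i" "i \<le> m"
    and "prob {\<omega> \<in> space M. hist k \<omega> = hs} = weight hs (\<lambda>_. 0) / norm_const k"
  shows "prob {\<omega> \<in> space M. hist k \<omega> = hs \<and> heads (k + 2) i \<omega> = r}
    = row_weight k r hs / (norm_const k * (\<Prod>j<i. edge_total k j))"
  using assms(2-4)
proof (induction i arbitrary: r)
  case 0
  have "count_list ([] :: nat list) = (\<lambda>_. 0)" by (rule ext) simp
  then show ?case using 0 assms(5) by (simp add: row_weight_def)
next
  case (Suc i)
  then obtain v r' where r: "r = v # r'" by (cases r) auto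
  have v: "v \<in> {1..k + 2}" and r': "set r' \<subseteq> {1..k + 2}" "length r' = i" "i \<le> m" "i < m"
    using Suc.prems r by auto
  show ?case unfolding r prob_edge[OF assms(1) r'(4) v] Suc.IH[OF r'(1-3)] row_weight_Cons[OF assms(1) v]
    by (simp add: mult_ac)
qed

lemma prob_hist:
  "hs \<in> graphs k \<Longrightarrow> prob {\<omega> \<in> space M. hist k \<omega> = hs} = weight hs (\<lambda>_. 0) / norm_const k"
proof (induction k arbitrary: hs)
  case 0
  then show ?case by (simp add: prob_space)
next
  case (Suc k)
  from Suc.prems obtain r hs' where hs: "hs = r # hs'" "hs' \<in> graphs k" "set r \<subseteq> {1..k + 2}" "length r = m" "length hs' = k"
    by (elim graphs_SucE)
  have "prob {\<omega> \<in> space M. hist (Suc k) \<omega> = hs} = prob {\<omega> \<in> space M. hist k \<omega> = hs' \<and> heads (k + 2) m \<omega> = r}"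
    using hs(1) by (intro arg_cong[where f=prob]) auto
  also have "\<dots> = row_weight k r hs' / (norm_const k * (\<Prod>j<m. edge_total k j))"
    by (rule prob_history) (use hs Suc.IH in auto)
  finally show ?case using hs by (simp add: row_weight_def edge_total_def)
qed

text \<open>
  The exploration from the newest vertex \<open>k + 2\<close> starts with its \<open>m - l\<close> proper out-edges as open edges.
\<close>

lemma sum_prob_hist:
  "(\<Sum>hs\<in>graphs (Suc k). weight hs (\<lambda>_. 0) / norm_const (Suc k) * f (card (reach hs {k + 2})))
    = Ep (bind_pmf (loops (k + 2)) (\<lambda>l. chain (k + 1) (m - l))) (\<lambda>w. f (Suc (hits (k + 1) w)))"
proof -
  define g1 where "g1 = (\<lambda>i. real i + 1 + \<rho>)"
  define K where "K = k + 2"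
  have K: "K \<ge> 1" "K - 1 = k + 1" by (simp_all add: K_def)
  define F where "F l r = (\<Sum>hs\<in>graphs k. weight hs (count_list r) * f (Suc (card (reach hs (set r)))))"
    for l :: nat and r :: "nat list"
  have "(\<Sum>hs\<in>graphs (Suc k). weight hs (\<lambda>_. 0) * f (card (reach hs {k + 2})))
    = (\<Sum>hs\<in>graphs k. \<Sum>r\<in>words K m. urn_weight g1 K r * (weight hs (count_list (filter (\<lambda>v. v \<noteq> K) r))
         * f (Suc (card (reach hs (set (filter (\<lambda>v. v \<noteq> K) r)))))))"
    unfolding sum_graphs_Suc K_def
  proof (intro sum.cong refl)
    fix hs r assume h: "hs \<in> graphs k" "r \<in> words (k + 2) m"
    have len: "length hs = k" by (rule graphs_length[OF h(1)])
    have 1: "card (reach (r # hs) (set [k + 2])) = Suc (card (reach hs (set (filter (\<lambda>v. v \<noteq> k + 2) r))))"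
      using reach_Cons_card[OF h(1), of r "[k + 2]"] h(2) by (simp add: words_def)
    have 2: "weight hs (count_list r) = weight hs (count_list (filter (\<lambda>v. v \<noteq> k + 2) r))"
      by (rule weight_cong) (use len in \<open>auto simp: count_list_filter_neq\<close>)
    have 3: "weight (r # hs) (\<lambda>_. 0) = urn_weight g1 (k + 2) r * weight hs (count_list r)"
      using len by (simp add: g1_def)
    show "weight (r # hs) (\<lambda>_. 0) * f (card (reach (r # hs) {k + 2}))
      = urn_weight g1 (k + 2) r * (weight hs (count_list (filter (\<lambda>v. v \<noteq> k + 2) r))
         * f (Suc (card (reach hs (set (filter (\<lambda>v. v \<noteq> k + 2) r))))))"
      using 1 unfolding 3 2 list.set by (simp only: mult.assoc)
  qed
  also have "\<dots> = (\<Sum>r\<in>words K m. urn_weight g1 K r * F (count_list r K) (filter (\<lambda>v. v \<noteq> K) r))"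
    by (subst sum.swap) (simp add: F_def sum_distrib_left)
  also have "\<dots> = (\<Sum>l\<le>m. urn_coeff g1 m l * (\<Sum>r\<in>words (k + 1) (m - l). F l r))"
    by (subst sum_words_urn[OF K(1)]) (simp only: K(2))
  also have "\<dots> = (\<Sum>l\<le>m. urn_coeff g1 m l * total_weight k (m - l) (\<lambda>x. f (Suc x)))"
    unfolding F_def total_weight_def by (subst sum.swap) simp
  also have "\<dots> = norm_const k * (\<Sum>l\<le>m. urn_coeff g1 m l * (pochhammer (real (k + 1) * c) (m - l) *
       Ep (chain (k + 1) (m - l)) (\<lambda>w. f (Suc (hits (k + 1) w)))))"
    unfolding total_weight_chain sum_distrib_left by (simp add: mult_ac)
  also have "\<dots> = norm_const k * ((\<Prod>i<m. g1 i + real (k + 1) * c + real i) *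
       Ep (urn g1 (real (k + 1) * c) m) (\<lambda>l. Ep (chain (k + 1) (m - l)) (\<lambda>w. f (Suc (hits (k + 1) w)))))"
    by (subst Ep_urn_coeff) (use rho in \<open>auto simp: g1_def\<close>)
  also have "urn g1 (real (k + 1) * c) m = loops (k + 2)"
    by (simp add: loops_def g1_def)
  also have "norm_const k * ((\<Prod>i<m. g1 i + real (k + 1) * c + real i) *
       Ep (loops (k + 2)) (\<lambda>l. Ep (chain (k + 1) (m - l)) (\<lambda>w. f (Suc (hits (k + 1) w)))))
     = norm_const (Suc k) * Ep (bind_pmf (loops (k + 2)) (\<lambda>l. chain (k + 1) (m - l))) (\<lambda>w. f (Suc (hits (k + 1) w)))"
    by (subst Ep_bind[OF finite_loops finite_chain]) (simp only: norm_const.simps g1_def mult.assoc)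
  finally have eq: "(\<Sum>hs\<in>graphs (Suc k). weight hs (\<lambda>_. 0) * f (card (reach hs {k + 2})))
    = norm_const (Suc k) * Ep (bind_pmf (loops (k + 2)) (\<lambda>l. chain (k + 1) (m - l))) (\<lambda>w. f (Suc (hits (k + 1) w)))" .
  have "(\<Sum>hs\<in>graphs (Suc k). weight hs (\<lambda>_. 0) / norm_const (Suc k) * f (card (reach hs {k + 2})))
    = (\<Sum>hs\<in>graphs (Suc k). weight hs (\<lambda>_. 0) * f (card (reach hs {k + 2}))) / norm_const (Suc k)"
    unfolding sum_divide_distrib by simp
  also have "\<dots> = Ep (bind_pmf (loops (k + 2)) (\<lambda>l. chain (k + 1) (m - l))) (\<lambda>w. f (Suc (hits (k + 1) w)))"
    unfolding eq by (rule nonzero_mult_div_cancel_left) (rule less_imp_neq[OF norm_const_pos, THEN not_sym])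
  finally show ?thesis .
qed

lemma hist_in_graphs: "AE \<omega> in M. hist k \<omega> \<in> graphs k"
proof (cases k)
  case (Suc k')
  have "prob {\<omega> \<in> space M. hist k \<omega> \<in> graphs k} = (\<Sum>hs\<in>graphs k. prob {\<omega> \<in> space M. hist k \<omega> = hs})"
  proof -
    have "{\<omega> \<in> space M. hist k \<omega> \<in> graphs k} = (\<Union>hs\<in>graphs k. {\<omega> \<in> space M. hist k \<omega> = hs})" by auto
    then show ?thesis by (simp only:) (subst finite_measure_finite_Union, auto simp: disjoint_family_on_def)
  qed
  also have "\<dots> = (\<Sum>hs\<in>graphs (Suc k'). weight hs (\<lambda>_. 0) / norm_const (Suc k') * 1)"
    unfolding Suc by (intro sum.cong refl) (simp only: prob_hist mult_1_right)
  also have "\<dots> = 1"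
    by (subst sum_prob_hist) simp
  finally have "prob {\<omega> \<in> space M. hist k \<omega> \<in> graphs k} = 1" .
  then show ?thesis by (subst (asm) prob_Collect_eq_1) auto
qed auto

text \<open>
  Reachability in the digraph coincides with the recursive definition because all edges point to older
  vertices or are self-loops. The second claim carries this order through the induction.
\<close>

lemma reach_iff:
  assumes "hist k \<omega> \<in> graphs k" "\<forall>l\<in>{1..m}. E 1 l \<omega> = 1"
  defines "R \<equiv> {(i, j). i \<ge> 1 \<and> (\<exists>l\<in>{1..m}. j = E i l \<omega>)}"
  shows "w \<in> reach (hist k \<omega>) S \<longleftrightarrow> w \<ge> 1 \<and> (\<exists>v\<in>S \<inter> {1..k + 1}. (v, w) \<in> R\<^sup>* )"
    and "\<forall>(i, j)\<in>R. i \<le> k + 1 \<longrightarrow> 1 \<le> j \<and> j \<le> i"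
proof -
  have "(\<forall>w S. w \<in> reach (hist k \<omega>) S \<longleftrightarrow> w \<ge> 1 \<and> (\<exists>v\<in>S \<inter> {1..k + 1}. (v, w) \<in> R\<^sup>* ))
     \<and> (\<forall>(i, j)\<in>R. i \<le> k + 1 \<longrightarrow> 1 \<le> j \<and> j \<le> i)"
    using assms(1)
  proof (induction k)
    case 0
    have R1: "i = 1 \<and> j = 1" if "(i, j) \<in> R" "i \<le> 1" for i j
      using assms(2) that by (auto simp: R_def)
    have star: "(v, w) \<in> R\<^sup>* \<Longrightarrow> v = 1 \<Longrightarrow> w = 1" for v w
      by (induction rule: rtrancl_induct) (use R1 in auto)
    have "w \<in> reach (hist 0 \<omega>) S \<longleftrightarrow> w \<ge> 1 \<and> (\<exists>v\<in>S \<inter> {1..0 + 1}. (v, w) \<in> R\<^sup>* )" for w S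
      using star[of 1 w] by auto
    then show ?case using R1 by fastforce
  next
    case (Suc k)
    from Suc.prems have hk: "hist k \<omega> \<in> graphs k" and row: "set (heads (k + 2) m \<omega>) \<subseteq> {1..k + 2}"
      by (auto simp: words_def)
    from Suc.IH[OF hk] have IH: "w \<in> reach (hist k \<omega>) S \<longleftrightarrow> w \<ge> 1 \<and> (\<exists>v\<in>S \<inter> {1..k + 1}. (v, w) \<in> R\<^sup>* )"
      and down: "(i, j) \<in> R \<Longrightarrow> i \<le> k + 1 \<Longrightarrow> 1 \<le> j \<and> j \<le> i" for w S i j by auto
    have rowR: "(k + 2, j) \<in> R \<longleftrightarrow> j \<in> set (heads (k + 2) m \<omega>)" for j
      by (auto simp: R_def set_heads)
    have down': "(i, j) \<in> R \<Longrightarrow> i \<le> k + 2 \<Longrightarrow> 1 \<le> j \<and> j \<le> i" for i j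
    proof -
      assume ij: "(i, j) \<in> R" "i \<le> k + 2"
      show "1 \<le> j \<and> j \<le> i"
      proof (cases "i = k + 2")
        case True
        then show ?thesis using ij rowR[of j] row by auto
      qed (use down[OF ij(1)] ij(2) in auto)
    qed
    have down_star: "(v, w) \<in> R\<^sup>* \<Longrightarrow> 1 \<le> v \<Longrightarrow> v \<le> k + 2 \<Longrightarrow> 1 \<le> w \<and> w \<le> v" for v w
    proof (induction rule: rtrancl_induct)
      case (step y z)
      then show ?case using down'[of y z] by auto
    qed auto
    have first: "(k + 2, w) \<in> R\<^sup>* \<Longrightarrow> w = k + 2 \<or> (\<exists>v\<in>set (heads (k + 2) m \<omega>) \<inter> {1..k + 1}. (v, w) \<in> R\<^sup>* )" for w
    proof (induction rule: rtrancl_induct)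
      case (step y z)
      show ?case
      proof (cases "y = k + 2")
        case True
        then have "z \<in> set (heads (k + 2) m \<omega>)" using step(2) rowR by simp
        moreover have "z \<le> k + 2" "z \<ge> 1" using subsetD[OF row \<open>z \<in> set (heads (k + 2) m \<omega>)\<close>] by simp_all
        ultimately show ?thesis by (cases "z = k + 2") (auto intro!: bexI[of _ z])
      next
        case False
        then show ?thesis using step by (auto intro: rtrancl_into_rtrancl)
      qed
    qed auto
    have "w \<in> reach (hist (Suc k) \<omega>) S \<longleftrightarrow> w \<ge> 1 \<and> (\<exists>v\<in>S \<inter> {1..k + 2}. (v, w) \<in> R\<^sup>* )" for w S
    proof
      assume w: "w \<in> reach (hist (Suc k) \<omega>) S"
      show "w \<ge> 1 \<and> (\<exists>v\<in>S \<inter> {1..k + 2}. (v, w) \<in> R\<^sup>* )"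
      proof (cases "k + 2 \<in> S")
        case True
        then consider "w = k + 2" | "w \<in> reach (hist k \<omega>) (S \<union> set (heads (k + 2) m \<omega>))" using w by auto
        then show ?thesis
        proof cases
          case 2
          then obtain v where v: "w \<ge> 1" "v \<in> S \<union> set (heads (k + 2) m \<omega>)" "v \<in> {1..k + 1}" "(v, w) \<in> R\<^sup>*"
            unfolding IH by blast
          show ?thesis
          proof (cases "v \<in> S")
            case False
            then have "(k + 2, w) \<in> R\<^sup>*" using v rowR by (auto intro: converse_rtrancl_into_rtrancl)
            then show ?thesis using True v(1) by auto
          qed (use v in auto)
        qed (use True in auto)
      qed (use w IH in auto)
    next
      assume "w \<ge> 1 \<and> (\<exists>v\<in>S \<inter> {1..k + 2}. (v, w) \<in> R\<^sup>* )"
      then obtain v where v: "w \<ge> 1" "v \<in> S" "v \<in> {1..k + 2}" "(v, w) \<in> R\<^sup>*" by auto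
      show "w \<in> reach (hist (Suc k) \<omega>) S"
      proof (cases "v = k + 2")
        case True
        then show ?thesis using first[of w] v by (auto simp: IH)
      next
        case False
        then have "v \<in> {1..k + 1}" using v(3) by auto
        then show ?thesis using v by (auto simp: IH)
      qed
    qed
    then show ?case using down' by auto
  qed
  then show "w \<in> reach (hist k \<omega>) S \<longleftrightarrow> w \<ge> 1 \<and> (\<exists>v\<in>S \<inter> {1..k + 1}. (v, w) \<in> R\<^sup>* )"
    and "\<forall>(i, j)\<in>R. i \<le> k + 1 \<longrightarrow> 1 \<le> j \<and> j \<le> i" by auto
qed

lemma descendants_hist:
  assumes "hist k \<omega> \<in> graphs k" "\<forall>l\<in>{1..m}. E 1 l \<omega> = 1"
  shows "num_descendants (k + 1) \<omega> = card (reach (hist k \<omega>) {k + 1})"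
proof -
  define R where "R = {(i, j). i \<ge> 1 \<and> (\<exists>l\<in>{1..m}. j = E i l \<omega>)}"
  let ?G = "pa_graph m (\<lambda>i l. E i l \<omega>) (k + 1)"
  have down: "(i, j) \<in> R \<Longrightarrow> i \<le> k + 1 \<Longrightarrow> 1 \<le> j \<and> j \<le> i" for i j
    using reach_iff(2)[OF assms, folded R_def] by blast
  have ends: "arcs_ends ?G = {(i, j) \<in> R. i \<le> k + 1}"
    unfolding pa_graph_def arcs_ends_conv R_def by (force simp: image_iff)
  interpret wf_digraph ?G
  proof
    fix e assume "e \<in> arcs ?G"
    then obtain i l where e: "e = (i, l)" "i \<in> {1..k + 1}" "l \<in> {1..m}"
      by (auto simp: pa_graph_def)
    then have "(i, E i l \<omega>) \<in> R" by (auto simp: R_def)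
    then have "1 \<le> E i l \<omega> \<and> E i l \<omega> \<le> k + 1" using down[of i "E i l \<omega>"] e by auto
    then show "tail ?G e \<in> verts ?G" "head ?G e \<in> verts ?G" using e by (simp_all add: pa_graph_def)
  qed
  have star: "(k + 1, w) \<in> (arcs_ends ?G)\<^sup>* \<longleftrightarrow> (k + 1, w) \<in> R\<^sup>*" for w
  proof
    show "(k + 1, w) \<in> (arcs_ends ?G)\<^sup>* \<Longrightarrow> (k + 1, w) \<in> R\<^sup>*"
      unfolding ends by (rule subsetD[OF rtrancl_mono]) auto
    assume "(k + 1, w) \<in> R\<^sup>*"
    then have "(k + 1, w) \<in> (arcs_ends ?G)\<^sup>* \<and> 1 \<le> w \<and> w \<le> k + 1"
    proof (induction rule: rtrancl_induct)
      case (step y z)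
      then have "(y, z) \<in> arcs_ends ?G" "1 \<le> z" "z \<le> k + 1" using down[of y z] unfolding ends by auto
      then show ?case using step rtrancl_into_rtrancl by metis
    qed auto
    then show "(k + 1, w) \<in> (arcs_ends ?G)\<^sup>*" by simp
  qed
  have bnd: "(k + 1, w) \<in> R\<^sup>* \<Longrightarrow> 1 \<le> w \<and> w \<le> k + 1" for w
  proof (induction rule: rtrancl_induct)
    case (step y z)
    then show ?case using down[of y z] by auto
  qed auto
  have v: "verts ?G = {1..k + 1}" by (simp add: pa_graph_def)
  have r: "(k + 1) \<rightarrow>\<^sup>*\<^bsub>?G\<^esub> w \<longleftrightarrow> (k + 1, w) \<in> (arcs_ends ?G)\<^sup>*" for w
    by (rule reachable_conv') (simp add: pa_graph_def)
  have "w \<in> reach (hist k \<omega>) {k + 1} \<longleftrightarrow> w \<ge> 1 \<and> (k + 1, w) \<in> R\<^sup>*" for w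
    using reach_iff(1)[OF assms, folded R_def, of w "{k + 1}"] by simp
  then have "descendants ?G (k + 1) = reach (hist k \<omega>) {k + 1}"
    unfolding descendants_def v r star using bnd by auto
  then show ?thesis by (simp add: num_descendants_def)
qed

end

context pa_parameters begin

text \<open>
  The state in which the exploration from \<open>n\<close> begins, as \<open>n\<close> itself is reached for sure.
\<close>

definition start :: "nat \<Rightarrow> (nat \<Rightarrow> bool \<times> nat) pmf"
  where "start n = bind_pmf (loops n) (\<lambda>l. chain (n - 1) (m - l))"

lemma finite_start [simp]: "finite (set_pmf (start n))"
  unfolding start_def by simp

end

context pa_process begin

lemma measurable_num_descendants [measurable]:
  "num_descendants n \<in> measurable M (count_space UNIV)"
proof -
  define full where "full \<omega> = heads 1 m \<omega> # hist n \<omega>" for \<omega>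
  have full: "full \<in> measurable M (count_space UNIV)"
    unfolding full_def[abs_def] by (intro measurable_Cons_countable measurable_heads measurable_hist) auto
  have eq: "num_descendants n \<omega> = num_descendants n \<omega>'" if "full \<omega> = full \<omega>'" for \<omega> \<omega>'
  proof -
    have E: "E i l \<omega> = E i l \<omega>'" if "i \<in> {1..n}" "l \<in> {1..m}" for i l
    proof (cases "i = 1")
      case True
      then show ?thesis using \<open>full \<omega> = full \<omega>'\<close> that unfolding full_def by (simp add: heads_eq_iff)
    next
      case False
      then have "i \<in> {2..n + 1}" using that by auto
      then show ?thesis using \<open>full \<omega> = full \<omega>'\<close> that unfolding full_def by (simp add: hist_eq_iff)
    qed
    have "arcs_ends (pa_graph m (\<lambda>i l. E i l \<omega>) n) = arcs_ends (pa_graph m (\<lambda>i l. E i l \<omega>') n)"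
      unfolding arcs_ends_conv pa_graph_def by (intro image_cong) (auto simp: E)
    moreover have "verts (pa_graph m (\<lambda>i l. E i l \<omega>) n) = verts (pa_graph m (\<lambda>i l. E i l \<omega>') n)"
      by (simp add: pa_graph_def)
    ultimately show ?thesis
      unfolding num_descendants_def descendants_def reachable_def by simp
  qed
  have "num_descendants n \<omega> = num_descendants n (SOME \<omega>'. full \<omega>' = full \<omega>)" for \<omega>
    by (rule eq) (rule someI[of "\<lambda>\<omega>'. full \<omega>' = full \<omega>" \<omega>, THEN sym], simp)
  then have "num_descendants n = (\<lambda>x. num_descendants n (SOME \<omega>'. full \<omega>' = x)) \<circ> full"
    by (simp add: fun_eq_iff)
  then show ?thesis using measurable_comp[OF full, of "\<lambda>x. num_descendants n (SOME \<omega>'. full \<omega>' = x)" "count_space UNIV"]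
    by simp
qed

lemma descendants_prob:
  "prob {\<omega> \<in> space M. num_descendants (k + 2) \<omega> = x}
    = Ep (start (k + 2)) (\<lambda>w. of_bool (Suc (hits (k + 1) w) = x))"
proof -
  let ?G = "{hs \<in> graphs (Suc k). card (reach hs {k + 2}) = x}"
  have fin: "finite ?G" by simp
  have "prob {\<omega> \<in> space M. num_descendants (k + 2) \<omega> = x} = prob (\<Union>hs\<in>?G. {\<omega> \<in> space M. hist (Suc k) \<omega> = hs})"
  proof (rule measure_eq_AE)
    show "AE \<omega> in M. \<omega> \<in> {\<omega> \<in> space M. num_descendants (k + 2) \<omega> = x} \<longleftrightarrow>
       \<omega> \<in> (\<Union>hs\<in>?G. {\<omega> \<in> space M. hist (Suc k) \<omega> = hs})"
      using first_row hist_in_graphs[of "Suc k"]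
    proof eventually_elim
      case (elim \<omega>)
      then have "num_descendants (k + 2) \<omega> = card (reach (hist (Suc k) \<omega>) {k + 2})"
        using descendants_hist[OF elim(2,1)] by simp
      then show ?case using elim by auto
    qed
    show "(\<Union>hs\<in>?G. {\<omega> \<in> space M. hist (Suc k) \<omega> = hs}) \<in> sets M"
      using fin by (intro sets.finite_UN) auto
  qed simp
  also have "\<dots> = (\<Sum>hs\<in>?G. prob {\<omega> \<in> space M. hist (Suc k) \<omega> = hs})"
    using fin by (intro finite_measure_finite_Union) (auto simp: disjoint_family_on_def)
  also have "\<dots> = (\<Sum>hs\<in>?G. weight hs (\<lambda>_. 0) / norm_const (Suc k))"
    by (intro sum.cong refl prob_hist) auto
  also have "\<dots> = (\<Sum>hs\<in>graphs (Suc k). weight hs (\<lambda>_. 0) / norm_const (Suc k) * of_bool (card (reach hs {k + 2}) = x))"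
    by (rule sum.mono_neutral_cong_left) auto
  also have "\<dots> = Ep (start (k + 2)) (\<lambda>w. of_bool (Suc (hits (k + 1) w) = x))"
    unfolding start_def by (subst sum_prob_hist) simp
  finally show ?thesis .
qed

text \<open>
  From here on the random graph is replaced by the exploration chain, a finite distribution.
\<close>

lemma descendants_law:
  fixes f :: "nat \<Rightarrow> 'c::{banach, second_countable_topology}"
  assumes "n \<ge> 2"
  shows "(LINT \<omega>|M. f (num_descendants n \<omega>)) = Ep (start n) (\<lambda>w. f (Suc (hits (n - 1) w)))"
proof -
  obtain k where n: "n = k + 2" using assms by (metis add.commute le_Suc_ex)
  let ?p = "map_pmf (\<lambda>w. Suc (hits (k + 1) w)) (start n)"
  have "distr M (count_space UNIV) (num_descendants n) = measure_pmf ?p"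
  proof (rule measure_eqI_countable[of _ UNIV])
    fix x :: nat
    have "emeasure (distr M (count_space UNIV) (num_descendants n)) {x}
      = ennreal (prob {\<omega> \<in> space M. num_descendants n \<omega> = x})"
      by (subst emeasure_distr) (auto simp: emeasure_eq_measure vimage_def Int_def conj_commute)
    also have "prob {\<omega> \<in> space M. num_descendants n \<omega> = x} = Ep ?p (\<lambda>y. of_bool (y = x))"
      unfolding n descendants_prob by simp
    also have "\<dots> = measure (measure_pmf ?p) {x}"
    proof -
      have "(\<lambda>y. of_bool (y = x) :: real) = indicator {x}" by (auto simp: indicator_def)
      then show ?thesis by simp
    qed
    finally show "emeasure (distr M (count_space UNIV) (num_descendants n)) {x} = emeasure (measure_pmf ?p) {x}"
      by (simp add: measure_pmf.emeasure_eq_measure)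
  qed auto
  then have "(LINT y|distr M (count_space UNIV) (num_descendants n). f y) = Ep ?p f" by simp
  moreover have "(LINT y|distr M (count_space UNIV) (num_descendants n). f y) = (LINT \<omega>|M. f (num_descendants n \<omega>))"
    by (rule integral_distr) auto
  ultimately show ?thesis by (simp add: n)
qed

end

section \<open>Factorial moments of the number of hits\<close>

context pa_parameters begin

definition hits_above :: "nat \<Rightarrow> nat \<Rightarrow> (nat \<Rightarrow> bool \<times> nat) \<Rightarrow> nat" where
  "hits_above k n w = card {i \<in> {k<..n}. fst (w i)}"

lemma hits_above_upd: "k \<le> n \<Longrightarrow> hits_above k (Suc n) (w(Suc n := (j, y))) = of_bool j + hits_above k n w"
proof -
  assume "k \<le> n"
  then have "{i \<in> {k<..Suc n}. fst ((w(Suc n := (j, y))) i)}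
     = (if j then insert (Suc n) {i \<in> {k<..n}. fst (w i)} else {i \<in> {k<..n}. fst (w i)})"
    by (auto simp: le_Suc_eq)
  then show ?thesis by (simp add: hits_above_def)
qed

text \<open>
  A hit costs a factor \<open>x * \<eta> k\<close> and turns \<open>x\<close> into at most \<open>x + 1\<close> particles; since
  \<open>x * pochhammer (x + 1) p = pochhammer x (Suc p)\<close>, the degree of the rising factorial counts the hits.
\<close>

lemma ker_hit_moment:
  assumes "k \<ge> 2"
  shows "Ep (ker k y) (\<lambda>(j, y'). of_bool j * pochhammer (particles y') p) \<le> \<eta> k * pochhammer (particles y) (Suc p)"
proof -
  have "Ep (ker k y) (\<lambda>(j, y'). of_bool j * pochhammer (particles y') p)
     \<le> Ep (ker k y) (\<lambda>x. pochhammer (particles y + 1) p * (case x of (j, y') \<Rightarrow> of_bool j))"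
  proof (rule Ep_mono, simp, clarify)
    fix j y' assume x: "(j, y') \<in> set_pmf (ker k y)"
    show "of_bool j * pochhammer (particles y') p \<le> pochhammer (particles y + 1) p * of_bool j"
    proof (cases j)
      case True
      then have "particles y' \<le> particles y + 1"
        using ker_le(1)[OF assms x] particles_mono[of y' "y + (m - 1)"] particles_step by simp
      then show ?thesis using True pochhammer_mono_real[of "particles y'" "particles y + 1" p] by simp
    qed simp
  qed
  also have "\<dots> = pochhammer (particles y + 1) p * Ep (ker k y) (\<lambda>(j, y'). of_bool j)"
    by (simp add: case_prod_unfold)
  also have "\<dots> \<le> pochhammer (particles y + 1) p * (particles y * \<eta> k)"
    using hit_prob_le[OF assms, of y] by (intro mult_left_mono pochhammer_nonneg_real) auto
  finally show ?thesis by (simp add: pochhammer_rec mult_ac)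
qed

text \<open>
  By induction on the number of explored vertices, where a binomial coefficient of the number of hits splits
  by Pascal's rule. The factor \<open>growth k n - 1\<close> is the contribution of the first hit and vanishes for \<open>n = k\<close>.
\<close>

lemma hits_above_moment:
  assumes "1 \<le> k" "k \<le> n" "p \<ge> 1"
  shows "Ep (chain n y) (\<lambda>w. real (hits_above k n w choose p))
    \<le> (growth k n - 1) * growth k n ^ (p - 1) * pochhammer (particles y) p"
  using assms(2,3)
proof (induction n arbitrary: y p rule: dec_induct)
  case base
  have "hits_above k k w = 0" for w by (simp add: hits_above_def)
  moreover have "0 choose p = (0::nat)" using base by (intro binomial_eq_0) auto
  ultimately show ?case by simp
next
  case (step n)
  obtain q where p: "p = Suc q" using step.prems by (cases p) auto
  define G where "G = growth k n"
  define A where "A q = (if q = 0 then 1 else (G - 1) * G ^ (q - 1))" for q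
  let ?h = "\<eta> (Suc n)"
  have n2: "Suc n \<ge> 2" using step.hyps assms(1) by simp
  have G1: "G \<ge> 1" unfolding G_def by (rule growth_ge1)
  have h0: "?h \<ge> 0" by (rule eta_nonneg)
  have A0: "A q \<ge> 0" for q using G1 by (simp add: A_def)
  have IH: "Ep (chain n y') (\<lambda>w. real (hits_above k n w choose q)) \<le> A q * pochhammer (particles y') q" for y' q
    using step.IH[of q y'] by (cases "q = 0") (auto simp: A_def G_def)
  have "Ep (chain (Suc n) y) (\<lambda>w. real (hits_above k (Suc n) w choose p))
    = Ep (ker (Suc n) y) (\<lambda>(j, y'). Ep (chain n y') (\<lambda>w. real (hits_above k n w choose p)
        + of_bool j * real (hits_above k n w choose q)))"
    unfolding Ep_chain_Suc using step.hyps
    by (intro Ep_cong) (auto simp: hits_above_upd p intro!: Ep_cong split: prod.splits)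
  also have "\<dots> = Ep (ker (Suc n) y) (\<lambda>(j, y'). Ep (chain n y') (\<lambda>w. real (hits_above k n w choose p))
        + of_bool j * Ep (chain n y') (\<lambda>w. real (hits_above k n w choose q)))"
    by (intro Ep_cong) (auto simp: integrable_measure_pmf_finite split: prod.splits)
  also have "\<dots> \<le> Ep (ker (Suc n) y) (\<lambda>(j, y'). A p * pochhammer (particles y') p
        + A q * (of_bool j * pochhammer (particles y') q))"
    using IH by (intro Ep_mono) (auto intro!: add_mono)
  also have "\<dots> = A p * Ep (ker (Suc n) y) (\<lambda>(j, y'). pochhammer (particles y') p)
        + A q * Ep (ker (Suc n) y) (\<lambda>(j, y'). of_bool j * pochhammer (particles y') q)"
    by (simp add: case_prod_unfold integrable_measure_pmf_finite)
  also have "\<dots> \<le> A p * ((1 + ?h) ^ p * pochhammer (particles y) p) + A q * (?h * pochhammer (particles y) p)"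
    unfolding p using A0 by (intro add_mono mult_left_mono ker_moment_step ker_hit_moment n2)
  also have "\<dots> = (A p * (1 + ?h) ^ p + A q * ?h) * pochhammer (particles y) p"
    by (simp add: algebra_simps)
  also have "\<dots> \<le> (growth k (Suc n) - 1) * growth k (Suc n) ^ (p - 1) * pochhammer (particles y) p"
  proof (intro mult_right_mono pochhammer_nonneg_real particles_nonneg)
    have gs: "growth k (Suc n) = (1 + ?h) * G" using step.hyps by (simp add: growth_Suc G_def)
    have "A p * (1 + ?h) ^ p + A q * ?h \<le> (1 + ?h) ^ q * G ^ q * ((G - 1) * (1 + ?h) + ?h)"
    proof -
      have 1: "A p * (1 + ?h) ^ p = (1 + ?h) ^ q * G ^ q * ((G - 1) * (1 + ?h))"
        by (simp add: A_def p mult_ac)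
      have "A q \<le> G ^ q"
      proof (cases q)
        case (Suc r)
        have "(G - 1) * G ^ r \<le> G * G ^ r" using G1 by (intro mult_right_mono) auto
        then show ?thesis by (simp add: A_def Suc)
      qed (simp add: A_def)
      also have "\<dots> = 1 * G ^ q" by simp
      also have "\<dots> \<le> (1 + ?h) ^ q * G ^ q"
        using h0 G1 by (intro mult_right_mono) (auto simp: one_le_power)
      finally have "A q * ?h \<le> (1 + ?h) ^ q * G ^ q * ?h" using h0 by (rule mult_right_mono)
      then show ?thesis using 1 by (simp add: algebra_simps)
    qed
    also have "\<dots> = (growth k (Suc n) - 1) * growth k (Suc n) ^ (p - 1)"
    proof -
      have "(G - 1) * (1 + ?h) + ?h = (1 + ?h) * G - 1" by (simp add: algebra_simps)
      then show ?thesis unfolding gs p by (simp add: power_mult_distrib)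
    qed
    finally show "A p * (1 + ?h) ^ p + A q * ?h \<le> (growth k (Suc n) - 1) * growth k (Suc n) ^ (p - 1)" .
  qed
  finally show ?case .
qed

end

section \<open>Drift of the number of open edges\<close>

lemma powr_nonpos_le_1: "1 \<le> (b::real) \<Longrightarrow> e \<le> 0 \<Longrightarrow> b powr e \<le> 1"
  using powr_mono[of e 0 b] by simp

lemma powr_taylor2:
  fixes u e :: real
  assumes "0 \<le> u" "e \<le> 2"
  shows "\<bar>(1 + u) powr e - 1 - e * u\<bar> \<le> \<bar>e * (e - 1)\<bar> * u\<^sup>2"
proof (cases "u = 0")
  case False
  then have u: "u > 0" using assms by simp
  define f where "f x = (1 + x) powr e" for x :: real
  define f' where "f' x = e * (1 + x) powr (e - 1)" for x :: real
  define f'' where "f'' x = e * (e - 1) * (1 + x) powr (e - 2)" for x :: real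
  have d: "(f has_real_derivative f' x) (at x)" if "x \<ge> 0" for x
    unfolding f_def f'_def using that by (auto intro!: derivative_eq_intros)
  have d': "(f' has_real_derivative f'' x) (at x)" if "x \<ge> 0" for x
    unfolding f'_def f''_def using that by (auto intro!: derivative_eq_intros)
  obtain z where z: "0 < z" "z < u" "f u - f 0 = (u - 0) * f' z"
    using MVT2[of 0 u f f'] u d by auto
  obtain y where y: "0 < y" "y < z" "f' z - f' 0 = (z - 0) * f'' y"
    using MVT2[of 0 z f' f''] z d' by auto
  have "(1 + u) powr e - 1 - e * u = f u - f 0 - u * f' 0"
    by (simp add: f_def f'_def)
  also have "\<dots> = u * (f' z - f' 0)" using z(3) by (simp add: algebra_simps)
  also have "\<dots> = u * z * (e * (e - 1)) * (1 + y) powr (e - 2)"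
    using y(3) by (simp add: f''_def)
  finally have eq: "(1 + u) powr e - 1 - e * u = u * z * (e * (e - 1)) * (1 + y) powr (e - 2)" .
  have p1: "(1 + y) powr (e - 2) \<le> 1" using y assms by (intro powr_nonpos_le_1) auto
  have "\<bar>(1 + u) powr e - 1 - e * u\<bar> = u * z * \<bar>e * (e - 1)\<bar> * (1 + y) powr (e - 2)"
    unfolding eq using u z by (simp add: abs_mult)
  also have "\<dots> \<le> u * u * \<bar>e * (e - 1)\<bar> * 1"
    using u z p1 by (intro mult_mono) auto
  finally show ?thesis by (simp add: power2_eq_square mult_ac)
qed simp

context pa_parameters begin

text \<open>
  The probability that none of \<open>x\<close> open edges points to \<open>k\<close> is a product of urn probabilities that
  approximates \<open>(1 + x / (c * k)) powr (- \<alpha>)\<close>. In \<open>drift\<close>, the first term is the expected number of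
  closed edges and the second term the expected number of opened ones.
\<close>

definition hit_rate :: "nat \<Rightarrow> real \<Rightarrow> real"
  where "hit_rate k x = 1 - (1 + x / (c * real k)) powr (- \<alpha>)"

definition drift :: "nat \<Rightarrow> real \<Rightarrow> real"
  where "drift k x = - (x * \<alpha> / (real k * c)) + real m * hit_rate k x"

lemma miss_factor:
  assumes "t \<ge> 1"
  shows "\<bar>(1 - \<alpha> / t) - (t / (t + 1)) powr \<alpha>\<bar> \<le> \<alpha> * (\<alpha> + 1) / t\<^sup>2"
proof -
  have "(t / (t + 1)) powr \<alpha> = (1 + 1 / t) powr (- \<alpha>)"
  proof -
    have "t / (t + 1) = inverse (1 + 1 / t)" using assms by (simp add: field_simps)
    then show ?thesis using assms by (simp add: powr_minus powr_divide inverse_powr divide_inverse)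
  qed
  moreover have "\<bar>(1 + 1 / t) powr (- \<alpha>) - 1 - (- \<alpha>) * (1 / t)\<bar> \<le> \<bar>(- \<alpha>) * (- \<alpha> - 1)\<bar> * (1 / t)\<^sup>2"
    using assms by (intro powr_taylor2) (auto intro: order_trans[of _ 0])
  moreover have "\<bar>(- \<alpha>) * (- \<alpha> - 1)\<bar> = \<alpha> * (\<alpha> + 1)"
  proof -
    have "\<bar>- \<alpha> - 1\<bar> = \<alpha> + 1" using alpha_pos by linarith
    then show ?thesis by (simp add: abs_mult)
  qed
  ultimately show ?thesis by (simp add: power_divide abs_minus_commute)
qed

text \<open>
  Each factor \<open>1 - \<alpha> / t\<close> of the urn product is replaced by the factor \<open>(t / (t + 1)) powr \<alpha>\<close>, with which
  the product telescopes.
\<close>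

lemma miss_prob_urn:
  assumes "k \<ge> 2" "l \<le> m"
  shows "\<bar>Ep (urn (\<lambda>_. \<alpha> + real l) ((real k - 1) * c + real m - real l) y) (\<lambda>z. of_bool (z = 0))
      - (1 + real y / (c * real k)) powr (- \<alpha>)\<bar>
    \<le> real y * (real l / real k + \<alpha> * (\<alpha> + 1) / (real k)\<^sup>2)"
proof -
  let ?T = "real k * c"
  have k: "real k \<ge> 2" using assms by simp
  have T: "?T \<ge> real k" "?T > 0" using k c_ge mult_left_mono[of 1 c "real k"] by auto
  have al: "\<alpha> + real l \<le> c" using assms(2) by (simp add: c_eq)
  have Tc: "?T \<ge> c" using k c_pos mult_right_mono[of 1 "real k" c] by simp
  define f where "f i = 1 - (\<alpha> + real l) / (?T + real i)" for i :: nat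
  define g where "g i = ((?T + real i) / (?T + real i + 1)) powr \<alpha>" for i :: nat
  have "Ep (urn (\<lambda>_. \<alpha> + real l) ((real k - 1) * c + real m - real l) y) (\<lambda>z. of_bool (z = 0))
     = (\<Prod>i<y. (((real k - 1) * c + real m - real l) + real i) / (\<alpha> + real l + ((real k - 1) * c + real m - real l) + real i))"
    by (rule polya_none) (use urn_base_pos[OF assms] in auto)
  also have "\<dots> = (\<Prod>i<y. f i)"
    unfolding urn_total
  proof (rule prod.cong[OF refl])
    fix i
    have e: "(real k - 1) * c + real m - real l + real i = ?T + real i - (\<alpha> + real l)"
      by (simp add: c_eq algebra_simps)
    have nz: "?T + real i \<noteq> 0" using T by linarith
    show "((real k - 1) * c + real m - real l + real i) / (?T + real i) = f i"
      unfolding f_def e diff_divide_distrib by (simp only: divide_self[OF nz])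
  qed
  finally have 1: "Ep (urn (\<lambda>_. \<alpha> + real l) ((real k - 1) * c + real m - real l) y) (\<lambda>z. of_bool (z = 0)) = (\<Prod>i<y. f i)" .
  have "(\<Prod>i<y. (?T + real i) / (?T + real i + 1)) = ?T / (?T + real y)" for y
    by (induction y) (use T k in \<open>auto simp: divide_simps\<close>)
  moreover have "(\<Prod>i<y. g i) = (\<Prod>i<y. (?T + real i) / (?T + real i + 1)) powr \<alpha>"
    unfolding g_def using T by (subst prod_powr_distrib) auto
  ultimately have "(\<Prod>i<y. g i) = (?T / (?T + real y)) powr \<alpha>" by simp
  also have "?T / (?T + real y) = inverse (1 + real y / (c * real k))"
  proof -
    have "k > 0" using k by simp
    then show ?thesis using T by (simp add: field_simps)
  qed
  also have "\<dots> powr \<alpha> = (1 + real y / (c * real k)) powr (- \<alpha>)"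
    by (simp add: powr_minus inverse_powr)
  finally have 2: "(\<Prod>i<y. g i) = (1 + real y / (c * real k)) powr (- \<alpha>)" .
  have "norm ((\<Prod>i<y. f i) - (\<Prod>i<y. g i)) \<le> (\<Sum>i<y. norm (f i - g i))"
  proof (rule norm_prod_diff)
    fix i
    have "\<alpha> + real l \<le> ?T + real i" "0 < ?T + real i" using al Tc T by linarith+
    then have "(\<alpha> + real l) / (?T + real i) \<le> 1" by (simp only: divide_le_eq_1_pos)
    moreover have "0 \<le> (\<alpha> + real l) / (?T + real i)"
      using \<open>0 < ?T + real i\<close> by (intro divide_nonneg_pos add_nonneg_nonneg) auto
    ultimately show "norm (f i) \<le> 1" unfolding f_def real_norm_def by linarith
    show "norm (g i) \<le> 1" unfolding g_def using T by (auto intro!: powr_le1)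
  qed
  also have "\<dots> \<le> (\<Sum>i<y. real l / real k + \<alpha> * (\<alpha> + 1) / (real k)\<^sup>2)"
  proof (rule sum_mono)
    fix i
    let ?t = "?T + real i"
    have t: "?t \<ge> real k" using T by simp
    have "\<bar>f i - g i\<bar> \<le> real l / ?t + \<bar>(1 - \<alpha> / ?t) - (?t / (?t + 1)) powr \<alpha>\<bar>"
    proof -
      have "f i - g i = ((1 - \<alpha> / ?t) - (?t / (?t + 1)) powr \<alpha>) - real l / ?t"
        by (simp add: f_def g_def add_divide_distrib)
      then have "\<bar>f i - g i\<bar> \<le> \<bar>(1 - \<alpha> / ?t) - (?t / (?t + 1)) powr \<alpha>\<bar> + \<bar>real l / ?t\<bar>"
        by (simp only: abs_triangle_ineq4)
      then show ?thesis using t k by simp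
    qed
    also have "\<dots> \<le> real l / real k + \<alpha> * (\<alpha> + 1) / ?t\<^sup>2"
      using t k by (intro add_mono miss_factor divide_left_mono) auto
    also have "\<dots> \<le> real l / real k + \<alpha> * (\<alpha> + 1) / (real k)\<^sup>2"
      using t k by (intro add_left_mono divide_left_mono power_mono) auto
    finally show "norm (f i - g i) \<le> real l / real k + \<alpha> * (\<alpha> + 1) / (real k)\<^sup>2" by simp
  qed
  finally show ?thesis unfolding 1 2 by simp
qed

definition hit_rate_const :: real where "hit_rate_const = 2 * real m + \<alpha> * (\<alpha> + 1)"

lemma hit_prob_rate:
  assumes "k \<ge> 2"
  shows "\<bar>Ep (ker k y) (\<lambda>(j, y'). of_bool j) - hit_rate k (real y)\<bar> \<le> hit_rate_const * real y / (real k)\<^sup>2"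
proof -
  let ?r = "(1 + real y / (c * real k)) powr (- \<alpha>)"
  let ?u = "\<lambda>l. Ep (urn (\<lambda>_. \<alpha> + real l) ((real k - 1) * c + real m - real l) y) (\<lambda>z. of_bool (z = 0))"
  have "Ep (ker k y) (\<lambda>(j, y'). of_bool j) = Ep (draws k y) (\<lambda>(l, z). 1 - of_bool (z = 0) :: real)"
    unfolding Ep_ker[OF assms] by (rule Ep_cong) (auto simp: move_def)
  also have "\<dots> = Ep (loops k) (\<lambda>l. 1 - ?u l)"
    unfolding Ep_draws by (simp add: integrable_measure_pmf_finite)
  finally have eq: "Ep (ker k y) (\<lambda>(j, y'). of_bool j) - hit_rate k (real y) = Ep (loops k) (\<lambda>l. ?r - ?u l)"
    by (simp add: hit_rate_def integrable_measure_pmf_finite)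
  have "\<bar>Ep (ker k y) (\<lambda>(j, y'). of_bool j) - hit_rate k (real y)\<bar> \<le> Ep (loops k) (\<lambda>l. \<bar>?r - ?u l\<bar>)"
    unfolding eq real_norm_def[symmetric] by (rule Ep_norm_le)
  also have "\<dots> \<le> Ep (loops k) (\<lambda>l. real y * (real l / real k + \<alpha> * (\<alpha> + 1) / (real k)\<^sup>2))"
  proof (rule Ep_mono)
    fix l assume "l \<in> set_pmf (loops k)"
    then show "\<bar>?r - ?u l\<bar> \<le> real y * (real l / real k + \<alpha> * (\<alpha> + 1) / (real k)\<^sup>2)"
      by (subst abs_minus_commute) (rule miss_prob_urn[OF assms loops_le])
  qed simp
  also have "\<dots> = real y * (Ep (loops k) real / real k + \<alpha> * (\<alpha> + 1) / (real k)\<^sup>2)"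
    by (simp add: integrable_measure_pmf_finite)
  also have "\<dots> \<le> real y * ((2 * real m / real k) / real k + \<alpha> * (\<alpha> + 1) / (real k)\<^sup>2)"
    using loops_mean[OF assms] by (intro mult_left_mono add_right_mono divide_right_mono) auto
  also have "\<dots> = hit_rate_const * real y / (real k)\<^sup>2"
    by (simp add: hit_rate_const_def power2_eq_square add_divide_distrib algebra_simps)
  finally show ?thesis .
qed

definition drift_const :: real where "drift_const = real m * hit_rate_const + 4 * real m"

lemma mean_drift:
  assumes "k \<ge> 2"
  shows "\<bar>Ep (ker k y) (\<lambda>(j, y'). real y') - (real y + drift k (real y))\<bar> \<le> drift_const * real y / (real k)\<^sup>2"
proof -
  let ?D = "draws k y"
  have "Ep (ker k y) (\<lambda>(j, y'). real y')
     = Ep ?D (\<lambda>(l, z). real y - real z + real m * of_bool (z \<noteq> 0) - real l * of_bool (z \<noteq> 0))"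
    unfolding Ep_ker[OF assms]
    by (rule Ep_cong) (auto simp: move_def of_nat_diff dest!: draws_le)
  also have "\<dots> = real y - Ep ?D (\<lambda>(l, z). real z) + real m * Ep ?D (\<lambda>(l, z). of_bool (z \<noteq> 0))
      - Ep ?D (\<lambda>(l, z). real l * of_bool (z \<noteq> 0))"
    by (simp add: case_prod_unfold integrable_measure_pmf_finite)
  finally have e: "Ep (ker k y) (\<lambda>(j, y'). real y') = \<dots>" .
  have j: "Ep ?D (\<lambda>(l, z). of_bool (z \<noteq> 0)) = Ep (ker k y) (\<lambda>(j, y'). of_bool j :: real)"
    unfolding Ep_ker[OF assms] by (rule Ep_cong) (auto simp: move_def)
  have l0: "0 \<le> Ep ?D (\<lambda>(l, z). real l * of_bool (z \<noteq> 0))"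
    by (rule Ep_nonneg) auto
  have "Ep ?D (\<lambda>(l, z). real l * of_bool (z \<noteq> 0)) \<le> Ep ?D (\<lambda>(l, z). real l * real z)"
    by (rule Ep_mono) (auto intro!: mult_left_mono)
  also have "\<dots> \<le> 2 * real m * real y / (real k)\<^sup>2" by (rule draws_loop_moment[OF assms])
  finally have l1: "Ep ?D (\<lambda>(l, z). real l * of_bool (z \<noteq> 0)) \<le> 2 * real m * real y / (real k)\<^sup>2" .
  have z: "\<bar>Ep ?D (\<lambda>(l, z). real z) - real y * \<alpha> / (real k * c)\<bar> \<le> 2 * real m * real y / (real k)\<^sup>2"
    by (rule draws_mean_error[OF assms])
  have h: "\<bar>real m * (Ep (ker k y) (\<lambda>(j, y'). of_bool j) - hit_rate k (real y))\<bar> \<le> real m * (hit_rate_const * real y / (real k)\<^sup>2)"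
    unfolding abs_mult using hit_prob_rate[OF assms, of y] by (intro mult_mono) auto
  have "drift_const * real y / (real k)\<^sup>2 = real m * (hit_rate_const * real y / (real k)\<^sup>2) + 2 * (2 * real m * real y / (real k)\<^sup>2)"
    by (simp add: drift_const_def algebra_simps add_divide_distrib)
  moreover have "\<bar>real y - Z + real m * H - L - (real y + (- W + real m * R))\<bar> \<le> A + 2 * B"
    if "0 \<le> L" "L \<le> B" "\<bar>Z - W\<bar> \<le> B" "\<bar>real m * (H - R)\<bar> \<le> A" for Z H L W R A B :: real
    using that unfolding right_diff_distrib by linarith
  ultimately show ?thesis using l0 l1 z h unfolding e j drift_def by presburger
qed

definition square_const :: real where "square_const = (real m + 1)\<^sup>2 * (3 + 2 * real m)"

lemma step_square:
  assumes "k \<ge> 2"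
  shows "Ep (ker k y) (\<lambda>(j, y'). (real y' - real y)\<^sup>2) \<le> square_const * ((real y)\<^sup>2 / (real k)\<^sup>2 + real y / real k)"
proof -
  have k: "real k \<ge> 2" using assms by simp
  have "Ep (ker k y) (\<lambda>(j, y'). (real y' - real y)\<^sup>2)
    \<le> Ep (draws k y) (\<lambda>(l, z). (real m + 1)\<^sup>2 * (real z * (real z - 1) + real z))"
    unfolding Ep_ker[OF assms]
  proof (rule Ep_mono, simp, clarify)
    fix l z assume lz: "(l, z) \<in> set_pmf (draws k y)"
    note b = draws_le[OF lz]
    show "(case move y (l, z) of (j, y') \<Rightarrow> (real y' - real y)\<^sup>2) \<le> (real m + 1)\<^sup>2 * (real z * (real z - 1) + real z)"
    proof (cases "z = 0")
      case False
      have zz: "real z \<ge> 1" using False by simp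
      have e: "real (y - z + (m - l)) - real y = real m - real l - real z" using b by (simp add: of_nat_diff)
      have "real m \<le> real m * real z" using zz by simp
      then have "\<bar>real m - real l - real z\<bar> \<le> (real m + 1) * real z"
      proof -
        have "(real m + 1) * real z = real m * real z + real z" by (simp add: algebra_simps)
        moreover have "real l \<le> real m" "0 \<le> real l" using b by simp_all
        ultimately show ?thesis using zz \<open>real m \<le> real m * real z\<close> by linarith
      qed
      then have "(real m - real l - real z)\<^sup>2 \<le> ((real m + 1) * real z)\<^sup>2"
        by (metis abs_le_square_iff abs_of_nonneg abs_ge_zero order_trans power2_abs power_mono)
      moreover have "((real m + 1) * real z)\<^sup>2 = (real m + 1)\<^sup>2 * (real z * (real z - 1) + real z)"
        by (simp add: power_mult_distrib) (simp add: power2_eq_square algebra_simps)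
      moreover have "(case move y (l, z) of (j, y') \<Rightarrow> (real y' - real y)\<^sup>2) = (real m - real l - real z)\<^sup>2"
        unfolding e[symmetric] using False by (simp add: move_def)
      ultimately show ?thesis by (simp only:)
    qed (simp add: move_def)
  qed
  also have "\<dots> = (real m + 1)\<^sup>2 * (Ep (draws k y) (\<lambda>(l, z). real z * (real z - 1)) + Ep (draws k y) (\<lambda>(l, z). real z))"
    by (simp add: case_prod_unfold integrable_measure_pmf_finite del: of_nat_mult)
  also have "\<dots> \<le> (real m + 1)\<^sup>2 * (2 * (real y)\<^sup>2 / (real k)\<^sup>2 + (1 + 2 * real m) * (real y / real k))"
  proof (intro mult_left_mono add_mono draws_factorial_moment[OF assms])
    have "Ep (draws k y) (\<lambda>(l, z). real z) \<le> real y * \<alpha> / (real k * c) + 2 * real m * real y / (real k)\<^sup>2"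
      using draws_mean_error[OF assms, of y] by linarith
    also have "\<dots> \<le> real y / real k + 2 * real m * real y / real k"
    proof (intro add_mono)
      have "\<alpha> / c \<le> 1" by (simp add: c_eq add_nonneg_pos)
      then have "real y / real k * (\<alpha> / c) \<le> real y / real k * 1" by (intro mult_left_mono) auto
      then show "real y * \<alpha> / (real k * c) \<le> real y / real k" by simp
      show "2 * real m * real y / (real k)\<^sup>2 \<le> 2 * real m * real y / real k"
        using k by (intro divide_left_mono) (auto simp: power2_eq_square)
    qed
    finally show "Ep (draws k y) (\<lambda>(l, z). real z) \<le> (1 + 2 * real m) * (real y / real k)"
      by (simp add: algebra_simps)
  qed auto
  also have "\<dots> \<le> (real m + 1)\<^sup>2 * ((3 + 2 * real m) * ((real y)\<^sup>2 / (real k)\<^sup>2) + (3 + 2 * real m) * (real y / real k))"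
  proof (intro mult_left_mono add_mono)
    have "2 * ((real y)\<^sup>2 / (real k)\<^sup>2) \<le> (3 + 2 * real m) * ((real y)\<^sup>2 / (real k)\<^sup>2)"
      by (intro mult_right_mono) auto
    then show "2 * (real y)\<^sup>2 / (real k)\<^sup>2 \<le> (3 + 2 * real m) * ((real y)\<^sup>2 / (real k)\<^sup>2)" by simp
    show "(1 + 2 * real m) * (real y / real k) \<le> (3 + 2 * real m) * (real y / real k)"
      by (intro mult_right_mono) auto
  qed auto
  also have "\<dots> = square_const * ((real y)\<^sup>2 / (real k)\<^sup>2 + real y / real k)"
  proof -
    have "A * (B * u + B * v) = A * B * (u + v)" for A B u v :: real by (simp add: algebra_simps)
    then show ?thesis unfolding square_const_def by blast
  qed
  finally show ?thesis .
qed

lemma hit_rate_lipschitz: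
  assumes "k \<ge> 1" "0 \<le> x" "0 \<le> x'"
  shows "\<bar>hit_rate k x - hit_rate k x'\<bar> \<le> \<alpha> / (c * real k) * \<bar>x - x'\<bar>"
proof -
  have k: "c * real k > 0" using assms by simp
  have "\<bar>hit_rate k x - hit_rate k x'\<bar> \<le> \<alpha> / (c * real k) * \<bar>x - x'\<bar>" if "0 \<le> x'" "x' < x" for x x'
  proof -
    define f' where "f' z = \<alpha> * (1 + z / (c * real k)) powr (- \<alpha> - 1) * (1 / (c * real k))" for z
    have der: "(hit_rate k has_real_derivative f' z) (at z)" if "0 \<le> z" for z
    proof -
      have "1 + z / (c * real k) > 0" using that k by (simp add: add_pos_nonneg)
      then show ?thesis unfolding hit_rate_def[abs_def] f'_def using assms(1)
        by (auto intro!: derivative_eq_intros)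
    qed
    have "\<exists>z>x'. z < x \<and> hit_rate k x - hit_rate k x' = (x - x') * f' z"
      by (rule MVT2) (use that in \<open>auto intro!: der\<close>)
    then obtain z where z: "x' < z" "z < x" "hit_rate k x - hit_rate k x' = (x - x') * f' z"
      by auto
    have "(1 + z / (c * real k)) powr (- \<alpha> - 1) \<le> 1"
    proof (rule powr_nonpos_le_1)
      have "0 \<le> z / (c * real k)" using z that k by (intro divide_nonneg_nonneg) linarith+
      then show "1 \<le> 1 + z / (c * real k)" by simp
      show "- \<alpha> - 1 \<le> 0" using alpha_pos by linarith
    qed
    then have "f' z \<le> \<alpha> * 1 * (1 / (c * real k))"
      unfolding f'_def using k by (intro mult_mono) auto
    moreover have "f' z \<ge> 0" unfolding f'_def using k by simp
    ultimately have "\<bar>f' z\<bar> \<le> \<alpha> / (c * real k)" by simp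
    then have "(x - x') * \<bar>f' z\<bar> \<le> (x - x') * (\<alpha> / (c * real k))"
      using that by (intro mult_left_mono) auto
    then show ?thesis unfolding z(3) abs_mult using that by (simp add: mult.commute)
  qed
  note this[of x' x] this[of x x']
  then show ?thesis
    using assms abs_minus_commute[of x x'] abs_minus_commute[of "hit_rate k x" "hit_rate k x'"]
    by (cases x x' rule: linorder_cases) auto
qed

text \<open>
  Two solutions of the recursion drift apart by a factor \<open>1 + \<gamma> / k\<close> per step at most, so over the whole second
  phase errors are amplified by the natural growth factor only.
\<close>

lemma drift_lipschitz:
  assumes "k \<ge> 1" "0 \<le> x" "0 \<le> x'"
  shows "\<bar>(x + drift k x) - (x' + drift k x')\<bar> \<le> (1 + \<gamma> / real k) * \<bar>x - x'\<bar>"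
proof -
  have k: "c * real k > 0" "real k \<ge> 1" using assms by simp_all
  have "\<bar>(x + drift k x) - (x' + drift k x')\<bar> \<le> (1 + \<gamma> / real k) * \<bar>x - x'\<bar>" if x: "0 \<le> x'" "x' < x" for x x'
  proof -
    define d where "d = hit_rate k x - hit_rate k x'"
    define A where "A = \<alpha> / (c * real k)"
    have "0 \<le> d"
    proof -
      have "(1 + x / (c * real k)) powr (- \<alpha>) \<le> (1 + x' / (c * real k)) powr (- \<alpha>)"
        using x k by (intro powr_mono2') (auto intro!: divide_right_mono add_pos_nonneg)
      then show ?thesis by (simp add: d_def hit_rate_def)
    qed
    then have d0: "0 \<le> real m * d" by simp
    have "d \<le> A * (x - x')"
      using hit_rate_lipschitz[OF assms(1), of x x'] x \<open>0 \<le> d\<close> by (simp add: d_def A_def)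
    then have d1: "real m * d \<le> real m * (A * (x - x'))" by (intro mult_left_mono) auto
    have "A \<le> 1"
    proof -
      have "\<alpha> \<le> 1 * c" by (simp add: c_eq)
      also have "\<dots> \<le> real k * c" using k by (intro mult_right_mono) auto
      finally show ?thesis using k by (simp add: A_def mult.commute)
    qed
    then have A: "A * (x - x') \<le> x - x'" using x mult_right_mono[of A 1 "x - x'"] by simp
    have e: "(x + drift k x) - (x' + drift k x') = (x - x') - A * (x - x') + real m * d"
      by (simp add: drift_def d_def A_def algebra_simps diff_divide_distrib)
    have g: "\<gamma> / real k = real m * A - A"
      using k by (simp add: \<gamma>_def A_def field_simps)
    have r: "(1 + \<gamma> / real k) * (x - x') = (x - x') - A * (x - x') + real m * (A * (x - x'))"
      unfolding g by (simp add: algebra_simps)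
    have "\<bar>(x + drift k x) - (x' + drift k x')\<bar> \<le> (1 + \<gamma> / real k) * (x - x')"
      unfolding e r using d0 d1 A by (simp only: abs_le_iff) linarith
    then show ?thesis using x by simp
  qed
  note this[of x' x] this[of x x']
  then show ?thesis
    using assms abs_minus_commute[of x x'] abs_minus_commute[of "x + drift k x" "x' + drift k x'"]
    by (cases x x' rule: linorder_cases) auto
qed

end

section \<open>The fluid limit\<close>

context pa_parameters begin

definition \<beta> :: real where "\<beta> = 1 + \<gamma>"
definition \<kappa> :: real where "\<kappa> = \<alpha> / (\<alpha> + 1)"

text \<open>
  The substitution \<open>y = c * s * (Q - 1)\<close> turns the mean evolution \<open>dy/ds = - drift s y\<close> of the number of open
  edges into a Bernoulli equation with the solution \<open>fluid x\<close>; the constant \<open>x\<close> parametrises the solutions.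
  Along a solution, \<open>hit_rate\<close> becomes \<open>fluid_rate\<close>.
\<close>

definition fluid :: "real \<Rightarrow> real \<Rightarrow> real"
  where "fluid x s = c * s * ((1 + x * s powr (- \<beta>)) powr (1 / (\<alpha> + 1)) - 1)"

definition fluid_rate :: "real \<Rightarrow> real \<Rightarrow> real"
  where "fluid_rate x s = 1 - (1 + x * s powr (- \<beta>)) powr (- \<kappa>)"

lemma alpha1 [simp]: "0 < \<alpha> + 1" "\<alpha> + 1 \<noteq> 0" "0 < 1 + \<alpha>" "1 + \<alpha> \<noteq> 0"
  using alpha_pos by linarith+

lemma beta_gt1: "\<beta> > 1" by (simp add: \<beta>_def)

lemma beta_eq: "c * \<beta> = real m * (\<alpha> + 1)"
proof -
  have "c * \<beta> = c + (real m - 1) * \<alpha>" by (simp add: \<beta>_def \<gamma>_def distrib_left)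
  then show ?thesis by (simp add: c_eq algebra_simps)
qed

lemma kappa_bounds: "0 < \<kappa>" "\<kappa> < 1" using alpha_pos by (simp_all add: \<kappa>_def)

lemma fluid_nonneg:
  assumes "x \<ge> 0" "s \<ge> 0"
  shows "fluid x s \<ge> 0"
proof -
  have "1 \<le> 1 + x * s powr (- \<beta>)" using assms by simp
  then have "1 \<le> (1 + x * s powr (- \<beta>)) powr (1 / (\<alpha> + 1))" by (intro ge_one_powr_ge_zero) auto
  then show ?thesis unfolding fluid_def using assms by simp
qed

lemma fluid_hit:
  assumes "x \<ge> 0" "k \<ge> 1"
  shows "hit_rate k (fluid x (real k)) = fluid_rate x (real k)"
proof -
  let ?q = "1 + x * real k powr (- \<beta>)"
  have q: "?q > 0" using assms by (simp add: add_pos_nonneg)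
  have "1 + fluid x (real k) / (c * real k) = ?q powr (1 / (\<alpha> + 1))"
    using assms by (simp add: fluid_def)
  then show ?thesis unfolding hit_rate_def fluid_rate_def
    by (simp add: powr_powr \<kappa>_def)
qed

text \<open>
  The drift along a fluid solution as a function of the scaled variable \<open>x * s powr (- \<beta>)\<close>.
\<close>

definition flow :: "real \<Rightarrow> real" where
  "flow q = \<alpha> * ((1 + q) powr (1 / (\<alpha> + 1)) - 1) - real m * (1 - (1 + q) powr (- \<kappa>))"

lemma drift_fluid:
  assumes "x \<ge> 0" "k \<ge> 1"
  shows "drift k (fluid x (real k)) = - flow (x * real k powr (- \<beta>))"
proof -
  have "fluid x (real k) * \<alpha> / (real k * c) = \<alpha> * ((1 + x * real k powr (- \<beta>)) powr (1 / (\<alpha> + 1)) - 1)"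
    using assms by (simp add: fluid_def)
  then show ?thesis unfolding drift_def fluid_hit[OF assms] flow_def fluid_rate_def by simp
qed

lemma fluid_derivative:
  assumes "x \<ge> 0" "s > 0"
  shows "(fluid x has_real_derivative flow (x * s powr (- \<beta>))) (at s)"
proof -
  let ?e = "1 / (\<alpha> + 1)"
  let ?q = "x * s powr (- \<beta>)"
  have q: "?q \<ge> 0" "1 + ?q > 0" using assms by (simp_all add: add_pos_nonneg)
  have k: "?e - 1 = - \<kappa>"
  proof -
    have "1 / (\<alpha> + 1) + \<alpha> / (\<alpha> + 1) = (1 + \<alpha>) / (\<alpha> + 1)" by (rule add_divide_distrib[symmetric])
    also have "\<dots> = 1" by (subst add.commute) simp
    finally show ?thesis unfolding \<kappa>_def by linarith
  qed
  have "(fluid x has_real_derivative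
     c * ((1 + ?q) powr ?e - 1) + c * s * (?e * (1 + ?q) powr (?e - 1) * (x * (- \<beta> * s powr (- \<beta> - 1))))) (at s)"
    unfolding fluid_def[abs_def] using assms q
    by (auto intro!: derivative_eq_intros simp: algebra_simps)
  also have "c * s * (?e * (1 + ?q) powr (?e - 1) * (x * (- \<beta> * s powr (- \<beta> - 1))))
     = - (c * \<beta> * ?e) * (?q * (1 + ?q) powr (- \<kappa>))"
  proof -
    have "s * s powr (- \<beta> - 1) = s powr (- \<beta>)" using assms by (simp add: powr_mult_base)
    then show ?thesis unfolding k by (simp add: algebra_simps)
  qed
  also have "c * \<beta> * ?e = real m" using alpha_pos beta_eq by (simp add: field_simps)
  also have "?q * (1 + ?q) powr (- \<kappa>) = (1 + ?q) powr ?e - (1 + ?q) powr (- \<kappa>)"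
  proof -
    have k2: "?e = 1 - \<kappa>" using k by linarith
    have "(1 + ?q) powr ?e = (1 + ?q) * (1 + ?q) powr (- \<kappa>)"
      unfolding k2 using q by (simp add: powr_mult_base)
    then show ?thesis by (simp add: algebra_simps)
  qed
  also have "c * ((1 + ?q) powr ?e - 1) + - real m * ((1 + ?q) powr ?e - (1 + ?q) powr (- \<kappa>)) = flow ?q"
    by (simp add: flow_def c_eq algebra_simps)
  finally show ?thesis .
qed

lemma flow_lipschitz:
  assumes "0 \<le> p" "p < q"
  shows "\<bar>flow q - flow p\<bar> \<le> c * (q - p)"
proof -
  let ?e = "1 / (\<alpha> + 1)"
  define f' where "f' z = \<alpha> * (?e * (1 + z) powr (?e - 1)) - real m * (\<kappa> * (1 + z) powr (- \<kappa> - 1))" for z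
  have der: "(flow has_real_derivative f' z) (at z)" if "0 \<le> z" for z
    unfolding flow_def[abs_def] f'_def using that
    by (auto intro!: derivative_eq_intros simp: algebra_simps)
  have "\<exists>z>p. z < q \<and> flow q - flow p = (q - p) * f' z"
    by (rule MVT2) (use assms in \<open>auto intro!: der\<close>)
  then obtain z where z: "p < z" "z < q" "flow q - flow p = (q - p) * f' z" by auto
  have z0: "1 \<le> 1 + z" using z assms by simp
  have "?e - 1 \<le> 0" using alpha_pos by (simp add: field_simps)
  then have p1: "(1 + z) powr (?e - 1) \<le> 1" using z0 by (intro powr_nonpos_le_1)
  have p2: "(1 + z) powr (- \<kappa> - 1) \<le> 1" using z0 kappa_bounds by (intro powr_nonpos_le_1) auto
  have "?e * (1 + z) powr (?e - 1) \<le> 1 * 1" using p1 by (intro mult_mono) auto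
  then have a: "\<alpha> * (?e * (1 + z) powr (?e - 1)) \<le> \<alpha> * 1" by (intro mult_left_mono) auto
  have "\<kappa> * (1 + z) powr (- \<kappa> - 1) \<le> 1 * 1" using p2 kappa_bounds by (intro mult_mono) auto
  then have b: "real m * (\<kappa> * (1 + z) powr (- \<kappa> - 1)) \<le> real m * 1" by (intro mult_left_mono) auto
  have a0: "0 \<le> \<alpha> * (?e * (1 + z) powr (?e - 1))" by simp
  have b0: "0 \<le> real m * (\<kappa> * (1 + z) powr (- \<kappa> - 1))" using kappa_bounds by simp
  have "\<bar>f' z\<bar> \<le> \<alpha> + real m" using a b a0 b0 unfolding f'_def by linarith
  then have "(q - p) * \<bar>f' z\<bar> \<le> (q - p) * c" using assms by (intro mult_left_mono) (auto simp: c_eq)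
  then show ?thesis unfolding z(3) abs_mult using assms by (simp add: mult.commute)
qed

definition fluid_step_const :: real where "fluid_step_const = c * \<beta> * 2 powr (\<beta> + 1)"

lemma fluid_step:
  assumes "x \<ge> 0" "k \<ge> 2"
  shows "\<bar>fluid x (real k - 1) - (fluid x (real k) + drift k (fluid x (real k)))\<bar>
    \<le> fluid_step_const * x * real k powr (- \<beta> - 1)"
proof -
  have k: "real k \<ge> 2" using assms by simp
  let ?q = "\<lambda>s::real. x * s powr (- \<beta>)"
  have "\<exists>z>real k - 1. z < real k \<and> fluid x (real k) - fluid x (real k - 1) = (real k - (real k - 1)) * flow (?q z)"
    by (rule MVT2) (use k assms(1) in \<open>auto intro!: fluid_derivative\<close>)
  then obtain z where z: "real k - 1 < z" "z < real k" "fluid x (real k) - fluid x (real k - 1) = flow (?q z)"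
    by auto
  have "fluid x (real k - 1) - (fluid x (real k) + drift k (fluid x (real k))) = flow (?q (real k)) - flow (?q z)"
    using z(3) drift_fluid[OF assms(1), of k] assms(2) by simp
  also have "\<bar>\<dots>\<bar> \<le> c * (?q (real k - 1) - ?q (real k))"
  proof -
    have d: "real k powr (- \<beta>) < z powr (- \<beta>)" "z powr (- \<beta>) \<le> (real k - 1) powr (- \<beta>)"
      using z k beta_gt1 by (auto intro!: powr_less_mono2_neg powr_mono2')
    show ?thesis
    proof (cases "x = 0")
      case False
      then have "?q (real k) < ?q z" using d assms(1) by simp
      then have "\<bar>flow (?q z) - flow (?q (real k))\<bar> \<le> c * (?q z - ?q (real k))"
        using assms(1) by (intro flow_lipschitz) auto
      also have "\<dots> \<le> c * (?q (real k - 1) - ?q (real k))"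
        using d assms(1) by (intro mult_left_mono diff_right_mono) auto
      finally show ?thesis by (simp add: abs_minus_commute)
    qed simp
  qed
  also have "\<dots> = c * x * ((real k - 1) powr (- \<beta>) - real k powr (- \<beta>))" by (simp add: algebra_simps)
  also have "\<dots> \<le> c * x * (\<beta> * 2 powr (\<beta> + 1) * real k powr (- \<beta> - 1))"
  proof (intro mult_left_mono)
    have "\<exists>y>real k - 1. y < real k \<and> real k powr (- \<beta>) - (real k - 1) powr (- \<beta>) = (real k - (real k - 1)) * (- \<beta> * y powr (- \<beta> - 1))"
      by (rule MVT2) (use k in \<open>auto intro!: derivative_eq_intros\<close>)
    then obtain y where y: "real k - 1 < y" "y < real k"
      "real k powr (- \<beta>) - (real k - 1) powr (- \<beta>) = (real k - (real k - 1)) * (- \<beta> * y powr (- \<beta> - 1))"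
      by auto
    have "y powr (- \<beta> - 1) \<le> (real k / 2) powr (- \<beta> - 1)"
      using y k beta_gt1 by (intro powr_mono2') auto
    also have "\<dots> = 2 powr (\<beta> + 1) * real k powr (- \<beta> - 1)"
    proof -
      have "(2::real) powr (- \<beta> - 1) = inverse (2 powr (\<beta> + 1))"
        by (metis add.commute minus_add_distrib diff_conv_add_uminus powr_minus)
      then show ?thesis using k by (simp add: powr_divide field_simps)
    qed
    finally have "\<beta> * y powr (- \<beta> - 1) \<le> \<beta> * (2 powr (\<beta> + 1) * real k powr (- \<beta> - 1))"
      using beta_gt1 by (intro mult_left_mono) auto
    then show "(real k - 1) powr (- \<beta>) - real k powr (- \<beta>) \<le> \<beta> * 2 powr (\<beta> + 1) * real k powr (- \<beta> - 1)"
      using y(3) by simp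
  qed (use assms in auto)
  also have "\<dots> = fluid_step_const * x * real k powr (- \<beta> - 1)" by (simp add: fluid_step_const_def)
  finally show ?thesis .
qed

text \<open>
  As \<open>y / k\<close> is small at the start of the second phase, \<open>fluid x k\<close> is there close to
  \<open>c / (\<alpha> + 1) * x * k powr (- \<gamma>)\<close>; solving \<open>fluid x k = y\<close> to first order gives this constant.
\<close>

definition fluid_const :: "real \<Rightarrow> real \<Rightarrow> real"
  where "fluid_const k y = (\<alpha> + 1) / c * y * k powr \<gamma>"

lemma fluid_initial:
  assumes "k \<ge> 1" "y \<ge> 0"
  shows "\<bar>fluid (fluid_const k y) k - y\<bar> \<le> (\<alpha> + 1)\<^sup>2 / c * y\<^sup>2 / k"
proof -
  let ?u = "fluid_const k y * k powr (- \<beta>)"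
  let ?e = "1 / (\<alpha> + 1)"
  have u: "?u = (\<alpha> + 1) / c * (y / k)"
    using assms by (simp add: fluid_const_def \<beta>_def powr_add[symmetric] powr_minus_divide)
      (simp add: powr_diff powr_add)
  have u0: "?u \<ge> 0" unfolding u using assms by simp
  have lin: "c * k * (?e * ?u) = y" unfolding u using assms by simp
  have "?e \<le> 2" using alpha_pos by (simp add: field_simps)
  then have "\<bar>(1 + ?u) powr ?e - 1 - ?e * ?u\<bar> \<le> \<bar>?e * (?e - 1)\<bar> * ?u\<^sup>2"
    using u0 by (intro powr_taylor2)
  also have "\<dots> \<le> 1 * ?u\<^sup>2"
  proof (intro mult_right_mono)
    have "0 < ?e" "?e \<le> 1" using alpha_pos by (simp_all add: field_simps)
    then have "\<bar>?e\<bar> * \<bar>?e - 1\<bar> \<le> 1 * 1" by (intro mult_mono) auto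
    then show "\<bar>?e * (?e - 1)\<bar> \<le> 1" by (simp add: abs_mult)
  qed simp
  finally have t: "\<bar>(1 + ?u) powr ?e - 1 - ?e * ?u\<bar> \<le> ?u\<^sup>2" by simp
  have "fluid (fluid_const k y) k - y = c * k * ((1 + ?u) powr ?e - 1 - ?e * ?u)"
    unfolding fluid_def by (subst lin[symmetric]) (simp add: algebra_simps)
  then have "\<bar>fluid (fluid_const k y) k - y\<bar> = c * k * \<bar>(1 + ?u) powr ?e - 1 - ?e * ?u\<bar>"
    using assms by (simp add: abs_mult)
  also have "\<dots> \<le> c * k * ?u\<^sup>2" using t assms by (intro mult_left_mono) auto
  also have "\<dots> = (\<alpha> + 1)\<^sup>2 / c * y\<^sup>2 / k"
    unfolding u using assms by (simp add: power2_eq_square field_simps)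
  finally show ?thesis .
qed

section \<open>The Markov property and the compensated number of hits\<close>

lemma chain_step:
  fixes \<Phi> :: "nat \<Rightarrow> bool \<Rightarrow> nat \<Rightarrow> 'b::{banach, second_countable_topology}"
  assumes "1 \<le> k" "Suc k \<le> n"
  shows "Ep (chain n y) (\<lambda>w. \<Phi> (snd (w (Suc k))) (fst (w (Suc k))) (snd (w k)))
    = Ep (chain n y) (\<lambda>w. Ep (ker (Suc k) (snd (w (Suc k)))) (\<lambda>(j, y'). \<Phi> (snd (w (Suc k))) j y'))"
  using assms(2)
proof (induction n arbitrary: y rule: dec_induct)
  case base
  obtain q where k: "k = Suc q" using assms(1) by (cases k) auto
  have "Ep (chain (Suc k) y) (\<lambda>w. \<Phi> (snd (w (Suc k))) (fst (w (Suc k))) (snd (w k)))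
      = Ep (ker (Suc k) y) (\<lambda>(j, y'). Ep (chain (Suc q) y') (\<lambda>w. \<Phi> y j (snd (w (Suc q)))))"
    unfolding k by (subst Ep_chain_Suc) (simp add: case_prod_unfold del: chain.simps)
  also have "\<dots> = Ep (ker (Suc k) y) (\<lambda>(j, y'). \<Phi> y j y')"
    by (rule Ep_cong) (simp add: case_prod_unfold Ep_chain_Suc del: chain.simps)
  also have "\<dots> = Ep (chain (Suc k) y) (\<lambda>w. Ep (ker (Suc k) (snd (w (Suc k)))) (\<lambda>(j, y'). \<Phi> (snd (w (Suc k))) j y'))"
    by (simp add: case_prod_unfold Ep_chain_Suc del: chain.simps)
  finally show ?case .
next
  case (step n)
  have "k \<noteq> n" "k \<noteq> Suc n" using step.hyps by auto
  then show ?case by (simp add: Ep_chain_Suc step.IH case_prod_unfold del: chain.simps)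
qed

text \<open>
  Given the number of open edges at \<open>k\<close>, the rest of the exploration is again a chain, started at \<open>k\<close>.
\<close>

lemma chain_markov:
  fixes \<Phi> :: "nat \<Rightarrow> (nat \<Rightarrow> bool \<times> nat) \<Rightarrow> 'b::{banach, second_countable_topology}"
  assumes "1 \<le> k" "k \<le> n"
    and local: "\<And>y v v'. (\<And>i. i \<in> {1..k} \<Longrightarrow> v i = v' i) \<Longrightarrow> \<Phi> y v = \<Phi> y v'"
  shows "Ep (chain n y) (\<lambda>w. \<Phi> (snd (w k)) w)
    = Ep (chain n y) (\<lambda>w. Ep (chain k (snd (w k))) (\<Phi> (snd (w k))))"
  using assms(2)
proof (induction n arbitrary: y rule: dec_induct)
  case base
  obtain q where k: "k = Suc q" using assms(1) by (cases k) auto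
  show ?case unfolding k by (simp add: case_prod_unfold Ep_chain_Suc del: chain.simps)
next
  case (step n)
  have "\<Phi> y' (w(Suc n := z)) = \<Phi> y' w" for y' w z
    by (rule local) (use step.hyps in auto)
  then show ?case using step.hyps by (simp add: Ep_chain_Suc step.IH case_prod_unfold del: chain.simps)
qed

definition hit_prob :: "nat \<Rightarrow> nat \<Rightarrow> real"
  where "hit_prob k y = Ep (ker k y) (\<lambda>(j, y'). of_bool j)"

lemma hit_prob_bounds: "0 \<le> hit_prob k y" "hit_prob k y \<le> 1"
  unfolding hit_prob_def by (auto intro!: Ep_nonneg Ep_le_const)

text \<open>
  The martingale part of the number of hits.
\<close>

definition compensated :: "nat \<Rightarrow> (nat \<Rightarrow> bool \<times> nat) \<Rightarrow> real"
  where "compensated n w = (\<Sum>k=1..n. of_bool (fst (w k)) - hit_prob k (snd (w k)))"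

lemma compensated_upd:
  "compensated (Suc n) (w(Suc n := (j, y))) = (of_bool j - hit_prob (Suc n) y) + compensated n w"
proof -
  have "(\<Sum>k=1..n. of_bool (fst ((w(Suc n := (j, y))) k)) - hit_prob k (snd ((w(Suc n := (j, y))) k)))
     = (\<Sum>k=1..n. of_bool (fst (w k)) - hit_prob k (snd (w k)))"
    by (rule sum.cong) auto
  then show ?thesis by (simp add: compensated_def)
qed

lemma compensated_mean: "Ep (chain n y) (compensated n) = 0"
proof (induction n arbitrary: y)
  case (Suc n)
  have "Ep (chain (Suc n) y) (compensated (Suc n))
    = Ep (ker (Suc n) y) (\<lambda>(j, y'). Ep (chain n y') (\<lambda>w. (of_bool j - hit_prob (Suc n) y) + compensated n w))"
    by (simp add: Ep_chain_Suc compensated_upd case_prod_unfold del: chain.simps)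
  also have "\<dots> = Ep (ker (Suc n) y) (\<lambda>(j, y'). of_bool j - hit_prob (Suc n) y)"
    by (rule Ep_cong) (simp add: Suc integrable_measure_pmf_finite case_prod_unfold del: chain.simps)
  also have "\<dots> = 0"
    by (simp add: case_prod_unfold integrable_measure_pmf_finite hit_prob_def)
  finally show ?case .
qed (simp add: compensated_def)

text \<open>
  Martingale increments are orthogonal, and the variance of an indicator is at most its mean.
\<close>

lemma compensated_square:
  "Ep (chain n y) (\<lambda>w. (compensated n w)\<^sup>2) \<le> (\<Sum>k=1..n. Ep (chain n y) (\<lambda>w. hit_prob k (snd (w k))))"
proof (induction n arbitrary: y)
  case (Suc n)
  let ?q = "hit_prob (Suc n) y"
  have "Ep (chain (Suc n) y) (\<lambda>w. (compensated (Suc n) w)\<^sup>2)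
    = Ep (ker (Suc n) y) (\<lambda>(j, y'). Ep (chain n y') (\<lambda>w. (of_bool j - ?q)\<^sup>2
        + 2 * (of_bool j - ?q) * compensated n w + (compensated n w)\<^sup>2))"
    unfolding Ep_chain_Suc compensated_upd
    by (intro Ep_cong) (auto intro!: Ep_cong simp: power2_sum split: prod.splits)
  also have "\<dots> = Ep (ker (Suc n) y) (\<lambda>(j, y'). (of_bool j - ?q)\<^sup>2 + Ep (chain n y') (\<lambda>w. (compensated n w)\<^sup>2))"
    by (rule Ep_cong) (simp add: compensated_mean integrable_measure_pmf_finite case_prod_unfold del: chain.simps)
  also have "\<dots> = Ep (ker (Suc n) y) (\<lambda>(j, y'). (of_bool j - ?q)\<^sup>2)
      + Ep (ker (Suc n) y) (\<lambda>(j, y'). Ep (chain n y') (\<lambda>w. (compensated n w)\<^sup>2))"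
    by (simp add: case_prod_unfold integrable_measure_pmf_finite)
  also have "Ep (ker (Suc n) y) (\<lambda>(j, y'). (of_bool j - ?q)\<^sup>2) \<le> ?q"
  proof -
    have "Ep (ker (Suc n) y) (\<lambda>(j, y'). (of_bool j - ?q)\<^sup>2)
      = Ep (ker (Suc n) y) (\<lambda>x. (1 - 2 * ?q) * (case x of (j, y') \<Rightarrow> of_bool j) + ?q\<^sup>2)"
      by (rule Ep_cong) (auto simp: power2_eq_square algebra_simps split: prod.splits)
    also have "\<dots> = (1 - 2 * ?q) * ?q + ?q\<^sup>2"
      unfolding hit_prob_def by (simp add: integrable_measure_pmf_finite)
    also have "\<dots> \<le> ?q" by (simp add: power2_eq_square algebra_simps)
    finally show ?thesis .
  qed
  also have "Ep (ker (Suc n) y) (\<lambda>(j, y'). Ep (chain n y') (\<lambda>w. (compensated n w)\<^sup>2))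
    \<le> Ep (ker (Suc n) y) (\<lambda>(j, y'). \<Sum>k=1..n. Ep (chain n y') (\<lambda>w. hit_prob k (snd (w k))))"
    using Suc by (intro Ep_mono) auto
  also have "\<dots> = (\<Sum>k=1..n. Ep (ker (Suc n) y) (\<lambda>(j, y'). Ep (chain n y') (\<lambda>w. hit_prob k (snd (w k)))))"
    by (simp add: case_prod_unfold Ep_sum)
  also have "\<dots> = (\<Sum>k=1..n. Ep (chain (Suc n) y) (\<lambda>w. hit_prob k (snd (w k))))"
    by (rule sum.cong) (auto simp: Ep_chain_Suc simp del: chain.simps)
  also have "?q = Ep (chain (Suc n) y) (\<lambda>w. hit_prob (Suc n) (snd (w (Suc n))))"
    by (simp add: Ep_chain_Suc case_prod_unfold del: chain.simps)
  finally show ?case by (simp del: chain.simps)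
qed (simp add: compensated_def)

end

section \<open>Deviation from the fluid limit\<close>

context pa_parameters begin

text \<open>
  The price for replacing \<open>growth k n\<close> by \<open>(n / k) powr \<gamma>\<close>.
\<close>

definition H :: real where "H = exp (2 * real m * \<gamma>)"

lemma H_ge1: "1 \<le> H" by (simp add: H_def)

lemma chain_mean:
  assumes "1 \<le> k" "k \<le> n"
  shows "Ep (chain n y) (\<lambda>w. real (snd (w k))) \<le> growth k n * real y"
proof -
  have m1: "real m - 1 > 0" using m2 by simp
  have "Ep (chain n y) (\<lambda>w. real (snd (w k)))
     = (real m - 1) * Ep (chain n y) (\<lambda>w. pochhammer (particles (snd (w k))) 1)"
    using m1 by (simp add: particles_def del: chain.simps)
  also have "\<dots> \<le> (real m - 1) * (growth k n ^ 1 * pochhammer (particles y) 1)"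
    using m1 by (intro mult_left_mono chain_moment assms) auto
  also have "\<dots> = growth k n * real y" using m1 by (simp add: particles_def)
  finally show ?thesis .
qed

lemma chain_mean_square:
  assumes "1 \<le> k" "k \<le> n"
  shows "Ep (chain n y) (\<lambda>w. (real (snd (w k)))\<^sup>2) \<le> real m * (growth k n)\<^sup>2 * (real y)\<^sup>2"
proof -
  have m1: "real m - 1 > 0" using m2 by simp
  have poch: "pochhammer x 2 = x * (x + 1)" for x :: real
    by (simp add: numeral_2_eq_2 pochhammer_Suc)
  have "Ep (chain n y) (\<lambda>w. (real (snd (w k)))\<^sup>2)
     \<le> Ep (chain n y) (\<lambda>w. (real m - 1)\<^sup>2 * pochhammer (particles (snd (w k))) 2)"
  proof (rule Ep_mono[OF finite_chain])
    fix w
    have "real (snd (w k)) = (real m - 1) * particles (snd (w k))" using m1 by (simp add: particles_def)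
    then have "(real (snd (w k)))\<^sup>2 = (real m - 1)\<^sup>2 * (particles (snd (w k)) * particles (snd (w k)))"
      by (simp add: power_mult_distrib power2_eq_square)
    also have "\<dots> \<le> (real m - 1)\<^sup>2 * (particles (snd (w k)) * (particles (snd (w k)) + 1))"
      by (intro mult_left_mono) auto
    finally show "(real (snd (w k)))\<^sup>2 \<le> (real m - 1)\<^sup>2 * pochhammer (particles (snd (w k))) 2" unfolding poch .
  qed
  also have "\<dots> = (real m - 1)\<^sup>2 * Ep (chain n y) (\<lambda>w. pochhammer (particles (snd (w k))) 2)" by simp
  also have "\<dots> \<le> (real m - 1)\<^sup>2 * (growth k n ^ 2 * pochhammer (particles y) 2)"
    by (intro mult_left_mono chain_moment assms) auto
  also have "\<dots> = (growth k n)\<^sup>2 * (real y * (real y + (real m - 1)))"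
  proof -
    have py: "real y = (real m - 1) * particles y" using m1 by (simp add: particles_def)
    show ?thesis unfolding poch py by (simp add: power2_eq_square algebra_simps)
  qed
  also have "\<dots> \<le> (growth k n)\<^sup>2 * (real m * (real y)\<^sup>2)"
  proof (intro mult_left_mono)
    have "(real m - 1) * real y \<le> (real m - 1) * (real y * real y)"
      using m1 by (intro mult_left_mono) (cases y; simp)+
    then show "real y * (real y + (real m - 1)) \<le> real m * (real y)\<^sup>2"
      by (simp add: power2_eq_square algebra_simps)
  qed simp
  finally show ?thesis by (simp add: mult_ac)
qed

lemma growth_le_H:
  assumes "1 \<le> k" "k \<le> n"
  shows "growth k n \<le> H * (real n / real k) powr \<gamma>"
  unfolding H_def by (rule growth_le[OF assms])

definition step_factor :: "nat \<Rightarrow> real"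
  where "step_factor k = (1 + \<gamma> / real k)\<^sup>2 * (1 + 1 / (real k)\<^sup>2)"

text \<open>
  The contraction estimate \<open>drift_lipschitz\<close> is squared. The extra factor \<open>1 + 1 / k\<^sup>2\<close> comes from splitting the
  square of a sum into the main part and the discretisation errors, whose contribution is thereby
  multiplied by a factor of order \<open>k\<^sup>2\<close>; they are of order \<open>1 / k\<^sup>2\<close> themselves.
\<close>

lemma ker_square_step:
  assumes "k \<ge> 2" "x \<ge> 0"
  shows "Ep (ker k y) (\<lambda>(j, y'). (real y' - fluid x (real k - 1))\<^sup>2)
    \<le> step_factor k * (real y - fluid x (real k))\<^sup>2
      + ((4 * drift_const\<^sup>2 + square_const) * (real y)\<^sup>2 + 4 * fluid_step_const\<^sup>2 * (x * real k powr (- \<gamma>))\<^sup>2) / (real k)\<^sup>2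
      + square_const * real y / real k"
proof -
  let ?f = "fluid x (real k)"
  let ?f' = "fluid x (real k - 1)"
  define \<mu> where "\<mu> = Ep (ker k y) (\<lambda>(j, y'). real y')"
  define u where "u = x * real k powr (- \<gamma>)"
  define B where "B = (drift_const * real y + fluid_step_const * u) / (real k)\<^sup>2"
  define A where "A = (1 + \<gamma> / real k) * \<bar>real y - ?f\<bar>"
  have k: "real k \<ge> 2" using assms by simp
  have f: "?f \<ge> 0" using assms by (intro fluid_nonneg) auto
  have "Ep (ker k y) (\<lambda>(j, y'). (real y' - ?f')\<^sup>2)
     = Ep (ker k y) (\<lambda>x. (case x of (j, y') \<Rightarrow> (real y' - real y)\<^sup>2)
        + (2 * (real y - ?f') * (case x of (j, y') \<Rightarrow> real y') + (?f'\<^sup>2 - (real y)\<^sup>2)))"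
    by (rule Ep_cong) (auto simp: power2_eq_square algebra_simps split: prod.splits)
  also have "\<dots> = Ep (ker k y) (\<lambda>(j, y'). (real y' - real y)\<^sup>2)
       + (2 * (real y - ?f') * \<mu> + (?f'\<^sup>2 - (real y)\<^sup>2))"
    unfolding \<mu>_def by (simp add: integrable_measure_pmf_finite)
  also have "2 * (real y - ?f') * \<mu> + (?f'\<^sup>2 - (real y)\<^sup>2) = (\<mu> - ?f')\<^sup>2 - (\<mu> - real y)\<^sup>2"
    by (simp add: power2_eq_square algebra_simps)
  finally have "Ep (ker k y) (\<lambda>(j, y'). (real y' - ?f')\<^sup>2)
     \<le> square_const * ((real y)\<^sup>2 / (real k)\<^sup>2 + real y / real k) + (\<mu> - ?f')\<^sup>2"
    using step_square[OF assms(1), of y] zero_le_power2[of "\<mu> - real y"] by linarith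
  moreover have "(\<mu> - ?f')\<^sup>2 \<le> step_factor k * (real y - ?f)\<^sup>2 + (4 * drift_const\<^sup>2 * (real y)\<^sup>2 + 4 * fluid_step_const\<^sup>2 * u\<^sup>2) / (real k)\<^sup>2"
  proof -
    have "real k powr (- \<beta> - 1) = real k powr (- \<gamma>) / (real k)\<^sup>2"
    proof -
      have e: "- \<beta> - 1 = - \<gamma> - 2" by (simp add: \<beta>_def)
      show ?thesis unfolding e using k by (simp add: powr_diff)
    qed
    then have 3: "\<bar>?f' - (?f + drift k ?f)\<bar> \<le> fluid_step_const * u / (real k)\<^sup>2"
      using fluid_step[OF assms(2,1)] by (simp add: u_def mult_ac)
    have 1: "\<bar>\<mu> - (real y + drift k (real y))\<bar> \<le> drift_const * real y / (real k)\<^sup>2"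
      unfolding \<mu>_def by (rule mean_drift[OF assms(1)])
    have 2: "\<bar>(real y + drift k (real y)) - (?f + drift k ?f)\<bar> \<le> A"
      unfolding A_def using assms f by (intro drift_lipschitz) auto
    have "B = drift_const * real y / (real k)\<^sup>2 + fluid_step_const * u / (real k)\<^sup>2"
      by (simp add: B_def add_divide_distrib)
    then have "\<bar>\<mu> - ?f'\<bar> \<le> A + B" using 1 2 3 by linarith
    then have "(\<mu> - ?f')\<^sup>2 \<le> (A + B)\<^sup>2" by (metis abs_ge_zero power2_abs power_mono)
    also have "\<dots> \<le> A\<^sup>2 * (1 + 1 / (real k)\<^sup>2) + B\<^sup>2 * (1 + (real k)\<^sup>2)"
    proof -
      have "0 \<le> (A / real k - B * real k)\<^sup>2" by simp
      also have "\<dots> = A\<^sup>2 / (real k)\<^sup>2 + B\<^sup>2 * (real k)\<^sup>2 - 2 * (A * B)"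
        using k by (simp add: power2_diff power_mult_distrib power_divide)
      finally show ?thesis by (simp add: power2_sum algebra_simps)
    qed
    also have "A\<^sup>2 * (1 + 1 / (real k)\<^sup>2) = step_factor k * (real y - ?f)\<^sup>2"
      unfolding A_def step_factor_def by (simp add: power_mult_distrib mult_ac)
    also have "B\<^sup>2 * (1 + (real k)\<^sup>2) \<le> (4 * drift_const\<^sup>2 * (real y)\<^sup>2 + 4 * fluid_step_const\<^sup>2 * u\<^sup>2) / (real k)\<^sup>2"
    proof -
      have "B\<^sup>2 * (1 + (real k)\<^sup>2) \<le> B\<^sup>2 * (2 * (real k)\<^sup>2)"
      proof (intro mult_left_mono)
        have "1 \<le> (real k)\<^sup>2" using k by (intro one_le_power) auto
        then show "1 + (real k)\<^sup>2 \<le> 2 * (real k)\<^sup>2" by linarith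
      qed simp
      also have "\<dots> = 2 * (drift_const * real y + fluid_step_const * u)\<^sup>2 / (real k)\<^sup>2"
      proof -
        have "(z / q)\<^sup>2 * (2 * q) = 2 * z\<^sup>2 / q" if "q \<noteq> 0" for z q :: real
          using that by (simp add: power2_eq_square)
        moreover have "(real k)\<^sup>2 \<noteq> 0" using k by simp
        ultimately show ?thesis unfolding B_def by blast
      qed
      also have "\<dots> \<le> 2 * (2 * (drift_const * real y)\<^sup>2 + 2 * (fluid_step_const * u)\<^sup>2) / (real k)\<^sup>2"
      proof (intro divide_right_mono mult_left_mono)
        have "0 \<le> (drift_const * real y - fluid_step_const * u)\<^sup>2" by simp
        then show "(drift_const * real y + fluid_step_const * u)\<^sup>2 \<le> 2 * (drift_const * real y)\<^sup>2 + 2 * (fluid_step_const * u)\<^sup>2"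
          by (simp add: power2_sum power2_diff)
      qed auto
      finally show ?thesis by (simp add: power_mult_distrib mult.assoc)
    qed
    finally show ?thesis by simp
  qed
  moreover have "square_const * ((real y)\<^sup>2 / (real k)\<^sup>2 + real y / real k) + (P + (4 * drift_const\<^sup>2 * (real y)\<^sup>2 + 4 * fluid_step_const\<^sup>2 * u\<^sup>2) / (real k)\<^sup>2)
     = P + ((4 * drift_const\<^sup>2 + square_const) * (real y)\<^sup>2 + 4 * fluid_step_const\<^sup>2 * u\<^sup>2) / (real k)\<^sup>2 + square_const * real y / real k" for P
    by (simp add: add_divide_distrib distrib_right distrib_left)
  ultimately show ?thesis unfolding u_def by (smt (verit))
qed

definition deviation_step_const :: real where "deviation_step_const = (4 * drift_const\<^sup>2 + square_const) * (real m * H\<^sup>2) + 4 * fluid_step_const\<^sup>2 + square_const * H"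

text \<open>
  The mean square distance to the fluid solution that starts from \<open>y\<close> open edges at \<open>n\<close>.
\<close>

definition deviation :: "nat \<Rightarrow> nat \<Rightarrow> nat \<Rightarrow> real" where
  "deviation n y k = Ep (chain n y) (\<lambda>w. (real (snd (w k)) - fluid (fluid_const (real n) (real y)) (real k))\<^sup>2)"

lemma step_consts_nonneg: "0 \<le> hit_rate_const" "0 \<le> drift_const" "0 \<le> square_const" "0 \<le> fluid_step_const" "0 \<le> deviation_step_const"
proof -
  show hit_rate_const: "0 \<le> hit_rate_const" by (simp add: hit_rate_const_def)
  then show drift_const: "0 \<le> drift_const" by (simp add: drift_const_def)
  show square_const: "0 \<le> square_const" by (simp add: square_const_def)
  show fluid_step_const: "0 \<le> fluid_step_const" using beta_gt1 by (simp add: fluid_step_const_def)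
  show "0 \<le> deviation_step_const" using square_const H_ge1 by (simp add: deviation_step_const_def)
qed

lemma deviation_step:
  assumes "1 \<le> k" "Suc k \<le> n"
  shows "deviation n y k \<le> step_factor (Suc k) * deviation n y (Suc k)
    + deviation_step_const * ((real n / real (Suc k)) powr (2 * \<gamma>) * (real y)\<^sup>2 / (real (Suc k))\<^sup>2 + (real n / real (Suc k)) powr \<gamma> * real y / real (Suc k))"
proof -
  define x where "x = fluid_const (real n) (real y)"
  define K where "K = real (Suc k)"
  define g where "g = (real n / K) powr \<gamma>"
  define a1 where "a1 = 4 * drift_const\<^sup>2 + square_const"
  have K: "K > 0" "real (Suc k) = K" "real k = K - 1" by (simp_all add: K_def)
  have n: "real n > 0" using assms by simp
  have x: "x \<ge> 0" by (simp add: x_def fluid_const_def)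
  have a1: "a1 \<ge> 0" using step_consts_nonneg by (simp add: a1_def)
  have g2: "(real n / K) powr (2 * \<gamma>) = g\<^sup>2"
    by (simp add: g_def powr_powr[symmetric] powr_realpow' mult.commute[of 2] flip: powr_numeral)
  have xk: "x * K powr (- \<gamma>) = (\<alpha> + 1) / c * real y * g"
    using K n by (simp add: x_def fluid_const_def g_def powr_divide powr_minus_divide)
  have "deviation n y k = Ep (chain n y) (\<lambda>w. Ep (ker (Suc k) (snd (w (Suc k)))) (\<lambda>(j, y'). (real y' - fluid x (real (Suc k) - 1))\<^sup>2))"
    unfolding deviation_def x_def[symmetric]
    using chain_step[OF assms, where y = y and \<Phi> = "\<lambda>_ _ y'. (real y' - fluid x (real k))\<^sup>2"] by simp
  also have "\<dots> \<le> Ep (chain n y) (\<lambda>w. step_factor (Suc k) * (real (snd (w (Suc k))) - fluid x K)\<^sup>2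
      + (a1 * (real (snd (w (Suc k))))\<^sup>2 + 4 * fluid_step_const\<^sup>2 * (x * K powr (- \<gamma>))\<^sup>2) / K\<^sup>2
      + square_const * real (snd (w (Suc k))) / K)"
    unfolding a1_def K_def using assms(1) by (intro Ep_mono ker_square_step x) auto
  also have "\<dots> = step_factor (Suc k) * deviation n y (Suc k)
      + (a1 * Ep (chain n y) (\<lambda>w. (real (snd (w (Suc k))))\<^sup>2) + 4 * fluid_step_const\<^sup>2 * (x * K powr (- \<gamma>))\<^sup>2) / K\<^sup>2
      + square_const * Ep (chain n y) (\<lambda>w. real (snd (w (Suc k)))) / K"
    unfolding deviation_def x_def[symmetric] K(2) by (simp add: integrable_measure_pmf_finite del: chain.simps)
  also have "\<dots> \<le> step_factor (Suc k) * deviation n y (Suc k)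
      + (a1 * (real m * H\<^sup>2 * g\<^sup>2 * (real y)\<^sup>2) + 4 * fluid_step_const\<^sup>2 * (g\<^sup>2 * (real y)\<^sup>2)) / K\<^sup>2
      + square_const * (H * g * real y) / K"
  proof -
    have G: "growth (Suc k) n \<le> H * g" using growth_le_H[of "Suc k" n] assms by (simp add: g_def K_def)
    have G0: "growth (Suc k) n \<ge> 0" using growth_ge1[of "Suc k" n] by simp
    have "Ep (chain n y) (\<lambda>w. (real (snd (w (Suc k))))\<^sup>2) \<le> real m * (growth (Suc k) n)\<^sup>2 * (real y)\<^sup>2"
      using assms by (intro chain_mean_square) auto
    also have "\<dots> \<le> real m * (H * g)\<^sup>2 * (real y)\<^sup>2"
      using G G0 by (intro mult_right_mono mult_left_mono power_mono) auto
    finally have 1: "Ep (chain n y) (\<lambda>w. (real (snd (w (Suc k))))\<^sup>2) \<le> real m * H\<^sup>2 * g\<^sup>2 * (real y)\<^sup>2"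
      by (simp add: power_mult_distrib mult_ac)
    have "Ep (chain n y) (\<lambda>w. real (snd (w (Suc k)))) \<le> growth (Suc k) n * real y"
      using assms by (intro chain_mean) auto
    also have "\<dots> \<le> H * g * real y" using G by (intro mult_right_mono) auto
    finally have 2: "Ep (chain n y) (\<lambda>w. real (snd (w (Suc k)))) \<le> H * g * real y" .
    have "\<alpha> + 1 \<le> c" using m2 by (simp add: c_eq)
    then have "(\<alpha> + 1) / c \<le> 1" by (subst divide_le_eq_1_pos) auto
    then have "(\<alpha> + 1) / c * (real y * g) \<le> 1 * (real y * g)" by (intro mult_right_mono) (auto simp: g_def)
    then have "(x * K powr (- \<gamma>))\<^sup>2 \<le> (real y * g)\<^sup>2"
      unfolding xk by (intro power_mono) (auto simp: g_def mult_ac)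
    then have 3: "(x * K powr (- \<gamma>))\<^sup>2 \<le> g\<^sup>2 * (real y)\<^sup>2" by (simp add: power_mult_distrib mult_ac)
    show ?thesis
      using 1 2 3 K a1 step_consts_nonneg by (intro add_mono divide_right_mono mult_left_mono order_refl) auto
  qed
  also have "\<dots> \<le> step_factor (Suc k) * deviation n y (Suc k) + deviation_step_const * (g\<^sup>2 * (real y)\<^sup>2 / K\<^sup>2 + g * real y / K)"
  proof -
    have "(a1 * (real m * H\<^sup>2 * g\<^sup>2 * (real y)\<^sup>2) + 4 * fluid_step_const\<^sup>2 * (g\<^sup>2 * (real y)\<^sup>2)) / K\<^sup>2
        = (a1 * (real m * H\<^sup>2) + 4 * fluid_step_const\<^sup>2) * (g\<^sup>2 * (real y)\<^sup>2 / K\<^sup>2)"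
      by (simp add: algebra_simps add_divide_distrib)
    also have "\<dots> \<le> deviation_step_const * (g\<^sup>2 * (real y)\<^sup>2 / K\<^sup>2)"
      using step_consts_nonneg H_ge1 by (intro mult_right_mono) (auto simp: deviation_step_const_def a1_def)
    finally have 1: "(a1 * (real m * H\<^sup>2 * g\<^sup>2 * (real y)\<^sup>2) + 4 * fluid_step_const\<^sup>2 * (g\<^sup>2 * (real y)\<^sup>2)) / K\<^sup>2 \<le> deviation_step_const * (g\<^sup>2 * (real y)\<^sup>2 / K\<^sup>2)" .
    have "square_const * (H * g * real y) / K = (square_const * H) * (g * real y / K)" by simp
    also have "\<dots> \<le> deviation_step_const * (g * real y / K)"
      using step_consts_nonneg H_ge1 K by (intro mult_right_mono) (auto simp: deviation_step_const_def g_def)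
    finally show ?thesis using 1 by (simp only: distrib_left)
  qed
  finally show ?thesis unfolding K(2) g2 g_def[symmetric] by simp
qed

lemma sum_powr_minus1:
  assumes "1 \<le> k" "k \<le> n"
  shows "(\<Sum>i\<in>{k<..n}. real i powr (\<gamma> - 1)) \<le> 2 powr \<gamma> / \<gamma> * real n powr \<gamma>"
proof -
  have "(\<Sum>i\<in>{k<..n}. real i powr (\<gamma> - 1)) \<le> 2 powr \<gamma> / \<gamma> * (real n powr \<gamma> - real k powr \<gamma>)"
    using assms(2)
  proof (induction n rule: dec_induct)
    case (step n)
    have n: "real n \<ge> 1" "real n > 0" using step.hyps assms(1) by simp_all
    have "\<exists>z>real n. z < real (Suc n) \<and> real (Suc n) powr \<gamma> - real n powr \<gamma> = (real (Suc n) - real n) * (\<gamma> * z powr (\<gamma> - 1))"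
      by (rule MVT2) (use n in \<open>auto intro!: derivative_eq_intros\<close>)
    then obtain z where z: "real n < z" "z < real (Suc n)" "real (Suc n) powr \<gamma> - real n powr \<gamma> = \<gamma> * z powr (\<gamma> - 1)"
      by auto
    have "real (Suc n) powr (\<gamma> - 1) \<le> 2 powr \<gamma> * z powr (\<gamma> - 1)"
    proof (cases "\<gamma> \<ge> 1")
      case True
      have "real (Suc n) powr (\<gamma> - 1) \<le> (2 * z) powr (\<gamma> - 1)"
        using True z n by (intro powr_mono2) auto
      also have "\<dots> = 2 powr (\<gamma> - 1) * z powr (\<gamma> - 1)" using z n by (simp add: powr_mult)
      also have "\<dots> \<le> 2 powr \<gamma> * z powr (\<gamma> - 1)" by (intro mult_right_mono powr_mono) auto
      finally show ?thesis .
    next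
      case False
      have "real (Suc n) powr (\<gamma> - 1) \<le> 1 * z powr (\<gamma> - 1)"
        using False z n powr_mono2'[of "\<gamma> - 1" z "real (Suc n)"] by simp
      also have "\<dots> \<le> 2 powr \<gamma> * z powr (\<gamma> - 1)"
        by (intro mult_right_mono ge_one_powr_ge_zero) auto
      finally show ?thesis .
    qed
    also have "\<dots> = 2 powr \<gamma> / \<gamma> * (real (Suc n) powr \<gamma> - real n powr \<gamma>)"
      using gamma_pos unfolding z(3) by (simp add: less_imp_neq[THEN not_sym])
    finally have "real (Suc n) powr (\<gamma> - 1) \<le> 2 powr \<gamma> / \<gamma> * (real (Suc n) powr \<gamma> - real n powr \<gamma>)" .
    moreover have "{k<..Suc n} = insert (Suc n) {k<..n}" using step.hyps by auto
    ultimately show ?case using step.IH by (simp add: algebra_simps)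
  qed simp
  also have "\<dots> \<le> 2 powr \<gamma> / \<gamma> * real n powr \<gamma>"
    by (intro mult_left_mono) auto
  finally show ?thesis .
qed

lemma sum_inverse_squares:
  assumes "1 \<le> k" "k \<le> n"
  shows "(\<Sum>i\<in>{k<..n}. 1 / (real i)\<^sup>2) \<le> 1 / real k"
proof -
  have "(\<Sum>i\<in>{k<..n}. 1 / (real i)\<^sup>2) \<le> 1 / real k - 1 / real n"
    using assms(2)
  proof (induction n rule: dec_induct)
    case (step n)
    have n: "real n > 0" using step.hyps assms(1) by simp
    have "1 / (real (Suc n))\<^sup>2 \<le> 1 / real n - 1 / real (Suc n)"
      using n by (simp add: divide_simps power2_eq_square)
    moreover have "{k<..Suc n} = insert (Suc n) {k<..n}" using step.hyps by auto
    ultimately show ?case using step.IH by simp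
  qed simp
  then show ?thesis by (smt (verit) divide_nonneg_nonneg of_nat_0_le_iff)
qed

text \<open>
  The weight \<open>k powr (2 * \<gamma>) * exp (- 1 / k)\<close> absorbs the step factor; the exponential takes care of all terms
  of order \<open>1 / k\<^sup>2\<close>.
\<close>

lemma step_factor_le:
  assumes "1 \<le> k"
  shows "real k powr (2 * \<gamma>) * exp (- (1 / real k)) * step_factor (Suc k)
    \<le> real (Suc k) powr (2 * \<gamma>) * exp (- (1 / real (Suc k)))"
proof -
  define K where "K = real (Suc k)"
  have K: "K \<ge> 2" "real k = K - 1" using assms by (simp_all add: K_def)
  have "(real k / K) powr (2 * \<gamma>) \<le> exp (- 1 / K) powr (2 * \<gamma>)"
  proof (intro powr_mono2)
    have "real k / K = 1 + (- 1 / K)" using K by (simp add: field_simps)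
    then show "real k / K \<le> exp (- 1 / K)" using exp_ge_add_one_self[of "- 1 / K"] by simp
  qed (use K in auto)
  also have "\<dots> = exp (- 2 * \<gamma> / K)" by (simp add: powr_def)
  finally have 1: "(real k / K) powr (2 * \<gamma>) \<le> exp (- 2 * \<gamma> / K)" .
  have "(1 + \<gamma> / K)\<^sup>2 \<le> (exp (\<gamma> / K))\<^sup>2"
    using K by (intro power_mono exp_ge_add_one_self) auto
  also have "\<dots> = exp (2 * \<gamma> / K)" by (simp add: exp_double[symmetric])
  finally have 2: "(1 + \<gamma> / K)\<^sup>2 \<le> exp (2 * \<gamma> / K)" .
  have 3: "1 + 1 / K\<^sup>2 \<le> exp (1 / K\<^sup>2)" by (rule exp_ge_add_one_self)
  have "step_factor (Suc k) \<le> exp (2 * \<gamma> / K) * exp (1 / K\<^sup>2)"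
    unfolding step_factor_def K_def[symmetric] using 2 3 by (intro mult_mono) (auto intro: add_nonneg_nonneg)
  then have "(real k / K) powr (2 * \<gamma>) * (exp (- (1 / real k)) * step_factor (Suc k))
    \<le> exp (- 2 * \<gamma> / K) * (exp (- (1 / real k)) * (exp (2 * \<gamma> / K) * exp (1 / K\<^sup>2)))"
    using 1 by (intro mult_mono mult_left_mono) (auto simp: step_factor_def)
  also have "\<dots> = exp (1 / K\<^sup>2 - 1 / real k)"
    unfolding mult_exp_exp by (intro arg_cong[where f=exp]) simp
  also have "\<dots> \<le> exp (- (1 / K))"
    using K unfolding exp_le_cancel_iff K(2) by (simp add: divide_simps power2_eq_square) (simp add: algebra_simps)
  finally have "K powr (2 * \<gamma>) * ((real k / K) powr (2 * \<gamma>) * (exp (- (1 / real k)) * step_factor (Suc k)))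
     \<le> K powr (2 * \<gamma>) * exp (- (1 / K))"
    by (intro mult_left_mono) auto
  moreover have "K powr (2 * \<gamma>) * (real k / K) powr (2 * \<gamma>) = real k powr (2 * \<gamma>)"
    using K by (simp add: powr_divide)
  ultimately show ?thesis unfolding K_def[symmetric] by (simp add: mult_ac)
qed

definition deviation_const :: real where "deviation_const = 3 * (((\<alpha> + 1)\<^sup>2 / c)\<^sup>2 + deviation_step_const + deviation_step_const * (2 powr \<gamma> / \<gamma>))"

text \<open>
  A discrete Gronwall argument: after multiplication by the weight of \<open>step_factor_le\<close> the recursion for the
  deviation telescopes.
\<close>

lemma deviation_bound:
  assumes "1 \<le> k" "k \<le> n"
  shows "deviation n y k \<le> deviation_const * (real n / real k) powr (2 * \<gamma>) *
    ((real y) ^ 4 / (real n)\<^sup>2 + (real y)\<^sup>2 / real k + real y)"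
proof -
  define U where "U k = deviation n y k * (real k powr (2 * \<gamma>) * exp (- (1 / real k)))" for k
  define r where "r i = deviation_step_const * (real n powr (2 * \<gamma>) * (real y)\<^sup>2 * (1 / (real i)\<^sup>2) + real n powr \<gamma> * real y * real i powr (\<gamma> - 1))" for i
  have n: "real n > 0" using assms by simp
  have dev0: "deviation n y k \<ge> 0" for k unfolding deviation_def by (rule Ep_nonneg) simp
  have Ustep: "U k \<le> U (Suc k) + r (Suc k)" if "1 \<le> k" "Suc k \<le> n" for k
  proof -
    define K where "K = real (Suc k)"
    have K: "K > 0" by (simp add: K_def)
    define e where "e = real k powr (2 * \<gamma>) * exp (- (1 / real k))"
    have e0: "e \<ge> 0" by (simp add: e_def)
    have e1: "e \<le> K powr (2 * \<gamma>)"
    proof -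
      have "real k powr (2 * \<gamma>) \<le> K powr (2 * \<gamma>)" by (intro powr_mono2) (auto simp: K_def)
      moreover have "exp (- (1 / real k)) \<le> 1" by simp
      ultimately have "e \<le> K powr (2 * \<gamma>) * 1" unfolding e_def by (intro mult_mono) auto
      then show ?thesis by simp
    qed
    define N where "N = deviation_step_const * ((real n / K) powr (2 * \<gamma>) * (real y)\<^sup>2 / K\<^sup>2 + (real n / K) powr \<gamma> * real y / K)"
    have N0: "N \<ge> 0" unfolding N_def using step_consts_nonneg K by (intro mult_nonneg_nonneg add_nonneg_nonneg) auto
    have "U k \<le> (step_factor (Suc k) * deviation n y (Suc k) + N) * e"
      unfolding U_def e_def[symmetric] N_def K_def using deviation_step[OF that, of y] e0 by (rule mult_right_mono)
    also have "\<dots> = deviation n y (Suc k) * (e * step_factor (Suc k)) + N * e" by (simp add: algebra_simps)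
    also have "\<dots> \<le> deviation n y (Suc k) * (real (Suc k) powr (2 * \<gamma>) * exp (- (1 / real (Suc k)))) + N * K powr (2 * \<gamma>)"
      using step_factor_le[OF that(1)] dev0 N0 e1 unfolding e_def by (intro add_mono mult_left_mono) auto
    also have "N * K powr (2 * \<gamma>) = r (Suc k)"
    proof -
      have 1: "(real n / K) powr (2 * \<gamma>) * K powr (2 * \<gamma>) = real n powr (2 * \<gamma>)"
        using K n by (simp add: powr_divide)
      have 2: "(real n / K) powr \<gamma> / K * K powr (2 * \<gamma>) = real n powr \<gamma> * K powr (\<gamma> - 1)"
      proof -
        have "K powr (2 * \<gamma>) = K powr \<gamma> * K powr (\<gamma> - 1) * K"
          using K by (simp add: powr_diff powr_add[symmetric])
        then show ?thesis using K n by (simp add: powr_divide)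
      qed
      have eq: "N * K powr (2 * \<gamma>) = deviation_step_const * (((real n / K) powr (2 * \<gamma>) * K powr (2 * \<gamma>)) * (real y)\<^sup>2 * (1 / K\<^sup>2)
         + ((real n / K) powr \<gamma> / K * K powr (2 * \<gamma>)) * real y)"
        by (simp add: N_def algebra_simps)
      show ?thesis unfolding eq 1 2 r_def K_def[symmetric] by (simp add: mult_ac)
    qed
    finally show ?thesis unfolding U_def .
  qed
  have "U k \<le> U n + (\<Sum>i\<in>{k<..n}. r i)"
    using assms(2,1)
  proof (induction k rule: inc_induct)
    case (step k)
    have "{k<..n} = insert (Suc k) {Suc k<..n}" using step.hyps by auto
    then show ?case using step.IH step.prems Ustep[of k] step.hyps by simp
  qed simp
  also have "(\<Sum>i\<in>{k<..n}. r i) = deviation_step_const * (real n powr (2 * \<gamma>) * (real y)\<^sup>2 * (\<Sum>i\<in>{k<..n}. 1 / (real i)\<^sup>2)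
      + real n powr \<gamma> * real y * (\<Sum>i\<in>{k<..n}. real i powr (\<gamma> - 1)))"
    by (simp only: r_def sum_distrib_left[symmetric] sum.distrib)
  also have "\<dots> \<le> deviation_step_const * (real n powr (2 * \<gamma>) * (real y)\<^sup>2 * (1 / real k)
      + real n powr \<gamma> * real y * (2 powr \<gamma> / \<gamma> * real n powr \<gamma>))"
    using step_consts_nonneg assms by (intro mult_left_mono add_mono sum_inverse_squares sum_powr_minus1) auto
  also have "\<dots> = real n powr (2 * \<gamma>) * (deviation_step_const * ((real y)\<^sup>2 / real k) + deviation_step_const * (2 powr \<gamma> / \<gamma>) * real y)"
  proof -
    have "real n powr (2 * \<gamma>) = real n powr \<gamma> * real n powr \<gamma>" by (simp add: powr_add[symmetric])
    then show ?thesis by (simp add: algebra_simps)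
  qed
  also have "U n \<le> real n powr (2 * \<gamma>) * (((\<alpha> + 1)\<^sup>2 / c)\<^sup>2 * ((real y) ^ 4 / (real n)\<^sup>2))"
  proof -
    obtain q where q: "n = Suc q" using assms by (cases n) auto
    have "deviation n y n = (real y - fluid (fluid_const (real n) (real y)) (real n))\<^sup>2"
      unfolding deviation_def by (subst (1) q, subst Ep_chain_Suc) (simp add: q case_prod_unfold del: chain.simps)
    also have "\<dots> \<le> ((\<alpha> + 1)\<^sup>2 / c * (real y)\<^sup>2 / real n)\<^sup>2"
      using fluid_initial[of "real n" "real y"] assms by (subst abs_le_square_iff[symmetric]) (auto simp: abs_minus_commute)
    also have "\<dots> = ((\<alpha> + 1)\<^sup>2 / c)\<^sup>2 * ((real y) ^ 4 / (real n)\<^sup>2)"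
      by (simp add: power_mult_distrib power_divide flip: power_mult)
    finally have "deviation n y n \<le> \<dots>" .
    then have "U n \<le> (((\<alpha> + 1)\<^sup>2 / c)\<^sup>2 * ((real y) ^ 4 / (real n)\<^sup>2)) * (real n powr (2 * \<gamma>) * 1)"
      unfolding U_def using dev0 by (intro mult_mono mult_left_mono) auto
    then show ?thesis by (simp add: mult_ac)
  qed
  finally have U: "U k \<le> real n powr (2 * \<gamma>) * (((\<alpha> + 1)\<^sup>2 / c)\<^sup>2 * ((real y) ^ 4 / (real n)\<^sup>2)
      + deviation_step_const * ((real y)\<^sup>2 / real k) + deviation_step_const * (2 powr \<gamma> / \<gamma>) * real y)"
    by (simp add: algebra_simps)
  define S where "S = (real y) ^ 4 / (real n)\<^sup>2 + (real y)\<^sup>2 / real k + real y"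
  have k: "real k \<ge> 1" using assms by simp
  have "deviation n y k * real k powr (2 * \<gamma>) * 1 \<le> deviation n y k * real k powr (2 * \<gamma>) * (3 * exp (- (1 / real k)))"
  proof (intro mult_left_mono)
    have "exp (1 / real k) \<le> exp 1" using k by simp
    also have "\<dots> \<le> 3" by (rule exp_le)
    finally show "1 \<le> 3 * exp (- (1 / real k))" by (simp add: exp_minus field_simps)
  qed (use dev0 in auto)
  also have "\<dots> = 3 * U k" by (simp add: U_def)
  also have "\<dots> \<le> 3 * (real n powr (2 * \<gamma>) * ((((\<alpha> + 1)\<^sup>2 / c)\<^sup>2 + deviation_step_const + deviation_step_const * (2 powr \<gamma> / \<gamma>)) * S))"
  proof (intro mult_left_mono order_trans[OF U])
    let ?a = "((\<alpha> + 1)\<^sup>2 / c)\<^sup>2" and ?b = "deviation_step_const * (2 powr \<gamma> / \<gamma>)"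
    define s1 where "s1 = (real y) ^ 4 / (real n)\<^sup>2"
    define s2 where "s2 = (real y)\<^sup>2 / real k"
    have s: "0 \<le> s1" "0 \<le> s2" "0 \<le> real y" "S = s1 + s2 + real y" by (simp_all add: s1_def s2_def S_def)
    have ab: "0 \<le> ?a" "0 \<le> ?b" "0 \<le> deviation_step_const" using step_consts_nonneg by simp_all
    have "?a * s1 \<le> ?a * S" "deviation_step_const * s2 \<le> deviation_step_const * S" "?b * real y \<le> ?b * S"
      using s ab by (intro mult_left_mono; simp)+
    then show "?a * ((real y) ^ 4 / (real n)\<^sup>2) + deviation_step_const * ((real y)\<^sup>2 / real k) + ?b * real y \<le> (?a + deviation_step_const + ?b) * S"
      unfolding s1_def[symmetric] s2_def[symmetric] distrib_right by linarith
  qed auto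
  also have "\<dots> = real n powr (2 * \<gamma>) * (deviation_const * S)" by (simp add: deviation_const_def)
  finally have "deviation n y k * real k powr (2 * \<gamma>) \<le> real n powr (2 * \<gamma>) * (deviation_const * S)" by simp
  then have "deviation n y k \<le> real n powr (2 * \<gamma>) * (deviation_const * S) / real k powr (2 * \<gamma>)"
    using k by (subst pos_le_divide_eq) auto
  also have "\<dots> = deviation_const * (real n / real k) powr (2 * \<gamma>) * S" using k by (simp add: powr_divide)
  finally show ?thesis unfolding S_def .
qed

text \<open>
  The hitting rate is Lipschitz with constant of order \<open>1 / k\<close> in the number of open edges.
\<close>

lemma rate_deviation:
  assumes "2 \<le> k" "k \<le> n"
  shows "Ep (chain n y) (\<lambda>w. \<bar>hit_prob k (snd (w k)) - fluid_rate (fluid_const (real n) (real y)) (real k)\<bar>)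
    \<le> hit_rate_const * Ep (chain n y) (\<lambda>w. real (snd (w k))) / (real k)\<^sup>2 + sqrt (deviation n y k) / real k"
proof -
  define x where "x = fluid_const (real n) (real y)"
  have x: "x \<ge> 0" by (simp add: x_def fluid_const_def)
  have k: "real k \<ge> 2" "k \<ge> 1" using assms by simp_all
  have f: "0 \<le> fluid x (real k)" using x by (intro fluid_nonneg) auto
  have "Ep (chain n y) (\<lambda>w. \<bar>hit_prob k (snd (w k)) - fluid_rate x (real k)\<bar>)
    \<le> Ep (chain n y) (\<lambda>w. hit_rate_const / (real k)\<^sup>2 * real (snd (w k)) + 1 / real k * \<bar>real (snd (w k)) - fluid x (real k)\<bar>)"
  proof (rule Ep_mono[OF finite_chain])
    fix w :: "nat \<Rightarrow> bool \<times> nat"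
    let ?y = "snd (w k)"
    have 1: "\<bar>hit_prob k ?y - hit_rate k (real ?y)\<bar> \<le> hit_rate_const * real ?y / (real k)\<^sup>2"
      unfolding hit_prob_def by (rule hit_prob_rate[OF assms(1)])
    have 2: "\<bar>hit_rate k (real ?y) - hit_rate k (fluid x (real k))\<bar> \<le> \<alpha> / (c * real k) * \<bar>real ?y - fluid x (real k)\<bar>"
      using f k by (intro hit_rate_lipschitz) auto
    have "\<alpha> / (c * real k) \<le> c / (c * real k)" by (intro divide_right_mono) (auto simp: c_eq)
    then have "\<alpha> / (c * real k) \<le> 1 / real k" by simp
    then have 3: "\<alpha> / (c * real k) * \<bar>real ?y - fluid x (real k)\<bar> \<le> 1 / real k * \<bar>real ?y - fluid x (real k)\<bar>"
      by (intro mult_right_mono) auto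
    show "\<bar>hit_prob k ?y - fluid_rate x (real k)\<bar> \<le> hit_rate_const / (real k)\<^sup>2 * real ?y + 1 / real k * \<bar>real ?y - fluid x (real k)\<bar>"
      using 1 2 3 unfolding fluid_hit[OF x k(2)] by simp
  qed
  also have "\<dots> = hit_rate_const / (real k)\<^sup>2 * Ep (chain n y) (\<lambda>w. real (snd (w k)))
     + 1 / real k * Ep (chain n y) (\<lambda>w. \<bar>real (snd (w k)) - fluid x (real k)\<bar>)"
    by (simp add: integrable_measure_pmf_finite del: chain.simps)
  also have "\<dots> \<le> hit_rate_const / (real k)\<^sup>2 * Ep (chain n y) (\<lambda>w. real (snd (w k))) + 1 / real k * sqrt (deviation n y k)"
    unfolding deviation_def x_def[symmetric]
    by (intro add_left_mono mult_left_mono Ep_abs_le_sqrt finite_chain) auto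
  finally show ?thesis unfolding x_def by simp
qed

end

section \<open>Moments of the number of descendants\<close>

context pa_parameters begin

text \<open>
  The hitting rates become of order one when \<open>k\<close> open edges are reached at vertex \<open>k\<close>, that is for
  \<open>(n / k) powr \<gamma> = k\<close>; this happens at \<open>k = n powr \<nu>\<close>, and a positive fraction of the vertices below is hit.
\<close>

definition \<nu> :: real where "\<nu> = \<gamma> / \<beta>"

lemma gamma_ge_m1 [simp]: "- 1 \<le> \<gamma>"
  using gamma_pos by linarith

lemma gamma_nz [simp]: "\<gamma> \<noteq> 0"
  using gamma_pos by linarith

lemma nu_bounds: "0 < \<nu>" "\<nu> < 1"
proof -
  have "0 < 1 + \<gamma>" using gamma_pos by linarith
  then show "0 < \<nu>" "\<nu> < 1" by (simp_all add: \<nu>_def \<beta>_def)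
qed

lemma gamma_nu: "\<gamma> - \<gamma> * \<nu> = \<nu>"
proof -
  have "\<nu> * \<beta> = \<gamma>" using beta_gt1 by (simp add: \<nu>_def)
  then show ?thesis by (simp add: \<beta>_def algebra_simps)
qed

definition moment_const :: "nat \<Rightarrow> real"
  where "moment_const p = (real m - 1) ^ p * H ^ p * pochhammer (particles m) p"

lemma moment_const_nonneg: "0 \<le> moment_const p"
  unfolding moment_const_def using m2 H_ge1 by (intro mult_nonneg_nonneg pochhammer_nonneg_real) auto

lemma Ep_start_le:
  fixes f :: "(nat \<Rightarrow> bool \<times> nat) \<Rightarrow> real"
  assumes "\<And>y. y \<le> m \<Longrightarrow> Ep (chain (n - 1) y) f \<le> B"
  shows "Ep (start n) f \<le> B"
proof -
  have "Ep (start n) f = Ep (loops n) (\<lambda>l. Ep (chain (n - 1) (m - l)) f)"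
    unfolding start_def by (rule Ep_bind[OF finite_loops finite_chain])
  also have "\<dots> \<le> B" by (rule Ep_le_const[OF finite_loops]) (rule assms, simp)
  finally show ?thesis .
qed

lemma growth_start:
  assumes "1 \<le> k" "k \<le> n - 1"
  shows "growth k (n - 1) \<le> H * (real n / real k) powr \<gamma>"
proof -
  have "growth k (n - 1) \<le> H * (real (n - 1) / real k) powr \<gamma>"
    by (rule growth_le_H[OF assms])
  also have "\<dots> \<le> H * (real n / real k) powr \<gamma>"
    using assms H_ge1 by (intro mult_left_mono powr_mono2 divide_right_mono) auto
  finally show ?thesis .
qed

lemma power_le_pochhammer: "0 \<le> (x::real) \<Longrightarrow> x ^ p \<le> pochhammer x p"
  by (induction p) (auto simp: pochhammer_Suc intro!: mult_mono pochhammer_nonneg_real simp del: power_Suc simp: power_Suc2)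

lemma start_moment:
  assumes "1 \<le> k" "k \<le> n - 1"
  shows "Ep (start n) (\<lambda>w. real (snd (w k)) ^ p) \<le> moment_const p * ((real n / real k) powr \<gamma>) ^ p"
proof (rule Ep_start_le)
  fix y assume y: "y \<le> m"
  have m1: "real m - 1 > 0" using m2 by simp
  let ?g = "(real n / real k) powr \<gamma>"
  have "Ep (chain (n - 1) y) (\<lambda>w. real (snd (w k)) ^ p)
     \<le> Ep (chain (n - 1) y) (\<lambda>w. (real m - 1) ^ p * pochhammer (particles (snd (w k))) p)"
  proof (rule Ep_mono[OF finite_chain])
    fix w :: "nat \<Rightarrow> bool \<times> nat"
    have "real (snd (w k)) = (real m - 1) * particles (snd (w k))" using m1 by (simp add: particles_def)
    then have "real (snd (w k)) ^ p = (real m - 1) ^ p * particles (snd (w k)) ^ p"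
      by (simp only: power_mult_distrib)
    also have "\<dots> \<le> (real m - 1) ^ p * pochhammer (particles (snd (w k))) p"
      using m1 by (intro mult_left_mono power_le_pochhammer) auto
    finally show "real (snd (w k)) ^ p \<le> (real m - 1) ^ p * pochhammer (particles (snd (w k))) p" .
  qed
  also have "\<dots> = (real m - 1) ^ p * Ep (chain (n - 1) y) (\<lambda>w. pochhammer (particles (snd (w k))) p)"
    by (rule integral_mult_right_zero)
  also have "\<dots> \<le> (real m - 1) ^ p * (growth k (n - 1) ^ p * pochhammer (particles y) p)"
    using m1 by (intro mult_left_mono chain_moment assms) auto
  also have "\<dots> \<le> (real m - 1) ^ p * ((H * ?g) ^ p * pochhammer (particles m) p)"
    using m1 growth_start[OF assms] growth_ge1[of k "n - 1"] particles_mono[OF y] H_ge1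
    by (intro mult_left_mono mult_mono power_mono pochhammer_mono_real pochhammer_nonneg_real) auto
  finally show "Ep (chain (n - 1) y) (\<lambda>w. real (snd (w k)) ^ p) \<le> moment_const p * ?g ^ p"
    by (simp add: moment_const_def power_mult_distrib mult_ac)
qed

definition hit_const :: "nat \<Rightarrow> real"
  where "hit_const p = H ^ p * pochhammer (particles m) p"

lemma hit_const_nonneg: "0 \<le> hit_const p"
  unfolding hit_const_def using H_ge1 by (intro mult_nonneg_nonneg pochhammer_nonneg_real) auto

lemma start_hits_above:
  assumes "1 \<le> k" "p \<ge> 1"
  shows "Ep (start n) (\<lambda>w. real (hits_above k (n - 1) w choose p)) \<le> hit_const p * ((real n / real k) powr \<gamma>) ^ p"
proof (rule Ep_start_le)
  fix y assume y: "y \<le> m"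
  let ?g = "(real n / real k) powr \<gamma>"
  show "Ep (chain (n - 1) y) (\<lambda>w. real (hits_above k (n - 1) w choose p)) \<le> hit_const p * ?g ^ p"
  proof (cases "k \<le> n - 1")
    case True
    let ?G = "growth k (n - 1)"
    have "Ep (chain (n - 1) y) (\<lambda>w. real (hits_above k (n - 1) w choose p))
        \<le> (?G - 1) * ?G ^ (p - 1) * pochhammer (particles y) p"
      by (rule hits_above_moment[OF assms(1) True assms(2)])
    also have "\<dots> \<le> ?G * ?G ^ (p - 1) * pochhammer (particles m) p"
      using growth_ge1[of k "n - 1"] particles_mono[OF y]
      by (intro mult_mono pochhammer_mono_real pochhammer_nonneg_real) auto
    also have "?G * ?G ^ (p - 1) = ?G ^ p" using assms(2) by (cases p) auto
    also have "?G ^ p * pochhammer (particles m) p \<le> (H * ?g) ^ p * pochhammer (particles m) p"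
      using growth_start[OF assms(1) True] growth_ge1[of k "n - 1"]
      by (intro mult_right_mono power_mono pochhammer_nonneg_real) auto
    finally show ?thesis by (simp add: hit_const_def power_mult_distrib mult_ac)
  next
    case False
    then have "hits_above k (n - 1) w = 0" for w by (simp add: hits_above_def)
    moreover have "0 \<le> hit_const p * ?g ^ p" using hit_const_nonneg by simp
    ultimately show ?thesis using assms(2) by (simp add: binomial_eq_0)
  qed
qed

lemma hits_split: "k \<le> n \<Longrightarrow> hits n w = hits k w + hits_above k n w"
proof -
  assume "k \<le> n"
  then have "{i \<in> {1..n}. fst (w i)} = {i \<in> {1..k}. fst (w i)} \<union> {i \<in> {k<..n}. fst (w i)}" by auto
  moreover have "{i \<in> {1..k}. fst (w i)} \<inter> {i \<in> {k<..n}. fst (w i)} = {}" by auto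
  ultimately show ?thesis unfolding hits_def hits_above_def by (simp add: card_Un_disjoint)
qed

lemma hits_le: "hits n w \<le> n"
  unfolding hits_def by (rule order_trans[OF card_mono[of "{1..n}"]]) auto

text \<open>
  For \<open>x < p\<close> the constant \<open>p ^ p\<close> suffices, otherwise \<open>(x / p) ^ p \<le> x choose p\<close>.
\<close>

lemma power_le_choose: "p \<ge> 1 \<Longrightarrow> real (x ^ p) \<le> real (p ^ p) * (1 + real (x choose p))"
proof (cases "p \<le> x")
  case True
  assume "p \<ge> 1"
  have "(real x / real p) ^ p \<le> real (x choose p)"
    using binomial_ge_n_over_k_pow_k[OF True, where 'a = real] by simp
  then have "real x ^ p \<le> real (x choose p) * real p ^ p"
    using \<open>p \<ge> 1\<close> by (simp add: power_divide divide_le_eq)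
  also have "\<dots> \<le> real p ^ p * (1 + real (x choose p))" by (simp add: algebra_simps)
  finally show ?thesis by simp
next
  case False
  then have "real x ^ p \<le> real p ^ p" by (intro power_mono) auto
  also have "\<dots> \<le> real p ^ p * (1 + real (x choose p))" by (simp add: algebra_simps)
  finally show ?thesis by simp
qed

definition descendants_const :: "nat \<Rightarrow> real"
  where "descendants_const p = 2 ^ p * (3 ^ p + real (p ^ p) * (1 + hit_const p))"

lemma descendants_const_nonneg: "0 \<le> descendants_const p"
  unfolding descendants_const_def using hit_const_nonneg[of p] by (intro mult_nonneg_nonneg add_nonneg_nonneg) auto

text \<open>
  Split at \<open>k = n powr \<nu>\<close>: at most \<open>k\<close> hits occur below, and the factorial moments of the hits above are
  bounded by powers of \<open>(n / k) powr \<gamma>\<close>, which is of the same size.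
\<close>

lemma descendants_moment:
  assumes "n \<ge> 2" "p \<ge> 1"
  shows "Ep (start n) (\<lambda>w. real (Suc (hits (n - 1) w)) ^ p) \<le> descendants_const p * (real n powr \<nu>) ^ p"
proof -
  define s where "s = real n powr \<nu>"
  define k where "k = nat \<lceil>s\<rceil>"
  have s1: "s \<ge> 1" unfolding s_def using assms nu_bounds by (intro ge_one_powr_ge_zero) auto
  have k: "1 \<le> k" "s \<le> real k" "real k \<le> s + 1" using s1 by (simp_all add: k_def) linarith+
  have g: "(real n / real k) powr \<gamma> \<le> s"
  proof -
    have "(real n / real k) powr \<gamma> \<le> (real n / s) powr \<gamma>"
      using k s1 by (intro powr_mono2 divide_left_mono) auto
    also have "\<dots> = real n powr (\<gamma> - \<gamma> * \<nu>)"
      using assms by (simp add: s_def powr_divide powr_powr powr_diff mult.commute)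
    finally show ?thesis by (simp add: gamma_nu s_def)
  qed
  have pt: "real (Suc (hits (n - 1) w)) ^ p \<le> 2 ^ p * ((3 * s) ^ p + real (p ^ p) * (1 + real (hits_above k (n - 1) w choose p)))" for w
  proof -
    let ?h = "hits_above k (n - 1) w"
    have "hits (n - 1) w \<le> k + ?h"
    proof (cases "k \<le> n - 1")
      case True
      then show ?thesis using hits_split[OF True, of w] hits_le[of k w] by simp
    qed (use hits_le[of "n - 1" w] in simp)
    then have "real (Suc (hits (n - 1) w)) \<le> 3 * s + real ?h" using k s1 by linarith
    also have "\<dots> \<le> 2 * max (3 * s) (real ?h)" by simp
    finally have "real (Suc (hits (n - 1) w)) ^ p \<le> (2 * max (3 * s) (real ?h)) ^ p" by (intro power_mono) auto
    also have "\<dots> = 2 ^ p * max (3 * s) (real ?h) ^ p" by (simp add: power_mult_distrib)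
    also have "\<dots> \<le> 2 ^ p * ((3 * s) ^ p + real ?h ^ p)"
      using s1 by (intro mult_left_mono) (auto simp: max_def)
    also have "\<dots> \<le> 2 ^ p * ((3 * s) ^ p + real (p ^ p) * (1 + real (?h choose p)))"
      using power_le_choose[OF assms(2), of ?h] by (intro mult_left_mono add_left_mono) auto
    finally show ?thesis .
  qed
  have "Ep (start n) (\<lambda>w. real (Suc (hits (n - 1) w)) ^ p)
    \<le> Ep (start n) (\<lambda>w. 2 ^ p * ((3 * s) ^ p + real (p ^ p) * (1 + real (hits_above k (n - 1) w choose p))))"
    using pt by (intro Ep_mono finite_start)
  also have "\<dots> = 2 ^ p * ((3 * s) ^ p + real (p ^ p) * (1 + Ep (start n) (\<lambda>w. real (hits_above k (n - 1) w choose p))))"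
    by (simp add: integrable_measure_pmf_finite)
  also have "\<dots> \<le> 2 ^ p * ((3 * s) ^ p + real (p ^ p) * (1 * s ^ p + hit_const p * s ^ p))"
  proof -
    have "Ep (start n) (\<lambda>w. real (hits_above k (n - 1) w choose p)) \<le> hit_const p * ((real n / real k) powr \<gamma>) ^ p"
      by (rule start_hits_above[OF k(1) assms(2)])
    also have "\<dots> \<le> hit_const p * s ^ p"
      using g hit_const_nonneg by (intro mult_left_mono power_mono) auto
    finally have "Ep (start n) (\<lambda>w. real (hits_above k (n - 1) w choose p)) \<le> hit_const p * s ^ p" .
    moreover have "1 \<le> s ^ p" using s1 by (rule one_le_power)
    ultimately show ?thesis by (intro mult_left_mono add_left_mono add_mono) auto
  qed
  also have "\<dots> = descendants_const p * s ^ p"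
    by (simp add: descendants_const_def power_mult_distrib algebra_simps)
  finally show ?thesis by (simp add: s_def)
qed

lemma sum_powr_tail:
  assumes "2 \<le> K"
  shows "(\<Sum>k\<in>{K..n}. real k powr (- \<gamma> - 1)) \<le> (2 / real K) powr \<gamma> / \<gamma>"
proof -
  have "(\<Sum>k\<in>{K..n}. real k powr (- \<gamma> - 1)) \<le> (real K - 1) powr (- \<gamma>) / \<gamma>"
  proof (cases "K \<le> n")
    case True
    then have "(\<Sum>k\<in>{K..n}. real k powr (- \<gamma> - 1)) \<le> ((real K - 1) powr (- \<gamma>) - real n powr (- \<gamma>)) / \<gamma>"
    proof (induction n rule: dec_induct)
      case base
      have "\<exists>z>real K - 1. z < real K \<and> real K powr (- \<gamma>) - (real K - 1) powr (- \<gamma>) = (real K - (real K - 1)) * (- \<gamma> * z powr (- \<gamma> - 1))"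
        by (rule MVT2) (use assms in \<open>auto intro!: derivative_eq_intros\<close>)
      then obtain z where z: "real K - 1 < z" "z < real K" "real K powr (- \<gamma>) - (real K - 1) powr (- \<gamma>) = - \<gamma> * z powr (- \<gamma> - 1)"
        by auto
      have "real K powr (- \<gamma> - 1) \<le> z powr (- \<gamma> - 1)" by (intro powr_mono2') (use z assms gamma_pos in auto)
      also have "z powr (- \<gamma> - 1) = ((real K - 1) powr (- \<gamma>) - real K powr (- \<gamma>)) / \<gamma>"
        using z(3) gamma_pos by (simp add: field_simps)
      finally show ?case by simp
    next
      case (step n)
      have n: "real n \<ge> 1" using step.hyps assms by simp
      have "\<exists>z>real n. z < real (Suc n) \<and> real (Suc n) powr (- \<gamma>) - real n powr (- \<gamma>) = (real (Suc n) - real n) * (- \<gamma> * z powr (- \<gamma> - 1))"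
        by (rule MVT2) (use n in \<open>auto intro!: derivative_eq_intros\<close>)
      then obtain z where z: "real n < z" "z < real (Suc n)" "real (Suc n) powr (- \<gamma>) - real n powr (- \<gamma>) = - \<gamma> * z powr (- \<gamma> - 1)"
        by auto
      have "real (Suc n) powr (- \<gamma> - 1) \<le> z powr (- \<gamma> - 1)" by (intro powr_mono2') (use z n gamma_pos in auto)
      also have "z powr (- \<gamma> - 1) = (real n powr (- \<gamma>) - real (Suc n) powr (- \<gamma>)) / \<gamma>"
        using z(3) gamma_pos by (simp add: field_simps)
      finally have s: "real (Suc n) powr (- \<gamma> - 1) \<le> (real n powr (- \<gamma>) - real (Suc n) powr (- \<gamma>)) / \<gamma>" .
      have "{K..Suc n} = insert (Suc n) {K..n}" using step.hyps by auto
      then show ?case using s step.IH by (simp add: diff_divide_distrib)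
    qed
    also have "\<dots> \<le> (real K - 1) powr (- \<gamma>) / \<gamma>" by (intro divide_right_mono) auto
    finally show ?thesis .
  qed simp
  also have "(real K - 1) powr (- \<gamma>) \<le> (real K / 2) powr (- \<gamma>)"
    using assms by (intro powr_mono2') auto
  also have "(real K / 2) powr (- \<gamma>) = (2 / real K) powr \<gamma>"
    using assms by (simp add: powr_divide powr_minus field_simps)
  finally show ?thesis by (simp add: divide_right_mono)
qed

end

section \<open>The number of descendants and the fluid limit\<close>

context pa_parameters begin

lemma start_markov:
  fixes \<Phi> :: "nat \<Rightarrow> (nat \<Rightarrow> bool \<times> nat) \<Rightarrow> real"
  assumes "1 \<le> k" "k \<le> n - 1"
    and "\<And>y v v'. (\<And>i. i \<in> {1..k} \<Longrightarrow> v i = v' i) \<Longrightarrow> \<Phi> y v = \<Phi> y v'"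
  shows "Ep (start n) (\<lambda>w. \<Phi> (snd (w k)) w) = Ep (start n) (\<lambda>w. Ep (chain k (snd (w k))) (\<Phi> (snd (w k))))"
  unfolding start_def Ep_bind[OF finite_loops finite_chain]
  by (rule Ep_cong) (rule chain_markov[OF assms])

definition fluid_sum :: "nat \<Rightarrow> nat \<Rightarrow> real"
  where "fluid_sum k y = (\<Sum>i=1..k. fluid_rate (fluid_const (real k) (real y)) (real i))"

lemma hits_eq_sum: "real (hits k w) = (\<Sum>i=1..k. of_bool (fst (w i)))"
  unfolding hits_def by (subst sum_of_bool_eq) (auto simp: Int_def)

lemma fluid_rate_bounds:
  assumes "x \<ge> 0"
  shows "0 \<le> fluid_rate x s" "fluid_rate x s \<le> 1"
proof -
  have "1 \<le> 1 + x * s powr (- \<beta>)" using assms by simp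
  then have "(1 + x * s powr (- \<beta>)) powr (- \<kappa>) \<le> 1" using kappa_bounds by (intro powr_nonpos_le_1) auto
  then show "0 \<le> fluid_rate x s" by (simp add: fluid_rate_def)
qed (simp add: fluid_rate_def)

text \<open>
  The deviation from the fluid solution that is chosen at \<open>k0\<close>, relative to the typical size
  \<open>(n / k) powr (2 * \<gamma>)\<close> of the square, uniformly for \<open>K \<le> k \<le> k0\<close>.
\<close>

definition deviation_rate :: "nat \<Rightarrow> nat \<Rightarrow> nat \<Rightarrow> real"
  where "deviation_rate n k0 K = deviation_const * (moment_const 4 * (real n / real k0) powr (2 * \<gamma>) / (real k0)\<^sup>2
     + moment_const 2 / real K + moment_const 1 * (real k0 / real n) powr \<gamma>)"

lemma start_deviation:
  assumes "1 \<le> K" "K \<le> k" "k \<le> k0" "k0 \<le> n - 1"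
  shows "Ep (start n) (\<lambda>w. deviation k0 (snd (w k0)) k) \<le> (real n / real k) powr (2 * \<gamma>) * deviation_rate n k0 K"
proof -
  have k: "real k > 0" "real k0 > 0" "real n > 0" "real K > 0" using assms by auto
  define g where "g = (real n / real k0) powr \<gamma>"
  have k0: "1 \<le> k0" using assms by simp
  have "g\<^sup>2 = (real n / real k0) powr (2 * \<gamma>)"
    by (simp add: g_def power2_eq_square powr_add[symmetric])
  moreover have "g ^ 4 = g\<^sup>2 * g\<^sup>2" by (simp add: eval_nat_numeral)
  ultimately have g2: "g\<^sup>2 = (real n / real k0) powr (2 * \<gamma>)" "g ^ 4 = g\<^sup>2 * g\<^sup>2" by auto
  have gi: "g = g\<^sup>2 * (real k0 / real n) powr \<gamma>"
  proof -
    have 1: "g = real n powr \<gamma> / real k0 powr \<gamma>" "(real k0 / real n) powr \<gamma> = real k0 powr \<gamma> / real n powr \<gamma>"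
      unfolding g_def using k by (simp_all add: powr_divide)
    show ?thesis unfolding 1 using k by (simp add: power2_eq_square)
  qed
  have deviation_const: "deviation_const \<ge> 0" unfolding deviation_const_def using step_consts_nonneg by (intro mult_nonneg_nonneg add_nonneg_nonneg) auto
  let ?A = "deviation_const * (real k0 / real k) powr (2 * \<gamma>)"
  have "Ep (start n) (\<lambda>w. deviation k0 (snd (w k0)) k)
    \<le> Ep (start n) (\<lambda>w. ?A * (real (snd (w k0)) ^ 4 / (real k0)\<^sup>2 + (real (snd (w k0)))\<^sup>2 / real k + real (snd (w k0)) ^ 1))"
    using assms by (intro Ep_mono finite_start) (simp only: power_one_right, rule deviation_bound, auto)
  also have "\<dots> = ?A * (Ep (start n) (\<lambda>w. real (snd (w k0)) ^ 4) / (real k0)\<^sup>2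
      + Ep (start n) (\<lambda>w. (real (snd (w k0)))\<^sup>2) / real k + Ep (start n) (\<lambda>w. real (snd (w k0)) ^ 1))"
    by (simp add: integrable_measure_pmf_finite)
  also have "\<dots> \<le> ?A * (moment_const 4 * g ^ 4 / (real k0)\<^sup>2 + moment_const 2 * g\<^sup>2 / real K + moment_const 1 * g ^ 1)"
  proof (intro mult_left_mono add_mono divide_right_mono)
    have "Ep (start n) (\<lambda>w. (real (snd (w k0)))\<^sup>2) / real k \<le> moment_const 2 * g\<^sup>2 / real k"
      unfolding g_def by (intro divide_right_mono start_moment k0 assms) auto
    also have "\<dots> \<le> moment_const 2 * g\<^sup>2 / real K"
      using k assms moment_const_nonneg by (intro divide_left_mono) auto
    finally show "Ep (start n) (\<lambda>w. (real (snd (w k0)))\<^sup>2) / real k \<le> moment_const 2 * g\<^sup>2 / real K" .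
    show "Ep (start n) (\<lambda>w. real (snd (w k0)) ^ 4) \<le> moment_const 4 * g ^ 4"
      "Ep (start n) (\<lambda>w. real (snd (w k0)) ^ 1) \<le> moment_const 1 * g ^ 1"
      unfolding g_def by (rule start_moment[OF k0 assms(4)])+
  qed (use deviation_const in auto)
  also have "moment_const 4 * g ^ 4 / (real k0)\<^sup>2 + moment_const 2 * g\<^sup>2 / real K + moment_const 1 * g ^ 1
     = g\<^sup>2 * (moment_const 4 * g\<^sup>2 / (real k0)\<^sup>2 + moment_const 2 / real K + moment_const 1 * (real k0 / real n) powr \<gamma>)"
    unfolding g2(2) power_one_right by (subst (3) gi) (simp add: algebra_simps)
  also have "?A * \<dots> = ((real k0 / real k) powr (2 * \<gamma>) * g\<^sup>2) * deviation_rate n k0 K"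
    unfolding deviation_rate_def g2(1) by (simp add: mult_ac)
  also have "(real k0 / real k) powr (2 * \<gamma>) * g\<^sup>2 = (real n / real k) powr (2 * \<gamma>)"
    unfolding g2(1) using k by (simp add: powr_mult[symmetric])
  finally show ?thesis .
qed

lemma start_rate_deviation:
  assumes "2 \<le> K" "K \<le> k" "k \<le> k0" "k0 \<le> n - 1"
  shows "Ep (start n) (\<lambda>w. \<bar>hit_prob k (snd (w k)) - fluid_rate (fluid_const (real k0) (real (snd (w k0)))) (real k)\<bar>)
    \<le> real n powr \<gamma> * real k powr (- \<gamma> - 1) * (hit_rate_const * moment_const 1 / real K + sqrt (deviation_rate n k0 K))"
proof -
  have k: "real k > 0" "real n > 0" "real K > 0" "1 \<le> k0" "1 \<le> k" "2 \<le> k" "k \<le> n - 1" using assms by auto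
  define g where "g = (real n / real k) powr \<gamma>"
  have g2: "g\<^sup>2 = (real n / real k) powr (2 * \<gamma>)"
    by (simp add: g_def power2_eq_square powr_add[symmetric])
  define \<Phi> where "\<Phi> y v = \<bar>hit_prob k (snd (v k)) - fluid_rate (fluid_const (real k0) (real y)) (real k)\<bar>"
    for y :: nat and v :: "nat \<Rightarrow> bool \<times> nat"
  have "Ep (start n) (\<lambda>w. \<bar>hit_prob k (snd (w k)) - fluid_rate (fluid_const (real k0) (real (snd (w k0)))) (real k)\<bar>)
    = Ep (start n) (\<lambda>w. \<Phi> (snd (w k0)) w)" by (simp add: \<Phi>_def)
  also have "\<dots> = Ep (start n) (\<lambda>w. Ep (chain k0 (snd (w k0))) (\<Phi> (snd (w k0))))"
    by (rule start_markov) (use assms k in \<open>auto simp: \<Phi>_def\<close>)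
  also have "\<dots> \<le> Ep (start n) (\<lambda>w. hit_rate_const / (real k)\<^sup>2 * Ep (chain k0 (snd (w k0))) (\<lambda>v. real (snd (v k)))
      + 1 / real k * \<bar>sqrt (deviation k0 (snd (w k0)) k)\<bar>)"
  proof (rule Ep_mono[OF finite_start])
    fix w :: "nat \<Rightarrow> bool \<times> nat"
    have "deviation k0 (snd (w k0)) k \<ge> 0" unfolding deviation_def by (rule Ep_nonneg) simp
    then show "Ep (chain k0 (snd (w k0))) (\<Phi> (snd (w k0))) \<le> hit_rate_const / (real k)\<^sup>2 * Ep (chain k0 (snd (w k0))) (\<lambda>v. real (snd (v k)))
      + 1 / real k * \<bar>sqrt (deviation k0 (snd (w k0)) k)\<bar>"
      using rate_deviation[OF k(6) assms(3), of "snd (w k0)"] unfolding \<Phi>_def by simp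
  qed
  also have "\<dots> = hit_rate_const / (real k)\<^sup>2 * Ep (start n) (\<lambda>w. Ep (chain k0 (snd (w k0))) (\<lambda>v. real (snd (v k))))
      + 1 / real k * Ep (start n) (\<lambda>w. \<bar>sqrt (deviation k0 (snd (w k0)) k)\<bar>)"
    by (simp only: Ep_add[OF finite_start] integral_mult_right_zero)
  also have "Ep (start n) (\<lambda>w. Ep (chain k0 (snd (w k0))) (\<lambda>v. real (snd (v k)))) = Ep (start n) (\<lambda>w. real (snd (w k)) ^ 1)"
    using start_markov[of k0 n "\<lambda>_ v. real (snd (v k))"] assms k by simp
  also have "hit_rate_const / (real k)\<^sup>2 * Ep (start n) (\<lambda>w. real (snd (w k)) ^ 1) + 1 / real k * Ep (start n) (\<lambda>w. \<bar>sqrt (deviation k0 (snd (w k0)) k)\<bar>)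
     \<le> hit_rate_const / (real k)\<^sup>2 * (moment_const 1 * g ^ 1) + 1 / real k * (g * sqrt (deviation_rate n k0 K))"
  proof (intro add_mono mult_left_mono)
    show "Ep (start n) (\<lambda>w. real (snd (w k)) ^ 1) \<le> moment_const 1 * g ^ 1"
      unfolding g_def by (rule start_moment) (use k in auto)
    have "Ep (start n) (\<lambda>w. \<bar>sqrt (deviation k0 (snd (w k0)) k)\<bar>) \<le> sqrt (Ep (start n) (\<lambda>w. (sqrt (deviation k0 (snd (w k0)) k))\<^sup>2))"
      by (rule Ep_abs_le_sqrt) simp
    also have "(\<lambda>w. (sqrt (deviation k0 (snd (w k0)) k))\<^sup>2) = (\<lambda>w. deviation k0 (snd (w k0)) k)"
      by (rule ext, rule real_sqrt_pow2) (auto simp: deviation_def intro!: Ep_nonneg)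
    also have "sqrt (Ep (start n) (\<lambda>w. deviation k0 (snd (w k0)) k)) \<le> sqrt (g\<^sup>2 * deviation_rate n k0 K)"
      unfolding g2 by (intro real_sqrt_le_mono start_deviation) (use assms in auto)
    also have "\<dots> = g * sqrt (deviation_rate n k0 K)" by (simp add: real_sqrt_mult g_def)
    finally show "Ep (start n) (\<lambda>w. \<bar>sqrt (deviation k0 (snd (w k0)) k)\<bar>) \<le> g * sqrt (deviation_rate n k0 K)" .
  qed (use step_consts_nonneg in auto)
  also have "\<dots> = g / real k * (hit_rate_const * moment_const 1 / real k + sqrt (deviation_rate n k0 K))"
    using k by (simp add: power2_eq_square algebra_simps)
  also have "\<dots> \<le> g / real k * (hit_rate_const * moment_const 1 / real K + sqrt (deviation_rate n k0 K))"
    using k assms step_consts_nonneg moment_const_nonneg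
    by (intro mult_left_mono add_right_mono divide_left_mono) (auto simp: g_def)
  also have "g / real k = real n powr \<gamma> * real k powr (- \<gamma> - 1)"
  proof -
    have 1: "(real n / real k) powr \<gamma> = real n powr \<gamma> / real k powr \<gamma>" using k by (simp add: powr_divide)
    have 2: "real k powr (- \<gamma> - 1) = 1 / (real k powr \<gamma> * real k)" using k by (simp add: powr_diff powr_minus_divide)
    show ?thesis unfolding g_def 1 2 by simp
  qed
  finally show ?thesis .
qed

text \<open>
  The hits above \<open>k0\<close> are bounded by their mean, and the vertices below \<open>K\<close> are too few
  to matter. In between the hits are replaced by their conditional probabilities, at the cost of the standard
  deviation of the martingale part, and these probabilities by the fluid hitting rates.
\<close>

lemma descendants_fluid_error:
  assumes "2 \<le> K" "1 \<le> k0" "k0 \<le> n - 1"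
  shows "Ep (start n) (\<lambda>w. \<bar>real (Suc (hits (n - 1) w)) - fluid_sum k0 (snd (w k0))\<bar>)
    \<le> 1 + hit_const 1 * (real n / real k0) powr \<gamma> + sqrt (descendants_const 1 * real n powr \<nu>) + real K
      + (2 * real n / real K) powr \<gamma> / \<gamma> * (hit_rate_const * moment_const 1 / real K + sqrt (deviation_rate n k0 K))"
proof -
  define x where "x w = fluid_const (real k0) (real (snd (w k0)))" for w :: "nat \<Rightarrow> bool \<times> nat"
  define D where "D w = (\<Sum>k=1..k0. \<bar>hit_prob k (snd (w k)) - fluid_rate (x w) (real k)\<bar>)" for w
  have n2: "n \<ge> 2" using assms by simp
  have x0: "x w \<ge> 0" for w by (simp add: x_def fluid_const_def)
  have pt: "\<bar>real (Suc (hits (n - 1) w)) - fluid_sum k0 (snd (w k0))\<bar>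
    \<le> 1 + real (hits_above k0 (n - 1) w) + \<bar>compensated k0 w\<bar> + D w" for w
  proof -
    have "real (hits k0 w) - fluid_sum k0 (snd (w k0)) = compensated k0 w + (\<Sum>k=1..k0. hit_prob k (snd (w k)) - fluid_rate (x w) (real k))"
      unfolding compensated_def fluid_sum_def hits_eq_sum x_def by (simp add: sum_subtractf)
    moreover have "\<bar>\<Sum>k=1..k0. hit_prob k (snd (w k)) - fluid_rate (x w) (real k)\<bar> \<le> D w"
      unfolding D_def by (rule sum_abs)
    ultimately show ?thesis using hits_split[OF assms(3), of w] by simp
  qed
  have "Ep (start n) (\<lambda>w. \<bar>real (Suc (hits (n - 1) w)) - fluid_sum k0 (snd (w k0))\<bar>)
    \<le> Ep (start n) (\<lambda>w. 1 + real (hits_above k0 (n - 1) w) + \<bar>compensated k0 w\<bar> + D w)"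
    using pt by (intro Ep_mono finite_start)
  also have "\<dots> = 1 + Ep (start n) (\<lambda>w. real (hits_above k0 (n - 1) w choose 1))
      + Ep (start n) (\<lambda>w. \<bar>compensated k0 w\<bar>) + Ep (start n) D"
    by (simp add: integrable_measure_pmf_finite)
  also have "\<dots> \<le> 1 + hit_const 1 * ((real n / real k0) powr \<gamma>) ^ 1 + sqrt (descendants_const 1 * real n powr \<nu>)
      + (real K + (2 * real n / real K) powr \<gamma> / \<gamma> * (hit_rate_const * moment_const 1 / real K + sqrt (deviation_rate n k0 K)))"
  proof (intro add_mono order_refl)
    show "Ep (start n) (\<lambda>w. real (hits_above k0 (n - 1) w choose 1)) \<le> hit_const 1 * ((real n / real k0) powr \<gamma>) ^ 1"
      by (rule start_hits_above[OF assms(2)]) simp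
    have loc: "compensated k0 v = compensated k0 v'" "hits k0 v = hits k0 v'"
      if "\<And>i. i \<in> {1..k0} \<Longrightarrow> v i = v' i" for v v'
    proof -
      show "compensated k0 v = compensated k0 v'" unfolding compensated_def using that by (intro sum.cong) auto
      have "{i \<in> {1..k0}. fst (v i)} = {i \<in> {1..k0}. fst (v' i)}" using that by auto
      then show "hits k0 v = hits k0 v'" by (simp add: hits_def)
    qed
    have "Ep (start n) (\<lambda>w. (compensated k0 w)\<^sup>2) = Ep (start n) (\<lambda>w. Ep (chain k0 (snd (w k0))) (\<lambda>v. (compensated k0 v)\<^sup>2))"
      by (rule start_markov[OF assms(2,3), of "\<lambda>_ v. (compensated k0 v)\<^sup>2"])
        (rule arg_cong[where f = "\<lambda>x::real. x\<^sup>2"], rule loc(1), simp)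
    also have "\<dots> \<le> Ep (start n) (\<lambda>w. \<Sum>k=1..k0. Ep (chain k0 (snd (w k0))) (\<lambda>v. hit_prob k (snd (v k))))"
      by (intro Ep_mono finite_start compensated_square)
    also have "\<dots> = Ep (start n) (\<lambda>w. Ep (chain k0 (snd (w k0))) (\<lambda>v. real (hits k0 v)))"
    proof (rule Ep_cong)
      fix w :: "nat \<Rightarrow> bool \<times> nat"
      have "0 = Ep (chain k0 (snd (w k0))) (compensated k0)" by (rule compensated_mean[symmetric])
      also have "\<dots> = Ep (chain k0 (snd (w k0))) (\<lambda>v. real (hits k0 v) - (\<Sum>k=1..k0. hit_prob k (snd (v k))))"
        unfolding compensated_def hits_eq_sum by (simp add: sum_subtractf)
      also have "\<dots> = Ep (chain k0 (snd (w k0))) (\<lambda>v. real (hits k0 v)) - (\<Sum>k=1..k0. Ep (chain k0 (snd (w k0))) (\<lambda>v. hit_prob k (snd (v k))))"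
        by (simp only: Ep_diff[OF finite_chain] Ep_sum[OF finite_chain])
      finally show "(\<Sum>k=1..k0. Ep (chain k0 (snd (w k0))) (\<lambda>v. hit_prob k (snd (v k)))) = Ep (chain k0 (snd (w k0))) (\<lambda>v. real (hits k0 v))"
        by simp
    qed
    also have "\<dots> = Ep (start n) (\<lambda>w. real (hits k0 w))"
      by (rule start_markov[OF assms(2,3), of "\<lambda>_ v. real (hits k0 v)", symmetric])
        (rule arg_cong[where f = real], rule loc(2), simp)
    also have "\<dots> \<le> Ep (start n) (\<lambda>w. real (Suc (hits (n - 1) w)) ^ 1)"
      using hits_split[OF assms(3)] by (intro Ep_mono finite_start) simp
    also have "\<dots> \<le> descendants_const 1 * (real n powr \<nu>) ^ 1"
      by (rule descendants_moment[OF n2]) simp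
    finally have c2: "Ep (start n) (\<lambda>w. (compensated k0 w)\<^sup>2) \<le> descendants_const 1 * real n powr \<nu>" by simp
    have "Ep (start n) (\<lambda>w. \<bar>compensated k0 w\<bar>) \<le> sqrt (Ep (start n) (\<lambda>w. (compensated k0 w)\<^sup>2))"
      by (rule Ep_abs_le_sqrt) simp
    also have "\<dots> \<le> sqrt (descendants_const 1 * real n powr \<nu>)" using c2 by (rule real_sqrt_le_mono)
    finally show "Ep (start n) (\<lambda>w. \<bar>compensated k0 w\<bar>) \<le> sqrt (descendants_const 1 * real n powr \<nu>)" .
    define r where "r = hit_rate_const * moment_const 1 / real K + sqrt (deviation_rate n k0 K)"
    define d where "d k = Ep (start n) (\<lambda>w. \<bar>hit_prob k (snd (w k)) - fluid_rate (x w) (real k)\<bar>)" for k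
    have d0: "0 \<le> d k" for k unfolding d_def by (rule Ep_nonneg) simp
    have d1: "d k \<le> 1" for k
      unfolding d_def
    proof (rule Ep_le_const[OF finite_start])
      fix w :: "nat \<Rightarrow> bool \<times> nat"
      show "\<bar>hit_prob k (snd (w k)) - fluid_rate (x w) (real k)\<bar> \<le> 1"
        using hit_prob_bounds[of k "snd (w k)"] fluid_rate_bounds[OF x0, of w "real k"] by linarith
    qed
    have r0: "0 \<le> r"
    proof -
      have "0 \<le> deviation_rate n k0 K" unfolding deviation_rate_def deviation_const_def
        using step_consts_nonneg moment_const_nonneg by (intro mult_nonneg_nonneg add_nonneg_nonneg divide_nonneg_nonneg) auto
      then show ?thesis unfolding r_def using step_consts_nonneg moment_const_nonneg[of 1] by simp
    qed
    have "Ep (start n) D = (\<Sum>k=1..k0. d k)" unfolding D_def d_def by (rule Ep_sum) simp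
    also have "\<dots> \<le> (\<Sum>k\<in>{1..<K} \<union> {K..k0}. d k)"
      by (rule sum_mono2) (use d0 in auto)
    also have "\<dots> = (\<Sum>k\<in>{1..<K}. d k) + (\<Sum>k\<in>{K..k0}. d k)" by (rule sum.union_disjoint) auto
    also have "\<dots> \<le> real K + (\<Sum>k\<in>{K..k0}. real n powr \<gamma> * real k powr (- \<gamma> - 1) * r)"
    proof (intro add_mono sum_mono)
      have "(\<Sum>k\<in>{1..<K}. d k) \<le> (\<Sum>k\<in>{1..<K}. 1)" by (intro sum_mono d1)
      then show "(\<Sum>k\<in>{1..<K}. d k) \<le> real K" by simp
      fix k assume "k \<in> {K..k0}"
      then show "d k \<le> real n powr \<gamma> * real k powr (- \<gamma> - 1) * r"
        unfolding d_def x_def r_def by (intro start_rate_deviation) (use assms in auto)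
    qed
    also have "(\<Sum>k\<in>{K..k0}. real n powr \<gamma> * real k powr (- \<gamma> - 1) * r) = real n powr \<gamma> * (\<Sum>k\<in>{K..k0}. real k powr (- \<gamma> - 1)) * r"
      by (simp add: sum_distrib_left sum_distrib_right)
    also have "\<dots> \<le> real n powr \<gamma> * ((2 / real K) powr \<gamma> / \<gamma>) * r"
      using r0 by (intro mult_right_mono mult_left_mono sum_powr_tail assms) auto
    also have "real n powr \<gamma> * ((2 / real K) powr \<gamma> / \<gamma>) = (2 * real n / real K) powr \<gamma> / \<gamma>"
      using assms by (simp add: powr_divide powr_mult)
    finally show "Ep (start n) D \<le> real K + (2 * real n / real K) powr \<gamma> / \<gamma> * (hit_rate_const * moment_const 1 / real K + sqrt (deviation_rate n k0 K))"
      unfolding r_def by simp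
  qed
  finally show ?thesis by simp
qed

end

section \<open>The characteristic function of the gamma distribution\<close>

lemma gamma_density_nonneg: "0 < s \<Longrightarrow> 0 \<le> gamma_density s 1 x"
  by (simp add: gamma_density_def Gamma_real_pos less_imp_le)

lemma gamma_density_measurable [measurable]: "gamma_density s 1 \<in> borel_measurable borel"
  unfolding gamma_density_def by measurable

lemma gamma_density_moment:
  assumes "0 < s" "0 < s + p"
  shows "has_bochner_integral lborel (\<lambda>x. gamma_density s 1 x * x powr p) (Gamma (s + p) / Gamma s)"
proof -
  have "has_bochner_integral lborel (\<lambda>x::real. indicator {0..} x * x powr (s + p - 1) / exp x) (Gamma (s + p))"
    using assms by (intro has_bochner_integral_nn_integral)
      (auto simp: Gamma_real_pos less_imp_le Gamma_conv_nn_integral_real[symmetric])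
  then have "has_bochner_integral lborel (\<lambda>x::real. indicator {0..} x * x powr (s + p - 1) / exp x / Gamma s) (Gamma (s + p) / Gamma s)"
    by (rule has_bochner_integral_divide_zero)
  moreover have "(\<lambda>x::real. indicator {0..} x * x powr (s + p - 1) / exp x / Gamma s) = (\<lambda>x. gamma_density s 1 x * x powr p)"
  proof
    fix x :: real
    show "indicator {0..} x * x powr (s + p - 1) / exp x / Gamma s = gamma_density s 1 x * x powr p"
      by (cases "x > 0"; cases "x = 0")
         (auto simp: gamma_density_def indicator_def exp_minus field_simps powr_add[symmetric] diff_add_eq)
  qed
  ultimately show ?thesis by simp
qed

lemma gamma_density_total:
  assumes "0 < s"
  shows "has_bochner_integral lborel (gamma_density s 1) 1"
proof -
  have "(\<lambda>x. gamma_density s 1 x * x powr 0) = gamma_density s 1"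
    by (auto simp: gamma_density_def fun_eq_iff)
  moreover have "Gamma s \<noteq> 0" using Gamma_real_pos[OF assms] by simp
  ultimately show ?thesis using gamma_density_moment[of s 0] assms by simp
qed

lemma gamma_density_pow:
  assumes "0 < s"
  shows "has_bochner_integral lborel (\<lambda>x. gamma_density s 1 x * x ^ j) (pochhammer s j)"
proof -
  have "(\<lambda>x. gamma_density s 1 x * x powr real j) = (\<lambda>x. gamma_density s 1 x * x ^ j)"
    by (auto simp: gamma_density_def fun_eq_iff powr_realpow)
  moreover have "Gamma (s + real j) / Gamma s = pochhammer s j"
    using assms by (subst pochhammer_Gamma) (auto dest: nonpos_Ints_nonpos)
  ultimately show ?thesis using gamma_density_moment[of s "real j"] assms by simp
qed

text \<open>
  Size-biasing a gamma variable raises its shape parameter by one.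
\<close>

lemma gamma_density_shift:
  assumes "0 < s"
  shows "x * gamma_density s 1 x = s * gamma_density (s + 1) 1 x"
proof -
  have "Gamma (s + 1) = s * Gamma s" using assms by (intro Gamma_plus1) auto
  then show ?thesis using assms
    by (simp add: gamma_density_def powr_diff field_simps)
qed

definition gcf :: "real \<Rightarrow> real \<Rightarrow> complex"
  where "gcf s t = (LINT x|lborel. gamma_density s 1 x *\<^sub>R iexp (t * x))"

lemma gamma_integrable_dominated:
  fixes g :: "real \<Rightarrow> complex"
  assumes "0 < s" "g \<in> borel_measurable borel" "\<And>x. x > 0 \<Longrightarrow> norm (g x) \<le> B * x ^ j"
  shows "integrable lborel (\<lambda>x. gamma_density s 1 x *\<^sub>R g x)"
proof (rule Bochner_Integration.integrable_bound)
  show "integrable lborel (\<lambda>x. B * (gamma_density s 1 x * x ^ j))"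
    using gamma_density_pow[OF assms(1), of j] by (auto simp: has_bochner_integral_iff)
  show "AE x in lborel. norm (gamma_density s 1 x *\<^sub>R g x) \<le> norm (B * (gamma_density s 1 x * x ^ j))"
  proof (rule AE_I2)
    fix x :: real
    show "norm (gamma_density s 1 x *\<^sub>R g x) \<le> norm (B * (gamma_density s 1 x * x ^ j))"
    proof (cases "x > 0")
      case True
      then have "gamma_density s 1 x * norm (g x) \<le> gamma_density s 1 x * (B * x ^ j)"
        using assms gamma_density_nonneg by (intro mult_left_mono) auto
      then show ?thesis using gamma_density_nonneg[OF assms(1), of x] by (simp add: mult_ac)
    qed (simp add: gamma_density_def)
  qed
qed (use assms(2) in simp)

lemma gamma_integral_bound:
  fixes g :: "real \<Rightarrow> complex"
  assumes "0 < s" "has_bochner_integral lborel (\<lambda>x. gamma_density s 1 x * h x) I"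
    and "\<And>x. x > 0 \<Longrightarrow> norm (g x) \<le> h x"
  shows "norm (LINT x|lborel. gamma_density s 1 x *\<^sub>R g x) \<le> I"
proof -
  have "norm (LINT x|lborel. gamma_density s 1 x *\<^sub>R g x) \<le> (LINT x|lborel. norm (gamma_density s 1 x *\<^sub>R g x))"
    by (rule integral_norm_bound)
  also have "\<dots> \<le> (LINT x|lborel. gamma_density s 1 x * h x)"
  proof (cases "integrable lborel (\<lambda>x. norm (gamma_density s 1 x *\<^sub>R g x))")
    case True
    then show ?thesis
    proof (rule integral_mono)
      show "integrable lborel (\<lambda>x. gamma_density s 1 x * h x)" using assms(2) by (rule integrable.intros)
      fix x :: real
      show "norm (gamma_density s 1 x *\<^sub>R g x) \<le> gamma_density s 1 x * h x"
      proof (cases "x > 0")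
        case True
        then show ?thesis using assms(3)[OF True] gamma_density_nonneg[OF assms(1), of x]
          by (simp add: mult_left_mono)
      qed (simp add: gamma_density_def)
    qed
  next
    case False
    have "0 \<le> (LINT x|lborel. gamma_density s 1 x * h x)"
    proof (rule Bochner_Integration.integral_nonneg)
      fix x :: real
      show "0 \<le> gamma_density s 1 x * h x"
      proof (cases "x > 0")
        case True
        have "0 \<le> norm (g x)" by simp
        also have "\<dots> \<le> h x" by (rule assms(3)[OF True])
        finally show ?thesis using gamma_density_nonneg[OF assms(1), of x] by simp
      qed (simp add: gamma_density_def)
    qed
    then show ?thesis using False by (simp add: not_integrable_integral_eq)
  qed
  also have "\<dots> = I" using assms(2) by (rule has_bochner_integral_integral_eq)
  finally show ?thesis .
qed

lemma iexp_measurable: "(\<lambda>x. iexp (t * x)) \<in> borel_measurable borel"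
  by (intro borel_measurable_continuous_onI continuous_intros)

lemma gcf_integrable: "0 < s \<Longrightarrow> integrable lborel (\<lambda>x. gamma_density s 1 x *\<^sub>R iexp (t * x))"
  by (rule gamma_integrable_dominated[where B = 1 and j = 0]) (auto intro: iexp_measurable)

lemma gcf_le_1: "0 < s \<Longrightarrow> norm (gcf s t) \<le> 1"
  unfolding gcf_def by (rule gamma_integral_bound[where h = "\<lambda>_. 1"]) (use gamma_density_total in auto)

text \<open>
  Integration by parts. Since the derivative of \<open>gcf s t\<close> in \<open>t\<close> is \<open>\<i> * s * gcf (s + 1) t\<close>, this identity says
  that an infinitesimal dilation of \<open>t\<close> has the same effect as adding a particle at rate \<open>s\<close>: the
  gamma distributions are the limit laws of the branching process in which each particle splits in two.
\<close>

lemma gcf_succ: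
  assumes "0 < s"
  shows "gcf (s + 1) t - gcf s t = \<i> * complex_of_real t * gcf (s + 1) t"
proof -
  define p where "p x = x powr (s - 1) * exp (- x) / Gamma s" for x :: real
  define q where "q x = x powr s * exp (- x) / Gamma (s + 1)" for x :: real
  define F where "F x = complex_of_real (q x) * iexp (t * x)" for x
  define f where "f x = complex_of_real (p x - q x) * iexp (t * x) + complex_of_real (q x) * (\<i> * complex_of_real t * iexp (t * x))" for x
  have "Gamma (s + 1) = s * Gamma s" using assms by (intro Gamma_plus1) auto
  then have G: "Gamma (s + 1) = s * Gamma s" "Gamma s > 0" using assms by (auto intro: Gamma_real_pos)
  have "Gamma (s + 1) > 0" using assms by (intro Gamma_real_pos) auto
  then have nz: "Gamma (s + 1) \<noteq> 0" "Gamma s \<noteq> 0" using G(2) by linarith+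
  have pd: "gamma_density s 1 x = p x" "gamma_density (s + 1) 1 x = q x" if "x > 0" for x
    using that by (simp_all add: gamma_density_def p_def q_def)
  have zero: "gamma_density s 1 x = 0" "gamma_density (s + 1) 1 x = 0" if "\<not> x > 0" for x
    using that by (simp_all add: gamma_density_def)
  have dq: "(q has_real_derivative (p x - q x)) (at x)" if "x > 0" for x
  proof -
    have "((\<lambda>x. x powr s * exp (- x)) has_real_derivative (s * x powr (s - 1) * exp (- x) - x powr s * exp (- x))) (at x)"
      using that by (auto intro!: derivative_eq_intros)
    then have "(q has_real_derivative ((s * x powr (s - 1) * exp (- x) - x powr s * exp (- x)) / Gamma (s + 1))) (at x)"
      unfolding q_def[abs_def] by (rule DERIV_cdivide)
    moreover have "(s * x powr (s - 1) * exp (- x) - x powr s * exp (- x)) / Gamma (s + 1) = p x - q x"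
      unfolding p_def q_def diff_divide_distrib G(1) using assms by simp
    ultimately show ?thesis by simp
  qed
  have dF: "(F has_vector_derivative f x) (at x)" if "x > 0" for x
  proof -
    have "((\<lambda>x. complex_of_real (q x)) has_vector_derivative complex_of_real (p x - q x)) (at x)"
      using dq[OF that] by (intro has_vector_derivative_of_real) (simp add: has_real_derivative_iff_has_vector_derivative)
    moreover have "((\<lambda>x. iexp (t * x)) has_vector_derivative \<i> * complex_of_real t * iexp (t * x)) (at x)"
      by (auto intro!: derivative_eq_intros has_vector_derivative_real_field simp: algebra_simps)
    ultimately show ?thesis unfolding F_def[abs_def] f_def
      by (rule derivative_eq_intros) (simp add: add.commute)
  qed
  have fi: "f x = gamma_density s 1 x *\<^sub>R iexp (t * x) - gamma_density (s + 1) 1 x *\<^sub>R iexp (t * x)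
      + \<i> * complex_of_real t * (gamma_density (s + 1) 1 x *\<^sub>R iexp (t * x))" if "x > 0" for x
    unfolding f_def pd[OF that] by (simp add: scaleR_conv_of_real algebra_simps)
  define h where "h x = gamma_density s 1 x *\<^sub>R iexp (t * x) - gamma_density (s + 1) 1 x *\<^sub>R iexp (t * x)
      + \<i> * complex_of_real t * (gamma_density (s + 1) 1 x *\<^sub>R iexp (t * x))" for x
  have hi: "integrable lborel h"
    unfolding h_def using assms
    by (intro Bochner_Integration.integrable_add Bochner_Integration.integrable_diff integrable_mult_right gcf_integrable) auto
  have ind: "indicator (einterval 0 \<infinity>) x *\<^sub>R f x = h x" for x
  proof (cases "x > 0")
    case True
    then show ?thesis using fi by (simp add: einterval_def h_def indicator_def)
  next
    case False
    then show ?thesis using zero[OF False] by (simp add: einterval_def h_def indicator_def)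
  qed
  have norm_F: "norm (F x) = \<bar>q x\<bar>" for x by (simp add: F_def norm_mult)
  have "(LBINT x=0..\<infinity>. f x) = 0 - 0"
  proof (rule interval_integral_FTC_integrable[where F = F])
    fix x assume "0 < ereal x" "ereal x < \<infinity>"
    then have x: "x > 0" by simp
    then show "(F has_vector_derivative f x) (at x)" by (rule dF)
    show "isCont f x" unfolding f_def p_def q_def using x nz
      by (intro continuous_intros) auto
  next
    show "set_integrable lborel (einterval 0 \<infinity>) f"
      unfolding set_integrable_def ind using hi by simp
    have "(q \<longlongrightarrow> 0) (at_right 0)"
    proof -
      have "((\<lambda>x. x powr s) \<longlongrightarrow> 0) (at_right 0)"
        using assms by real_asymp
      then have "((\<lambda>x. x powr s * exp (- x) / Gamma (s + 1)) \<longlongrightarrow> 0 * exp (- 0) / Gamma (s + 1)) (at_right 0)"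
        using nz by (intro tendsto_intros) auto
      then show ?thesis by (simp add: q_def[abs_def])
    qed
    then have "(F \<longlongrightarrow> 0) (at_right 0)"
      by (intro tendsto_norm_zero_cancel[of F]) (simp add: norm_F tendsto_rabs_zero)
    then show "((F \<circ> real_of_ereal) \<longlongrightarrow> 0) (at_right 0)"
      unfolding zero_ereal_def by (simp add: ereal_tendsto_simps)
    have "(q \<longlongrightarrow> 0) at_top"
    proof -
      have "((\<lambda>x::real. x powr s * exp (- x)) \<longlongrightarrow> 0) at_top" using assms by real_asymp
      then have "((\<lambda>x. x powr s * exp (- x) / Gamma (s + 1)) \<longlongrightarrow> 0 / Gamma (s + 1)) at_top"
        using nz by (intro tendsto_intros) auto
      then show ?thesis by (simp add: q_def[abs_def])
    qed
    then have "(F \<longlongrightarrow> 0) at_top"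
      by (intro tendsto_norm_zero_cancel[of F]) (simp add: norm_F tendsto_rabs_zero)
    then show "((F \<circ> real_of_ereal) \<longlongrightarrow> 0) (at_left \<infinity>)"
      by (simp add: ereal_tendsto_simps)
  qed simp
  then have "(LINT x|lborel. h x) = 0"
    by (simp add: interval_lebesgue_integral_def set_lebesgue_integral_def ind)
  moreover have "(LINT x|lborel. h x) = gcf s t - gcf (s + 1) t + \<i> * complex_of_real t * gcf (s + 1) t"
  proof -
    have lin: "(LINT x|lborel. A x - B x + z * D x) = (LINT x|lborel. A x) - (LINT x|lborel. B x) + z * (LINT x|lborel. D x)"
      if "integrable lborel A" "integrable lborel B" "integrable lborel D" for A B D :: "real \<Rightarrow> complex" and z
      using that by simp
    show ?thesis unfolding h_def gcf_def using assms
      by (intro lin gcf_integrable) auto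
  qed
  ultimately show ?thesis by (simp add: algebra_simps)
qed

text \<open>
  The first order term in \<open>d\<close> is rewritten by \<open>gcf_succ\<close>.
\<close>

lemma gcf_taylor:
  assumes "0 < s"
  shows "norm (gcf s ((1 + d) * t) - gcf s t - complex_of_real (d * s) * (gcf (s + 1) t - gcf s t))
    \<le> (d * t)\<^sup>2 * (s * (s + 1)) / 2"
proof -
  define g where "g x = iexp ((1 + d) * t * x) - iexp (t * x) - complex_of_real d * (\<i> * complex_of_real (t * x) * iexp (t * x))" for x
  have poch2: "pochhammer s 2 = s * (s + 1)" by (simp add: numeral_2_eq_2 pochhammer_Suc)
  have xi: "integrable lborel (\<lambda>x. gamma_density s 1 x *\<^sub>R (\<i> * complex_of_real (t * x) * iexp (t * x)))"
    by (rule gamma_integrable_dominated[where B = "\<bar>t\<bar>" and j = 1])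
       (use assms iexp_measurable in \<open>auto simp: norm_mult abs_mult\<close>)
  have "(LINT x|lborel. gamma_density s 1 x *\<^sub>R (\<i> * complex_of_real (t * x) * iexp (t * x)))
     = (LINT x|lborel. (\<i> * complex_of_real (t * s)) * (gamma_density (s + 1) 1 x *\<^sub>R iexp (t * x)))"
  proof (rule Bochner_Integration.integral_cong[OF refl])
    fix x :: real
    have "gamma_density s 1 x *\<^sub>R (\<i> * complex_of_real (t * x) * iexp (t * x))
      = (\<i> * complex_of_real t) * complex_of_real (x * gamma_density s 1 x) * iexp (t * x)"
      by (simp add: scaleR_conv_of_real)
    also have "\<dots> = (\<i> * complex_of_real (t * s)) * (gamma_density (s + 1) 1 x *\<^sub>R iexp (t * x))"
      unfolding gamma_density_shift[OF assms] by (simp add: scaleR_conv_of_real)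
    finally show "gamma_density s 1 x *\<^sub>R (\<i> * complex_of_real (t * x) * iexp (t * x)) = \<dots>" .
  qed
  also have "\<dots> = (\<i> * complex_of_real (t * s)) * gcf (s + 1) t"
    unfolding gcf_def by (rule integral_mult_right_zero)
  also have "\<dots> = complex_of_real s * (gcf (s + 1) t - gcf s t)"
    unfolding gcf_succ[OF assms] by simp
  finally have xI: "(LINT x|lborel. gamma_density s 1 x *\<^sub>R (\<i> * complex_of_real (t * x) * iexp (t * x)))
     = complex_of_real s * (gcf (s + 1) t - gcf s t)" .
  have "gcf s ((1 + d) * t) - gcf s t - complex_of_real (d * s) * (gcf (s + 1) t - gcf s t)
    = gcf s ((1 + d) * t) - gcf s t - complex_of_real d * (LINT x|lborel. gamma_density s 1 x *\<^sub>R (\<i> * complex_of_real (t * x) * iexp (t * x)))"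
    unfolding xI by simp
  also have "\<dots> = (LINT x|lborel. gamma_density s 1 x *\<^sub>R iexp ((1 + d) * t * x) - gamma_density s 1 x *\<^sub>R iexp (t * x)
     - complex_of_real d * (gamma_density s 1 x *\<^sub>R (\<i> * complex_of_real (t * x) * iexp (t * x))))"
  proof -
    have lin: "(LINT x|lborel. A x - B x - z * D x) = (LINT x|lborel. A x) - (LINT x|lborel. B x) - z * (LINT x|lborel. D x)"
      if "integrable lborel A" "integrable lborel B" "integrable lborel D" for A B D :: "real \<Rightarrow> complex" and z
      using that by simp
    show ?thesis unfolding gcf_def
      by (rule lin[symmetric]) (rule gcf_integrable[OF assms] xi)+
  qed
  also have "\<dots> = (LINT x|lborel. gamma_density s 1 x *\<^sub>R g x)"
    by (rule Bochner_Integration.integral_cong) (simp_all add: g_def scaleR_conv_of_real algebra_simps)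
  finally have eq: "gcf s ((1 + d) * t) - gcf s t - complex_of_real (d * s) * (gcf (s + 1) t - gcf s t)
     = (LINT x|lborel. gamma_density s 1 x *\<^sub>R g x)" .
  have "has_bochner_integral lborel (\<lambda>x. gamma_density s 1 x * x ^ 2 * ((d * t)\<^sup>2 / 2)) (pochhammer s 2 * ((d * t)\<^sup>2 / 2))"
    by (intro has_bochner_integral_mult_left gamma_density_pow assms)
  then have "norm (LINT x|lborel. gamma_density s 1 x *\<^sub>R g x) \<le> pochhammer s 2 * ((d * t)\<^sup>2 / 2)"
  proof (intro gamma_integral_bound[where h = "\<lambda>x. x ^ 2 * ((d * t)\<^sup>2 / 2)"] assms)
    fix x :: real
    define u where "u = d * t * x"
    have "iexp ((1 + d) * t * x) = iexp (t * x) * iexp u"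
      by (simp add: u_def exp_add[symmetric] algebra_simps)
    then have "g x = iexp (t * x) * (iexp u - (\<Sum>k \<le> 1. (\<i> * u)^k / fact k))"
      by (simp add: g_def u_def algebra_simps)
    then have "norm (g x) \<le> \<bar>u\<bar> ^ 2 / 2"
      using iexp_approx1[of u 1] by (simp add: norm_mult numeral_2_eq_2)
    then show "norm (g x) \<le> x ^ 2 * ((d * t)\<^sup>2 / 2)" by (simp add: u_def power_mult_distrib mult_ac)
  qed (simp add: mult.assoc)
  then show ?thesis unfolding eq poch2 by (simp add: mult_ac)
qed

lemma iexp_diff_le: "norm (iexp x - iexp y) \<le> \<bar>x - y\<bar>"
proof -
  have "iexp x - iexp y = iexp y * (iexp (x - y) - (\<Sum>k \<le> 0. (\<i> * (x - y))^k / fact k))"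
    by (simp add: algebra_simps exp_add[symmetric])
  then show ?thesis using iexp_approx1[of "x - y" 0] by (simp add: norm_mult)
qed

lemma gcf_lipschitz:
  assumes "0 < s"
  shows "norm (gcf s t - gcf s t') \<le> \<bar>t - t'\<bar> * s"
proof -
  have eq: "gcf s t - gcf s t' = (LINT x|lborel. gamma_density s 1 x *\<^sub>R (iexp (t * x) - iexp (t' * x)))"
    unfolding gcf_def using gcf_integrable[OF assms, of t] gcf_integrable[OF assms, of t']
    by (simp add: scaleR_diff_right)
  have "has_bochner_integral lborel (\<lambda>x. gamma_density s 1 x * x ^ 1 * \<bar>t - t'\<bar>) (pochhammer s 1 * \<bar>t - t'\<bar>)"
    by (intro has_bochner_integral_mult_left gamma_density_pow assms)
  then have "norm (gcf s t - gcf s t') \<le> pochhammer s 1 * \<bar>t - t'\<bar>"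
    unfolding eq
  proof (intro gamma_integral_bound[where h = "\<lambda>x. x ^ 1 * \<bar>t - t'\<bar>"] assms)
    fix x :: real assume "x > 0"
    then show "norm (iexp (t * x) - iexp (t' * x)) \<le> x ^ 1 * \<bar>t - t'\<bar>"
      using iexp_diff_le[of "t * x" "t' * x"] by (simp add: left_diff_distrib[symmetric] abs_mult mult.commute)
  qed (simp add: mult.assoc)
  then show ?thesis by (simp add: mult.commute)
qed

text \<open>
  A gamma variable with a large shape parameter \<open>s\<close> is close to \<open>s\<close>, with standard deviation \<open>sqrt s\<close>.
\<close>

lemma gcf_concentrated:
  assumes "0 < s"
  shows "norm (gcf s t - iexp (t * s)) \<le> \<bar>t\<bar> * sqrt s"
proof -
  have tot: "integrable lborel (gamma_density s 1)" "(LINT x|lborel. gamma_density s 1 x) = 1"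
    using gamma_density_total[OF assms] by (auto simp: has_bochner_integral_iff)
  have "(LINT x|lborel. gamma_density s 1 x *\<^sub>R iexp (t * s)) = iexp (t * s)"
    using tot by simp
  moreover have "integrable lborel (\<lambda>x. gamma_density s 1 x *\<^sub>R iexp (t * s))" using tot by simp
  ultimately have eq: "gcf s t - iexp (t * s) = (LINT x|lborel. gamma_density s 1 x *\<^sub>R (iexp (t * x) - iexp (t * s)))"
    unfolding gcf_def using gcf_integrable[OF assms, of t] by (simp add: scaleR_diff_right)
  define q where "q = sqrt s"
  have q: "q > 0" "q\<^sup>2 = s" using assms by (simp_all add: q_def)
  let ?h = "\<lambda>x. x ^ 2 * (1 / (2 * q)) + x ^ 1 * (- (s / q)) + x ^ 0 * (s\<^sup>2 / (2 * q) + q / 2)"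
  have "has_bochner_integral lborel (\<lambda>x. (gamma_density s 1 x * x ^ 2 * (1 / (2 * q)) + gamma_density s 1 x * x ^ 1 * (- (s / q))
      + gamma_density s 1 x * x ^ 0 * (s\<^sup>2 / (2 * q) + q / 2)) * \<bar>t\<bar>)
      ((pochhammer s 2 * (1 / (2 * q)) + pochhammer s 1 * (- (s / q)) + pochhammer s 0 * (s\<^sup>2 / (2 * q) + q / 2)) * \<bar>t\<bar>)"
    by (intro has_bochner_integral_mult_left has_bochner_integral_add gamma_density_pow assms)
  moreover have "pochhammer s 2 * (1 / (2 * q)) + pochhammer s 1 * (- (s / q)) + pochhammer s 0 * (s\<^sup>2 / (2 * q) + q / 2) = q"
  proof -
    have "pochhammer s 2 = s\<^sup>2 + s" by (simp add: numeral_2_eq_2 pochhammer_Suc algebra_simps)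
    then have "pochhammer s 2 * (1 / (2 * q)) + pochhammer s 1 * (- (s / q)) + pochhammer s 0 * (s\<^sup>2 / (2 * q) + q / 2)
       = s / (2 * q) + q / 2" using q by (simp add: field_simps power2_eq_square)
    also have "\<dots> = q" using q by (simp add: power2_eq_square flip: q(2))
    finally show ?thesis .
  qed
  moreover have "(\<lambda>x. (gamma_density s 1 x * x ^ 2 * (1 / (2 * q)) + gamma_density s 1 x * x ^ 1 * (- (s / q))
      + gamma_density s 1 x * x ^ 0 * (s\<^sup>2 / (2 * q) + q / 2)) * \<bar>t\<bar>) = (\<lambda>x. gamma_density s 1 x * (?h x * \<bar>t\<bar>))"
    by (rule ext) (simp add: algebra_simps)
  ultimately have "has_bochner_integral lborel (\<lambda>x. gamma_density s 1 x * (?h x * \<bar>t\<bar>)) (q * \<bar>t\<bar>)" by simp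
  then have "norm (gcf s t - iexp (t * s)) \<le> q * \<bar>t\<bar>"
    unfolding eq
  proof (rule gamma_integral_bound[OF assms])
    fix x :: real
    have "\<bar>x - s\<bar> \<le> ?h x"
    proof -
      have "0 \<le> (\<bar>x - s\<bar> - q)\<^sup>2 / (2 * q)" using q by simp
      also have "\<dots> = ?h x - \<bar>x - s\<bar>"
        using q by (simp add: power2_diff field_simps) (simp add: power2_eq_square algebra_simps)
      finally show ?thesis by simp
    qed
    then have "\<bar>t\<bar> * \<bar>x - s\<bar> \<le> \<bar>t\<bar> * ?h x" by (intro mult_left_mono) auto
    moreover have "norm (iexp (t * x) - iexp (t * s)) \<le> \<bar>t\<bar> * \<bar>x - s\<bar>"
      using iexp_diff_le[of "t * x" "t * s"] by (simp add: right_diff_distrib[symmetric] abs_mult)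
    ultimately show "norm (iexp (t * x) - iexp (t * s)) \<le> ?h x * \<bar>t\<bar>" by (simp add: mult.commute)
  qed
  then show ?thesis by (simp add: q_def mult.commute)
qed

section \<open>The branching phase\<close>

lemma powr_taylor2_small:
  fixes u e :: real
  assumes "0 \<le> u" "u \<le> 1"
  shows "\<bar>(1 + u) powr e - 1 - e * u\<bar> \<le> \<bar>e * (e - 1)\<bar> * 2 powr \<bar>e\<bar> * u\<^sup>2"
proof (cases "u = 0")
  case False
  then have u: "u > 0" using assms by simp
  have "\<exists>z>0. z < u \<and> (1 + u) powr e - (1 + 0) powr e = (u - 0) * (e * (1 + z) powr (e - 1))"
    by (rule MVT2) (use u in \<open>auto intro!: derivative_eq_intros\<close>)
  then obtain z where z: "0 < z" "z < u" "(1 + u) powr e - 1 = u * (e * (1 + z) powr (e - 1))" by auto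
  have "\<exists>y>0. y < z \<and> (1 + z) powr (e - 1) - (1 + 0) powr (e - 1) = (z - 0) * ((e - 1) * (1 + y) powr (e - 1 - 1))"
    by (rule MVT2) (use z in \<open>auto intro!: derivative_eq_intros\<close>)
  then obtain y where y: "0 < y" "y < z" "(1 + z) powr (e - 1) - 1 = z * ((e - 1) * (1 + y) powr (e - 2))" by auto
  have "(1 + u) powr e - 1 - e * u = u * e * ((1 + z) powr (e - 1) - 1)"
    unfolding z(3) by (simp add: algebra_simps)
  also have "\<dots> = (e * (e - 1)) * (1 + y) powr (e - 2) * (u * z)" unfolding y(3) by (simp add: algebra_simps)
  finally have eq: "\<bar>(1 + u) powr e - 1 - e * u\<bar> = \<bar>e * (e - 1)\<bar> * (1 + y) powr (e - 2) * (u * z)"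
    using u z by (simp add: abs_mult)
  have "(1 + y) powr (e - 2) \<le> (1 + y) powr \<bar>e\<bar>" using y by (intro powr_mono) auto
  also have "\<dots> \<le> 2 powr \<bar>e\<bar>" using y z assms by (intro powr_mono2) auto
  finally have "(1 + y) powr (e - 2) \<le> 2 powr \<bar>e\<bar>" .
  then show ?thesis unfolding eq power2_eq_square using u z by (intro mult_mono) auto
qed simp

context pa_parameters begin

definition rescale_const :: real where "rescale_const = 2 * \<gamma> + 4 * (\<bar>\<gamma> * (\<gamma> - 1)\<bar> * 2 powr \<gamma>)"

lemma rescale_const_nonneg: "0 \<le> rescale_const" by (simp add: rescale_const_def)

lemma scale_increment:
  assumes "k \<ge> 2"
  defines "d \<equiv> (real k / (real k - 1)) powr \<gamma> - 1"
  shows "\<bar>d - \<gamma> / real k\<bar> \<le> rescale_const / (real k)\<^sup>2" "\<bar>d\<bar> \<le> (\<gamma> + rescale_const) / real k"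
proof -
  have k: "real k \<ge> 2" using assms by simp
  define u where "u = 1 / (real k - 1)"
  have u: "0 \<le> u" "u \<le> 1" "u \<le> 2 / real k" using k by (simp_all add: u_def field_simps)
  have "real k / (real k - 1) = 1 + u" using k by (simp add: u_def field_simps)
  then have d: "d = (1 + u) powr \<gamma> - 1" by (simp add: d_def)
  have "\<bar>d - \<gamma> * u\<bar> \<le> \<bar>\<gamma> * (\<gamma> - 1)\<bar> * 2 powr \<gamma> * u\<^sup>2"
    using powr_taylor2_small[OF u(1,2), of \<gamma>] unfolding d by simp
  also have "\<dots> \<le> \<bar>\<gamma> * (\<gamma> - 1)\<bar> * 2 powr \<gamma> * (2 / real k)\<^sup>2"
    using u by (intro mult_left_mono power_mono) auto
  finally have 1: "\<bar>d - \<gamma> * u\<bar> \<le> 4 * (\<bar>\<gamma> * (\<gamma> - 1)\<bar> * 2 powr \<gamma>) / (real k)\<^sup>2"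
    by (simp add: power_divide mult_ac)
  have "\<gamma> * u - \<gamma> / real k = \<gamma> * (u / real k)" using k by (simp add: u_def divide_simps) (simp add: algebra_simps)
  also have "\<dots> \<le> \<gamma> * ((2 / real k) / real k)" using u by (intro mult_left_mono divide_right_mono) auto
  finally have 2: "\<gamma> * u - \<gamma> / real k \<le> 2 * \<gamma> / (real k)\<^sup>2" by (simp add: power2_eq_square mult.commute)
  have 3: "0 \<le> \<gamma> * u - \<gamma> / real k"
    unfolding \<open>\<gamma> * u - \<gamma> / real k = \<gamma> * (u / real k)\<close> using u by simp
  have "\<bar>d - \<gamma> / real k\<bar> \<le> \<bar>d - \<gamma> * u\<bar> + (\<gamma> * u - \<gamma> / real k)" using 3 by linarith
  also have "\<dots> \<le> 4 * (\<bar>\<gamma> * (\<gamma> - 1)\<bar> * 2 powr \<gamma>) / (real k)\<^sup>2 + 2 * \<gamma> / (real k)\<^sup>2" using 1 2 by linarith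
  finally show A: "\<bar>d - \<gamma> / real k\<bar> \<le> rescale_const / (real k)\<^sup>2" by (simp add: rescale_const_def add_divide_distrib)
  have "rescale_const / (real k)\<^sup>2 \<le> rescale_const / real k" using k rescale_const_nonneg by (intro divide_left_mono) (auto simp: power2_eq_square)
  moreover have "0 \<le> \<gamma> / real k" by simp
  ultimately show "\<bar>d\<bar> \<le> (\<gamma> + rescale_const) / real k" using A unfolding add_divide_distrib by linarith
qed

definition rescale :: "nat \<Rightarrow> nat \<Rightarrow> real"
  where "rescale n k = (real k / real n) powr \<gamma>"

text \<open>
  The characteristic function that the rescaled particle number would have in the end if \<open>y\<close> open edges at
  \<open>k\<close> behaved like independent branching particles.
\<close>

definition branching_char :: "real \<Rightarrow> nat \<Rightarrow> nat \<Rightarrow> nat \<Rightarrow> complex"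
  where "branching_char t n k y = (if y = 0 then 1 else gcf (particles y) (t * rescale n k))"

definition branching_step_const :: "real \<Rightarrow> real"
  where "branching_step_const t = 8 + 12 * real m + 2 * rescale_const + (\<gamma> + rescale_const)\<^sup>2 * t\<^sup>2"

lemma particles_pos: "y > 0 \<Longrightarrow> 0 < particles y"
  using m2 by (simp add: particles_def)

lemma particles_le: "particles y \<le> real y"
proof -
  have "real y / (real m - 1) \<le> real y / 1" using m2 by (intro divide_left_mono) auto
  then show ?thesis by (simp add: particles_def)
qed

lemma branching_char_le_1: "norm (branching_char t n k y) \<le> 1"
  unfolding branching_char_def using gcf_le_1[OF particles_pos] by simp

text \<open>
  The characteristic function is almost invariant under one step of the exploration. With probability close to
  \<open>\<gamma> / k\<close> times the number of particles one particle is added, and the dilation by \<open>(k / (k - 1)) powr \<gamma>\<close>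
  compensates for this by \<open>gcf_taylor\<close>. Multiple hits, and hits of a vertex with self-loops, have probability of order \<open>y\<^sup>2 / k\<^sup>2\<close>.
\<close>

lemma branching_step:
  assumes "k \<ge> 2" "k \<le> n"
  shows "norm (Ep (ker k y) (\<lambda>(j, y'). branching_char t n (k - 1) y') - branching_char t n k y)
    \<le> branching_step_const t * ((real y)\<^sup>2 / (real k)\<^sup>2)"
proof (cases "y = 0")
  case True
  have "Ep (ker k y) (\<lambda>(j, y'). branching_char t n (k - 1) y') = Ep (draws k y) (\<lambda>_. 1)"
    unfolding Ep_ker[OF assms(1)]
    by (rule Ep_cong) (use True in \<open>auto simp: move_def branching_char_def dest!: draws_le split: prod.splits\<close>)
  then show ?thesis using True by (simp add: branching_char_def)
next
  case False
  define s where "s = particles y"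
  define \<tau> where "\<tau> = t * rescale n (k - 1)"
  define G where "G = branching_char t n (k - 1)"
  define D where "D = G (y + (m - 1)) - G y"
  define d where "d = (real k / (real k - 1)) powr \<gamma> - 1"
  have k: "real k \<ge> 2" using assms by simp
  have y1: "real y \<ge> 1" using False by simp
  have yy: "real y \<le> (real y)\<^sup>2" using y1 by (simp add: power2_eq_square)
  have s: "s > 0" "s \<le> real y" using False particles_pos particles_le by (auto simp: s_def)
  have G1: "norm (G y') \<le> 1" for y' unfolding G_def by (rule branching_char_le_1)
  have D2: "norm D \<le> 2" unfolding D_def using norm_triangle_ineq4[of "G (y + (m - 1))" "G y"] G1[of y] G1[of "y + (m - 1)"] by linarith
  have GD: "G y = gcf s \<tau>" "D = gcf (s + 1) \<tau> - gcf s \<tau>"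
    unfolding D_def G_def branching_char_def s_def \<tau>_def particles_step using False by simp_all
  have tk: "t * rescale n k = (1 + d) * \<tau>"
  proof -
    have "real (k - 1) = real k - 1" using k by simp
    then have "(real k / (real k - 1)) powr \<gamma> * rescale n (k - 1) = rescale n k"
      using k assms by (simp add: rescale_def powr_divide)
    then show ?thesis by (simp add: d_def \<tau>_def mult_ac)
  qed
  have mk: "branching_char t n k y = gcf s ((1 + d) * \<tau>)"
    using False by (simp add: branching_char_def s_def tk)
  define Ez where "Ez = Ep (draws k y) (\<lambda>(l, z). real z)"
  \<comment> \<open>At most one open edge points to \<open>k\<close> up to an error of order \<open>y\<^sup>2 / k\<^sup>2\<close>, and then exactly one particle is added.\<close>
  have "Ep (ker k y) (\<lambda>(j, y'). G y') - G y - complex_of_real Ez * D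
     = Ep (draws k y) (\<lambda>(l, z). G (snd (move y (l, z))) - G y - complex_of_real (real z) * D)"
    unfolding Ez_def Ep_ker[OF assms(1)]
    by (simp add: case_prod_unfold integrable_measure_pmf_finite del: of_real_of_nat_eq)
  also have "norm \<dots> \<le> Ep (draws k y) (\<lambda>x. norm (case x of (l, z) \<Rightarrow> G (snd (move y (l, z))) - G y - complex_of_real (real z) * D))"
    by (rule Ep_norm_le)
  also have "\<dots> \<le> Ep (draws k y) (\<lambda>x. 4 * (case x of (l, z) \<Rightarrow> real z * (real z - 1)) + 4 * (case x of (l, z) \<Rightarrow> real l * real z))"
  proof (rule Ep_mono[OF finite_draws], clarify)
    fix l z assume lz: "(l, z) \<in> set_pmf (draws k y)"
    note b = draws_le[OF lz]
    consider "z = 0" | "z = 1" "l = 0" | "z = 1" "l \<ge> 1" | "z \<ge> 2" by linarith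
    then show "norm (G (snd (move y (l, z))) - G y - complex_of_real (real z) * D) \<le> 4 * (real z * (real z - 1)) + 4 * (real l * real z)"
    proof cases
      case 1
      then show ?thesis by (simp add: move_def)
    next
      case 2
      then have "y - 1 + m = y + (m - 1)" using b m2 by simp
      then show ?thesis using 2 by (simp add: move_def D_def)
    next
      case 3
      have "norm (G (snd (move y (l, z))) - G y - complex_of_real (real z) * D) \<le> norm (G (snd (move y (l, z)))) + norm (G y) + norm D"
        using 3 norm_triangle_ineq4[of "G (snd (move y (l, z))) - G y" D] norm_triangle_ineq4[of "G (snd (move y (l, z)))" "G y"] by simp
      also have "\<dots> \<le> 4" using G1[of "snd (move y (l, z))"] G1[of y] D2 by linarith
      finally show ?thesis using 3 by simp
    next
      case 4
      have "norm (G (snd (move y (l, z))) - G y - complex_of_real (real z) * D) \<le> norm (G (snd (move y (l, z)))) + norm (G y) + real z * norm D"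
        using norm_triangle_ineq4[of "G (snd (move y (l, z))) - G y" "complex_of_real (real z) * D"]
          norm_triangle_ineq4[of "G (snd (move y (l, z)))" "G y"] by (simp add: norm_mult)
      also have "\<dots> \<le> 2 + real z * 2"
        using G1[of "snd (move y (l, z))"] G1[of y] mult_left_mono[OF D2, of "real z"] by simp
      also have "\<dots> \<le> 4 * (real z * (real z - 1))"
      proof -
        have "real z \<ge> 2" using 4 by simp
        then have 1: "2 * (real z - 1) \<le> real z * (real z - 1)" by (intro mult_right_mono) auto
        have "2 + x * 2 \<le> 4 * q" if "2 * (x - 1) \<le> q" "2 \<le> x" for x q :: real using that by argo
        from this[OF 1 \<open>real z \<ge> 2\<close>] show ?thesis .
      qed
      finally show ?thesis by (simp add: add_increasing2)
    qed
  qed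
  also have "\<dots> = 4 * Ep (draws k y) (\<lambda>(l, z). real z * (real z - 1)) + 4 * Ep (draws k y) (\<lambda>(l, z). real l * real z)"
    by (simp add: integrable_measure_pmf_finite)
  also have "\<dots> \<le> 4 * (2 * (real y)\<^sup>2 / (real k)\<^sup>2) + 4 * (2 * real m * real y / (real k)\<^sup>2)"
    by (intro add_mono mult_left_mono draws_factorial_moment draws_loop_moment assms) auto
  also have "\<dots> \<le> 4 * (2 * (real y)\<^sup>2 / (real k)\<^sup>2) + 4 * (2 * real m * (real y)\<^sup>2 / (real k)\<^sup>2)"
    using yy by (intro add_mono mult_left_mono divide_right_mono) auto
  finally have e1: "norm (Ep (ker k y) (\<lambda>(j, y'). G y') - G y - complex_of_real Ez * D) \<le> (8 + 8 * real m) * ((real y)\<^sup>2 / (real k)\<^sup>2)"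
    by (simp add: algebra_simps)
  \<comment> \<open>The expected number of open edges into \<open>k\<close> agrees with the rate at which the time scale moves.\<close>
  have sg: "real y * \<alpha> / (real k * c) = s * \<gamma> / real k"
    using m2 by (simp add: s_def particles_def \<gamma>_def)
  have "\<bar>Ez - d * s\<bar> \<le> \<bar>Ez - real y * \<alpha> / (real k * c)\<bar> + \<bar>d - \<gamma> / real k\<bar> * s"
  proof -
    have "Ez - d * s = (Ez - real y * \<alpha> / (real k * c)) - (d - \<gamma> / real k) * s"
      unfolding sg by (simp add: algebra_simps)
    then have "\<bar>Ez - d * s\<bar> \<le> \<bar>Ez - real y * \<alpha> / (real k * c)\<bar> + \<bar>(d - \<gamma> / real k) * s\<bar>"
      by (simp only: abs_triangle_ineq4)
    then show ?thesis using s by (simp add: abs_mult)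
  qed
  also have "\<dots> \<le> 2 * real m * real y / (real k)\<^sup>2 + rescale_const / (real k)\<^sup>2 * real y"
    using draws_mean_error[OF assms(1), of y] scale_increment(1)[OF assms(1)] s rescale_const_nonneg
    unfolding Ez_def d_def by (intro add_mono mult_mono) auto
  also have "\<dots> = (2 * real m + rescale_const) * (real y / (real k)\<^sup>2)" by (simp add: add_divide_distrib algebra_simps)
  also have "\<dots> \<le> (2 * real m + rescale_const) * ((real y)\<^sup>2 / (real k)\<^sup>2)"
    using yy rescale_const_nonneg by (intro mult_left_mono divide_right_mono) auto
  finally have "\<bar>Ez - d * s\<bar> * norm D \<le> (2 * real m + rescale_const) * ((real y)\<^sup>2 / (real k)\<^sup>2) * 2"
    using D2 rescale_const_nonneg by (intro mult_mono) auto
  then have e2: "norm (complex_of_real Ez * D - complex_of_real (d * s) * D) \<le> (4 * real m + 2 * rescale_const) * ((real y)\<^sup>2 / (real k)\<^sup>2)"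
  proof -
    have "complex_of_real Ez * D - complex_of_real (d * s) * D = complex_of_real (Ez - d * s) * D"
      by (simp add: left_diff_distrib)
    then have "norm (complex_of_real Ez * D - complex_of_real (d * s) * D) = \<bar>Ez - d * s\<bar> * norm D"
      by (simp only: norm_mult norm_of_real)
    moreover have "(2 * real m + rescale_const) * ((real y)\<^sup>2 / (real k)\<^sup>2) * 2 = (4 * real m + 2 * rescale_const) * ((real y)\<^sup>2 / (real k)\<^sup>2)"
      by (simp only: distrib_right mult_ac) (simp add: algebra_simps)
    ultimately show ?thesis using \<open>\<bar>Ez - d * s\<bar> * norm D \<le> (2 * real m + rescale_const) * ((real y)\<^sup>2 / (real k)\<^sup>2) * 2\<close> by (simp only:)
  qed
  \<comment> \<open>The change of the time scale is compensated to first order by the added particle.\<close>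
  have "norm (gcf s ((1 + d) * \<tau>) - gcf s \<tau> - complex_of_real (d * s) * D) \<le> (d * \<tau>)\<^sup>2 * (s * (s + 1)) / 2"
    unfolding GD by (rule gcf_taylor[OF s(1)])
  also have "\<dots> \<le> (((\<gamma> + rescale_const) / real k)\<^sup>2 * t\<^sup>2) * (2 * (real y)\<^sup>2) / 2"
  proof (rule divide_right_mono[OF mult_mono])
    have "\<bar>d\<bar> \<le> (\<gamma> + rescale_const) / real k" unfolding d_def by (rule scale_increment(2)[OF assms(1)])
    then have d2: "d\<^sup>2 \<le> ((\<gamma> + rescale_const) / real k)\<^sup>2" using abs_le_square_iff[of d "(\<gamma> + rescale_const) / real k"] rescale_const_nonneg by simp
    have "rescale n (k - 1) \<le> 1" unfolding rescale_def using assms by (intro powr_le1) auto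
    then have "\<tau>\<^sup>2 \<le> t\<^sup>2" unfolding \<tau>_def power_mult_distrib
      by (intro mult_left_le power_le_one) (auto simp: rescale_def)
    then show "(d * \<tau>)\<^sup>2 \<le> ((\<gamma> + rescale_const) / real k)\<^sup>2 * t\<^sup>2"
      unfolding power_mult_distrib[of d] using d2 by (intro mult_mono) auto
    have "1 \<le> real y" using y1 by simp
    then have "s + 1 \<le> real y + real y" using s(2) by argo
    then have "s * (s + 1) \<le> real y * (real y + real y)" using s by (intro mult_mono) auto
    then show "s * (s + 1) \<le> 2 * (real y)\<^sup>2" by (simp add: power2_eq_square)
  qed (use s in auto)
  also have "\<dots> = ((\<gamma> + rescale_const)\<^sup>2 * t\<^sup>2) * ((real y)\<^sup>2 / (real k)\<^sup>2)" by (simp add: power_divide)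
  finally have e3: "norm (gcf s ((1 + d) * \<tau>) - gcf s \<tau> - complex_of_real (d * s) * D) \<le> \<dots>" .
  have "Ep (ker k y) (\<lambda>(j, y'). G y') - branching_char t n k y
    = (Ep (ker k y) (\<lambda>(j, y'). G y') - G y - complex_of_real Ez * D)
    + (complex_of_real Ez * D - complex_of_real (d * s) * D)
    - (gcf s ((1 + d) * \<tau>) - gcf s \<tau> - complex_of_real (d * s) * D)"
    unfolding mk GD(1) by simp
  also have "norm \<dots> \<le> norm (Ep (ker k y) (\<lambda>(j, y'). G y') - G y - complex_of_real Ez * D)
    + norm (complex_of_real Ez * D - complex_of_real (d * s) * D)
    + norm (gcf s ((1 + d) * \<tau>) - gcf s \<tau> - complex_of_real (d * s) * D)"
    by (intro order_trans[OF norm_triangle_ineq4] add_right_mono norm_triangle_ineq)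
  also have "\<dots> \<le> (8 + 8 * real m) * ((real y)\<^sup>2 / (real k)\<^sup>2) + (4 * real m + 2 * rescale_const) * ((real y)\<^sup>2 / (real k)\<^sup>2)
     + ((\<gamma> + rescale_const)\<^sup>2 * t\<^sup>2) * ((real y)\<^sup>2 / (real k)\<^sup>2)"
    by (intro add_mono e1 e2 e3)
  also have "\<dots> = branching_step_const t * ((real y)\<^sup>2 / (real k)\<^sup>2)" by (simp add: branching_step_const_def algebra_simps)
  finally show ?thesis unfolding G_def .
qed

lemma branching_step_const_nonneg: "0 \<le> branching_step_const t"
  unfolding branching_step_const_def using rescale_const_nonneg by (intro add_nonneg_nonneg) auto

text \<open>
  The errors of the single steps add up, because each of them is an average over the rest of the chain.
\<close>

lemma branching_chain:
  assumes "1 \<le> k" "k \<le> N" "N \<le> n"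
  shows "norm (Ep (chain N y) (\<lambda>w. branching_char t n k (snd (w k))) - branching_char t n N y)
    \<le> branching_step_const t * (\<Sum>i\<in>{k<..N}. Ep (chain N y) (\<lambda>w. (real (snd (w i)))\<^sup>2) / (real i)\<^sup>2)"
  using assms(2,3)
proof (induction N arbitrary: y rule: dec_induct)
  case base
  obtain q where q: "k = Suc q" using assms(1) by (cases k) auto
  have "Ep (chain k y) (\<lambda>w. branching_char t n k (snd (w k))) = branching_char t n k y"
    unfolding q by (subst Ep_chain_Suc) (simp add: case_prod_unfold del: chain.simps)
  then show ?case by simp
next
  case (step N)
  let ?G = "branching_char t n"
  let ?S = "\<lambda>y'. \<Sum>i\<in>{k<..N}. Ep (chain N y') (\<lambda>w. (real (snd (w i)))\<^sup>2) / (real i)\<^sup>2"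
  have N: "Suc N \<ge> 2" "Suc N \<le> n" using step assms by auto
  have split: "Ep (chain (Suc N) y) (\<lambda>w. ?G k (snd (w k))) - ?G (Suc N) y
    = Ep (ker (Suc N) y) (\<lambda>(j, y'). Ep (chain N y') (\<lambda>w. ?G k (snd (w k))) - ?G N y')
      + (Ep (ker (Suc N) y) (\<lambda>(j, y'). ?G N y') - ?G (Suc N) y)"
    using step.hyps by (subst Ep_chain_Suc) (simp add: case_prod_unfold integrable_measure_pmf_finite del: chain.simps)
  have "norm (Ep (chain (Suc N) y) (\<lambda>w. ?G k (snd (w k))) - ?G (Suc N) y)
      \<le> norm (Ep (ker (Suc N) y) (\<lambda>(j, y'). Ep (chain N y') (\<lambda>w. ?G k (snd (w k))) - ?G N y'))
      + norm (Ep (ker (Suc N) y) (\<lambda>(j, y'). ?G N y') - ?G (Suc N) y)"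
    unfolding split by (rule norm_triangle_ineq)
  also have "\<dots> \<le> Ep (ker (Suc N) y) (\<lambda>(j, y'). branching_step_const t * ?S y') + branching_step_const t * ((real y)\<^sup>2 / (real (Suc N))\<^sup>2)"
  proof (intro add_mono)
    have "norm (Ep (ker (Suc N) y) (\<lambda>(j, y'). Ep (chain N y') (\<lambda>w. ?G k (snd (w k))) - ?G N y'))
      \<le> Ep (ker (Suc N) y) (\<lambda>x. norm (case x of (j, y') \<Rightarrow> Ep (chain N y') (\<lambda>w. ?G k (snd (w k))) - ?G N y'))"
      by (rule Ep_norm_le)
    also have "\<dots> \<le> Ep (ker (Suc N) y) (\<lambda>(j, y'). branching_step_const t * ?S y')"
      using step.IH N(2) by (intro Ep_mono finite_ker) (auto split: prod.splits)
    finally show "norm (Ep (ker (Suc N) y) (\<lambda>(j, y'). Ep (chain N y') (\<lambda>w. ?G k (snd (w k))) - ?G N y'))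
      \<le> Ep (ker (Suc N) y) (\<lambda>(j, y'). branching_step_const t * ?S y')" .
    show "norm (Ep (ker (Suc N) y) (\<lambda>(j, y'). ?G N y') - ?G (Suc N) y) \<le> branching_step_const t * ((real y)\<^sup>2 / (real (Suc N))\<^sup>2)"
      using branching_step[OF N, of y t] by simp
  qed
  finally have bound: "norm (Ep (chain (Suc N) y) (\<lambda>w. ?G k (snd (w k))) - ?G (Suc N) y)
      \<le> Ep (ker (Suc N) y) (\<lambda>(j, y'). branching_step_const t * ?S y') + branching_step_const t * ((real y)\<^sup>2 / (real (Suc N))\<^sup>2)" .
  have "Ep (ker (Suc N) y) (\<lambda>(j, y'). branching_step_const t * ?S y')
     = branching_step_const t * (\<Sum>i\<in>{k<..N}. Ep (ker (Suc N) y) (\<lambda>(j, y'). Ep (chain N y') (\<lambda>w. (real (snd (w i)))\<^sup>2)) / (real i)\<^sup>2)"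
    by (simp add: case_prod_unfold integrable_measure_pmf_finite)
  also have "(\<Sum>i\<in>{k<..N}. Ep (ker (Suc N) y) (\<lambda>(j, y'). Ep (chain N y') (\<lambda>w. (real (snd (w i)))\<^sup>2)) / (real i)\<^sup>2)
    = (\<Sum>i\<in>{k<..N}. Ep (chain (Suc N) y) (\<lambda>w. (real (snd (w i)))\<^sup>2) / (real i)\<^sup>2)"
    using step.hyps by (intro sum.cong refl, subst Ep_chain_Suc) (simp_all add: case_prod_unfold del: chain.simps)
  finally have earlier: "Ep (ker (Suc N) y) (\<lambda>(j, y'). branching_step_const t * ?S y') = branching_step_const t * (\<Sum>i\<in>{k<..N}. Ep (chain (Suc N) y) (\<lambda>w. (real (snd (w i)))\<^sup>2) / (real i)\<^sup>2)" .
  have last: "Ep (chain (Suc N) y) (\<lambda>w. (real (snd (w (Suc N))))\<^sup>2) = (real y)\<^sup>2"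
    using step.hyps by (subst Ep_chain_Suc) (simp_all add: case_prod_unfold del: chain.simps)
  have set: "{k<..Suc N} = insert (Suc N) {k<..N}" using step.hyps by auto
  have "(\<Sum>i\<in>{k<..Suc N}. Ep (chain (Suc N) y) (\<lambda>w. (real (snd (w i)))\<^sup>2) / (real i)\<^sup>2)
      = (real y)\<^sup>2 / (real (Suc N))\<^sup>2 + (\<Sum>i\<in>{k<..N}. Ep (chain (Suc N) y) (\<lambda>w. (real (snd (w i)))\<^sup>2) / (real i)\<^sup>2)"
    unfolding set last[symmetric] by (simp del: chain.simps of_nat_Suc)
  then show ?case using bound unfolding earlier by (simp only: distrib_left add.commute)
qed

definition branching_const :: "real \<Rightarrow> real"
  where "branching_const t = branching_step_const t * (real m * H\<^sup>2 * (real m)\<^sup>2)"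

lemma start_branching:
  assumes "1 \<le> k" "k \<le> n - 1"
  shows "norm (Ep (start n) (\<lambda>w. branching_char t n k (snd (w k))) - gcf (particles m) t)
    \<le> branching_const t * ((real n / real k) powr (2 * \<gamma>) / real k)
      + 4 * real m / real n + \<bar>t\<bar> * (1 - rescale n (n - 1)) * particles m"
proof -
  have n: "n \<ge> 2" "real n > 0" "real k > 0" using assms by auto
  let ?N = "n - 1"
  have one: "norm (Ep (chain ?N y) (\<lambda>w. branching_char t n k (snd (w k))) - branching_char t n ?N y)
    \<le> branching_const t * ((real n / real k) powr (2 * \<gamma>) / real k)" if y: "y \<le> m" for y
  proof -
    let ?g = "(real n / real k) powr (2 * \<gamma>)"
    have "norm (Ep (chain ?N y) (\<lambda>w. branching_char t n k (snd (w k))) - branching_char t n ?N y)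
      \<le> branching_step_const t * (\<Sum>i\<in>{k<..?N}. Ep (chain ?N y) (\<lambda>w. (real (snd (w i)))\<^sup>2) / (real i)\<^sup>2)"
      using assms by (intro branching_chain) auto
    also have "\<dots> \<le> branching_step_const t * (\<Sum>i\<in>{k<..?N}. (real m * H\<^sup>2 * (real m)\<^sup>2 * ?g) * (1 / (real i)\<^sup>2))"
    proof (intro mult_left_mono sum_mono branching_step_const_nonneg)
      fix i assume i: "i \<in> {k<..?N}"
      have "Ep (chain ?N y) (\<lambda>w. (real (snd (w i)))\<^sup>2) \<le> real m * (growth i ?N)\<^sup>2 * (real y)\<^sup>2"
        using i assms by (intro chain_mean_square) auto
      also have "\<dots> \<le> real m * (H\<^sup>2 * ?g) * (real m)\<^sup>2"
      proof (intro mult_mono mult_left_mono)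
        have "growth i ?N \<le> H * (real n / real i) powr \<gamma>" using i by (intro growth_start) auto
        also have "\<dots> \<le> H * (real n / real k) powr \<gamma>"
          using i n H_ge1 by (intro mult_left_mono powr_mono2 divide_left_mono) auto
        finally have "(growth i ?N)\<^sup>2 \<le> (H * (real n / real k) powr \<gamma>)\<^sup>2"
          using growth_ge1[of i ?N] by (intro power_mono) auto
        also have "\<dots> = H\<^sup>2 * ?g" by (simp add: power_mult_distrib power2_eq_square powr_add[symmetric])
        finally show "(growth i ?N)\<^sup>2 \<le> H\<^sup>2 * ?g" .
        show "(real y)\<^sup>2 \<le> (real m)\<^sup>2" using y by (intro power_mono) auto
      qed auto
      finally have "Ep (chain ?N y) (\<lambda>w. (real (snd (w i)))\<^sup>2) \<le> real m * H\<^sup>2 * (real m)\<^sup>2 * ?g" by (simp add: mult_ac)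
      then show "Ep (chain ?N y) (\<lambda>w. (real (snd (w i)))\<^sup>2) / (real i)\<^sup>2 \<le> (real m * H\<^sup>2 * (real m)\<^sup>2 * ?g) * (1 / (real i)\<^sup>2)"
        by (simp add: divide_right_mono)
    qed
    also have "\<dots> = branching_step_const t * ((real m * H\<^sup>2 * (real m)\<^sup>2 * ?g) * (\<Sum>i\<in>{k<..?N}. 1 / (real i)\<^sup>2))"
      by (simp only: sum_distrib_left)
    also have "\<dots> \<le> branching_step_const t * ((real m * H\<^sup>2 * (real m)\<^sup>2 * ?g) * (1 / real k))"
      by (intro mult_left_mono branching_step_const_nonneg sum_inverse_squares assms) auto
    finally show ?thesis by (simp add: branching_const_def mult_ac)
  qed
  have two: "norm (branching_char t n ?N (m - l) - gcf (particles m) t) \<le> 2 * real l + \<bar>t\<bar> * (1 - rescale n ?N) * particles m" for l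
  proof (cases "l = 0")
    case True
    have p: "particles m > 0" by (rule particles_pos) simp
    have sc: "rescale n ?N \<le> 1" unfolding rescale_def using n by (intro powr_le1) auto
    have "norm (gcf (particles m) (t * rescale n ?N) - gcf (particles m) t) \<le> \<bar>t * rescale n ?N - t\<bar> * particles m"
      by (rule gcf_lipschitz[OF p])
    also have "\<bar>t * rescale n ?N - t\<bar> = \<bar>t\<bar> * (1 - rescale n ?N)"
    proof -
      have "t * rescale n ?N - t = - (t * (1 - rescale n ?N))" by (simp add: algebra_simps)
      then show ?thesis using sc by (simp add: abs_mult)
    qed
    finally show ?thesis using True m2 by (simp add: branching_char_def)
  next
    case False
    have p: "particles m > 0" by (rule particles_pos) simp
    have sc: "rescale n ?N \<le> 1" unfolding rescale_def using n by (intro powr_le1) auto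
    have "norm (branching_char t n ?N (m - l) - gcf (particles m) t) \<le> 1 + 1"
      by (rule order_trans[OF norm_triangle_ineq4]) (intro add_mono branching_char_le_1 gcf_le_1 p)
    also have "\<dots> \<le> 2 * real l" using False by simp
    finally show ?thesis using sc p by (simp add: add_increasing2)
  qed
  let ?B = "branching_const t * ((real n / real k) powr (2 * \<gamma>) / real k)"
  have split: "Ep (start n) (\<lambda>w. branching_char t n k (snd (w k))) - gcf (particles m) t
     = Ep (loops n) (\<lambda>l. Ep (chain ?N (m - l)) (\<lambda>w. branching_char t n k (snd (w k))) - gcf (particles m) t)"
    unfolding start_def Ep_bind[OF finite_loops finite_chain]
    by (simp add: integrable_measure_pmf_finite del: chain.simps)
  have "norm (Ep (start n) (\<lambda>w. branching_char t n k (snd (w k))) - gcf (particles m) t) \<le> Ep (loops n) (\<lambda>l. norm (Ep (chain ?N (m - l)) (\<lambda>w. branching_char t n k (snd (w k))) - gcf (particles m) t))"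
    unfolding split by (rule Ep_norm_le)
  also have "\<dots> \<le> Ep (loops n) (\<lambda>l. (?B + \<bar>t\<bar> * (1 - rescale n ?N) * particles m) + 2 * real l)"
  proof (rule Ep_mono[OF finite_loops])
    fix l
    have "norm (Ep (chain ?N (m - l)) (\<lambda>w. branching_char t n k (snd (w k))) - gcf (particles m) t)
      \<le> norm (Ep (chain ?N (m - l)) (\<lambda>w. branching_char t n k (snd (w k))) - branching_char t n ?N (m - l))
        + norm (branching_char t n ?N (m - l) - gcf (particles m) t)"
      by (rule order_trans[OF _ norm_triangle_ineq]) simp
    then show "norm (Ep (chain ?N (m - l)) (\<lambda>w. branching_char t n k (snd (w k))) - gcf (particles m) t)
      \<le> (?B + \<bar>t\<bar> * (1 - rescale n ?N) * particles m) + 2 * real l"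
      using one[of "m - l"] two[of l] by simp
  qed
  also have "\<dots> = (?B + \<bar>t\<bar> * (1 - rescale n ?N) * particles m) + 2 * Ep (loops n) real"
    by (simp add: integrable_measure_pmf_finite)
  also have "\<dots> \<le> (?B + \<bar>t\<bar> * (1 - rescale n ?N) * particles m) + 2 * (2 * real m / real n)"
    using loops_mean[OF n(1)] by (intro add_left_mono mult_left_mono) auto
  finally show ?thesis by (simp add: algebra_simps)
qed

text \<open>
  The number of particles at \<open>k\<close>, rescaled by its growth. In the limit it has the gamma law whose shape
  parameter \<open>m / (m - 1)\<close> is the initial number of particles.
\<close>

definition limit_var :: "nat \<Rightarrow> nat \<Rightarrow> (nat \<Rightarrow> bool \<times> nat) \<Rightarrow> real"
  where "limit_var n k w = rescale n k * particles (snd (w k))"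

lemma start_particles_mean:
  assumes "1 \<le> k" "k \<le> n - 1"
  shows "Ep (start n) (\<lambda>w. particles (snd (w k))) \<le> moment_const 1 * (real n / real k) powr \<gamma>"
proof -
  have "Ep (start n) (\<lambda>w. particles (snd (w k))) \<le> Ep (start n) (\<lambda>w. real (snd (w k)) ^ 1)"
    using particles_le by (intro Ep_mono finite_start) auto
  also have "\<dots> \<le> moment_const 1 * ((real n / real k) powr \<gamma>) ^ 1" by (rule start_moment[OF assms])
  finally show ?thesis by simp
qed

text \<open>
  At the end of the first phase \<open>branching_char\<close> belongs to a gamma law with a large shape parameter, so it is
  close to the exponential of the particle number itself.
\<close>

lemma limit_var_char:
  assumes "1 \<le> k" "k \<le> n - 1"
  shows "norm (Ep (start n) (\<lambda>w. iexp (t * limit_var n k w)) - gcf (particles m) t)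
    \<le> branching_const t * ((real n / real k) powr (2 * \<gamma>) / real k)
      + 4 * real m / real n + \<bar>t\<bar> * (1 - rescale n (n - 1)) * particles m
      + \<bar>t\<bar> * sqrt (moment_const 1 * rescale n k)"
proof -
  have n: "real n > 0" "real k > 0" using assms by auto
  have sc: "rescale n k \<ge> 0" by (simp add: rescale_def)
  have gs: "(real n / real k) powr \<gamma> * rescale n k = 1"
    using n by (simp add: rescale_def powr_divide)
  have pt: "norm (iexp (t * limit_var n k w) - branching_char t n k (snd (w k))) \<le> \<bar>t\<bar> * rescale n k * \<bar>sqrt (particles (snd (w k)))\<bar>" for w
  proof (cases "snd (w k) = 0")
    case True
    then show ?thesis using sc by (simp add: limit_var_def branching_char_def particles_def)
  next
    case False
    then have p: "0 < particles (snd (w k))" by (intro particles_pos) auto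
    have "norm (gcf (particles (snd (w k))) (t * rescale n k) - iexp (t * rescale n k * particles (snd (w k)))) \<le> \<bar>t * rescale n k\<bar> * sqrt (particles (snd (w k)))"
      by (rule gcf_concentrated[OF p])
    then show ?thesis using False sc p
      by (simp add: branching_char_def limit_var_def norm_minus_commute abs_mult mult_ac)
  qed
  have split: "Ep (start n) (\<lambda>w. iexp (t * limit_var n k w)) - gcf (particles m) t
    = Ep (start n) (\<lambda>w. iexp (t * limit_var n k w) - branching_char t n k (snd (w k)))
     + (Ep (start n) (\<lambda>w. branching_char t n k (snd (w k))) - gcf (particles m) t)"
    by (simp add: integrable_measure_pmf_finite)
  have tri: "norm (Ep (start n) (\<lambda>w. iexp (t * limit_var n k w)) - gcf (particles m) t)
     \<le> norm (Ep (start n) (\<lambda>w. iexp (t * limit_var n k w) - branching_char t n k (snd (w k))))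
     + norm (Ep (start n) (\<lambda>w. branching_char t n k (snd (w k))) - gcf (particles m) t)"
    unfolding split by (rule norm_triangle_ineq)
  have "norm (Ep (start n) (\<lambda>w. iexp (t * limit_var n k w) - branching_char t n k (snd (w k)))) \<le> \<bar>t\<bar> * sqrt (moment_const 1 * rescale n k)"
  proof -
    have "norm (Ep (start n) (\<lambda>w. iexp (t * limit_var n k w) - branching_char t n k (snd (w k))))
      \<le> Ep (start n) (\<lambda>w. norm (iexp (t * limit_var n k w) - branching_char t n k (snd (w k))))" by (rule Ep_norm_le)
    also have "\<dots> \<le> Ep (start n) (\<lambda>w. \<bar>t\<bar> * rescale n k * \<bar>sqrt (particles (snd (w k)))\<bar>)"
      using pt by (intro Ep_mono finite_start)
    also have "\<dots> = \<bar>t\<bar> * rescale n k * Ep (start n) (\<lambda>w. \<bar>sqrt (particles (snd (w k)))\<bar>)" by simp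
    also have "\<dots> \<le> \<bar>t\<bar> * rescale n k * sqrt (Ep (start n) (\<lambda>w. (sqrt (particles (snd (w k))))\<^sup>2))"
      using sc by (intro mult_left_mono Ep_abs_le_sqrt finite_start) auto
    also have "\<dots> \<le> \<bar>t\<bar> * rescale n k * sqrt (moment_const 1 * (real n / real k) powr \<gamma>)"
      using sc start_particles_mean[OF assms] by (intro mult_left_mono real_sqrt_le_mono) auto
    also have "\<dots> = \<bar>t\<bar> * sqrt (moment_const 1 * rescale n k)"
    proof -
      have "rescale n k * sqrt (moment_const 1 * (real n / real k) powr \<gamma>) = sqrt ((rescale n k)\<^sup>2 * (moment_const 1 * (real n / real k) powr \<gamma>))"
        using sc by (simp add: real_sqrt_mult)
      also have "(rescale n k)\<^sup>2 * (moment_const 1 * (real n / real k) powr \<gamma>) = moment_const 1 * rescale n k * ((real n / real k) powr \<gamma> * rescale n k)"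
        by (simp add: power2_eq_square mult_ac)
      finally show ?thesis unfolding gs by (simp add: mult.assoc)
    qed
    finally show ?thesis .
  qed
  then show ?thesis using tri start_branching[OF assms, of t] by simp
qed

end

section \<open>The sum of the fluid hitting rates\<close>

lemma nn_integral_power_tail:
  fixes \<kappa> b :: real
  assumes "0 < \<kappa>" "0 < b" "b \<le> 1"
  shows "(\<integral>\<^sup>+v. ennreal (\<kappa> * v powr (\<kappa> - 1)) * indicator {b..1} v \<partial>lborel) = ennreal (1 - b powr \<kappa>)"
proof -
  have "(\<integral>\<^sup>+v. ennreal (\<kappa> * v powr (\<kappa> - 1)) * indicator {b..1} v \<partial>lborel) = ennreal (1 powr \<kappa> - b powr \<kappa>)"
    using assms by (intro nn_integral_FTC_Icc) (auto intro!: derivative_eq_intros)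
  then show ?thesis by simp
qed

text \<open>
  For \<open>V\<close> with density \<open>power_density \<kappa>\<close>, the fluid hitting rate at \<open>k\<close> is the probability that
  \<open>x powr (1 / \<beta>) * odds_power (1 / \<beta>) V\<close> is at least \<open>k\<close>.
\<close>

definition odds_power :: "real \<Rightarrow> real \<Rightarrow> real"
  where "odds_power \<sigma> v = (v / (1 - v)) powr \<sigma>"

definition power_density :: "real \<Rightarrow> real \<Rightarrow> real"
  where "power_density \<kappa> v = \<kappa> * v powr (\<kappa> - 1) * indicator {0<..<1} v"

lemma power_density_measurable [measurable]: "power_density \<kappa> \<in> borel_measurable borel"
  unfolding power_density_def by measurable

lemma odds_power_measurable [measurable]: "odds_power \<sigma> \<in> borel_measurable borel"
  unfolding odds_power_def by measurable

lemma le_powr_inverse_iff: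
  fixes z k \<beta> :: real
  assumes "0 < z" "0 < k" "0 < \<beta>"
  shows "k \<le> z powr (1 / \<beta>) \<longleftrightarrow> k powr \<beta> \<le> z"
proof
  assume "k \<le> z powr (1 / \<beta>)"
  then have "k powr \<beta> \<le> (z powr (1 / \<beta>)) powr \<beta>" using assms by (intro powr_mono2) auto
  then show "k powr \<beta> \<le> z" using assms by (simp add: powr_powr)
next
  assume "k powr \<beta> \<le> z"
  then have "(k powr \<beta>) powr (1 / \<beta>) \<le> z powr (1 / \<beta>)" using assms by (intro powr_mono2) auto
  then show "k \<le> z powr (1 / \<beta>)" using assms by (simp add: powr_powr)
qed

text \<open>
  The event is equivalent to \<open>V \<ge> b\<close> with \<open>b = 1 / (1 + x * k powr (- \<beta>))\<close>, whose probability is \<open>1 - b powr \<kappa>\<close>.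
\<close>

lemma odds_tail_probability:
  fixes \<kappa> \<beta> x k :: real
  assumes "0 < \<kappa>" "0 < \<beta>" "0 < x" "0 < k"
  shows "(\<integral>\<^sup>+v. ennreal (power_density \<kappa> v) * indicator {v. k \<le> x powr (1 / \<beta>) * odds_power (1 / \<beta>) v} v \<partial>lborel)
    = ennreal (1 - (1 + x * k powr (- \<beta>)) powr (- \<kappa>))"
proof -
  define b where "b = k powr \<beta> / (k powr \<beta> + x)"
  have kb: "k powr \<beta> > 0" using assms by simp
  have b: "0 < b" "b \<le> 1" using kb assms add_pos_pos[OF kb assms(3)] by (auto simp: b_def)
  have iff: "k \<le> x powr (1 / \<beta>) * odds_power (1 / \<beta>) v \<longleftrightarrow> b \<le> v" if v: "0 < v" "v < 1" for v
  proof -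
    have "x powr (1 / \<beta>) * odds_power (1 / \<beta>) v = (x * (v / (1 - v))) powr (1 / \<beta>)"
      using v assms unfolding odds_power_def by (subst powr_mult) auto
    then have "k \<le> x powr (1 / \<beta>) * odds_power (1 / \<beta>) v \<longleftrightarrow> k powr \<beta> \<le> x * (v / (1 - v))"
      using le_powr_inverse_iff[of "x * (v / (1 - v))" k \<beta>] v assms by simp
    also have "\<dots> \<longleftrightarrow> k powr \<beta> * (1 - v) \<le> x * v" using v by (simp add: pos_le_divide_eq)
    also have "\<dots> \<longleftrightarrow> k powr \<beta> \<le> v * (k powr \<beta> + x)" by (simp add: algebra_simps)
    also have "\<dots> \<longleftrightarrow> b \<le> v" using add_pos_pos[OF kb assms(3)] unfolding b_def by (subst pos_divide_le_eq) auto
    finally show ?thesis .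
  qed
  have "(\<integral>\<^sup>+v. ennreal (power_density \<kappa> v) * indicator {v. k \<le> x powr (1 / \<beta>) * odds_power (1 / \<beta>) v} v \<partial>lborel)
     = (\<integral>\<^sup>+v. ennreal (\<kappa> * v powr (\<kappa> - 1)) * indicator {b..1} v \<partial>lborel)"
  proof (rule nn_integral_cong_AE)
    have pw: "ennreal (power_density \<kappa> v) * indicator {v. k \<le> x powr (1 / \<beta>) * odds_power (1 / \<beta>) v} v
      = ennreal (\<kappa> * v powr (\<kappa> - 1)) * indicator {b..1} v" if "v \<noteq> 1" for v
    proof (cases "0 < v \<and> v < 1")
      case True
      then have "k \<le> x powr (1 / \<beta>) * odds_power (1 / \<beta>) v \<longleftrightarrow> v \<in> {b..1}" using iff[of v] by simp
      then show ?thesis using True by (cases "v \<in> {b..1}") (simp_all add: power_density_def)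
    next
      case False
      then have "v \<notin> {b..1}" "v \<notin> {0<..<1}" using b(1) that by auto
      then show ?thesis by (simp add: power_density_def)
    qed
    show "AE v in lborel. ennreal (power_density \<kappa> v) * indicator {v. k \<le> x powr (1 / \<beta>) * odds_power (1 / \<beta>) v} v
      = ennreal (\<kappa> * v powr (\<kappa> - 1)) * indicator {b..1} v"
      using AE_lborel_singleton[of "1::real"] by (rule eventually_mono) (rule pw)
  qed
  also have "\<dots> = ennreal (1 - b powr \<kappa>)" by (rule nn_integral_power_tail[OF assms(1) b])
  also have "b powr \<kappa> = (1 + x * k powr (- \<beta>)) powr (- \<kappa>)"
  proof -
    have "1 + x * k powr (- \<beta>) = inverse b" using kb assms by (simp add: b_def powr_minus field_simps)
    then show ?thesis using b by (simp add: powr_minus inverse_powr)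
  qed
  finally show ?thesis .
qed

lemma nn_integral_Beta:
  fixes \<kappa> a b :: real
  assumes "0 < \<kappa>" "0 < a" "0 < b"
  shows "(\<integral>\<^sup>+v. indicator {0..1} v * (\<kappa> * (v powr (a - 1) * (1 - v) powr (b - 1))) \<partial>lborel) = ennreal (\<kappa> * Beta a b)"
proof (rule nn_integral_has_integral_lborel)
  have "((\<lambda>v. \<kappa> * (v powr (a - 1) * (1 - v) powr (b - 1))) has_integral \<kappa> * Beta a b) {0..1}"
    using assms by (intro has_integral_mult_right has_integral_Beta_real) auto
  then have "((\<lambda>v. if v \<in> {0..1} then \<kappa> * (v powr (a - 1) * (1 - v) powr (b - 1)) else 0) has_integral \<kappa> * Beta a b) UNIV"
    by (simp only: has_integral_restrict_UNIV)
  moreover have "(\<lambda>v. if v \<in> {0..1} then \<kappa> * (v powr (a - 1) * (1 - v) powr (b - 1)) else 0)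
    = (\<lambda>v. indicator {0..1} v * (\<kappa> * (v powr (a - 1) * (1 - v) powr (b - 1))))"
    by (auto simp: fun_eq_iff indicator_def)
  ultimately show "((\<lambda>v. indicator {0..1} v * (\<kappa> * (v powr (a - 1) * (1 - v) powr (b - 1)))) has_integral \<kappa> * Beta a b) UNIV"
    by (simp only:)
qed (use assms in auto)

lemma nn_integral_odds_power:
  fixes \<kappa> \<sigma> :: real
  assumes "0 < \<kappa>" "0 < \<sigma>" "\<sigma> < 1"
  shows "(\<integral>\<^sup>+v. ennreal (power_density \<kappa> v) * ennreal (odds_power \<sigma> v) \<partial>lborel)
    = ennreal (Gamma (1 - \<sigma>) * Gamma (\<kappa> + \<sigma>) / Gamma \<kappa>)"
proof -
  have "(\<integral>\<^sup>+v. indicator {0..1} v * (\<kappa> * (v powr (\<kappa> + \<sigma> - 1) * (1 - v) powr (1 - \<sigma> - 1))) \<partial>lborel) = ennreal (\<kappa> * Beta (\<kappa> + \<sigma>) (1 - \<sigma>))"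
    using assms by (intro nn_integral_Beta) auto
  moreover have "\<kappa> * Beta (\<kappa> + \<sigma>) (1 - \<sigma>) = Gamma (1 - \<sigma>) * Gamma (\<kappa> + \<sigma>) / Gamma \<kappa>"
  proof -
    have "Gamma (\<kappa> + 1) = \<kappa> * Gamma \<kappa>" using assms by (intro Gamma_plus1) (auto simp: nonpos_Ints_def)
    moreover have "Gamma \<kappa> > 0" using assms by (intro Gamma_real_pos)
    ultimately show ?thesis using assms by (simp add: Beta_def field_simps)
  qed
  moreover have "indicator {0..1} v * (\<kappa> * (v powr (\<kappa> + \<sigma> - 1) * (1 - v) powr (1 - \<sigma> - 1))) = power_density \<kappa> v * odds_power \<sigma> v" for v :: real
  proof (cases "0 < v \<and> v < 1")
    case True
    then have "odds_power \<sigma> v = v powr \<sigma> * (1 - v) powr (- \<sigma>)"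
      unfolding odds_power_def by (subst powr_divide) (auto simp: powr_minus field_simps)
    moreover have "v powr (\<kappa> + \<sigma> - 1) = v powr (\<kappa> - 1) * v powr \<sigma>"
      by (simp add: powr_add[symmetric] algebra_simps)
    ultimately show ?thesis using True by (simp add: power_density_def)
  next
    case False
    then show ?thesis by (cases "v = 0 \<or> v = 1") (auto simp: power_density_def indicator_def)
  qed
  moreover have "ennreal (power_density \<kappa> v) * ennreal (odds_power \<sigma> v) = ennreal (power_density \<kappa> v * odds_power \<sigma> v)" for v
    by (rule ennreal_mult'[symmetric]) (use assms in \<open>auto simp: power_density_def\<close>)
  ultimately show ?thesis by (simp only:)
qed

lemma count_le_real:
  fixes z :: real
  assumes "0 \<le> z"
  shows "(\<Sum>k. indicator {k. real (Suc k) \<le> z} k :: ennreal) = ennreal (real (nat \<lfloor>z\<rfloor>))"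
proof -
  have "(\<Sum>k. indicator {k. real (Suc k) \<le> z} k :: ennreal) = (\<Sum>k<nat \<lfloor>z\<rfloor>. indicator {k. real (Suc k) \<le> z} k)"
      proof (intro suminf_finite)
    fix k assume "k \<notin> {..<nat \<lfloor>z\<rfloor>}"
    then have "\<not> real (Suc k) \<le> z" using assms by (simp, linarith)
    then show "indicator {k. real (Suc k) \<le> z} k = (0 :: ennreal)" by simp
  qed simp
  also have "\<dots> = (\<Sum>k<nat \<lfloor>z\<rfloor>. 1 :: ennreal)"
    using assms by (intro sum.cong refl) (auto simp: indicator_def, linarith)
  finally show ?thesis by (simp add: ennreal_of_nat_eq_real_of_nat)
qed

text \<open>
  By the tail formula, the series of the hitting rates is the expectation of the integer part of a random
  variable, which differs from the expectation of the variable by at most one; the latter is a Beta integral.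
\<close>

lemma rate_series_comparison:
  fixes \<kappa> \<beta> x :: real
  assumes "0 < \<kappa>" "1 < \<beta>" "0 < x"
  defines "\<sigma> \<equiv> 1 / \<beta>"
  defines "A \<equiv> x powr \<sigma> * (Gamma (1 - \<sigma>) * Gamma (\<kappa> + \<sigma>) / Gamma \<kappa>)"
  defines "S \<equiv> (\<Sum>k. ennreal (1 - (1 + x * real (Suc k) powr (- \<beta>)) powr (- \<kappa>)))"
  shows "S \<le> ennreal A" "ennreal A \<le> S + 1"
proof -
  have \<sigma>: "0 < \<sigma>" "\<sigma> < 1" using assms(2) by (auto simp: \<sigma>_def)
  define a where "a = x powr \<sigma>"
  have a: "0 \<le> a" by (simp add: a_def)
  have ods: "0 \<le> odds_power \<sigma> v" for v by (simp add: odds_power_def)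
  define Z where "Z v = a * odds_power \<sigma> v" for v
  have Z0: "0 \<le> Z v" for v using a ods by (simp add: Z_def)
  have [measurable]: "Z \<in> borel_measurable borel" unfolding Z_def by measurable
  have "S = (\<Sum>k. \<integral>\<^sup>+v. ennreal (power_density \<kappa> v) * indicator {v. real (Suc k) \<le> Z v} v \<partial>lborel)"
    unfolding S_def Z_def a_def \<sigma>_def
    by (intro suminf_cong odds_tail_probability[symmetric]) (use assms in auto)
  also have "\<dots> = (\<integral>\<^sup>+v. (\<Sum>k. ennreal (power_density \<kappa> v) * indicator {v. real (Suc k) \<le> Z v} v) \<partial>lborel)"
    by (intro nn_integral_suminf[symmetric]) measurable
  also have "\<dots> = (\<integral>\<^sup>+v. ennreal (power_density \<kappa> v) * ennreal (real (nat \<lfloor>Z v\<rfloor>)) \<partial>lborel)"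
  proof (intro nn_integral_cong)
    fix v
    have "(\<Sum>k. ennreal (power_density \<kappa> v) * indicator {v. real (Suc k) \<le> Z v} v)
      = ennreal (power_density \<kappa> v) * (\<Sum>k. indicator {k. real (Suc k) \<le> Z v} k)"
      by (subst ennreal_suminf_cmult[symmetric]) (simp add: indicator_def)
    then show "(\<Sum>k. ennreal (power_density \<kappa> v) * indicator {v. real (Suc k) \<le> Z v} v)
      = ennreal (power_density \<kappa> v) * ennreal (real (nat \<lfloor>Z v\<rfloor>))"
      unfolding count_le_real[OF Z0] .
  qed
  finally have S: "S = (\<integral>\<^sup>+v. ennreal (power_density \<kappa> v) * ennreal (real (nat \<lfloor>Z v\<rfloor>)) \<partial>lborel)" .
  have A: "ennreal A = (\<integral>\<^sup>+v. ennreal (power_density \<kappa> v) * ennreal (Z v) \<partial>lborel)"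
  proof -
    have "ennreal A = ennreal a * (\<integral>\<^sup>+v. ennreal (power_density \<kappa> v) * ennreal (odds_power \<sigma> v) \<partial>lborel)"
      unfolding nn_integral_odds_power[OF assms(1) \<sigma>] A_def a_def
      by (rule ennreal_mult') simp
    also have "\<dots> = (\<integral>\<^sup>+v. ennreal a * (ennreal (power_density \<kappa> v) * ennreal (odds_power \<sigma> v)) \<partial>lborel)"
      by (intro nn_integral_cmult[symmetric]) measurable
    finally show ?thesis unfolding Z_def ennreal_mult'[OF a] by (simp only: mult.left_commute)
  qed
  show "S \<le> ennreal A" unfolding S A
  proof (intro nn_integral_mono mult_left_mono ennreal_leI)
    fix v show "real (nat \<lfloor>Z v\<rfloor>) \<le> Z v" using Z0[of v] by (simp add: of_nat_floor)
  qed auto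
  have "ennreal A \<le> (\<integral>\<^sup>+v. ennreal (power_density \<kappa> v) * ennreal (real (nat \<lfloor>Z v\<rfloor>)) + ennreal (power_density \<kappa> v) \<partial>lborel)"
    unfolding A
  proof (intro nn_integral_mono)
    fix v
    have "Z v \<le> real (nat \<lfloor>Z v\<rfloor>) + 1" using Z0[of v] by linarith
    then have "ennreal (Z v) \<le> ennreal (real (nat \<lfloor>Z v\<rfloor>)) + 1"
      by (metis ennreal_1 ennreal_leI ennreal_plus of_nat_0_le_iff zero_le_one)
    then have "ennreal (power_density \<kappa> v) * ennreal (Z v) \<le> ennreal (power_density \<kappa> v) * (ennreal (real (nat \<lfloor>Z v\<rfloor>)) + 1)"
      by (rule mult_left_mono) simp
    then show "ennreal (power_density \<kappa> v) * ennreal (Z v)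
      \<le> ennreal (power_density \<kappa> v) * ennreal (real (nat \<lfloor>Z v\<rfloor>)) + ennreal (power_density \<kappa> v)"
      by (simp add: distrib_left)
  qed
  also have "\<dots> = S + (\<integral>\<^sup>+v. ennreal (power_density \<kappa> v) \<partial>lborel)"
    unfolding S by (rule nn_integral_add) auto
  also have "(\<integral>\<^sup>+v. ennreal (power_density \<kappa> v) \<partial>lborel) \<le> 1"
  proof -
    have "(\<integral>\<^sup>+v. indicator {0..1} v * (\<kappa> * (v powr (\<kappa> - 1) * (1 - v) powr (1 - 1))) \<partial>lborel) = ennreal (\<kappa> * Beta \<kappa> 1)"
      using assms(1) by (intro nn_integral_Beta) auto
    moreover have "\<kappa> * Beta \<kappa> 1 = 1"
    proof -
      have "Gamma (\<kappa> + 1) = \<kappa> * Gamma \<kappa>" using assms(1) by (intro Gamma_plus1) (auto simp: nonpos_Ints_def)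
      moreover have "Gamma \<kappa> \<noteq> 0" using Gamma_real_pos[OF assms(1)] by (metis less_irrefl)
      ultimately show ?thesis using assms(1) by (simp add: Beta_def)
    qed
    moreover have "(\<integral>\<^sup>+v. ennreal (power_density \<kappa> v) \<partial>lborel)
      \<le> (\<integral>\<^sup>+v. indicator {0..1} v * (\<kappa> * (v powr (\<kappa> - 1) * (1 - v) powr (1 - 1))) \<partial>lborel)"
      using assms(1) by (intro nn_integral_mono ennreal_leI) (auto simp: power_density_def indicator_def)
    ultimately show ?thesis by simp
  qed
  finally show "ennreal A \<le> S + 1" by (simp add: add_left_mono)
qed

context pa_parameters begin

text \<open>
  The value \<open>\<kappa> * Beta (\<kappa> + 1 - \<nu>) \<nu>\<close>, written with Gamma functions.
\<close>

definition hitting_scale :: real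
  where "hitting_scale = Gamma \<nu> * Gamma (\<kappa> + (1 - \<nu>)) / Gamma \<kappa>"

definition tail_const :: real where "tail_const = 2 powr \<gamma> / \<gamma>"

lemma fluid_rate_le:
  assumes "0 \<le> x"
  shows "fluid_rate x s \<le> x * s powr (- \<beta>)"
proof -
  define u where "u = x * s powr (- \<beta>)"
  have u: "0 \<le> u" using assms by (simp add: u_def)
  have "1 - u \<le> 1 / (1 + u)" using u by (simp add: field_simps)
  also have "\<dots> = (1 + u) powr (- 1)" using u by (simp add: powr_minus_divide)
  also have "\<dots> \<le> (1 + u) powr (- \<kappa>)" using u kappa_bounds by (intro powr_mono) auto
  finally show ?thesis unfolding fluid_rate_def u_def by simp
qed

text \<open>
  The fluid sum is the beginning of the series; its tail is bounded by \<open>fluid_rate_le\<close>.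
\<close>

lemma fluid_sum_asymptotic:
  fixes y :: nat
  assumes "1 \<le> k"
  defines "x \<equiv> fluid_const k y"
  shows "\<bar>fluid_sum k y - hitting_scale * x powr (1 - \<nu>)\<bar> \<le> 1 + tail_const * (x * real k powr (- \<gamma>))"
proof (cases "y = 0")
  case True
  then show ?thesis by (simp add: fluid_sum_def x_def fluid_const_def fluid_rate_def)
next
  case False
  have x: "0 < x" using False assms alpha_pos c_pos by (simp add: x_def fluid_const_def)
  define f where "f i = fluid_rate x (real (Suc i))" for i
  have f0: "0 \<le> f i" for i using x by (simp add: f_def fluid_rate_bounds)
  define A where "A = hitting_scale * x powr (1 - \<nu>)"
  define S where "S = (\<Sum>i. ennreal (f i))"
  define T where "T = tail_const * (x * real k powr (- \<gamma>))"
  have \<sigma>: "1 / \<beta> = 1 - \<nu>" 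
  proof -
    have "(1 - \<nu>) * \<beta> = 1" using gamma_nu unfolding \<beta>_def by (simp add: algebra_simps)
    then show ?thesis using beta_gt1 by (simp add: field_simps)
  qed
  have A: "A = x powr (1 / \<beta>) * (Gamma (1 - 1 / \<beta>) * Gamma (\<kappa> + 1 / \<beta>) / Gamma \<kappa>)"
    unfolding A_def hitting_scale_def \<sigma> by simp
  have SA: "S \<le> ennreal A" "ennreal A \<le> S + 1"
    using rate_series_comparison[OF kappa_bounds(1) beta_gt1 x] unfolding A S_def f_def fluid_rate_def by simp_all
  have fs: "fluid_sum k y = (\<Sum>i<k. f i)"
    unfolding fluid_sum_def f_def x_def by (rule sum.reindex_bij_witness[of _ Suc "\<lambda>i. i - 1"]) auto
  have fs0: "0 \<le> fluid_sum k y" unfolding fs by (intro sum_nonneg f0)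
  have "0 < \<kappa> + 1 / \<beta>" using kappa_bounds beta_gt1 by (intro add_pos_pos) auto
  then have A0: "0 \<le> A" unfolding A using kappa_bounds beta_gt1
    by (intro mult_nonneg_nonneg divide_nonneg_nonneg Gamma_real_nonneg) auto
  have T0: "0 \<le> T" using x gamma_pos by (simp add: T_def tail_const_def)
  have "ennreal (fluid_sum k y) = (\<Sum>i<k. ennreal (f i))" unfolding fs by (simp add: sum_ennreal f0)
  also have "\<dots> \<le> S" unfolding S_def by (intro sum_le_suminf) auto
  finally have up: "fluid_sum k y \<le> A" using SA(1) A0 by (metis ennreal_le_iff order_trans)
  have part: "(\<Sum>i<n. f i) \<le> fluid_sum k y + T" for n
  proof -
    have "(\<Sum>i<n. f i) \<le> (\<Sum>i\<in>{..<k} \<union> {k..<n}. f i)" using f0 by (intro sum_mono2) auto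
    also have "\<dots> = fluid_sum k y + (\<Sum>i\<in>{k..<n}. f i)" unfolding fs by (intro sum.union_disjoint) auto
    also have "(\<Sum>i\<in>{k..<n}. f i) \<le> (\<Sum>i\<in>{k..<n}. x * real (Suc i) powr (- \<gamma> - 1))"
    proof (intro sum_mono)
      fix i
      have e: "- \<gamma> - 1 = - \<beta>" by (simp add: \<beta>_def)
      show "f i \<le> x * real (Suc i) powr (- \<gamma> - 1)" unfolding f_def e by (rule fluid_rate_le) (use x in simp)
    qed
    also have "\<dots> = x * (\<Sum>i\<in>{k..<n}. real (Suc i) powr (- \<gamma> - 1))" by (simp add: sum_distrib_left)
    also have "(\<Sum>i\<in>{k..<n}. real (Suc i) powr (- \<gamma> - 1)) = (\<Sum>i\<in>{Suc k..n}. real i powr (- \<gamma> - 1))"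
      by (rule sum.reindex_bij_witness[of _ "\<lambda>i. i - 1" Suc]) auto
    also have "x * \<dots> \<le> x * ((2 / real (Suc k)) powr \<gamma> / \<gamma>)"
      using x assms by (intro mult_left_mono sum_powr_tail) auto
    also have "\<dots> \<le> x * ((2 / real k) powr \<gamma> / \<gamma>)"
      using x assms gamma_pos by (intro mult_left_mono divide_right_mono powr_mono2 divide_left_mono) auto
    also have "\<dots> = T" using assms unfolding T_def tail_const_def
      by (simp add: powr_divide powr_minus_divide mult_ac)
    finally show ?thesis by simp
  qed
  have "S \<le> ennreal (fluid_sum k y + T)" unfolding S_def
  proof (intro suminf_le_const)
    fix n
    have "(\<Sum>i<n. ennreal (f i)) = ennreal (\<Sum>i<n. f i)" by (simp add: sum_ennreal f0)
    then show "(\<Sum>i<n. ennreal (f i)) \<le> ennreal (fluid_sum k y + T)" using part[of n] by (simp add: ennreal_leI)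
  qed simp
  then have "ennreal A \<le> ennreal (fluid_sum k y + T) + 1" using SA(2) by (meson add_right_mono order_trans)
  also have "\<dots> = ennreal (fluid_sum k y + T + 1)" using fs0 T0 by simp
  finally have "ennreal A \<le> ennreal (fluid_sum k y + T + 1)" .
  moreover have "0 \<le> fluid_sum k y + T + 1" using fs0 T0 by linarith
  ultimately have "A \<le> fluid_sum k y + T + 1" by (simp only: ennreal_le_iff)
  then show ?thesis using up T0 unfolding A_def[symmetric] T_def[symmetric] by linarith
qed

end

section \<open>The limit variable at the cut between the two phases\<close>

context pa_parameters begin

text \<open>
  The first phase ends at \<open>cut n\<close>. The exponent has to exceed \<open>\<nu>\<close>, so that few vertices above are hit, and
  \<open>2 * \<gamma> / (1 + 2 * \<gamma>)\<close>, so that the branching approximation holds. The vertices below \<open>low_cut n\<close> are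
  negligible; \<open>\<delta>\<close> is small enough for the deviation from the fluid limit to be controlled above it.
\<close>

definition cut :: "nat \<Rightarrow> nat" where "cut n = nat \<lceil>real n powr ((1 + \<nu>) / 2)\<rceil>"

definition \<delta> :: real where "\<delta> = \<nu> / (8 * \<beta>)"

definition low_cut :: "nat \<Rightarrow> nat" where "low_cut n = nat \<lceil>real n powr (\<nu> - \<delta>)\<rceil> + 2"

definition limit_scale :: real
  where "limit_scale = hitting_scale * ((\<alpha> + 1) * (real m - 1) / c) powr (1 - \<nu>)"

lemma deviation_const_nonneg: "0 \<le> deviation_const"
  unfolding deviation_const_def using step_consts_nonneg gamma_pos by (intro mult_nonneg_nonneg add_nonneg_nonneg divide_nonneg_nonneg) auto

lemma delta_bounds: "0 < \<delta>" "\<delta> \<le> \<nu> / 8" "\<gamma> * \<delta> + \<delta> = \<nu> / 8"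
proof -
  show "0 < \<delta>" using nu_bounds beta_gt1 by (simp add: \<delta>_def)
  show eq: "\<gamma> * \<delta> + \<delta> = \<nu> / 8"
  proof -
    have "\<beta> * \<delta> = \<nu> / 8" using beta_gt1 by (simp add: \<delta>_def)
    then show ?thesis by (simp add: \<beta>_def algebra_simps)
  qed
  have "0 \<le> \<gamma> * \<delta>" using \<open>0 < \<delta>\<close> gamma_pos by simp
  then show "\<delta> \<le> \<nu> / 8" using eq by linarith
qed

lemma fluid_const_limit_var:
  assumes "1 \<le> k" "1 \<le> n"
  shows "fluid_const k (real (snd (w k))) = (\<alpha> + 1) * (real m - 1) / c * (limit_var n k w * real n powr \<gamma>)"
proof -
  have "limit_var n k w * real n powr \<gamma> = particles (snd (w k)) * real k powr \<gamma>"
    using assms by (simp add: limit_var_def rescale_def powr_divide)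
  then show ?thesis using m2 by (simp add: fluid_const_def particles_def)
qed

text \<open>
  The fluid constant is proportional to \<open>n powr \<gamma>\<close> times the limit variable, and \<open>\<gamma> * (1 - \<nu>) = \<nu>\<close>.
\<close>

lemma fluid_scale_limit_var:
  assumes "1 \<le> k" "1 \<le> n"
  shows "hitting_scale * fluid_const k (real (snd (w k))) powr (1 - \<nu>)
    = limit_scale * limit_var n k w powr (1 - \<nu>) * real n powr \<nu>"
proof -
  have "\<gamma> * (1 - \<nu>) = \<nu>" using gamma_nu by (simp add: algebra_simps)
  then have "(real n powr \<gamma>) powr (1 - \<nu>) = real n powr \<nu>" by (simp add: powr_powr)
  moreover have "0 \<le> limit_var n k w" using m2 by (simp add: limit_var_def rescale_def particles_def)
  moreover have "0 \<le> (\<alpha> + 1) * (real m - 1) / c" using m2 c_ge alpha_pos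
    by (intro divide_nonneg_nonneg mult_nonneg_nonneg) auto
  ultimately show ?thesis unfolding fluid_const_limit_var[OF assms] limit_scale_def
    by (simp only: powr_mult powr_ge_zero mult_nonneg_nonneg mult_ac)
qed

lemma cut_bounds:
  assumes "1 \<le> n"
  shows "real n powr ((1 + \<nu>) / 2) \<le> real (cut n)" "real (cut n) \<le> 2 * real n powr ((1 + \<nu>) / 2)" "1 \<le> cut n"
proof -
  have 1: "1 \<le> real n powr ((1 + \<nu>) / 2)" using assms nu_bounds by (intro ge_one_powr_ge_zero) auto
  show a: "real n powr ((1 + \<nu>) / 2) \<le> real (cut n)" unfolding cut_def by linarith
  show "real (cut n) \<le> 2 * real n powr ((1 + \<nu>) / 2)" unfolding cut_def using 1 by linarith
  show "1 \<le> cut n" using 1 a by linarith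
qed

lemma low_cut_bounds:
  assumes "1 \<le> n"
  shows "real n powr (\<nu> - \<delta>) \<le> real (low_cut n)" "real (low_cut n) \<le> 4 * real n powr (\<nu> - \<delta>)" "2 \<le> low_cut n" "0 < real (low_cut n)"
proof -
  have 1: "1 \<le> real n powr (\<nu> - \<delta>)" using assms nu_bounds delta_bounds by (intro ge_one_powr_ge_zero) auto
  show "real n powr (\<nu> - \<delta>) \<le> real (low_cut n)" unfolding low_cut_def using 1 by (simp, linarith)
  show "real (low_cut n) \<le> 4 * real n powr (\<nu> - \<delta>)" unfolding low_cut_def using 1 by (simp, linarith)
  show two: "2 \<le> low_cut n" by (simp add: low_cut_def)
  show "0 < real (low_cut n)" using two by linarith
qed

lemma cut_ratio:
  assumes "1 \<le> n"
  shows "(real n / real (cut n)) powr \<gamma> \<le> real n powr (\<nu> / 2)"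
    "(real n / real (cut n)) powr (2 * \<gamma>) \<le> real n powr \<nu>"
    "(real (cut n) / real n) powr \<gamma> \<le> 2 powr \<gamma> * real n powr (- \<nu> / 2)"
proof -
  let ?\<mu> = "(1 + \<nu>) / 2"
  have n: "0 < real n" "0 < real n powr ?\<mu>" "0 < real (cut n)" using assms cut_bounds(3)[OF assms] by auto
  have e: "(1 - ?\<mu>) * \<gamma> = \<nu> / 2" "(?\<mu> - 1) * \<gamma> = - \<nu> / 2" "(1 - ?\<mu>) * (2 * \<gamma>) = \<nu>"
    using gamma_nu by (simp_all add: field_simps)
  have "real n / real (cut n) \<le> real n / real n powr ?\<mu>"
    using cut_bounds(1)[OF assms] n by (intro divide_left_mono) auto
  also have "\<dots> = real n powr (1 - ?\<mu>)" unfolding powr_diff using n by simp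
  finally have r: "real n / real (cut n) \<le> real n powr (1 - ?\<mu>)" .
  have "(real n / real (cut n)) powr \<gamma> \<le> (real n powr (1 - ?\<mu>)) powr \<gamma>"
    using r gamma_pos by (intro powr_mono2) auto
  then show "(real n / real (cut n)) powr \<gamma> \<le> real n powr (\<nu> / 2)" unfolding powr_powr e .
  have "(real n / real (cut n)) powr (2 * \<gamma>) \<le> (real n powr (1 - ?\<mu>)) powr (2 * \<gamma>)"
    using r gamma_pos by (intro powr_mono2) auto
  then show "(real n / real (cut n)) powr (2 * \<gamma>) \<le> real n powr \<nu>" unfolding powr_powr e .
  have "real (cut n) / real n \<le> 2 * real n powr ?\<mu> / real n"
    using cut_bounds(2)[OF assms] n by (intro divide_right_mono) auto
  also have "\<dots> = 2 * real n powr (?\<mu> - 1)" unfolding powr_diff using n by simp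
  finally have "(real (cut n) / real n) powr \<gamma> \<le> (2 * real n powr (?\<mu> - 1)) powr \<gamma>"
    using gamma_pos by (intro powr_mono2) auto
  also have "\<dots> = 2 powr \<gamma> * (real n powr (?\<mu> - 1)) powr \<gamma>" by (simp add: powr_mult)
  finally show "(real (cut n) / real n) powr \<gamma> \<le> 2 powr \<gamma> * real n powr (- \<nu> / 2)" unfolding powr_powr e .
qed

definition cut_deviation_const :: real
  where "cut_deviation_const = deviation_const * (moment_const 4 + moment_const 2 + moment_const 1 * 2 powr \<gamma>)"

definition limit_error_const :: real
  where "limit_error_const = 6 + hit_const 1 + sqrt (descendants_const 1) + 2 powr \<gamma> / \<gamma> * (hit_rate_const * moment_const 1 + sqrt cut_deviation_const)
    + tail_const * ((\<alpha> + 1) / c * moment_const 1)"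

lemma deviation_rate_le:
  assumes "1 \<le> n"
  shows "deviation_rate n (cut n) (low_cut n) \<le> cut_deviation_const * real n powr (- \<nu> / 2)"
proof -
  have mono: "real n powr a \<le> real n powr b" if "a \<le> b" for a b using assms that by (intro powr_mono) auto
  have n: "0 < real n" using assms by simp
  have "(real n / real (cut n)) powr (2 * \<gamma>) / (real (cut n))\<^sup>2 \<le> real n powr \<nu> / (real n powr ((1 + \<nu>) / 2))\<^sup>2"
    using cut_ratio(2)[OF assms] cut_bounds(1)[OF assms] n by (intro frac_le power_mono) auto
  also have "\<dots> = real n powr (\<nu> - (1 + \<nu>))"
  proof -
    have "(real n powr ((1 + \<nu>) / 2))\<^sup>2 = real n powr ((1 + \<nu>) / 2 + (1 + \<nu>) / 2)"
      unfolding power2_eq_square powr_add ..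
    also have "(1 + \<nu>) / 2 + (1 + \<nu>) / 2 = 1 + \<nu>" by simp
    finally show ?thesis by (simp only: powr_diff)
  qed
  also have "\<dots> \<le> real n powr (- \<nu> / 2)" using nu_bounds by (intro mono) auto
  finally have 1: "(real n / real (cut n)) powr (2 * \<gamma>) / (real (cut n))\<^sup>2 \<le> real n powr (- \<nu> / 2)" .
  have "1 / real (low_cut n) \<le> 1 / real n powr (\<nu> - \<delta>)"
    using low_cut_bounds[OF assms] n by (intro divide_left_mono mult_pos_pos) auto
  also have "\<dots> = real n powr (- (\<nu> - \<delta>))" by (simp only: powr_minus_divide)
  also have "\<dots> \<le> real n powr (- \<nu> / 2)" using nu_bounds delta_bounds by (intro mono) auto
  finally have 2: "1 / real (low_cut n) \<le> real n powr (- \<nu> / 2)" .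
  have "deviation_rate n (cut n) (low_cut n) = deviation_const * (moment_const 4 * ((real n / real (cut n)) powr (2 * \<gamma>) / (real (cut n))\<^sup>2)
     + moment_const 2 * (1 / real (low_cut n)) + moment_const 1 * (real (cut n) / real n) powr \<gamma>)"
    by (simp add: deviation_rate_def)
  also have "\<dots> \<le> deviation_const * (moment_const 4 * real n powr (- \<nu> / 2) + moment_const 2 * real n powr (- \<nu> / 2)
     + moment_const 1 * (2 powr \<gamma> * real n powr (- \<nu> / 2)))"
    using deviation_const_nonneg by (intro mult_left_mono add_mono 1 2 cut_ratio(3)[OF assms] moment_const_nonneg)
  also have "\<dots> = cut_deviation_const * real n powr (- \<nu> / 2)" by (simp add: cut_deviation_const_def algebra_simps)
  finally show ?thesis .
qed

lemma start_mean:
  assumes "1 \<le> k" "k \<le> n - 1"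
  shows "Ep (start n) (\<lambda>w. real (snd (w k))) \<le> moment_const 1 * (real n / real k) powr \<gamma>"
  using start_moment[OF assms, of 1] by simp

text \<open>
  Every error term of the second phase is smaller than \<open>n powr \<nu>\<close> by a power of \<open>n\<close>.
\<close>

lemma descendants_limit_error:
  assumes "2 \<le> n" "cut n \<le> n - 1"
  shows "Ep (start n) (\<lambda>w. \<bar>real (Suc (hits (n - 1) w)) - limit_scale * limit_var n (cut n) w powr (1 - \<nu>) * real n powr \<nu>\<bar>)
    \<le> limit_error_const * real n powr (\<nu> - \<delta>)"
proof -
  let ?k = "cut n" and ?K = "low_cut n"
  let ?X = "\<lambda>w. real (Suc (hits (n - 1) w))" and ?F = "\<lambda>w. fluid_sum (cut n) (snd (w (cut n)))"
  let ?P = "real n powr (\<nu> - \<delta>)"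
  have n1: "1 \<le> n" using assms by simp
  note cb = cut_bounds[OF n1] and lb = low_cut_bounds[OF n1] and cr = cut_ratio[OF n1]
  have mono: "real n powr a \<le> real n powr b" if "a \<le> b" for a b using n1 that by (intro powr_mono) auto
  have half: "real n powr (\<nu> / 2) \<le> ?P" using delta_bounds nu_bounds by (intro mono) auto
  have one: "1 \<le> ?P" using n1 nu_bounds delta_bounds by (intro ge_one_powr_ge_zero) auto
  have ratio: "(real n / real ?k) powr \<gamma> \<le> ?P" using cr(1) half by (rule order_trans)
  have fluid: "\<bar>?F w - limit_scale * limit_var n ?k w powr (1 - \<nu>) * real n powr \<nu>\<bar>
      \<le> 1 + tail_const * ((\<alpha> + 1) / c * real (snd (w ?k)))" for w
  proof -
    have "fluid_const ?k (real (snd (w ?k))) * real ?k powr (- \<gamma>) = (\<alpha> + 1) / c * real (snd (w ?k))"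
      using cb(3) by (simp add: fluid_const_def powr_minus)
    then show ?thesis using fluid_sum_asymptotic[OF cb(3), of "snd (w ?k)"]
      unfolding fluid_scale_limit_var[OF cb(3) n1] by (simp only:)
  qed
  have tail_const: "0 \<le> tail_const" using gamma_pos by (simp add: tail_const_def)
  have "Ep (start n) (\<lambda>w. \<bar>?X w - limit_scale * limit_var n ?k w powr (1 - \<nu>) * real n powr \<nu>\<bar>)
    \<le> Ep (start n) (\<lambda>w. \<bar>?X w - ?F w\<bar> + (1 + tail_const * ((\<alpha> + 1) / c * real (snd (w ?k)))))"
  proof (rule Ep_mono[OF finite_start])
    fix w
    show "\<bar>?X w - limit_scale * limit_var n ?k w powr (1 - \<nu>) * real n powr \<nu>\<bar>
      \<le> \<bar>?X w - ?F w\<bar> + (1 + tail_const * ((\<alpha> + 1) / c * real (snd (w ?k))))"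
      using fluid[of w] by linarith
  qed
  also have "\<dots> = Ep (start n) (\<lambda>w. \<bar>?X w - ?F w\<bar>) + (1 + tail_const * ((\<alpha> + 1) / c * Ep (start n) (\<lambda>w. real (snd (w ?k)))))"
    by (simp add: integrable_measure_pmf_finite)
  also have "Ep (start n) (\<lambda>w. \<bar>?X w - ?F w\<bar>) \<le> (5 + hit_const 1 + sqrt (descendants_const 1) + 2 powr \<gamma> / \<gamma> * (hit_rate_const * moment_const 1 + sqrt cut_deviation_const)) * ?P"
  proof -
    have a: "hit_const 1 * (real n / real ?k) powr \<gamma> \<le> hit_const 1 * ?P"
      using ratio hit_const_nonneg by (intro mult_left_mono)
    have b: "sqrt (descendants_const 1 * real n powr \<nu>) \<le> sqrt (descendants_const 1) * ?P"
    proof -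
      have "sqrt (descendants_const 1 * real n powr \<nu>) = sqrt (descendants_const 1) * real n powr (\<nu> / 2)"
        by (simp add: real_sqrt_mult powr_half_sqrt[symmetric] powr_powr)
      also have "\<dots> \<le> sqrt (descendants_const 1) * ?P" using half descendants_const_nonneg by (intro mult_left_mono) auto
      finally show ?thesis .
    qed
    have d: "(2 * real n / real ?K) powr \<gamma> / \<gamma> * (hit_rate_const * moment_const 1 / real ?K + sqrt (deviation_rate n ?k ?K))
      \<le> 2 powr \<gamma> / \<gamma> * (hit_rate_const * moment_const 1 + sqrt cut_deviation_const) * ?P"
    proof -
      have "2 * real n / real ?K \<le> 2 * real n / real n powr (\<nu> - \<delta>)"
        using lb n1 by (intro divide_left_mono mult_pos_pos) auto
      also have "\<dots> = 2 * real n powr (1 - (\<nu> - \<delta>))" unfolding powr_diff[of _ 1] using n1 by simp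
      finally have "(2 * real n / real ?K) powr \<gamma> \<le> (2 * real n powr (1 - (\<nu> - \<delta>))) powr \<gamma>"
        using gamma_pos by (intro powr_mono2) auto
      also have "\<dots> = 2 powr \<gamma> * real n powr ((1 - (\<nu> - \<delta>)) * \<gamma>)" by (simp add: powr_mult powr_powr)
      also have "(1 - (\<nu> - \<delta>)) * \<gamma> = \<nu> + \<gamma> * \<delta>" using gamma_nu by (simp add: algebra_simps)
      finally have p1: "(2 * real n / real ?K) powr \<gamma> \<le> 2 powr \<gamma> * real n powr (\<nu> + \<gamma> * \<delta>)" .
      have "1 / real ?K \<le> 1 / real n powr (\<nu> - \<delta>)" using lb n1 by (intro divide_left_mono mult_pos_pos) auto
      also have "\<dots> = real n powr (- (\<nu> - \<delta>))" by (simp only: powr_minus_divide)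
      also have "\<dots> \<le> real n powr (- \<nu> / 4)" using nu_bounds delta_bounds by (intro mono) auto
      finally have "hit_rate_const * moment_const 1 * (1 / real ?K) \<le> hit_rate_const * moment_const 1 * real n powr (- \<nu> / 4)"
        using step_consts_nonneg moment_const_nonneg by (intro mult_left_mono mult_nonneg_nonneg)
      moreover have "sqrt (deviation_rate n ?k ?K) \<le> sqrt cut_deviation_const * real n powr (- \<nu> / 4)"
      proof -
        have "sqrt (deviation_rate n ?k ?K) \<le> sqrt (cut_deviation_const * real n powr (- \<nu> / 2))"
          by (intro real_sqrt_le_mono deviation_rate_le n1)
        also have "\<dots> = sqrt cut_deviation_const * real n powr (- \<nu> / 4)"
          by (simp add: real_sqrt_mult powr_half_sqrt[symmetric] powr_powr)
        finally show ?thesis .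
      qed
      ultimately have p2: "hit_rate_const * moment_const 1 / real ?K + sqrt (deviation_rate n ?k ?K)
        \<le> (hit_rate_const * moment_const 1 + sqrt cut_deviation_const) * real n powr (- \<nu> / 4)" by (simp add: distrib_right)
      have cut_deviation_const: "0 \<le> cut_deviation_const" unfolding cut_deviation_const_def using deviation_const_nonneg moment_const_nonneg
        by (intro mult_nonneg_nonneg add_nonneg_nonneg) auto
      have pos: "0 \<le> hit_rate_const * moment_const 1 + sqrt cut_deviation_const" using step_consts_nonneg moment_const_nonneg cut_deviation_const by (intro add_nonneg_nonneg mult_nonneg_nonneg) auto
      have pos2: "0 \<le> hit_rate_const * moment_const 1 / real ?K + sqrt (deviation_rate n ?k ?K)"
        unfolding deviation_rate_def using step_consts_nonneg deviation_const_nonneg moment_const_nonneg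
        by (intro add_nonneg_nonneg divide_nonneg_nonneg mult_nonneg_nonneg real_sqrt_ge_zero) auto
      have "(2 * real n / real ?K) powr \<gamma> / \<gamma> * (hit_rate_const * moment_const 1 / real ?K + sqrt (deviation_rate n ?k ?K))
        \<le> (2 powr \<gamma> * real n powr (\<nu> + \<gamma> * \<delta>)) / \<gamma> * ((hit_rate_const * moment_const 1 + sqrt cut_deviation_const) * real n powr (- \<nu> / 4))"
        using gamma_pos by (intro mult_mono[OF divide_right_mono p2] p1 pos2) auto
      also have "\<dots> = 2 powr \<gamma> / \<gamma> * (hit_rate_const * moment_const 1 + sqrt cut_deviation_const) * (real n powr (\<nu> + \<gamma> * \<delta>) * real n powr (- \<nu> / 4))"
        by simp
      also have "real n powr (\<nu> + \<gamma> * \<delta>) * real n powr (- \<nu> / 4) = real n powr (\<nu> + \<gamma> * \<delta> + (- \<nu> / 4))"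
        by (rule powr_add[symmetric])
      also have "2 powr \<gamma> / \<gamma> * (hit_rate_const * moment_const 1 + sqrt cut_deviation_const) * \<dots> \<le> 2 powr \<gamma> / \<gamma> * (hit_rate_const * moment_const 1 + sqrt cut_deviation_const) * ?P"
      proof (intro mult_left_mono mono)
        show "\<nu> + \<gamma> * \<delta> + (- \<nu> / 4) \<le> \<nu> - \<delta>" using delta_bounds(3) nu_bounds by linarith
        show "0 \<le> 2 powr \<gamma> / \<gamma> * (hit_rate_const * moment_const 1 + sqrt cut_deviation_const)" using pos gamma_pos by simp
      qed
      finally show ?thesis .
    qed
    have "Ep (start n) (\<lambda>w. \<bar>?X w - ?F w\<bar>)
      \<le> 1 + hit_const 1 * (real n / real ?k) powr \<gamma> + sqrt (descendants_const 1 * real n powr \<nu>) + real ?K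
        + (2 * real n / real ?K) powr \<gamma> / \<gamma> * (hit_rate_const * moment_const 1 / real ?K + sqrt (deviation_rate n ?k ?K))"
      by (rule descendants_fluid_error[OF lb(3) cb(3) assms(2)])
    also have "\<dots> \<le> ?P + hit_const 1 * ?P + sqrt (descendants_const 1) * ?P + 4 * ?P + 2 powr \<gamma> / \<gamma> * (hit_rate_const * moment_const 1 + sqrt cut_deviation_const) * ?P"
      by (intro add_mono one a b d lb(2))
    finally show ?thesis by (simp add: algebra_simps)
  qed
  also have "1 + tail_const * ((\<alpha> + 1) / c * Ep (start n) (\<lambda>w. real (snd (w ?k)))) \<le> ?P + tail_const * ((\<alpha> + 1) / c * (moment_const 1 * ?P))"
  proof -
    have "Ep (start n) (\<lambda>w. real (snd (w ?k))) \<le> moment_const 1 * ?P"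
      using start_mean[OF cb(3) assms(2)] mult_left_mono[OF ratio moment_const_nonneg[of 1]] by linarith
    then show ?thesis using one tail_const c_ge alpha_pos by (intro add_mono mult_left_mono) auto
  qed
  finally show ?thesis unfolding limit_error_const_def by (simp add: algebra_simps)
qed

end

section \<open>Moments under weak convergence\<close>

lemma isCont_powr_nonneg_exponent:
  fixes f :: "real \<Rightarrow> real"
  assumes "0 < s" "continuous_on UNIV f" "\<And>x. 0 \<le> f x"
  shows "isCont (\<lambda>x. f x powr s) x"
proof -
  have "continuous_on UNIV (\<lambda>x. f x powr s)"
    using assms by (intro continuous_on_powr' continuous_on_const) auto
  then show ?thesis by (simp add: continuous_on_eq_continuous_at)
qed

text \<open>
  A real \<open>a \<ge> 0\<close> exceeds its truncation at \<open>R\<close> by at most \<open>a\<^sup>2 / R\<close>.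
\<close>

lemma truncation_error:
  fixes \<mu> :: "real measure" and p R :: real
  assumes "real_distribution \<mu>" "integrable \<mu> (\<lambda>x. \<bar>x\<bar> powr (2 * p))" "0 < R"
  shows "\<bar>(LINT x|\<mu>. \<bar>x\<bar> powr p) - (LINT x|\<mu>. min (\<bar>x\<bar> powr p) R)\<bar> \<le> (LINT x|\<mu>. \<bar>x\<bar> powr (2 * p)) / R"
proof -
  interpret real_distribution \<mu> by fact
  have sq: "\<bar>x\<bar> powr (2 * p) = (\<bar>x\<bar> powr p)\<^sup>2" for x :: real
    by (simp add: power2_eq_square powr_add[symmetric])
  have pt: "\<bar>a - min a R\<bar> \<le> a\<^sup>2 / R" if "0 \<le> a" for a
  proof (cases "a \<le> R")
    case True then show ?thesis using assms(3) by simp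
  next
    case False
    then have "a * R \<le> a * a" using that by (intro mult_left_mono) auto
    then have "a \<le> a\<^sup>2 / R" using assms(3) by (simp add: pos_le_divide_eq power2_eq_square)
    then show ?thesis using False assms(3) by simp
  qed
  have lin: "a \<le> 1 + a\<^sup>2" for a :: real
    using zero_le_power2[of "a - 1"] by (simp add: power2_eq_square algebra_simps) (smt zero_le_square)
  have i1: "integrable \<mu> (\<lambda>x. \<bar>x\<bar> powr p)"
  proof (rule Bochner_Integration.integrable_bound)
    show "integrable \<mu> (\<lambda>x. 1 + \<bar>x\<bar> powr (2 * p))" using assms(2) by simp
    show "AE x in \<mu>. norm (\<bar>x\<bar> powr p) \<le> norm (1 + \<bar>x\<bar> powr (2 * p))"
      using lin by (intro AE_I2) (simp add: sq)
  qed simp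
  have i2: "integrable \<mu> (\<lambda>x. min (\<bar>x\<bar> powr p) R)"
    using assms(3) by (intro integrable_const_bound[where B = R]) auto
  have "\<bar>(LINT x|\<mu>. \<bar>x\<bar> powr p) - (LINT x|\<mu>. min (\<bar>x\<bar> powr p) R)\<bar>
    = \<bar>LINT x|\<mu>. \<bar>x\<bar> powr p - min (\<bar>x\<bar> powr p) R\<bar>"
    using i1 i2 by simp
  also have "\<dots> \<le> (LINT x|\<mu>. \<bar>\<bar>x\<bar> powr p - min (\<bar>x\<bar> powr p) R\<bar>)"
    by (rule integral_abs_bound)
  also have "\<dots> \<le> (LINT x|\<mu>. \<bar>x\<bar> powr (2 * p) / R)"
  proof (rule integral_mono)
    show "integrable \<mu> (\<lambda>x. \<bar>\<bar>x\<bar> powr p - min (\<bar>x\<bar> powr p) R\<bar>)" using i1 i2 by simp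
    show "integrable \<mu> (\<lambda>x. \<bar>x\<bar> powr (2 * p) / R)" using assms(2) by simp
    show "\<bar>\<bar>x\<bar> powr p - min (\<bar>x\<bar> powr p) R\<bar> \<le> \<bar>x\<bar> powr (2 * p) / R" for x unfolding sq by (rule pt) simp
  qed
  finally show ?thesis by simp
qed

text \<open>
  Bounded moments of twice the order make the truncation error uniformly small, and truncated moments converge
  as integrals of bounded continuous functions.
\<close>

lemma weak_conv_moments:
  fixes \<mu> :: "nat \<Rightarrow> real measure"
  assumes \<mu>: "\<And>n. real_distribution (\<mu> n)" and \<mu>': "real_distribution \<mu>'"
    and conv: "weak_conv_m \<mu> \<mu>'" and p: "0 < p"
    and int: "\<And>n. n \<ge> a \<Longrightarrow> integrable (\<mu> n) (\<lambda>x. \<bar>x\<bar> powr (2 * p))"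
    and bound: "\<And>n. n \<ge> a \<Longrightarrow> (LINT x|\<mu> n. \<bar>x\<bar> powr (2 * p)) \<le> B"
    and int': "integrable \<mu>' (\<lambda>x. \<bar>x\<bar> powr (2 * p))"
  shows "(\<lambda>n. LINT x|\<mu> n. \<bar>x\<bar> powr p) \<longlonglongrightarrow> (LINT x|\<mu>'. \<bar>x\<bar> powr p)"
proof (rule LIMSEQ_I)
  fix e :: real assume e: "0 < e"
  define B' where "B' = \<bar>B\<bar> + \<bar>LINT x|\<mu>'. \<bar>x\<bar> powr (2 * p)\<bar> + 1"
  define R where "R = 3 * B' / e"
  have B': "0 < B'" unfolding B'_def by (intro add_nonneg_pos add_nonneg_nonneg abs_ge_zero) simp
  have B'_ge: "B \<le> B'" "(LINT x|\<mu>'. \<bar>x\<bar> powr (2 * p)) \<le> B'"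
    unfolding B'_def using abs_ge_self[of B] abs_ge_self[of "LINT x|\<mu>'. \<bar>x\<bar> powr (2 * p)"]
      abs_ge_zero[of B] abs_ge_zero[of "LINT x|\<mu>'. \<bar>x\<bar> powr (2 * p)"] by argo+
  have R: "0 < R" using B' e by (simp add: R_def)
  have B'R: "B' / R = e / 3" using B' e by (simp add: R_def field_simps)
  let ?g = "\<lambda>x. min (\<bar>x\<bar> powr p) R"
  have "(\<lambda>n. LINT x|\<mu> n. ?g x) \<longlonglongrightarrow> (LINT x|\<mu>'. ?g x)"
  proof (rule weak_conv_imp_integral_bdd_continuous_conv[OF \<mu> \<mu>' conv])
    have "isCont (\<lambda>x. \<bar>x\<bar> powr p) x" for x :: real
      by (rule isCont_powr_nonneg_exponent) (use p in \<open>auto intro!: continuous_intros\<close>)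
    then show "isCont ?g x" for x
      by (rule isCont_o2[where g = "\<lambda>u. min u R"]) (intro continuous_intros)
    show "norm (?g x) \<le> R" for x using R by simp
  qed
  from LIMSEQ_D[OF this, of "e / 3"] e obtain n1 where
    n1: "\<And>n. n \<ge> n1 \<Longrightarrow> norm ((LINT x|\<mu> n. ?g x) - (LINT x|\<mu>'. ?g x)) < e / 3" by auto
  show "\<exists>no. \<forall>n\<ge>no. norm ((LINT x|\<mu> n. \<bar>x\<bar> powr p) - (LINT x|\<mu>'. \<bar>x\<bar> powr p)) < e"
  proof (intro exI[of _ "max a n1"] allI impI)
    fix n assume n: "max a n1 \<le> n"
    have "\<bar>(LINT x|\<mu> n. \<bar>x\<bar> powr p) - (LINT x|\<mu> n. ?g x)\<bar> \<le> (LINT x|\<mu> n. \<bar>x\<bar> powr (2 * p)) / R"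
      using n by (intro truncation_error \<mu> int R) auto
    also have "\<dots> \<le> B' / R" using n order_trans[OF bound B'_ge(1)] R by (intro divide_right_mono) auto
    finally have 1: "\<bar>(LINT x|\<mu> n. \<bar>x\<bar> powr p) - (LINT x|\<mu> n. ?g x)\<bar> \<le> e / 3" unfolding B'R .
    have "\<bar>(LINT x|\<mu>'. \<bar>x\<bar> powr p) - (LINT x|\<mu>'. ?g x)\<bar> \<le> (LINT x|\<mu>'. \<bar>x\<bar> powr (2 * p)) / R"
      by (intro truncation_error \<mu>' int' R)
    also have "\<dots> \<le> B' / R" using B'_ge(2) R by (intro divide_right_mono) auto
    finally have 2: "\<bar>(LINT x|\<mu>'. \<bar>x\<bar> powr p) - (LINT x|\<mu>'. ?g x)\<bar> \<le> e / 3" unfolding B'R .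
    have 3: "\<bar>(LINT x|\<mu> n. ?g x) - (LINT x|\<mu>'. ?g x)\<bar> < e / 3" using n1[of n] n by simp
    show "norm ((LINT x|\<mu> n. \<bar>x\<bar> powr p) - (LINT x|\<mu>'. \<bar>x\<bar> powr p)) < e"
      using 1 2 3 unfolding real_norm_def by argo
  qed
qed

lemma distr_lborel_eq_borel: "distr N lborel X = distr N borel X"
  by (rule distr_cong) auto

lemma gamma_variable_char:
  fixes \<xi> :: "'b \<Rightarrow> real"
  assumes "distributed N lborel \<xi> (gamma_density s 1)" "0 < s"
  shows "char (distr N borel \<xi>) t = gcf s t"
proof -
  have "distr N borel \<xi> = density lborel (gamma_density s 1)"
    using distributed_distr_eq_density[OF assms(1)] by (simp add: distr_lborel_eq_borel)
  then show ?thesis unfolding char_def gcf_def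
    using assms(2) by (simp add: integral_density gamma_density_nonneg)
qed

lemma gamma_variable_pos:
  fixes \<xi> :: "'b \<Rightarrow> real"
  assumes "distributed N lborel \<xi> (gamma_density s 1)"
  shows "AE x in N. 0 < \<xi> x"
proof -
  have "AE x in density lborel (gamma_density s 1). 0 < x"
    by (subst AE_density) (auto simp: gamma_density_def)
  then have "AE x in distr N lborel \<xi>. 0 < x" unfolding distributed_distr_eq_density[OF assms] .
  then show ?thesis by (rule AE_distrD[OF distributed_measurable[OF assms]])
qed

lemma gamma_variable_moment:
  fixes \<xi> :: "'b \<Rightarrow> real"
  assumes "distributed N lborel \<xi> (gamma_density s 1)" "0 < s" "0 \<le> \<sigma>" "0 \<le> r" "0 \<le> K"
  shows "has_bochner_integral N (\<lambda>x. \<bar>K * \<xi> x powr \<sigma>\<bar> powr r) (K powr r * (Gamma (r * \<sigma> + s) / Gamma s))"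
proof -
  let ?g = "\<lambda>x::real. \<bar>K * x powr \<sigma>\<bar> powr r"
  have "has_bochner_integral lborel (\<lambda>x. gamma_density s 1 x * x powr (r * \<sigma>)) (Gamma (s + r * \<sigma>) / Gamma s)"
    using assms by (intro gamma_density_moment) (auto intro: add_pos_nonneg)
  then have "has_bochner_integral lborel (\<lambda>x. K powr r * (gamma_density s 1 x * x powr (r * \<sigma>))) (K powr r * (Gamma (s + r * \<sigma>) / Gamma s))"
    by (intro has_bochner_integral_mult_right)
  moreover have "K powr r * (gamma_density s 1 x * x powr (r * \<sigma>)) = gamma_density s 1 x * ?g x" for x
    using assms(5) by (simp add: abs_mult powr_mult powr_powr mult.commute[of r])
  ultimately have "has_bochner_integral lborel (\<lambda>x. gamma_density s 1 x * ?g x) (K powr r * (Gamma (r * \<sigma> + s) / Gamma s))"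
    by (simp only: add.commute)
  then have i: "integrable lborel (\<lambda>x. gamma_density s 1 x * ?g x)"
    and v: "(LINT x|lborel. gamma_density s 1 x * ?g x) = K powr r * (Gamma (r * \<sigma> + s) / Gamma s)"
    by (auto simp: has_bochner_integral_iff)
  have "integrable lborel (\<lambda>x. gamma_density s 1 x * ?g x) \<longleftrightarrow> integrable N (\<lambda>x. ?g (\<xi> x))"
    using assms by (intro distributed_integrable[OF assms(1)]) (auto intro: gamma_density_nonneg)
  moreover have "(LINT x|lborel. gamma_density s 1 x * ?g x) = (LINT x|N. ?g (\<xi> x))"
    using assms by (intro distributed_integral[OF assms(1)]) (auto intro: gamma_density_nonneg)
  ultimately show ?thesis using i v by (simp add: has_bochner_integral_iff)
qed

section \<open>Convergence in distribution and of moments\<close>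

context pa_parameters begin

lemma tendsto_neg_power: "a < 0 \<Longrightarrow> (\<lambda>n. real n powr a) \<longlonglongrightarrow> 0"
  by (rule tendsto_neg_powr) (auto simp: filterlim_real_sequentially)

lemma eventually_cut_le: "\<forall>\<^sub>F n in sequentially. 2 \<le> n \<and> cut n \<le> n - 1"
proof -
  have "\<forall>\<^sub>F n in sequentially. \<bar>real n powr ((\<nu> - 1) / 2) - 0\<bar> < 1 / 4"
    using tendsto_neg_power[of "(\<nu> - 1) / 2"] nu_bounds by (intro order_tendstoD(2) tendsto_rabs_zero LIM_zero) auto
  then show ?thesis using eventually_ge_at_top[of 2]
  proof eventually_elim
    case (elim n)
    have n: "1 \<le> n" using elim by simp
    have "real n powr ((1 + \<nu>) / 2) = real n powr ((\<nu> - 1) / 2) * real n powr 1"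
      unfolding powr_add[symmetric] by (simp add: field_simps)
    also have "\<dots> \<le> 1 / 4 * real n" using elim n by (intro mult_mono) auto
    finally have "real (cut n) \<le> real n / 2" using cut_bounds(2)[OF n] by linarith
    then have "2 * cut n \<le> n" by linarith
    then show ?case using elim by linarith
  qed
qed

lemma limit_var_tendsto:
  "(\<lambda>n. Ep (start n) (\<lambda>w. iexp (t * limit_var n (cut n) w))) \<longlonglongrightarrow> gcf (particles m) t"
proof -
  let ?b = "\<lambda>n. branching_const t * (real n powr ((\<nu> - 1) / 2)) + 4 * real m * real n powr (-1)
    + \<bar>t\<bar> * (1 - (1 - real n powr (-1)) powr \<gamma>) * particles m
    + \<bar>t\<bar> * sqrt (moment_const 1 * (2 powr \<gamma> * real n powr (- \<nu> / 2)))"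
  have "?b \<longlonglongrightarrow> branching_const t * 0 + 4 * real m * 0 + \<bar>t\<bar> * (1 - (1 - 0) powr \<gamma>) * particles m + \<bar>t\<bar> * sqrt (moment_const 1 * (2 powr \<gamma> * 0))"
    using nu_bounds by (intro tendsto_intros tendsto_neg_power) auto
  then have b0: "?b \<longlonglongrightarrow> 0" by simp
  have branching_const: "0 \<le> branching_const t" unfolding branching_const_def using branching_step_const_nonneg by (intro mult_nonneg_nonneg) auto
  have "(\<lambda>n. Ep (start n) (\<lambda>w. iexp (t * limit_var n (cut n) w)) - gcf (particles m) t) \<longlonglongrightarrow> 0"
  proof (rule Lim_null_comparison[OF _ b0])
    show "\<forall>\<^sub>F n in sequentially. norm (Ep (start n) (\<lambda>w. iexp (t * limit_var n (cut n) w)) - gcf (particles m) t) \<le> ?b n"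
      using eventually_cut_le
    proof eventually_elim
      case (elim n)
      then have n: "1 \<le> n" "0 < real n" by auto
      have "(real n / real (cut n)) powr (2 * \<gamma>) / real (cut n) \<le> real n powr \<nu> / real n powr ((1 + \<nu>) / 2)"
        using cut_ratio(2)[OF n(1)] cut_bounds(1)[OF n(1)] n by (intro frac_le) auto
      also have "\<dots> = real n powr ((\<nu> - 1) / 2)" unfolding powr_diff[symmetric] by (simp add: field_simps)
      finally have 1: "(real n / real (cut n)) powr (2 * \<gamma>) / real (cut n) \<le> real n powr ((\<nu> - 1) / 2)" .
      have 2: "4 * real m / real n = 4 * real m * real n powr (-1)" using n by (simp add: powr_minus_divide)
      have "real (n - 1) / real n = 1 - real n powr (-1)" using n by (simp add: powr_minus_divide of_nat_diff diff_divide_distrib)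
      then have 3: "rescale n (n - 1) = (1 - real n powr (-1)) powr \<gamma>" by (simp add: rescale_def)
      have 4: "rescale n (cut n) \<le> 2 powr \<gamma> * real n powr (- \<nu> / 2)" unfolding rescale_def by (rule cut_ratio(3)[OF n(1)])
      have "norm (Ep (start n) (\<lambda>w. iexp (t * limit_var n (cut n) w)) - gcf (particles m) t)
        \<le> branching_const t * ((real n / real (cut n)) powr (2 * \<gamma>) / real (cut n))
        + 4 * real m / real n + \<bar>t\<bar> * (1 - rescale n (n - 1)) * particles m
        + \<bar>t\<bar> * sqrt (moment_const 1 * rescale n (cut n))"
        using elim cut_bounds(3)[OF n(1)] by (intro limit_var_char) auto
      also have "\<dots> \<le> ?b n" unfolding 2 3
        by (intro add_mono order_refl mult_left_mono real_sqrt_le_mono 1 4 branching_const moment_const_nonneg) auto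
      finally show ?case .
    qed
  qed
  then show ?thesis by (rule LIM_zero_cancel)
qed

lemma limit_scale_nonneg: "0 \<le> limit_scale"
  unfolding limit_scale_def hitting_scale_def using nu_bounds kappa_bounds
  by (intro mult_nonneg_nonneg divide_nonneg_nonneg Gamma_real_nonneg) auto

text \<open>
  Weak convergence of the limit variable passes to its power by continuity, and the distance between the
  number of descendants and this power tends to zero in mean.
\<close>

lemma descendants_char_tendsto:
  fixes \<xi> :: "'b \<Rightarrow> real"
  assumes "prob_space N" "distributed N lborel \<xi> (gamma_density (particles m) 1)"
  shows "(\<lambda>n. Ep (start n) (\<lambda>w. iexp (t * (real n powr (- \<nu>) * real (Suc (hits (n - 1) w))))))
    \<longlonglongrightarrow> (LINT x|N. iexp (t * (limit_scale * \<xi> x powr (1 - \<nu>))))"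
proof -
  interpret N: prob_space N by fact
  have [measurable]: "\<xi> \<in> borel_measurable N" using distributed_measurable[OF assms(2)] by simp
  define \<mu> where "\<mu> n = distr (measure_pmf (start n)) borel (limit_var n (cut n))" for n
  define F where "F x = iexp (t * (limit_scale * max 0 x powr (1 - \<nu>)))" for x
  have \<mu>: "real_distribution (\<mu> n)" for n
    unfolding \<mu>_def by (rule prob_space.real_distribution_distr[OF measure_pmf.prob_space_axioms]) simp
  have \<mu>': "real_distribution (distr N borel \<xi>)" by (rule N.real_distribution_distr) simp
  have pm: "0 < particles m" using m2 by (intro particles_pos) auto
  have "weak_conv_m \<mu> (distr N borel \<xi>)"
  proof (rule levy_continuity[OF \<mu> \<mu>'])
    fix t
    have "char (\<mu> n) t = Ep (start n) (\<lambda>w. iexp (t * limit_var n (cut n) w))" for n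
      unfolding char_def \<mu>_def by (subst integral_distr) auto
    then show "(\<lambda>n. char (\<mu> n) t) \<longlonglongrightarrow> char (distr N borel \<xi>) t"
      using limit_var_tendsto[of t] unfolding gamma_variable_char[OF assms(2) pm] by simp
  qed
  then have "(\<lambda>n. LINT x|\<mu> n. F x) \<longlonglongrightarrow> (LINT x|distr N borel \<xi>. F x)"
  proof (rule weak_conv_imp_integral_bdd_continuous_conv[OF \<mu> \<mu>'])
    have "isCont (\<lambda>x. max 0 x powr (1 - \<nu>)) x" for x :: real
      by (rule isCont_powr_nonneg_exponent) (use nu_bounds in \<open>auto intro!: continuous_intros\<close>)
    then show "isCont F x" for x
      unfolding F_def by (rule isCont_o2[where g = "\<lambda>u. iexp (t * (limit_scale * u))"]) (intro continuous_intros)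
    show "norm (F x) \<le> 1" for x by (simp add: F_def)
  qed
  moreover have F: "F \<in> borel_measurable borel" unfolding F_def by measurable
  moreover have "(LINT x|\<mu> n. F x) = Ep (start n) (\<lambda>w. iexp (t * (limit_scale * limit_var n (cut n) w powr (1 - \<nu>))))" for n
  proof -
    have "0 \<le> limit_var n (cut n) w" for w using m2 by (simp add: limit_var_def rescale_def particles_def)
    then have "F (limit_var n (cut n) w) = iexp (t * (limit_scale * limit_var n (cut n) w powr (1 - \<nu>)))" for w
      by (simp add: F_def max_absorb2)
    then show ?thesis unfolding \<mu>_def using F by (subst integral_distr) auto
  qed
  moreover have "(LINT x|distr N borel \<xi>. F x) = (LINT x|N. iexp (t * (limit_scale * \<xi> x powr (1 - \<nu>))))"
  proof -
    have "(LINT x|distr N borel \<xi>. F x) = (LINT x|N. F (\<xi> x))" using F by (subst integral_distr) auto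
    also have "\<dots> = (LINT x|N. iexp (t * (limit_scale * \<xi> x powr (1 - \<nu>))))"
    proof (rule integral_cong_AE)
      show "AE x in N. F (\<xi> x) = iexp (t * (limit_scale * \<xi> x powr (1 - \<nu>)))"
        using gamma_variable_pos[OF assms(2)] by eventually_elim (simp add: F_def)
      show "(\<lambda>x. F (\<xi> x)) \<in> borel_measurable N" using F by measurable
      show "(\<lambda>x. iexp (t * (limit_scale * \<xi> x powr (1 - \<nu>)))) \<in> borel_measurable N" by measurable
    qed
    finally show ?thesis .
  qed
  ultimately have main: "(\<lambda>n. Ep (start n) (\<lambda>w. iexp (t * (limit_scale * limit_var n (cut n) w powr (1 - \<nu>)))))
    \<longlonglongrightarrow> (LINT x|N. iexp (t * (limit_scale * \<xi> x powr (1 - \<nu>))))" by simp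
  have err0: "(\<lambda>n. \<bar>t\<bar> * (limit_error_const * real n powr (- \<delta>))) \<longlonglongrightarrow> 0"
    using tendsto_mult_right_zero[OF tendsto_mult_right_zero[OF tendsto_neg_power[of "- \<delta>"]]] delta_bounds by simp
  have "(\<lambda>n. Ep (start n) (\<lambda>w. iexp (t * (real n powr (- \<nu>) * real (Suc (hits (n - 1) w)))))
     - Ep (start n) (\<lambda>w. iexp (t * (limit_scale * limit_var n (cut n) w powr (1 - \<nu>))))) \<longlonglongrightarrow> 0"
  proof (rule Lim_null_comparison[OF _ err0])
    show "\<forall>\<^sub>F n in sequentially. norm (Ep (start n) (\<lambda>w. iexp (t * (real n powr (- \<nu>) * real (Suc (hits (n - 1) w)))))
     - Ep (start n) (\<lambda>w. iexp (t * (limit_scale * limit_var n (cut n) w powr (1 - \<nu>))))) \<le> \<bar>t\<bar> * (limit_error_const * real n powr (- \<delta>))"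
      using eventually_cut_le
    proof eventually_elim
      case (elim n)
      let ?X = "\<lambda>w. real (Suc (hits (n - 1) w))" and ?L = "\<lambda>w. limit_scale * limit_var n (cut n) w powr (1 - \<nu>)"
      let ?u = "real n powr (- \<nu>)"
      have n: "0 < real n" using elim by simp
      have un: "?u * real n powr \<nu> = 1" using n by (simp add: powr_minus)
      have pt: "norm (iexp (t * (?u * ?X w)) - iexp (t * ?L w)) \<le> \<bar>t\<bar> * ?u * \<bar>?X w - ?L w * real n powr \<nu>\<bar>" for w
      proof -
        have "norm (iexp (t * (?u * ?X w)) - iexp (t * ?L w)) \<le> \<bar>t * (?u * ?X w) - t * ?L w\<bar>"
          by (rule iexp_diff_le)
        also have "t * (?u * ?X w) - t * ?L w = t * ?u * (?X w - ?L w * real n powr \<nu>)"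
        proof -
          have "t * ?u * (?X w - ?L w * real n powr \<nu>) = t * (?u * ?X w) - t * ?L w * (?u * real n powr \<nu>)"
            by (simp only: right_diff_distrib mult_ac)
          then show ?thesis unfolding un by simp
        qed
        finally show ?thesis by (simp add: abs_mult)
      qed
      have "norm (Ep (start n) (\<lambda>w. iexp (t * (?u * ?X w))) - Ep (start n) (\<lambda>w. iexp (t * ?L w)))
        = norm (Ep (start n) (\<lambda>w. iexp (t * (?u * ?X w)) - iexp (t * ?L w)))"
        by (subst Ep_diff) auto
      also have "\<dots> \<le> Ep (start n) (\<lambda>w. norm (iexp (t * (?u * ?X w)) - iexp (t * ?L w)))" by (rule Ep_norm_le)
      also have "\<dots> \<le> Ep (start n) (\<lambda>w. \<bar>t\<bar> * ?u * \<bar>?X w - ?L w * real n powr \<nu>\<bar>)"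
        by (intro Ep_mono finite_start pt)
      also have "\<dots> = \<bar>t\<bar> * ?u * Ep (start n) (\<lambda>w. \<bar>?X w - ?L w * real n powr \<nu>\<bar>)" by simp
      also have "\<dots> \<le> \<bar>t\<bar> * ?u * (limit_error_const * real n powr (\<nu> - \<delta>))"
        using descendants_limit_error[of n] elim by (intro mult_left_mono) auto
      also have "\<dots> = \<bar>t\<bar> * (limit_error_const * (?u * real n powr (\<nu> - \<delta>)))" by (simp only: mult_ac)
      also have "?u * real n powr (\<nu> - \<delta>) = real n powr (- \<delta>)" by (simp add: powr_add[symmetric])
      finally show ?case .
    qed
  qed
  from tendsto_add[OF this main] show ?thesis by simp
qed

end

context pa_process begin

lemma num_descendants_le: "num_descendants n \<omega> \<le> n"
proof -
  have "descendants (pa_graph m (\<lambda>i l. E i l \<omega>) n) n \<subseteq> {1..n}"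
    by (auto simp: descendants_def pa_graph_def)
  then have "card (descendants (pa_graph m (\<lambda>i l. E i l \<omega>) n) n) \<le> card {1..n}" by (intro card_mono) auto
  then show ?thesis by (simp add: num_descendants_def)
qed

abbreviation normalized :: "nat \<Rightarrow> 'a \<Rightarrow> real"
  where "normalized n \<omega> \<equiv> real n powr (- \<nu>) * real (num_descendants n \<omega>)"

lemma normalized_measurable: "normalized n \<in> borel_measurable M"
  by measurable

lemma normalized_law:
  "real_distribution (distr M borel (normalized n))"
  by (intro real_distribution_distr normalized_measurable)

lemma normalized_weak_conv:
  fixes \<xi> :: "'b \<Rightarrow> real"
  assumes "prob_space N" "distributed N lborel \<xi> (gamma_density (particles m) 1)"
  shows "weak_conv_m (\<lambda>n. distr M borel (normalized n)) (distr N borel (\<lambda>x. limit_scale * \<xi> x powr (1 - \<nu>)))"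
proof (rule levy_continuity[OF normalized_law])
  interpret N: prob_space N by fact
  have [measurable]: "\<xi> \<in> borel_measurable N" using distributed_measurable[OF assms(2)] by simp
  show "real_distribution (distr N borel (\<lambda>x. limit_scale * \<xi> x powr (1 - \<nu>)))"
    by (rule N.real_distribution_distr) measurable
  fix t
  have lim: "char (distr N borel (\<lambda>x. limit_scale * \<xi> x powr (1 - \<nu>))) t = (LINT x|N. iexp (t * (limit_scale * \<xi> x powr (1 - \<nu>))))"
    unfolding char_def by (subst integral_distr) auto
  have "char (distr M borel (normalized n)) t = Ep (start n) (\<lambda>w. iexp (t * (real n powr (- \<nu>) * real (Suc (hits (n - 1) w)))))"
    if "2 \<le> n" for n
  proof -
    have "char (distr M borel (normalized n)) t = (LINT \<omega>|M. iexp (t * normalized n \<omega>))"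
      unfolding char_def using normalized_measurable by (subst integral_distr) auto
    also have "\<dots> = Ep (start n) (\<lambda>w. iexp (t * (real n powr (- \<nu>) * real (Suc (hits (n - 1) w)))))"
      by (rule descendants_law[OF that])
    finally show ?thesis .
  qed
  then have "\<forall>\<^sub>F n in sequentially. Ep (start n) (\<lambda>w. iexp (t * (real n powr (- \<nu>) * real (Suc (hits (n - 1) w))))) = char (distr M borel (normalized n)) t"
    by (intro eventually_sequentiallyI[of 2]) simp
  with descendants_char_tendsto[OF assms, of t]
  show "(\<lambda>n. char (distr M borel (normalized n)) t) \<longlonglongrightarrow> char (distr N borel (\<lambda>x. limit_scale * \<xi> x powr (1 - \<nu>))) t"
    unfolding lim by (rule Lim_transform_eventually)
qed

lemma powr_le_one_plus_power:
  fixes a p :: real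
  assumes "0 \<le> a" "0 \<le> p" "p \<le> real q"
  shows "a powr p \<le> 1 + a ^ q"
proof (cases "a \<le> 1")
  case True
  then have "a powr p \<le> 1" using assms by (intro powr_le1) auto
  then show ?thesis using assms by (simp add: add_increasing2)
next
  case False
  then have "a powr p \<le> a powr real q" using assms by (intro powr_mono) auto
  then show ?thesis using False by (simp add: powr_realpow)
qed

lemma normalized_moment_bound:
  assumes "2 \<le> n" "0 < p"
  shows "integrable (distr M borel (normalized n)) (\<lambda>x. \<bar>x\<bar> powr p)"
    "(LINT x|distr M borel (normalized n). \<bar>x\<bar> powr p) \<le> 1 + descendants_const (nat \<lceil>p\<rceil>)"
proof -
  let ?q = "nat \<lceil>p\<rceil>" and ?u = "real n powr (- \<nu>)"
  have q: "p \<le> real ?q" "1 \<le> ?q" using assms(2) by linarith+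
  have n: "0 < real n" using assms(1) by simp
  have u: "0 \<le> ?u" by simp
  have bd: "\<bar>normalized n \<omega>\<bar> powr p \<le> (?u * real n) powr p" for \<omega>
    using num_descendants_le[of n \<omega>] assms(2) by (intro powr_mono2) (auto simp: abs_mult intro!: mult_left_mono)
  have "integrable M (\<lambda>\<omega>. \<bar>normalized n \<omega>\<bar> powr p)"
    using bd by (intro integrable_const_bound[where B = "(?u * real n) powr p"]) auto
  then show "integrable (distr M borel (normalized n)) (\<lambda>x. \<bar>x\<bar> powr p)"
    using normalized_measurable by (subst integrable_distr_eq) auto
  have "(LINT x|distr M borel (normalized n). \<bar>x\<bar> powr p) = (LINT \<omega>|M. \<bar>normalized n \<omega>\<bar> powr p)"
    using normalized_measurable by (subst integral_distr) auto
  also have "\<dots> = Ep (start n) (\<lambda>w. \<bar>?u * real (Suc (hits (n - 1) w))\<bar> powr p)"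
    by (rule descendants_law[OF assms(1)])
  also have "\<dots> \<le> Ep (start n) (\<lambda>w. 1 + ?u ^ ?q * real (Suc (hits (n - 1) w)) ^ ?q)"
  proof (rule Ep_mono[OF finite_start])
    fix w
    have "\<bar>?u * real (Suc (hits (n - 1) w))\<bar> powr p \<le> 1 + \<bar>?u * real (Suc (hits (n - 1) w))\<bar> ^ ?q"
      using assms(2) q by (intro powr_le_one_plus_power) auto
    also have "\<bar>?u * real (Suc (hits (n - 1) w))\<bar> ^ ?q = ?u ^ ?q * real (Suc (hits (n - 1) w)) ^ ?q"
      by (simp add: abs_mult power_mult_distrib)
    finally show "\<bar>?u * real (Suc (hits (n - 1) w))\<bar> powr p \<le> 1 + ?u ^ ?q * real (Suc (hits (n - 1) w)) ^ ?q" .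
  qed
  also have "\<dots> = 1 + ?u ^ ?q * Ep (start n) (\<lambda>w. real (Suc (hits (n - 1) w)) ^ ?q)"
    by (simp add: integrable_measure_pmf_finite)
  also have "\<dots> \<le> 1 + ?u ^ ?q * (descendants_const ?q * (real n powr \<nu>) ^ ?q)"
    using descendants_moment[OF assms(1) q(2)] by (intro add_left_mono mult_left_mono) auto
  also have "\<dots> = 1 + descendants_const ?q * (?u * real n powr \<nu>) ^ ?q" by (simp add: power_mult_distrib)
  also have "?u * real n powr \<nu> = 1" using n by (simp add: powr_minus)
  finally show "(LINT x|distr M borel (normalized n). \<bar>x\<bar> powr p) \<le> 1 + descendants_const ?q" by simp
qed

lemma normalized_moments:
  fixes \<xi> :: "'b \<Rightarrow> real"
  assumes "prob_space N" "distributed N lborel \<xi> (gamma_density (particles m) 1)" "0 < p"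
  shows "(\<lambda>n. (LINT \<omega>|M. real (num_descendants n \<omega>) powr p) / real n powr (p * \<nu>))
    \<longlonglongrightarrow> limit_scale powr p * (Gamma (p * (1 - \<nu>) + particles m) / Gamma (particles m))"
proof -
  interpret N: prob_space N by fact
  have [measurable]: "\<xi> \<in> borel_measurable N" using distributed_measurable[OF assms(2)] by simp
  let ?Z = "\<lambda>x. limit_scale * \<xi> x powr (1 - \<nu>)"
  have pm: "0 < particles m" using m2 by (intro particles_pos) auto
  have Z: "real_distribution (distr N borel ?Z)" by (rule N.real_distribution_distr) measurable
  have mom: "has_bochner_integral N (\<lambda>x. \<bar>?Z x\<bar> powr r) (limit_scale powr r * (Gamma (r * (1 - \<nu>) + particles m) / Gamma (particles m)))"
    if "0 \<le> r" for r
    using nu_bounds that limit_scale_nonneg by (intro gamma_variable_moment[OF assms(2) pm]) auto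
  have intZ: "integrable (distr N borel ?Z) (\<lambda>x. \<bar>x\<bar> powr (2 * p))"
    using mom[of "2 * p"] assms(3) by (subst integrable_distr_eq) (auto simp: has_bochner_integral_iff)
  have "(\<lambda>n. LINT x|distr M borel (normalized n). \<bar>x\<bar> powr p) \<longlonglongrightarrow> (LINT x|distr N borel ?Z. \<bar>x\<bar> powr p)"
    using assms(3) by (intro weak_conv_moments[OF normalized_law Z normalized_weak_conv[OF assms(1,2)] _ _ _ intZ,
      where a = 2 and B = "1 + descendants_const (nat \<lceil>2 * p\<rceil>)"] normalized_moment_bound) auto
  moreover have "(LINT x|distr N borel ?Z. \<bar>x\<bar> powr p) = limit_scale powr p * (Gamma (p * (1 - \<nu>) + particles m) / Gamma (particles m))"
    using mom[of p] assms(3) by (subst integral_distr) (auto simp: has_bochner_integral_iff)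
  moreover have "\<forall>\<^sub>F n in sequentially. (LINT x|distr M borel (normalized n). \<bar>x\<bar> powr p)
      = (LINT \<omega>|M. real (num_descendants n \<omega>) powr p) / real n powr (p * \<nu>)"
  proof (rule eventually_sequentiallyI[of 1])
    fix n :: nat assume n: "1 \<le> n"
    have "(LINT x|distr M borel (normalized n). \<bar>x\<bar> powr p) = (LINT \<omega>|M. \<bar>normalized n \<omega>\<bar> powr p)"
      using normalized_measurable by (subst integral_distr) auto
    also have "\<dots> = (LINT \<omega>|M. real (num_descendants n \<omega>) powr p / real n powr (p * \<nu>))"
    proof (rule Bochner_Integration.integral_cong[OF refl])
      fix \<omega>
      have "\<bar>normalized n \<omega>\<bar> powr p = (real n powr (- \<nu>)) powr p * real (num_descendants n \<omega>) powr p"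
        by (simp add: abs_mult powr_mult)
      also have "(real n powr (- \<nu>)) powr p = 1 / real n powr (p * \<nu>)"
      proof -
        have "- \<nu> * p = - (p * \<nu>)" by simp
        then show ?thesis unfolding powr_powr by (simp only: powr_minus_divide)
      qed
      finally show "\<bar>normalized n \<omega>\<bar> powr p = real (num_descendants n \<omega>) powr p / real n powr (p * \<nu>)" by simp
    qed
    finally show "(LINT x|distr M borel (normalized n). \<bar>x\<bar> powr p)
      = (LINT \<omega>|M. real (num_descendants n \<omega>) powr p) / real n powr (p * \<nu>)" by simp
  qed
  ultimately show ?thesis by (auto elim: Lim_transform_eventually)
qed

end

text \<open>
  Almost surely all edges of the first vertex are self-loops, so the rule applies to the second vertex with
  this history; its first edge is a self-loop with a probability that has the sign of \<open>1 + \<rho>\<close>.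
\<close>

lemma selfloops_rho_ge:
  assumes "pref_attachment_selfloops M m \<rho> E" "m \<ge> 2" "\<rho> > - real m"
  shows "-1 \<le> \<rho>"
proof (rule ccontr)
  assume neg: "\<not> -1 \<le> \<rho>"
  interpret pref_attachment_selfloops M m \<rho> E by fact
  let ?h = "\<lambda>i l::nat. 1::nat"
  let ?Q = "\<lambda>\<omega>. (\<forall>i\<in>{1..<2}. \<forall>l\<in>{1..m}. E i l \<omega> = ?h i l) \<and> (\<forall>l\<in>{1..0}. E 2 l \<omega> = ?h 2 l)"
  have Q: "?Q \<omega> \<longleftrightarrow> (\<forall>l\<in>{1..m}. E 1 l \<omega> = 1)" for \<omega>
  proof -
    have "{1..<2::nat} = {1}" by auto
    then show ?thesis by simp
  qed
  have "AE \<omega> in M. \<forall>l\<in>{1..m}. E 1 l \<omega> = 1" using first_vertex by (intro AE_finite_allI) auto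
  moreover have "Measurable.pred M (\<lambda>\<omega>. \<forall>l\<in>{1..m}. E 1 l \<omega> = 1)"
  proof (intro pred_intros_finite)
    fix l assume "l \<in> {1..m}"
    then have [measurable]: "E 1 l \<in> measurable M (count_space UNIV)" by (intro measurable_E) auto
    show "Measurable.pred M (\<lambda>\<omega>. E 1 l \<omega> = 1)" by measurable
  qed simp
  ultimately have "\<P>(\<omega> in M. \<forall>l\<in>{1..m}. E 1 l \<omega> = 1) = 1" by (simp add: prob_Collect_eq_1)
  then have "\<P>(\<omega> in M. ?Q \<omega>) > 0" unfolding Q by simp
  then have "\<P>(\<omega> in M. E 2 (0 + 1) \<omega> = 2 \<bar> ?Q \<omega>) = attach_prob m \<rho> ?h 2 0 2"
    using assms(2) by (intro attachment) auto
  moreover have "0 \<le> \<P>(\<omega> in M. E 2 (0 + 1) \<omega> = 2 \<bar> ?Q \<omega>)" unfolding cond_prob_def by simp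
  moreover have "attach_prob m \<rho> ?h 2 0 2 < 0"
    unfolding attach_prob_def using neg assms by (auto intro!: divide_neg_pos)
  ultimately show False by linarith
qed

theorem theorem12p2:
  fixes m :: nat and \<rho> \<nu> K :: real
    and M :: "'a measure" and E :: "nat \<Rightarrow> nat \<Rightarrow> 'a \<Rightarrow> nat" and X :: "nat \<Rightarrow> 'a \<Rightarrow> nat"
    and N :: "'b measure" and \<xi>\<^sub>1 :: "'b \<Rightarrow> real"
  assumes "m \<ge> 2" and "\<rho> > - real m"
    and "\<nu> = (real m - 1) * (real m + \<rho>) / (real m * (real m + \<rho> + 1))"
    and "pref_attachment_selfloops M m \<rho> E"
    and "X = pref_attachment_selfloops.num_descendants m E"
    and "prob_space N"
    and "distributed N lborel \<xi>\<^sub>1 (gamma_density (real m / (real m - 1)) 1)"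
    and "K = Gamma ((real m - 1) * (real m + \<rho>) / (real m * (real m + \<rho> + 1)))
           * Gamma ((real m + \<rho>) / (real m * (real m + \<rho> + 1)) + 1)
           / Gamma ((real m + \<rho>) / (real m + \<rho> + 1))
           * ((real m + \<rho> + 1) * (real m - 1) / (2 * real m + \<rho>)) powr (1 - \<nu>)"
  shows "0 < \<nu> \<and> \<nu> < 1
         \<and> weak_conv_m
           (\<lambda>n. distr M borel (\<lambda>\<omega>. real n powr (- \<nu>) * real (X n \<omega>)))
           (distr N borel (\<lambda>x. K * \<xi>\<^sub>1 x powr (1 - \<nu>)))
         \<and> (\<forall>p>0. (\<lambda>n. (LINT \<omega>|M. real (X n \<omega>) powr p) / real n powr (p * \<nu>))
           \<longlonglongrightarrow> K powr p * (Gamma (p * (1 - \<nu>) + real m / (real m - 1)) / Gamma (real m / (real m - 1))))"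
proof -
  have "-1 \<le> \<rho>" by (rule selfloops_rho_ge[OF assms(4,1,2)])
  then have "pa_parameters m \<rho>" using assms(1) by unfold_locales
  then interpret pa: pa_process M m \<rho> E using assms(4) by (simp add: pa_process_def)
  have m: "real m \<ge> 2" using assms(1) by simp
  have \<alpha>: "0 < pa.\<alpha>" by (rule pa.alpha_pos)
  have "pa.c * pa.\<beta> = real m * (pa.\<alpha> + 1)" by (rule pa.beta_eq)
  moreover have "pa.\<gamma> * pa.c = (real m - 1) * pa.\<alpha>" using pa.c_ge by (simp add: pa.\<gamma>_def)
  moreover have "pa.\<nu> = (pa.\<gamma> * pa.c) / (pa.c * pa.\<beta>)" using pa.c_ge by (simp add: pa.\<nu>_def)
  ultimately have nu': "pa.\<nu> = (real m - 1) * pa.\<alpha> / (real m * (pa.\<alpha> + 1))" by simp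
  then have nu: "\<nu> = pa.\<nu>" unfolding assms(3) pa.\<alpha>_def by (rule sym)
  have "pa.\<kappa> + (1 - pa.\<nu>) = pa.\<alpha> / (real m * (pa.\<alpha> + 1)) + 1"
  proof -
    have "pa.\<kappa> = real m * pa.\<alpha> / (real m * (pa.\<alpha> + 1))" using m by (simp add: pa.\<kappa>_def)
    then have "pa.\<kappa> - pa.\<nu> = (real m * pa.\<alpha> - (real m - 1) * pa.\<alpha>) / (real m * (pa.\<alpha> + 1))"
      unfolding nu' by (simp only: diff_divide_distrib)
    also have "real m * pa.\<alpha> - (real m - 1) * pa.\<alpha> = pa.\<alpha>" by (simp add: left_diff_distrib)
    finally show ?thesis by simp
  qed
  then have arg: "(real m + \<rho>) / (real m * (real m + \<rho> + 1)) + 1 = pa.\<kappa> + (1 - pa.\<nu>)"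
    unfolding pa.\<alpha>_def by (rule sym)
  have \<kappa>: "(real m + \<rho>) / (real m + \<rho> + 1) = pa.\<kappa>" by (simp add: pa.\<kappa>_def pa.\<alpha>_def)
  have K: "K = pa.limit_scale"
    unfolding assms(8) arg \<kappa> assms(3)[symmetric] nu pa.limit_scale_def pa.hitting_scale_def
    by (simp only: pa.\<alpha>_def pa.c_def)
  have s: "real m / (real m - 1) = pa.particles m" by (simp add: pa.particles_def)
  note gam = assms(7)[unfolded s]
  have "0 < \<nu>" "\<nu> < 1" unfolding nu by (rule pa.nu_bounds)+
  then show ?thesis
    using pa.normalized_weak_conv[OF assms(6) gam] pa.normalized_moments[OF assms(6) gam]
    unfolding K s assms(5) nu by blast
qed

end
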